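(* Let $X=(X_n,\,n\ge1)$ be a regenerative process with values in a measurable space $(\mathcal{X},\mathscr{X})$, and let $(S_n,\,n\ge0)$ be a random walk modulated by $X$ with increment distributions $(F_x,\,x\in\mathcal{X})$, as described in the context. Suppose that conditions (D1)–(D4) below hold for some reference distribution $F$ on $\mathbb{R}$ with finite mean and some measurable function $c:\mathcal{X}\to[0,1]$, and that $F^{\mathrm{I}}\in\mathcal{S}$. Then, with $M=\sup_{n\ge0}S_n$, $$\lim_{y\to\infty}\frac{P(M>y)}{\overline{F^{\mathrm{I}}}(y)}=\frac{C}{a}.$$ The conditions are: (D1) $\overline{F_x}(y)\le\overline{F}(y)$ for all $y\in\mathbb{R}$ and all $x\in\mathcal{X}$; (D2) $\overline{F_x^{\mathrm{I}}}(y)\sim c(x)\,\overline{F^{\mathrm{I}}}(y)$ as $y\to\infty$, for every $x\in\mathcal{X}$; (D3) $a:=-\int_{\mathcal{X}}a_x\,\pi(dx)$ is finite and strictly positive; (D4) for some nonnegative $b>\kappa$, $P(b\tau_0>n)=o(\overline{F^{\mathrm{I}}}(n))$ and $P(b\tau_1>n)=o(\overline{F}(n))$ as $n\to\infty$.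
   Context: For a distribution function $G$ on $\mathbb{R}$, $\overline{G}(y):=1-G(y)$. If $G$ has finite mean, its integrated tail distribution $G^{\mathrm{I}}$ is defined by $\overline{G^{\mathrm{I}}}(y):=\min\bigl(1,\int_y^\infty\overline{G}(z)\,dz\bigr)$. A distribution $G$ on $\mathbb{R}_+$ is subexponential ($G\in\mathcal{S}$) if $\overline{G^{*2}}(y)/\overline{G}(y)\to2$ as $y\to\infty$; a distribution $G$ on $\mathbb{R}$ is in $\mathcal{S}$ iff $G_+(y):=G(y)\mathbf{1}(y\ge0)$ is in $\mathcal{S}$. $f(y)\sim g(y)$ means $f(y)/g(y)\to1$ as $y\to\infty$. Setting: $X=(X_n,\,n\ge1)$ is regenerative with regeneration epochs $0\le T_0<T_1<\cdots$: the cycles $((X_n,\,T_{k-1}<n\le T_k),\,k\ge1)$ are i.i.d. and independent of the initial cycle $(X_n,\,0<n\le T_0)$. Put $\tau_0=T_0$, $\tau_k=T_k-T_{k-1}$ ($k\ge1$), and assume $E\tau_1<\infty$. The stationary measure is $\pi(B):=E\sum_{n=T_0+1}^{T_1}\mathbf{1}(X_n\in B)/E\tau_1$. The walk is $S_0=0$, $S_n=\xi_1+\cdots+\xi_n$, where, conditionally on $X$, the $\xi_n$ are independent and $P(\xi_n\le y\mid X)=P(\xi_n\le y\mid X_n)=F_{X_n}(y)$ a.s., for a family of distribution functions $(F_x,\,x\in\mathcal{X})$ with $x\mapsto F_x(y)$ measurable for each $y$. Each $F_x$ has finite mean $a_x:=\int_{\mathbb{R}}y\,F_x(dy)$. For $\beta>0$,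 $a_x^\beta:=\int_{\mathbb{R}}(y\vee-\beta)\,F_x(dy)$, and $\kappa:=\lim_{\beta\to\infty}\sup_{x\in\mathcal{X}}a_x^\beta$. Also $C:=\int_{\mathcal{X}}c(x)\,\pi(dx)$. *)

theory Defs
  imports "HOL-Probability.Probability" "HOL-Library.Landau_Symbols"
begin

definition itail :: "real measure \<Rightarrow> real \<Rightarrow> real" where
  "itail G y = min 1 (LINT z:{y..}|lborel. (1 - cdf G z))"

definition pos_part_cdf :: "(real \<Rightarrow> real) \<Rightarrow> real \<Rightarrow> real" where
  "pos_part_cdf G y = (if 0 \<le> y then G y else 0)"

definition subexponential :: "(real \<Rightarrow> real) \<Rightarrow> bool" where
  "subexponential G \<longleftrightarrow>
     (let \<mu> = interval_measure (pos_part_cdf G) in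
      ((\<lambda>y. (1 - measure (\<mu> \<star> \<mu>) {..y}) / (1 - pos_part_cdf G y)) \<longlongrightarrow> 2) at_top)"

text \<open>Encoding of the k-th cycle (k = 0: initial cycle (X_n, 0<n<=T_0);
  k >= 1: cycle (X_n, T_{k-1} < n <= T_k)) as a pair (length, padded sequence),
  where positions beyond the length are filled with a fixed point x0 of the state space.\<close>
definition cycle :: "'x \<Rightarrow> (nat \<Rightarrow> 'w \<Rightarrow> 'x) \<Rightarrow> (nat \<Rightarrow> 'w \<Rightarrow> nat) \<Rightarrow> nat \<Rightarrow> 'w \<Rightarrow> nat \<times> (nat \<Rightarrow> 'x)" where
  "cycle x0 X T k \<omega> =
     (let s = (if k = 0 then 0 else T (k - 1) \<omega>);
          l = (if k = 0 then T 0 \<omega> else T k \<omega> - T (k - 1) \<omega>)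
      in (l, \<lambda>n. if n < l then X (s + 1 + n) \<omega> else x0))"

definition cycle_space :: "'x measure \<Rightarrow> (nat \<times> (nat \<Rightarrow> 'x)) measure" where
  "cycle_space SX = count_space UNIV \<Otimes>\<^sub>M (\<Pi>\<^sub>M n\<in>UNIV. SX)"

definition stat_measure :: "'w measure \<Rightarrow> 'x measure \<Rightarrow> (nat \<Rightarrow> 'w \<Rightarrow> 'x) \<Rightarrow> (nat \<Rightarrow> 'w \<Rightarrow> nat) \<Rightarrow> 'x measure" where
  "stat_measure M SX X T = measure_of (space SX) (sets SX)
     (\<lambda>B. ennreal ((\<integral>\<omega>. (\<Sum>n\<in>{T 0 \<omega><..T 1 \<omega>}. indicator B (X n \<omega>)) \<partial>M)
                   / (\<integral>\<omega>. real (T 1 \<omega> - T 0 \<omega>) \<partial>M)))"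

definition trunc_mean :: "real measure \<Rightarrow> real \<Rightarrow> real" where
  "trunc_mean G \<beta> = (\<integral>y. max y (- \<beta>) \<partial>G)"

definition kappa :: "'x measure \<Rightarrow> ('x \<Rightarrow> real measure) \<Rightarrow> ereal" where
  "kappa SX Fm = Lim at_top (\<lambda>\<beta>::real. SUP x\<in>space SX. ereal (trunc_mean (Fm x) \<beta>))"

end

theory Submission
  imports Defs "HOL-Real_Asymp.Real_Asymp"
begin

text \<open>
  The argument is the principle of one big jump. Driving the walk by i.i.d. uniform variables through the
  quantile functions of the \<open>F\<^sub>x\<close> makes every increment at most the reference increment, and turns each
  crossing probability into an iterated integral over the environment. Cutting at the regeneration epochs
  leaves a walk with i.i.d. steps, the increments over cycles, each step carrying the maximum within its cycle.

  Inside a cycle of length \<open>n\<close> the increments, truncated at \<open>- \<beta>\<close> and lowered by some \<open>b > \<kappa>\<close>, have uniformly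
  negative drift, so crossing probabilities are bounded by a constant times the subexponential tail: one renews
  at the first crossing of a slowly declining line and closes the resulting inequality by optimising the constant.
  The cost \<open>b * n\<close> of the lowering is negligible by (D4), and dominated convergence shows that the mean excess over \<open>y\<close>
  of the maximum in a cycle is asymptotically the tail times the expected sum of \<open>c\<close> along the cycle.

  For the i.i.d. walk with drift \<open>- m\<close> the same renewal argument gives the upper bound, and restricting to paths
  that stay near the line of slope \<open>- m\<close> until the big jump gives the lower bound; both sum the tail of the cycle
  maximum along that line, which is the mean excess divided by \<open>m\<close>. The sum of \<open>c\<close> over a cycle divided by minus
  the mean increment over a cycle is \<open>C / a\<close>. The initial cycle contributes \<open>o\<close> of the tail.
\<close>

section \<open>Subexponential tails\<close>

text \<open>(D2) speaks of integrated tails only; the tails of the increments themselves need not be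
  comparable with the tail of \<open>F\<close>. Hence the asymptotic statements inside a cycle
  concern a mean excess \<open>E max 0 (W - y)\<close>, not a tail. The mean excess adds up exactly
  along successive increments (\<open>excess_Cons\<close>), and as the integral of the tail of
  \<open>W\<close> it reappears when that tail is summed along a line. All bounds are measured on
  the scale of a law \<open>H\<close> with the tail of the integrated distribution. A single
  increment has a tail of smaller order than this scale, so any fixed number of increments is
  negligible.

  The other obstacle is uniformity. In a fixed environment the limits follow by induction over its
  states, but cycles have unbounded length and arbitrary states, and dominated convergence over a
  random cycle needs bounds with one constant for all finite lists of states. This is why the
  renewal argument is set up for arbitrary lists over a class of steps. The two parts of (D4) differ
  since the initial cycle enters once, through its tail, whereas the later cycles enter through
  their mean excess.\<close>

definition tail :: "real measure \<Rightarrow> real \<Rightarrow> real" where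
  "tail H v = measure H {v<..}"

lemma borel_measurable_antimono:
  fixes f :: "real \<Rightarrow> real"
  assumes "\<And>u v. u \<le> v \<Longrightarrow> f v \<le> f u"
  shows "f \<in> borel_measurable borel"
proof -
  have "(\<lambda>v. - f v) \<in> borel_measurable borel"
    by (intro borel_measurable_mono monoI) (simp add: assms)
  then have "(\<lambda>v. - (- f v)) \<in> borel_measurable borel"
    by (rule borel_measurable_uminus)
  then show ?thesis by simp
qed

lemma (in prob_space) integrable_bounded:
  fixes f :: "'a \<Rightarrow> real"
  assumes "f \<in> borel_measurable M" "\<And>x. x \<in> space M \<Longrightarrow> \<bar>f x\<bar> \<le> B"
  shows "integrable M f"
  using assms by (intro integrable_const_bound[where B=B]) auto

lemma (in prob_space) integral_le_bound:
  fixes f :: "'a \<Rightarrow> real"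
  assumes "f \<in> borel_measurable M" "\<And>x. x \<in> space M \<Longrightarrow> 0 \<le> f x" "\<And>x. x \<in> space M \<Longrightarrow> f x \<le> B"
  shows "(\<integral>x. f x \<partial>M) \<le> B"
proof -
  have "(\<integral>x. f x \<partial>M) \<le> (\<integral>x. B \<partial>M)"
    using assms by (intro integral_mono integrable_bounded[where B=B]) force+
  then show ?thesis by (simp add: prob_space)
qed

lemma tail_nonneg: "0 \<le> tail H v"
  by (simp add: tail_def)

section \<open>Tails of probability laws on the line\<close>

context real_distribution
begin

lemma tail_le_1: "tail M v \<le> 1"
  by (simp add: tail_def)

lemma tail_antimono: "u \<le> v \<Longrightarrow> tail M v \<le> tail M u"
  unfolding tail_def by (intro finite_measure_mono) auto

lemma tail_eq_cdf: "tail M v = 1 - cdf M v"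
proof -
  have "tail M v = prob (space M - {..v})"
    unfolding tail_def by (rule arg_cong[where f=prob]) auto
  also have "\<dots> = 1 - prob {..v}"
    by (rule prob_compl) auto
  finally show ?thesis by (simp add: cdf_def)
qed

lemma tail_tendsto_0: "(tail M \<longlongrightarrow> 0) at_top"
proof -
  have "((\<lambda>v. 1 - cdf M v) \<longlongrightarrow> 1 - 1) at_top"
    by (intro tendsto_intros cdf_lim_at_top_prob)
  then show ?thesis by (simp add: tail_eq_cdf[abs_def])
qed

lemma borel_measurable_tail [measurable]: "tail M \<in> borel_measurable borel"
  by (rule borel_measurable_antimono) (rule tail_antimono)

lemma tail_indicator: "tail M (u - z) = (\<integral>h. indicator {u<..} (z + h) \<partial>M)"
proof -
  have "(\<lambda>h. indicator {u<..} (z + h) :: real) = indicator {u - z<..}"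
    by (auto simp: indicator_def)
  then show ?thesis by (simp add: tail_def)
qed

text \<open>Both sides are the probability that \<open>E\<close> occurs and
  \<open>\<zeta> + h\<close> exceeds \<open>u\<close>, where \<open>h\<close> has the law
  \<open>M\<close> and is independent of \<zeta>. On the right-hand side a tail bound for \<zeta>
  can be inserted under the integral over \<open>h\<close>.\<close>

lemma integral_tail_shift:
  assumes Q: "prob_space Q" and [measurable]: "\<zeta> \<in> borel_measurable Q" "E \<in> sets Q"
  shows "(\<integral>\<omega>. indicator E \<omega> * tail M (u - \<zeta> \<omega>) \<partial>Q)
       = (\<integral>h. measure Q {\<omega> \<in> space Q. \<omega> \<in> E \<and> u - h < \<zeta> \<omega>} \<partial>M)"
proof -
  interpret Q: prob_space Q by fact
  interpret QM: pair_prob_space Q M ..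
  have [measurable_cong]: "sets M = sets borel" by simp
  let ?f = "\<lambda>\<omega> h. indicator E \<omega> * indicator {u<..} (\<zeta> \<omega> + h) :: real"
  have int: "integrable (Q \<Otimes>\<^sub>M M) (\<lambda>(\<omega>, h). ?f \<omega> h)"
    by (rule QM.integrable_bounded[where B=1]) (auto split: split_indicator)
  have "(\<integral>\<omega>. indicator E \<omega> * tail M (u - \<zeta> \<omega>) \<partial>Q) = (\<integral>\<omega>. (\<integral>h. ?f \<omega> h \<partial>M) \<partial>Q)"
    by (intro Bochner_Integration.integral_cong) (auto simp: tail_indicator)
  also have "\<dots> = (\<integral>h. (\<integral>\<omega>. ?f \<omega> h \<partial>Q) \<partial>M)"
    by (rule QM.Fubini_integral[OF int, symmetric])
  also have "\<dots> = (\<integral>h. measure Q {\<omega> \<in> space Q. \<omega> \<in> E \<and> u - h < \<zeta> \<omega>} \<partial>M)"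
  proof (intro Bochner_Integration.integral_cong refl)
    fix h
    have "(\<integral>\<omega>. ?f \<omega> h \<partial>Q) = (\<integral>\<omega>. indicator {\<omega> \<in> space Q. \<omega> \<in> E \<and> u - h < \<zeta> \<omega>} \<omega> \<partial>Q)"
      by (intro Bochner_Integration.integral_cong) (auto split: split_indicator)
    then show "(\<integral>\<omega>. ?f \<omega> h \<partial>Q) = measure Q {\<omega> \<in> space Q. \<omega> \<in> E \<and> u - h < \<zeta> \<omega>}"
      by simp
  qed
  finally show ?thesis .
qed

end

text \<open>The integral in \<open>conv_ratio\<close> is the tail of the convolution of
  \<open>H\<close> with itself: the integrand is the conditional probability that a second,
  independent variable exceeds \<open>y - h\<close>. With \<open>tail_neg\<close>, which puts
  \<open>H\<close> on the nonnegative half-line, this is subexponentiality.\<close>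

locale subexp_law = real_distribution H for H +
  assumes tail_neg: "v < 0 \<Longrightarrow> tail H v = 1"
    and conv_ratio: "((\<lambda>y. (\<integral>h. tail H (y - h) \<partial>H) / tail H y) \<longlongrightarrow> 2) at_top"
begin

text \<open>If the tail vanished from some point on, the ratio in \<open>conv_ratio\<close> would be
  0 there, division by 0 giving 0, against the limit 2.\<close>

lemma tail_pos: "0 < tail H v"
proof (rule ccontr)
  assume "\<not> 0 < tail H v"
  then have z: "tail H y = 0" if "y \<ge> v" for y
    using tail_antimono[OF that] tail_nonneg[of H y] by auto
  have "\<forall>\<^sub>F y in at_top. (\<integral>h. tail H (y - h) \<partial>H) / tail H y > 1"
    using conv_ratio by (rule order_tendstoD) auto
  moreover have "\<forall>\<^sub>F y in at_top. y \<ge> v" by (rule eventually_ge_at_top)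
  ultimately have "\<forall>\<^sub>F y::real in at_top. False"
    by eventually_elim (simp add: z)
  then show False by simp
qed

lemma integrable_tail_conv: "integrable H (\<lambda>h. indicator {a<..b} h * tail H (u - h))"
  by (rule integrable_bounded[where B=1]) (auto simp: indicator_def tail_nonneg tail_le_1)

lemma integrable_tail_conv': "integrable H (\<lambda>h. tail H (u - h))"
  by (rule integrable_bounded[where B=1]) (auto simp: indicator_def tail_nonneg tail_le_1)

lemma AE_nonneg: "AE h in H. 0 \<le> h"
proof -
  have "tail H (-1/real (Suc n)) = 1" for n
    by (intro tail_neg) auto
  then have "AE h in H. h \<in> {-1/real (Suc n)<..}" for n
    by (subst prob_eq_1[symmetric]) (auto simp: tail_def)
  then have "AE h in H. \<forall>n. h \<in> {-1/real (Suc n)<..}"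
    by (simp only: AE_all_countable) blast
  then show ?thesis
  proof eventually_elim
    case (elim h)
    have "(\<lambda>n. -1/real (Suc n)) \<longlonglongrightarrow> 0"
      by real_asymp
    then show ?case
      by (rule LIMSEQ_le_const2) (use elim in \<open>auto intro: less_imp_le\<close>)
  qed
qed

text \<open>The integral is cut into \<open>h > y\<close>, where the integrand is 1,
  \<open>h \<le> A\<close>, where it is at least \<open>tail H y\<close>, and the rest. As the total
  is about twice \<open>tail H y\<close>, hardly anything remains for the rest.\<close>

lemma tail_conv_split:
  assumes "A \<le> y"
  shows "tail H y + (1 - tail H A) * tail H y + (\<integral>h. indicator {A<..y} h * tail H (y - h) \<partial>H)
       \<le> (\<integral>h. tail H (y - h) \<partial>H)"
proof -
  have i: "integrable H (\<lambda>h. indicator {y<..} h :: real)" "integrable H (\<lambda>h. indicator {..A} h * tail H y)"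
    by (rule integrable_bounded[where B=1]; auto simp: indicator_def tail_nonneg tail_le_1)+
  have "tail H y + (1 - tail H A) * tail H y = (\<integral>h. indicator {y<..} h \<partial>H) + (\<integral>h. indicator {..A} h * tail H y \<partial>H)"
    by (simp add: tail_def tail_eq_cdf[unfolded tail_def] cdf_def)
  then have "tail H y + (1 - tail H A) * tail H y + (\<integral>h. indicator {A<..y} h * tail H (y - h) \<partial>H)
     = (\<integral>h. indicator {y<..} h + indicator {..A} h * tail H y + indicator {A<..y} h * tail H (y - h) \<partial>H)"
    using i integrable_tail_conv by simp
  also have "\<dots> \<le> (\<integral>h. tail H (y - h) \<partial>H)"
  proof (rule integral_mono_AE)
    show "AE h in H. indicator {y<..} h + indicator {..A} h * tail H y + indicator {A<..y} h * tail H (y - h)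
       \<le> tail H (y - h)"
      using AE_nonneg
      by eventually_elim (use assms in \<open>auto simp: indicator_def tail_neg tail_antimono\<close>)
  qed (use i integrable_tail_conv integrable_tail_conv' in auto)
  finally show ?thesis .
qed

lemma conv_le_eventually:
  assumes "0 < \<epsilon>"
  shows "\<forall>\<^sub>F y in at_top. (\<integral>h. tail H (y - h) \<partial>H) \<le> (2 + \<epsilon>) * tail H y"
proof -
  have "\<forall>\<^sub>F y in at_top. (\<integral>h. tail H (y - h) \<partial>H) / tail H y < 2 + \<epsilon>"
    using conv_ratio by (rule order_tendstoD) (use assms in auto)
  then show ?thesis
    by eventually_elim (use tail_pos in \<open>simp add: field_simps less_imp_le\<close>)
qed

text \<open>Two large summands are a rare way to exceed \<open>y\<close>: the other two ranges of
  \<open>tail_conv_split\<close> already use up \<open>(2 - tail H A) * tail H y\<close>. Here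
  \<open>A0\<close> depends on \<epsilon> only, while the threshold for \<open>y\<close> may depend
  on \<open>A\<close>.\<close>

lemma mid_integral_small:
  assumes "0 < \<epsilon>"
  shows "\<exists>A0\<ge>0. \<forall>A\<ge>A0. \<forall>\<^sub>F y in at_top. (\<integral>h. indicator {A<..y} h * tail H (y - h) \<partial>H) \<le> \<epsilon> * tail H y"
proof -
  have "\<forall>\<^sub>F A in at_top. tail H A < \<epsilon>/2 \<and> A \<ge> 0"
    using order_tendstoD(2)[OF tail_tendsto_0, of "\<epsilon>/2"] eventually_ge_at_top[of 0] assms
    by (auto intro: eventually_conj)
  then obtain A0 where A0: "tail H A0 < \<epsilon>/2" "A0 \<ge> 0"
    by (auto dest: eventually_happens)
  show ?thesis
  proof (intro exI[of _ A0] conjI allI impI A0)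
    fix A assume "A0 \<le> A"
    then have A: "tail H A < \<epsilon>/2"
      using A0 tail_antimono[of A0 A] by simp
    have "\<forall>\<^sub>F y in at_top. (\<integral>h. tail H (y - h) \<partial>H) \<le> (2 + \<epsilon>/2) * tail H y"
      using assms by (intro conv_le_eventually) auto
    then show "\<forall>\<^sub>F y in at_top. (\<integral>h. indicator {A<..y} h * tail H (y - h) \<partial>H) \<le> \<epsilon> * tail H y"
      using eventually_ge_at_top[of A]
    proof eventually_elim
      case (elim y)
      have "tail H A * tail H y \<le> \<epsilon>/2 * tail H y"
        using A by (intro mult_right_mono tail_nonneg) auto
      with tail_conv_split[OF elim(2)] elim(1) show ?case
        by (simp add: algebra_simps)
    qed
  qed
qed

text \<open>A constant shift is asymptotically free. If \<open>tail H (y - B)\<close> were much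
  larger than \<open>tail H y\<close>, the middle range of the convolution integral, where the
  integrand is at least \<open>tail H (y - B)\<close>, would push the ratio in
  \<open>conv_ratio\<close> above 2.\<close>

lemma long_tailed:
  assumes "0 < \<epsilon>"
  shows "\<forall>\<^sub>F y in at_top. tail H (y - A) \<le> (1 + \<epsilon>) * tail H y"
proof -
  define B where "B = max A 0"
  \<comment> \<open>This quotient bounds \<open>tail H (y - B) / tail H y\<close>: its denominator
    is the mass of the middle range, its numerator what \<open>tail_conv_split\<close> leaves for
    that range, in units of \<open>tail H y\<close>.\<close>
  have lim: "((\<lambda>y. ((\<integral>h. tail H (y - h) \<partial>H) / tail H y - 2 + tail H B) / (tail H B - tail H y))
     \<longlongrightarrow> (2 - 2 + tail H B) / (tail H B - 0)) at_top"
    using tail_pos[of B] by (intro tendsto_intros conv_ratio tail_tendsto_0) auto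
  have "\<forall>\<^sub>F y in at_top. ((\<integral>h. tail H (y - h) \<partial>H) / tail H y - 2 + tail H B) / (tail H B - tail H y) < 1 + \<epsilon>"
    using lim by (rule order_tendstoD) (use tail_pos[of B] assms in auto)
  moreover have "\<forall>\<^sub>F y in at_top. tail H y < tail H B"
    using tail_tendsto_0 by (rule order_tendstoD) (rule tail_pos)
  ultimately show ?thesis
    using eventually_ge_at_top[of B]
  proof eventually_elim
    case (elim y)
    have "(tail H B - tail H y) * tail H (y - B) = (\<integral>h. indicator {B<..y} h * tail H (y - B) \<partial>H)"
    proof -
      have "prob {B<..y} = prob {B<..} - prob {y<..}"
        using elim(3) by (subst finite_measure_Diff[symmetric]) (auto intro!: arg_cong[where f=prob])
      then show ?thesis by (simp add: tail_def)
    qed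
    also have "\<dots> \<le> (\<integral>h. indicator {B<..y} h * tail H (y - h) \<partial>H)"
      by (intro integral_mono integrable_tail_conv integrable_bounded[where B=1])
        (auto simp: indicator_def tail_nonneg tail_le_1 tail_antimono)
    also have "\<dots> \<le> (\<integral>h. tail H (y - h) \<partial>H) - 2 * tail H y + tail H B * tail H y"
      using tail_conv_split[OF elim(3)] by (simp add: algebra_simps)
    also have "\<dots> = ((\<integral>h. tail H (y - h) \<partial>H) / tail H y - 2 + tail H B) * tail H y"
      using tail_pos[of y] by (simp add: field_simps)
    also have "\<dots> \<le> ((1 + \<epsilon>) * (tail H B - tail H y)) * tail H y"
      using elim(1,2) by (intro mult_right_mono tail_nonneg) (simp add: pos_divide_less_eq less_imp_le)
    finally have "tail H (y - B) \<le> (1 + \<epsilon>) * tail H y"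
      using elim(2) by (simp add: mult_ac)
    moreover have "tail H (y - A) \<le> tail H (y - B)"
      by (intro tail_antimono) (auto simp: B_def)
    ultimately show ?case by simp
  qed
qed

lemma long_tailed_lower:
  assumes "0 < \<epsilon>"
  shows "\<forall>\<^sub>F y in at_top. (1 - \<epsilon>) * tail H y \<le> tail H (y + L)"
proof -
  have "\<forall>\<^sub>F y in at_top. tail H (y - L) \<le> (1 + \<epsilon>) * tail H y"
    by (rule long_tailed[OF assms])
  moreover have "filterlim (\<lambda>y. y + L) at_top at_top"
    by real_asymp
  ultimately have "\<forall>\<^sub>F y in at_top. tail H (y + L - L) \<le> (1 + \<epsilon>) * tail H (y + L)"
    by (rule eventually_compose_filterlim)
  then show ?thesis
  proof eventually_elim
    case (elim y)
    have "(1 - \<epsilon>) * tail H y \<le> tail H y / (1 + \<epsilon>)"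
    proof -
      have "(1 - \<epsilon>) * (1 + \<epsilon>) \<le> 1" by (simp add: algebra_simps)
      then have "((1 - \<epsilon>) * (1 + \<epsilon>)) * tail H y \<le> 1 * tail H y"
        by (rule mult_right_mono[OF _ tail_nonneg])
      then show ?thesis
        using assms by (simp add: pos_le_divide_eq mult_ac)
    qed
    also have "\<dots> \<le> tail H (y + L)"
      using elim assms by (simp add: pos_divide_le_eq mult_ac)
    finally show ?case .
  qed
qed

text \<open>Below the threshold \<open>y0\<close> the convolution is at most 1 and
  \<open>tail H y\<close> is at least \<open>tail H y0\<close>; adding \<open>1 / tail H y0\<close>
  to the constant therefore extends the asymptotic bound to all \<open>y\<close>. The same device
  proves \<open>bounded_by_tail\<close>.\<close>

lemma conv_le:
  obtains K where "1 \<le> K" "\<And>y. (\<integral>h. tail H (y - h) \<partial>H) \<le> K * tail H y"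
proof -
  obtain y0 where y0: "\<And>y. y \<ge> y0 \<Longrightarrow> (\<integral>h. tail H (y - h) \<partial>H) \<le> 3 * tail H y"
    using conv_le_eventually[of 1] by (auto simp: eventually_at_top_linorder)
  define K where "K = 3 + 1 / tail H y0"
  have "(\<integral>h. tail H (y - h) \<partial>H) \<le> K * tail H y" for y
  proof (cases "y \<ge> y0")
    case True
    have "3 * tail H y \<le> K * tail H y"
      using tail_pos[of y0] by (intro mult_right_mono tail_nonneg) (simp add: K_def)
    with y0[OF True] show ?thesis by simp
  next
    case False
    have "(\<integral>h. tail H (y - h) \<partial>H) \<le> 1"
      by (rule integral_le_bound) (auto simp: tail_nonneg tail_le_1)
    also have "1 \<le> 1 / tail H y0 * tail H y"
      using tail_pos[of y0] tail_antimono[of y y0] False by (simp add: field_simps)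
    also have "\<dots> \<le> K * tail H y"
      by (intro mult_right_mono tail_nonneg) (simp add: K_def)
    finally show ?thesis .
  qed
  then show ?thesis
    using tail_pos[of y0] by (intro that[of K]) (auto simp: K_def)
qed

lemma bounded_by_tail:
  assumes "\<forall>\<^sub>F v in at_top. \<phi> v \<le> k * tail H v" "\<And>v. \<phi> v \<le> B"
  obtains K where "0 \<le> K" "k \<le> K" "\<And>v. \<phi> v \<le> K * tail H v"
proof -
  obtain v0 where v0: "\<And>v. v \<ge> v0 \<Longrightarrow> \<phi> v \<le> k * tail H v"
    using assms(1) by (auto simp: eventually_at_top_linorder)
  define K where "K = max k 0 + max B 0 / tail H v0"
  have K: "0 \<le> K" "k \<le> K" "max B 0 / tail H v0 \<le> K"
    using tail_pos[of v0] by (auto simp: K_def intro: add_nonneg_nonneg add_increasing2)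
  have "\<phi> v \<le> K * tail H v" for v
  proof (cases "v \<ge> v0")
    case True
    have "k * tail H v \<le> K * tail H v"
      using K by (intro mult_right_mono tail_nonneg)
    with v0[OF True] show ?thesis by simp
  next
    case False
    have "\<phi> v \<le> max B 0" using assms(2)[of v] by simp
    also have "max B 0 \<le> max B 0 / tail H v0 * tail H v"
    proof -
      have "max B 0 * tail H v0 \<le> max B 0 * tail H v"
        using tail_antimono[of v v0] False by (intro mult_left_mono) auto
      then show ?thesis by (simp only: times_divide_eq_left pos_le_divide_eq[OF tail_pos])
    qed
    also have "\<dots> \<le> K * tail H v"
      by (intro mult_right_mono tail_nonneg K)
    finally show ?thesis .
  qed
  with K show ?thesis by (intro that) auto
qed

text \<open>Moving the level by a variable \<zeta> whose tail is of smaller order than that of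
  \<open>H\<close> leaves the asymptotic constant \<open>k\<close> of \<phi> unchanged. Up to a
  large \<open>A\<close> the shift is absorbed by \<open>long_tailed\<close>; beyond
  \<open>A\<close> two tails are combined, and the result is a small multiple of a convolution tail.
  The cut at 0 keeps the argument of \<phi> in the range where it is known to be monotone.\<close>

lemma smoothing_upper:
  assumes Q: "prob_space Q" and [measurable]: "\<zeta> \<in> borel_measurable Q"
    and small: "\<And>\<epsilon>. 0 < \<epsilon> \<Longrightarrow> \<forall>\<^sub>F v in at_top. measure Q {\<omega> \<in> space Q. v < \<zeta> \<omega>} \<le> \<epsilon> * tail H v"
    and \<phi>0: "\<And>v. 0 \<le> v \<Longrightarrow> 0 \<le> \<phi> v"
    and \<phi>mono: "\<And>u v. 0 \<le> u \<Longrightarrow> u \<le> v \<Longrightarrow> \<phi> v \<le> \<phi> u"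
    and \<phi>lim: "\<And>k'. k < k' \<Longrightarrow> \<forall>\<^sub>F v in at_top. \<phi> v \<le> k' * tail H v"
    and k: "0 \<le> k" "k < k'"
  shows "\<forall>\<^sub>F y in at_top. (\<integral>\<omega>. \<phi> (max 0 (y - \<zeta> \<omega>)) \<partial>Q) \<le> k' * tail H y"
proof -
  interpret Q: prob_space Q by fact
  define \<psi> where "\<psi> v = \<phi> (max 0 v)" for v
  have \<psi>0: "0 \<le> \<psi> v" and \<psi>mono: "u \<le> v \<Longrightarrow> \<psi> v \<le> \<psi> u" and \<psi>bd: "\<psi> v \<le> \<phi> 0" for u v
    by (auto simp: \<psi>_def \<phi>0 intro: \<phi>mono)
  have [measurable]: "\<psi> \<in> borel_measurable borel" by (rule borel_measurable_antimono) (rule \<psi>mono)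
  have \<psi>lim: "\<forall>\<^sub>F v in at_top. \<psi> v \<le> k' * tail H v" if "k < k'" for k'
    using \<phi>lim[OF that] eventually_ge_at_top[of 0] by eventually_elim (simp add: \<psi>_def)
  obtain K where K: "0 \<le> K" "\<And>v. \<psi> v \<le> K * tail H v"
    by (rule bounded_by_tail[OF \<psi>lim[of "k+1"] \<psi>bd]) auto
  obtain K3 where K3: "1 \<le> K3" "\<And>y. (\<integral>h. tail H (y - h) \<partial>H) \<le> K3 * tail H y"
    using conv_le by blast
  \<comment> \<open>Three equal margins: for the constant of \<psi>, for the shift by
    \<open>A\<close>, and for the part where \<zeta> exceeds \<open>A\<close>.\<close>
  define e where "e = (k' - k) / 3"
  have e: "0 < e" "k' = k + 3 * e" using k by (simp_all add: e_def field_simps)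
  define \<epsilon> where "\<epsilon> = e / ((K + 1) * K3)"
  have \<epsilon>: "0 < \<epsilon>" "K * (\<epsilon> * K3) \<le> e"
  proof -
    have "0 < (K + 1) * K3" using K K3 by (intro mult_pos_pos) auto
    moreover have "K * K3 * e \<le> (K + 1) * K3 * e"
      using K K3 e by (intro mult_right_mono) auto
    moreover have "K * (\<epsilon> * K3) = K * K3 * e / ((K + 1) * K3)"
      by (simp add: \<epsilon>_def)
    ultimately show "0 < \<epsilon>" "K * (\<epsilon> * K3) \<le> e"
      using e(1) by (simp_all only: \<epsilon>_def divide_pos_pos pos_divide_le_eq) (simp add: mult_ac)
  qed
  obtain A where A: "\<And>v. v \<ge> A \<Longrightarrow> measure Q {\<omega> \<in> space Q. v < \<zeta> \<omega>} \<le> \<epsilon> * tail H v" "A \<ge> 0"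
    using eventually_conj[OF small[OF \<epsilon>(1)] eventually_ge_at_top[of 0]]
    unfolding eventually_at_top_linorder by blast
  define \<epsilon>' where "\<epsilon>' = e / (k + e + 1)"
  have \<epsilon>': "0 < \<epsilon>'" "(k + e) * (1 + \<epsilon>') \<le> k + 2 * e"
    using e k by (auto simp: \<epsilon>'_def field_simps)
  have sh: "filterlim (\<lambda>y. y - A) at_top at_top" by real_asymp
  have "\<forall>\<^sub>F y in at_top. \<psi> (y - A) \<le> (k + e) * tail H (y - A)"
    by (rule eventually_compose_filterlim[OF \<psi>lim sh]) (use e in auto)
  then show ?thesis
    using long_tailed[OF \<epsilon>'(1), of A]
  proof eventually_elim
    case (elim y)
    have [measurable]: "{\<omega> \<in> space Q. A < \<zeta> \<omega>} \<in> sets Q" by measurable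
    let ?E = "{\<omega> \<in> space Q. A < \<zeta> \<omega>}"
    have intE: "integrable Q (\<lambda>\<omega>. indicator ?E \<omega> * tail H (y - \<zeta> \<omega>))"
      by (rule Q.integrable_bounded[where B=1]) (auto simp: indicator_def tail_nonneg tail_le_1)
    have "(\<integral>\<omega>. \<phi> (max 0 (y - \<zeta> \<omega>)) \<partial>Q) = (\<integral>\<omega>. \<psi> (y - \<zeta> \<omega>) \<partial>Q)"
      by (simp add: \<psi>_def)
    also have "\<dots> \<le> (\<integral>\<omega>. \<psi> (y - A) + K * (indicator ?E \<omega> * tail H (y - \<zeta> \<omega>)) \<partial>Q)"
    proof (rule integral_mono)
      show "integrable Q (\<lambda>\<omega>. \<psi> (y - \<zeta> \<omega>))"
        by (rule Q.integrable_bounded[where B="\<phi> 0"]) (auto simp: \<psi>0 \<psi>bd)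
      show "integrable Q (\<lambda>\<omega>. \<psi> (y - A) + K * (indicator ?E \<omega> * tail H (y - \<zeta> \<omega>)))"
        using intE by simp
      show "\<psi> (y - \<zeta> \<omega>) \<le> \<psi> (y - A) + K * (indicator ?E \<omega> * tail H (y - \<zeta> \<omega>))" if "\<omega> \<in> space Q" for \<omega>
        using that K(2)[of "y - \<zeta> \<omega>"] \<psi>0[of "y - A"] \<psi>mono[of "y - A" "y - \<zeta> \<omega>"]
        by (cases "A < \<zeta> \<omega>") (auto simp: indicator_def)
    qed
    also have "\<dots> = \<psi> (y - A) + K * (\<integral>\<omega>. indicator ?E \<omega> * tail H (y - \<zeta> \<omega>) \<partial>Q)"
      using intE by (simp add: Q.prob_space)
    also have "(\<integral>\<omega>. indicator ?E \<omega> * tail H (y - \<zeta> \<omega>) \<partial>Q)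
        = (\<integral>h. measure Q {\<omega> \<in> space Q. \<omega> \<in> ?E \<and> y - h < \<zeta> \<omega>} \<partial>H)"
      by (rule integral_tail_shift[OF Q]) auto
    also have "\<dots> \<le> (\<integral>h. \<epsilon> * tail H (y - h) \<partial>H)"
    proof (rule integral_mono_AE')
      show "integrable H (\<lambda>h. \<epsilon> * tail H (y - h))"
        using integrable_tail_conv' by simp
      show "AE h in H. 0 \<le> \<epsilon> * tail H (y - h)"
        using \<epsilon> by (auto simp: tail_nonneg)
      show "AE h in H. measure Q {\<omega> \<in> space Q. \<omega> \<in> ?E \<and> y - h < \<zeta> \<omega>} \<le> \<epsilon> * tail H (y - h)"
      proof (rule AE_I2)
        fix h
        \<comment> \<open>On \<open>?E\<close> the level \<open>y - h\<close> may be raised to at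
          least \<open>A\<close>, so the bound known only from \<open>A\<close> on applies for every
          \<open>h\<close>.\<close>
        have "measure Q {\<omega> \<in> space Q. \<omega> \<in> ?E \<and> y - h < \<zeta> \<omega>} = measure Q {\<omega> \<in> space Q. max A (y - h) < \<zeta> \<omega>}"
          by (rule arg_cong[where f="measure Q"]) auto
        also have "\<dots> \<le> \<epsilon> * tail H (max A (y - h))" by (rule A) auto
        also have "\<dots> \<le> \<epsilon> * tail H (y - h)"
          using \<epsilon> by (intro mult_left_mono tail_antimono) auto
        finally show "measure Q {\<omega> \<in> space Q. \<omega> \<in> ?E \<and> y - h < \<zeta> \<omega>} \<le> \<epsilon> * tail H (y - h)" .
      qed
    qed
    also have "\<dots> \<le> \<epsilon> * (K3 * tail H y)"
      using K3(2)[of y] \<epsilon> by simp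
    finally have "(\<integral>\<omega>. \<phi> (max 0 (y - \<zeta> \<omega>)) \<partial>Q) \<le> \<psi> (y - A) + K * (\<epsilon> * (K3 * tail H y))"
      using K by (simp add: mult_left_mono)
    also have "\<dots> \<le> (k + e) * ((1 + \<epsilon>') * tail H y) + e * tail H y"
    proof (rule add_mono)
      have "(k + e) * tail H (y - A) \<le> (k + e) * ((1 + \<epsilon>') * tail H y)"
        using elim(2) k e by (intro mult_left_mono) auto
      with elim(1) show "\<psi> (y - A) \<le> (k + e) * ((1 + \<epsilon>') * tail H y)" by linarith
      have "K * (\<epsilon> * K3) * tail H y \<le> e * tail H y"
        using \<epsilon> by (intro mult_right_mono tail_nonneg)
      then show "K * (\<epsilon> * (K3 * tail H y)) \<le> e * tail H y" by (simp add: mult_ac)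
    qed
    also have "\<dots> = ((k + e) * (1 + \<epsilon>') + e) * tail H y" by (simp add: algebra_simps)
    also have "\<dots> \<le> k' * tail H y"
      using \<epsilon>' e by (intro mult_right_mono tail_nonneg) auto
    finally show ?case .
  qed
qed

end

section \<open>Level crossing of walks with independent steps\<close>

type_synonym 'a step = "('a \<Rightarrow> real) \<times> ('a \<Rightarrow> real)"

text \<open>A step \<open>(Y, Z)\<close> moves the walk by \<open>Y\<close>, and \<open>Z \<ge> Y\<close> is the highest point reached during the step
  (for a single increment \<open>Z = Y\<close>, for a whole cycle \<open>Z\<close> is its running maximum). With independent steps,
  \<open>hit Q ps u\<close> is the probability that the walk with steps \<open>ps\<close> ever exceeds \<open>u \<ge> 0\<close>; \<open>tail_sum Q d ps z\<close> is the
  expected number of steps that jump above the rising line \<open>z, z + d, z + 2 * d, \<dots>\<close>; and \<open>tilt d\<close> makes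
  the level \<open>0\<close> of the walk decrease by \<open>d\<close> per step.\<close>

primrec hit :: "'a measure \<Rightarrow> 'a step list \<Rightarrow> real \<Rightarrow> real" where
  "hit Q [] u = 0"
| "hit Q (p # ps) u = (\<integral>\<omega>. (if u < snd p \<omega> then 1 else hit Q ps (u - fst p \<omega>)) \<partial>Q)"

primrec tail_sum :: "'a measure \<Rightarrow> real \<Rightarrow> 'a step list \<Rightarrow> real \<Rightarrow> real" where
  "tail_sum Q d [] z = 0"
| "tail_sum Q d (p # ps) z = measure Q {\<omega> \<in> space Q. z < snd p \<omega>} + tail_sum Q d ps (z + d)"

definition steps :: "'a measure \<Rightarrow> 'a step set" where
  "steps Q = {p. fst p \<in> borel_measurable Q \<and> snd p \<in> borel_measurable Q \<and> (\<forall>\<omega>\<in>space Q. fst p \<omega> \<le> snd p \<omega>)}"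

definition tilt :: "real \<Rightarrow> 'a step \<Rightarrow> 'a step" where
  "tilt d p = (\<lambda>\<omega>. fst p \<omega> + d, snd p)"

lemma tail_sum_antimono:
  assumes "prob_space Q" "\<forall>p\<in>set ps. snd p \<in> borel_measurable Q" "u \<le> v"
  shows "tail_sum Q d ps v \<le> tail_sum Q d ps u"
  using assms(2,3)
proof (induction ps arbitrary: u v)
  case (Cons p ps)
  interpret prob_space Q by fact
  have [measurable]: "snd p \<in> borel_measurable Q" using Cons by simp
  have "prob {\<omega> \<in> space Q. v < snd p \<omega>} \<le> prob {\<omega> \<in> space Q. u < snd p \<omega>}"
    using Cons by (intro finite_measure_mono) auto
  moreover have "tail_sum Q d ps (v + d) \<le> tail_sum Q d ps (u + d)"
    using Cons by auto
  ultimately show ?case by simp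
qed simp

lemma tail_sum_nonneg: "0 \<le> tail_sum Q d ps z"
  by (induction ps arbitrary: z) auto

lemma (in prob_space) tail_sum_le_length: "tail_sum M d ps z \<le> length ps"
proof (induction ps arbitrary: z)
  case (Cons p ps)
  show ?case using add_mono[OF prob_le_1[of "{\<omega> \<in> space M. z < snd p \<omega>}"] Cons[of "z + d"]] by simp
qed simp

context prob_space
begin

text \<open>The three facts need one common induction: monotonicity of \<open>hit\<close> in the
  level supplies the measurability that the integrals of the next step require.\<close>

lemma
  assumes "\<forall>p\<in>set ps. fst p \<in> borel_measurable M \<and> snd p \<in> borel_measurable M"
  shows hit_nonneg: "0 \<le> hit M ps u" and hit_le_1: "hit M ps u \<le> 1"
    and hit_antimono: "u \<le> v \<Longrightarrow> hit M ps v \<le> hit M ps u"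
proof -
  have "0 \<le> hit M ps u \<and> hit M ps u \<le> 1 \<and> (u \<le> v \<longrightarrow> hit M ps v \<le> hit M ps u)" for u v
    using assms
  proof (induction ps arbitrary: u v)
    case (Cons p ps)
    have [measurable]: "fst p \<in> borel_measurable M" "snd p \<in> borel_measurable M" using Cons by auto
    have IH: "0 \<le> hit M ps u" "hit M ps u \<le> 1" "u \<le> v \<longrightarrow> hit M ps v \<le> hit M ps u" for u v
      using Cons.IH[of u v] Cons.prems by auto
    have [measurable]: "hit M ps \<in> borel_measurable borel"
      by (rule borel_measurable_antimono) (use IH in blast)
    have int: "integrable M (\<lambda>\<omega>. if u < snd p \<omega> then 1 else hit M ps (u - fst p \<omega>))" for u
      by (rule integrable_bounded[where B=1]) (use IH in auto)
    have "hit M (p # ps) v \<le> hit M (p # ps) u" if "u \<le> v"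
      unfolding hit.simps by (intro integral_mono int) (use that IH in auto)
    moreover have "hit M (p # ps) u \<le> 1"
      unfolding hit.simps by (intro integral_le_bound) (use IH in auto)
    moreover have "0 \<le> hit M (p # ps) u"
      unfolding hit.simps by (intro Bochner_Integration.integral_nonneg) (use IH in auto)
    ultimately show ?case by blast
  qed auto
  then show "0 \<le> hit M ps u" "hit M ps u \<le> 1" "u \<le> v \<Longrightarrow> hit M ps v \<le> hit M ps u" by blast+
qed

lemma borel_measurable_hit:
  assumes "\<forall>p\<in>set ps. fst p \<in> borel_measurable M \<and> snd p \<in> borel_measurable M"
  shows "hit M ps \<in> borel_measurable borel"
  by (rule borel_measurable_antimono) (rule hit_antimono[OF assms])

lemma integrable_hit:
  assumes "\<forall>p\<in>set (p # ps). fst p \<in> borel_measurable M \<and> snd p \<in> borel_measurable M"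
  shows "integrable M (\<lambda>\<omega>. if u < snd p \<omega> then 1 else hit M ps (u - fst p \<omega>))"
proof -
  have ps: "\<forall>p\<in>set ps. fst p \<in> borel_measurable M \<and> snd p \<in> borel_measurable M"
    and [measurable]: "fst p \<in> borel_measurable M" "snd p \<in> borel_measurable M" using assms by auto
  have [measurable]: "hit M ps \<in> borel_measurable borel"
    by (rule borel_measurable_hit[OF ps])
  show ?thesis
    by (rule integrable_bounded[where B=1]) (auto simp: hit_nonneg[OF ps] hit_le_1[OF ps])
qed

lemma lists_steps_measurable:
  assumes \<G>: "\<G> \<subseteq> steps M" and ps: "ps \<in> lists \<G>"
  shows "\<forall>p\<in>set ps. fst p \<in> borel_measurable M \<and> snd p \<in> borel_measurable M"
    "\<forall>p\<in>set (map (tilt d) ps). fst p \<in> borel_measurable M \<and> snd p \<in> borel_measurable M"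
proof -
  show *: "\<forall>p\<in>set ps. fst p \<in> borel_measurable M \<and> snd p \<in> borel_measurable M"
    using assms by (auto simp: steps_def in_lists_conv_set subset_iff)
  show "\<forall>p\<in>set (map (tilt d) ps). fst p \<in> borel_measurable M \<and> snd p \<in> borel_measurable M"
    using * by (force simp: tilt_def intro!: borel_measurable_add)
qed

text \<open>Renewal at the first crossing of the declining line \<open>r - k * d\<close>: the crossing step either passes
  \<open>u - A\<close> at once, or lands at distance at least \<open>A\<close> below \<open>u\<close>, where \<open>hyp\<close> applies to the remaining steps.\<close>

lemma hit_le_big_jump:
  assumes H: "real_distribution H" and \<G>: "\<G> \<subseteq> steps M" and K: "0 \<le> K" and d: "0 \<le> d" and Ac: "0 \<le> A" "A \<le> c"
    and hyp: "\<And>gs v. gs \<in> lists \<G> \<Longrightarrow> length gs < N \<Longrightarrow> A \<le> v \<Longrightarrow> hit M gs v \<le> K * tail H v"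
    and "ps \<in> lists \<G>" "length ps \<le> N" "- d \<le> r" "r \<le> u"
  shows "hit M ps u \<le> tail_sum M d ps (u - A - r - d)
      + K * (\<integral>h. indicator {A<..c} h * tail_sum M d ps (u - h - r - d) \<partial>H)
      + K * tail H c * hit M (map (tilt d) ps) r"
  using assms(8-11)
proof (induction ps arbitrary: r u rule: list.induct)
  case (Cons p ps)
  interpret H: real_distribution H by fact
  interpret MH: pair_prob_space M H ..
  have [measurable_cong]: "sets H = sets borel" by simp
  have p: "p \<in> \<G>" "ps \<in> lists \<G>" using Cons by auto
  note mp = lists_steps_measurable[OF \<G> Cons.prems(1)] and mps = lists_steps_measurable[OF \<G> p(2)]
  have [measurable]: "fst p \<in> borel_measurable M" "snd p \<in> borel_measurable M"
    and YZ: "\<And>\<omega>. \<omega> \<in> space M \<Longrightarrow> fst p \<omega> \<le> snd p \<omega>"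
    using p \<G> by (auto simp: steps_def)
  have [measurable]: "tail_sum M d ps \<in> borel_measurable borel"
    by (rule borel_measurable_antimono) (intro tail_sum_antimono prob_space_axioms, use mps in auto)
  have mts: "(\<lambda>h. measure M {\<omega> \<in> space M. u - h - r - d < snd p \<omega>}) \<in> borel_measurable borel"
  proof -
    have "(\<lambda>z. measure M {\<omega> \<in> space M. z < snd p \<omega>}) \<in> borel_measurable borel"
      by (rule borel_measurable_antimono) (auto intro!: finite_measure_mono)
    then show ?thesis by measurable
  qed
  \<comment> \<open>After \<open>k\<close> steps without a crossing the walk is at most
    \<open>r + d - k * d\<close> (for \<open>k = 0\<close> because \<open>- d \<le> r\<close>). A
    next step that brings it past \<open>u - A\<close> must therefore jump above
    \<open>u - A - r - d + k * d\<close>; \<open>a\<close> is the first of these events. A value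
    \<open>tail H (u - Z)\<close> is read as the probability that an independent \<open>h\<close> of
    law \<open>H\<close> exceeds \<open>u - Z\<close>: \<open>b\<close> and \<open>b'\<close>
    collect \<open>h \<le> c\<close>, and \<open>e\<close> carries the factor
    \<open>tail H c\<close>.\<close>
  define a where "a \<omega> = (if u - A - r - d < snd p \<omega> then 1 else 0 :: real)" for \<omega>
  define b where "b \<omega> h = indicator {A<..c} h * (if u - h - r - d < snd p \<omega> then 1 else 0 :: real)" for \<omega> h
  define b' where "b' h = indicator {A<..c} h * tail_sum M d ps (u - h - r)" for h
  define e where "e \<omega> = (if r < snd p \<omega> then 1 else hit M (map (tilt d) ps) (r - d - fst p \<omega>))" for \<omega>
  have b01: "0 \<le> b \<omega> h" "b \<omega> h \<le> 1" for \<omega> h by (auto simp: b_def)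
  have [measurable]: "(\<lambda>(\<omega>, h). b \<omega> h) \<in> borel_measurable (M \<Otimes>\<^sub>M H)" "b \<omega> \<in> borel_measurable borel" for \<omega>
    unfolding b_def by measurable
  have [measurable]: "b' \<in> borel_measurable borel"
    unfolding b'_def by measurable
  have intb: "integrable (M \<Otimes>\<^sub>M H) (\<lambda>(\<omega>, h). b \<omega> h)"
    by (rule MH.integrable_bounded[where B=1]) (auto simp: b01)
  have intbH: "integrable H (b \<omega>)" for \<omega>
    by (rule H.integrable_bounded[where B=1]) (auto simp: b01)
  have intb': "integrable H b'"
    by (rule H.integrable_bounded[where B="real (length ps)"])
      (auto simp: b'_def tail_sum_nonneg tail_sum_le_length indicator_def)
  have inta: "integrable M a"
    unfolding a_def by (rule integrable_bounded[where B=1]) auto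
  have e_eq: "e \<omega> = (if r < snd (tilt d p) \<omega> then 1 else hit M (map (tilt d) ps) (r - fst (tilt d p) \<omega>))" for \<omega>
    by (simp add: e_def tilt_def algebra_simps)
  have inte: "integrable M e"
    unfolding e_eq by (rule integrable_hit) (use mp(2) in auto)
  have intbM: "integrable M (\<lambda>\<omega>. \<integral>h. b \<omega> h \<partial>H)"
    using MH.integrable_fst'[OF intb] by simp
  have key: "(if u < snd p \<omega> then 1 else hit M ps (u - fst p \<omega>))
     \<le> a \<omega> + tail_sum M d ps (u - A - r) + K * ((\<integral>h. b \<omega> h \<partial>H) + (\<integral>h. b' h \<partial>H)) + K * tail H c * e \<omega>"
    (is "?L \<le> _") if \<omega>: "\<omega> \<in> space M" for \<omega>
  proof -
    have nn: "0 \<le> (\<integral>h. b \<omega> h \<partial>H)" "0 \<le> (\<integral>h. b' h \<partial>H)" "0 \<le> tail_sum M d ps (u - A - r)" "0 \<le> a \<omega>" "0 \<le> e \<omega>"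
      by (auto simp: b01 b'_def tail_sum_nonneg a_def e_def hit_nonneg[OF mps(2)] intro!: integral_nonneg)
    note nn' = nn(1,2)[THEN mult_nonneg_nonneg[OF K]] mult_nonneg_nonneg[OF mult_nonneg_nonneg[OF K tail_nonneg[of H c]] nn(5)]
    \<comment> \<open>The first step crosses the line and passes \<open>u - A\<close>, crosses it
      and lands lower, or does not cross it.\<close>
    consider "r < snd p \<omega>" "u - A < snd p \<omega>" | "r < snd p \<omega>" "snd p \<omega> \<le> u - A" | "snd p \<omega> \<le> r"
      by linarith
    then show ?thesis
    proof cases
      case 1
      have "?L \<le> 1" using hit_le_1[OF mps(1)] by auto
      moreover have "a \<omega> = 1" using 1 Cons.prems by (auto simp: a_def)
      ultimately show ?thesis using nn nn' by (auto simp: distrib_left)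
    next
      case 2
      have c2: "?L \<le> K * tail H (u - snd p \<omega>)" if "\<not> u < snd p \<omega>"
      proof -
        have "hit M ps (u - fst p \<omega>) \<le> hit M ps (u - snd p \<omega>)"
          using YZ[OF \<omega>] by (intro hit_antimono[OF mps(1)]) auto
        also have "\<dots> \<le> K * tail H (u - snd p \<omega>)"
          using Cons.prems p 2 by (intro hyp) auto
        finally show ?thesis using that by simp
      qed
      have "?L \<le> K * ((\<integral>h. b \<omega> h \<partial>H) + tail H c)"
      proof -
        have False': "\<not> u < snd p \<omega>" using 2 Ac by simp
        have "tail H (u - snd p \<omega>) = (\<integral>h. indicator {u - snd p \<omega><..} h \<partial>H)"
          by (simp add: tail_def)
        also have "\<dots> \<le> (\<integral>h. b \<omega> h + indicator {c<..} h \<partial>H)"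
        proof (rule integral_mono)
          fix h show "indicator {u - snd p \<omega><..} h \<le> b \<omega> h + indicator {c<..} h"
            using 2 Cons.prems by (auto simp: b_def indicator_def)
        next
          have i: "integrable H (indicator {x<..} :: real \<Rightarrow> real)" for x
            by (rule H.integrable_bounded[where B=1]) (auto simp: indicator_def)
          show "integrable H (indicator {u - snd p \<omega><..} :: real \<Rightarrow> real)" by (rule i)
          show "integrable H (\<lambda>h. b \<omega> h + indicator {c<..} h)" using intbH i by simp
        qed
        also have "\<dots> = (\<integral>h. b \<omega> h \<partial>H) + tail H c"
          using intbH by (simp add: tail_def less_top[symmetric])
        finally show ?thesis
          using c2[OF False'] K mult_left_mono by (meson order_trans)
      qed
      moreover have "e \<omega> = 1" using 2 by (simp add: e_def)
      ultimately show ?thesis using nn nn' by (auto simp: distrib_left)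
    next
      \<comment> \<open>Seen from the new position the levels are \<open>u - Y\<close> and
        \<open>r - d - Y\<close>. The latter is again at least \<open>- d\<close>, because
        \<open>Y \<le> Z \<le> r\<close>.\<close>
      case 3
      have "?L = hit M ps (u - fst p \<omega>)" using 3 Cons.prems by auto
      also have "\<dots> \<le> tail_sum M d ps ((u - fst p \<omega>) - A - (r - d - fst p \<omega>) - d)
      + K * (\<integral>h. indicator {A<..c} h * tail_sum M d ps ((u - fst p \<omega>) - h - (r - d - fst p \<omega>) - d) \<partial>H)
      + K * tail H c * hit M (map (tilt d) ps) (r - d - fst p \<omega>)"
        using Cons.prems d p YZ[OF \<omega>] 3 by (intro Cons.IH) auto
      also have "\<dots> = tail_sum M d ps (u - A - r) + K * (\<integral>h. b' h \<partial>H) + K * tail H c * e \<omega>"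
        using 3 by (simp add: b'_def e_def algebra_simps)
      finally show ?thesis using nn nn' by (auto simp: distrib_left)
    qed
  qed
  have "hit M (p # ps) u \<le> (\<integral>\<omega>. a \<omega> + tail_sum M d ps (u - A - r) + K * ((\<integral>h. b \<omega> h \<partial>H) + (\<integral>h. b' h \<partial>H)) + K * tail H c * e \<omega> \<partial>M)"
    unfolding hit.simps
    by (rule integral_mono[OF integrable_hit _ key]) (use mp inta inte intbM in auto)
  also have "\<dots> = (\<integral>\<omega>. a \<omega> \<partial>M) + tail_sum M d ps (u - A - r)
      + K * ((\<integral>\<omega>. (\<integral>h. b \<omega> h \<partial>H) \<partial>M) + (\<integral>h. b' h \<partial>H)) + K * tail H c * (\<integral>\<omega>. e \<omega> \<partial>M)"
    using inta inte intbM by (simp add: prob_space distrib_left)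
  also have "(\<integral>\<omega>. (\<integral>h. b \<omega> h \<partial>H) \<partial>M) = (\<integral>h. (\<integral>\<omega>. b \<omega> h \<partial>M) \<partial>H)"
    by (rule MH.Fubini_integral[OF intb, symmetric])
  also have "\<dots> = (\<integral>h. indicator {A<..c} h * measure M {\<omega> \<in> space M. u - h - r - d < snd p \<omega>} \<partial>H)"
  proof (intro Bochner_Integration.integral_cong refl)
    fix h
    have "(\<integral>\<omega>. (if u - h - r - d < snd p \<omega> then 1 else 0::real) \<partial>M) = (\<integral>\<omega>. indicator {\<omega> \<in> space M. u - h - r - d < snd p \<omega>} \<omega> \<partial>M)"
      by (intro Bochner_Integration.integral_cong) (auto simp: indicator_def)
    then show "(\<integral>\<omega>. b \<omega> h \<partial>M) = indicator {A<..c} h * measure M {\<omega> \<in> space M. u - h - r - d < snd p \<omega>}"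
      by (simp add: b_def)
  qed
  also have "\<dots> + (\<integral>h. b' h \<partial>H) = (\<integral>h. indicator {A<..c} h * tail_sum M d (p # ps) (u - h - r - d) \<partial>H)"
  proof (subst Bochner_Integration.integral_add[symmetric])
    show "integrable H (\<lambda>h. indicator {A<..c} h * measure M {\<omega> \<in> space M. u - h - r - d < snd p \<omega>})"
      using mts by (intro H.integrable_bounded[where B=1]) (auto simp: indicator_def)
  qed (use intb' in \<open>auto simp: b'_def distrib_left algebra_simps\<close>)
  also have "(\<integral>\<omega>. a \<omega> \<partial>M) = measure M {\<omega> \<in> space M. u - A - r - d < snd p \<omega>}"
  proof -
    have "(\<integral>\<omega>. a \<omega> \<partial>M) = (\<integral>\<omega>. indicator {\<omega> \<in> space M. u - A - r - d < snd p \<omega>} \<omega> \<partial>M)"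
      by (intro Bochner_Integration.integral_cong) (auto simp: indicator_def a_def)
    then show ?thesis by simp
  qed
  also have "(\<integral>\<omega>. e \<omega> \<partial>M) = hit M (map (tilt d) (p # ps)) r"
    by (simp add: e_eq)
  finally show ?case by (simp add: algebra_simps)
qed (use K in \<open>auto simp: tail_nonneg\<close>)

end

section \<open>Uniform tail bounds for crossing probabilities\<close>

context subexp_law
begin

text \<open>In units of the tail of \<open>H\<close>, the constant \<open>C\<close> bounds the
  expected number of jumps above a rising line of slope \<open>d\<close>; \<delta> bounds the chance
  that the walk ever crosses the declining line. Both bounds hold for all lists over \<G>, so the
  steps may follow one another in any order and number.\<close>

context
  fixes Q :: "'a measure" and \<G> :: "'a step set" and C d r \<delta> :: real
  assumes Q: "prob_space Q" and \<G>: "\<G> \<subseteq> steps Q"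
    and d: "0 \<le> d" "- d \<le> r"
    and jump: "\<And>C'. C < C' \<Longrightarrow> \<forall>\<^sub>F z in at_top. \<forall>ps\<in>lists \<G>. tail_sum Q d ps z \<le> C' * tail H z"
    and C: "0 \<le> C" and \<delta>: "0 \<le> \<delta>" "\<delta> < 1"
    and cross: "\<And>ps. ps \<in> lists \<G> \<Longrightarrow> hit Q (map (tilt d) ps) r \<le> \<delta>"
begin

text \<open>One renewal improves a constant \<open>K\<close> known for shorter lists:
  \<open>C\<close> accounts for the jumps that pass \<open>u - A\<close> at once, \<delta> for the
  walks that cross the declining line and land far below \<open>u\<close>, and two comparable jumps
  are covered by \<epsilon> through \<open>mid_integral_small\<close>. The range of \<open>u\<close>
  is fixed before \<open>K\<close> and \<open>N\<close>, so the bound can be iterated in the length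
  as well as in the constant.\<close>

lemma hit_improve:
  assumes \<epsilon>: "0 < \<epsilon>"
  shows "\<exists>A0. \<forall>A\<ge>A0. \<forall>\<^sub>F u in at_top. \<forall>K\<ge>0. \<forall>N.
     (\<forall>gs\<in>lists \<G>. length gs < N \<longrightarrow> (\<forall>v\<ge>A. hit Q gs v \<le> K * tail H v)) \<longrightarrow>
     (\<forall>ps\<in>lists \<G>. length ps \<le> N \<longrightarrow> hit Q ps u \<le> (C + \<epsilon> + K * (\<delta> + \<epsilon>)) * tail H u)"
proof -
  interpret Q: prob_space Q by fact
  \<comment> \<open>Small enough that the two coefficients computed in \<open>e1\<close> and
    \<open>e2\<close> exceed \<open>C\<close> and \<delta> by at most \<epsilon>.\<close>
  define e where "e = min 1 (\<epsilon> / (2 * C + 3))"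
  have e: "0 < e" "e \<le> 1" "e * (2 * C + 3) \<le> \<epsilon>"
  proof -
    show "e * (2 * C + 3) \<le> \<epsilon>"
      using C pos_le_divide_eq[of "2 * C + 3" e \<epsilon>] by (simp add: e_def)
  qed (use \<epsilon> C in \<open>auto simp: e_def\<close>)
  have ee: "e * e \<le> e" "C * (e * e) \<le> C * e" "e * \<delta> \<le> e" "e * e * e \<le> e"
    using e C \<delta> by (auto intro!: mult_left_mono mult_left_le mult_le_one)
  have e1: "(C + e) * (1 + e) \<le> C + \<epsilon>"
  proof -
    have "(C + e) * (1 + e) = C + C * e + e + e * e" by (simp add: algebra_simps)
    also have "\<dots> \<le> C + C * e + e + e" using ee by simp
    also have "\<dots> \<le> C + e * (2 * C + 3)" using C e by (simp add: algebra_simps)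
    finally show ?thesis using e by simp
  qed
  have e2: "(C + e) * (e * (1 + e)) + \<delta> * (1 + e) \<le> \<delta> + \<epsilon>"
  proof -
    have "(C + e) * (e * (1 + e)) + \<delta> * (1 + e) = C * e + C * (e * e) + e * e + e * e * e + \<delta> + e * \<delta>"
      by (simp add: algebra_simps)
    also have "\<dots> \<le> C * e + C * e + e + e + \<delta> + e" using ee by (intro add_mono) auto
    also have "\<dots> = \<delta> + e * (2 * C + 3)" by (simp add: algebra_simps)
    finally show ?thesis using e by simp
  qed
  obtain z0 where z0: "\<And>z ps. z \<ge> z0 \<Longrightarrow> ps \<in> lists \<G> \<Longrightarrow> tail_sum Q d ps z \<le> (C + e) * tail H z"
    using jump[of "C + e"] e by (auto simp: eventually_at_top_linorder)
  obtain A1 where A1: "A1 \<ge> 0" "\<And>A. A \<ge> A1 \<Longrightarrow> \<forall>\<^sub>F y in at_top. (\<integral>h. indicator {A<..y} h * tail H (y - h) \<partial>H) \<le> e * tail H y"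
    using mid_integral_small[OF e(1)] by blast
  show ?thesis
  proof (intro exI[of _ "max A1 z0"] allI impI)
    fix A assume A: "max A1 z0 \<le> A"
    have sh: "filterlim (\<lambda>u. u - (r + d)) at_top at_top" by real_asymp
    have "\<forall>\<^sub>F u in at_top. (\<integral>h. indicator {A<..u - (r + d)} h * tail H (u - (r + d) - h) \<partial>H) \<le> e * tail H (u - (r + d))"
      by (rule eventually_compose_filterlim[OF A1(2) sh]) (use A in auto)
    then show "\<forall>\<^sub>F u in at_top. \<forall>K\<ge>0. \<forall>N.
     (\<forall>gs\<in>lists \<G>. length gs < N \<longrightarrow> (\<forall>v\<ge>A. hit Q gs v \<le> K * tail H v)) \<longrightarrow>
     (\<forall>ps\<in>lists \<G>. length ps \<le> N \<longrightarrow> hit Q ps u \<le> (C + \<epsilon> + K * (\<delta> + \<epsilon>)) * tail H u)"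
      using long_tailed[OF e(1), of "r + d"] long_tailed[OF e(1), of "r + d + A"]
        eventually_ge_at_top[of "r + d + A + A"] eventually_ge_at_top[of "z0 + A + r + d"] eventually_ge_at_top[of r]
    proof (eventually_elim, intro allI impI ballI)
      fix u K N ps
      assume mid: "(\<integral>h. indicator {A<..u - (r + d)} h * tail H (u - (r + d) - h) \<partial>H) \<le> e * tail H (u - (r + d))"
        and lt: "tail H (u - (r + d)) \<le> (1 + e) * tail H u" "tail H (u - (r + d + A)) \<le> (1 + e) * tail H u"
        and u: "r + d + A + A \<le> u" "z0 + A + r + d \<le> u" "r \<le> u"
        and K: "0 \<le> K" and hyp: "\<forall>gs\<in>lists \<G>. length gs < N \<longrightarrow> (\<forall>v\<ge>A. hit Q gs v \<le> K * tail H v)"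
        and ps: "ps \<in> lists \<G>" "length ps \<le> N"
      \<comment> \<open>For \<open>h \<le> c\<close> the level \<open>u - h - r - d\<close> stays
        above \<open>A\<close>, where \<open>z0\<close> controls the jumps, while
        \<open>tail H c\<close> is still comparable with \<open>tail H u\<close>.\<close>
      define c where "c = u - r - d - A"
      have "hit Q ps u \<le> tail_sum Q d ps (u - A - r - d)
          + K * (\<integral>h. indicator {A<..c} h * tail_sum Q d ps (u - h - r - d) \<partial>H)
          + K * tail H c * hit Q (map (tilt d) ps) r"
        by (rule Q.hit_le_big_jump[where N=N and \<G>=\<G>])
          (use hyp K d u A A1 ps \<G> in \<open>auto simp: c_def real_distribution_axioms\<close>)
      also have "tail_sum Q d ps (u - A - r - d) \<le> (C + e) * tail H (u - A - r - d)"
        using u ps by (intro z0) auto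
      also have "\<dots> \<le> (C + e) * ((1 + e) * tail H u)"
        using C e lt(2) by (intro mult_left_mono) (auto simp: algebra_simps)
      also have "(\<integral>h. indicator {A<..c} h * tail_sum Q d ps (u - h - r - d) \<partial>H)
          \<le> (\<integral>h. (C + e) * (indicator {A<..u - (r + d)} h * tail H (u - (r + d) - h)) \<partial>H)"
      proof (rule integral_mono_AE')
        show "integrable H (\<lambda>h. (C + e) * (indicator {A<..u - (r + d)} h * tail H (u - (r + d) - h)))"
          using integrable_tail_conv by simp
        show "AE h in H. 0 \<le> (C + e) * (indicator {A<..u - (r + d)} h * tail H (u - (r + d) - h))"
          using C e by (auto simp: tail_nonneg)
        show "AE h in H. indicator {A<..c} h * tail_sum Q d ps (u - h - r - d)
            \<le> (C + e) * (indicator {A<..u - (r + d)} h * tail H (u - (r + d) - h))"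
        proof (rule AE_I2)
          fix h
          show "indicator {A<..c} h * tail_sum Q d ps (u - h - r - d)
            \<le> (C + e) * (indicator {A<..u - (r + d)} h * tail H (u - (r + d) - h))"
          proof (cases "h \<in> {A<..c}")
            case True
            then have "h \<in> {A<..u - (r + d)}" "z0 \<le> u - h - r - d" using A A1 by (auto simp: c_def)
            then show ?thesis using True z0[of "u - h - r - d" ps] ps by (simp add: algebra_simps)
          qed (use C e in \<open>auto simp: tail_nonneg\<close>)
        qed
      qed
      also have "(\<integral>h. (C + e) * (indicator {A<..u - (r + d)} h * tail H (u - (r + d) - h)) \<partial>H)
         \<le> (C + e) * (e * tail H (u - (r + d)))"
        using mid C e by (simp add: mult_left_mono)
      also have "\<dots> \<le> (C + e) * (e * ((1 + e) * tail H u))"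
        using C e lt(1) by (intro mult_left_mono) auto
      also have "K * tail H c * hit Q (map (tilt d) ps) r \<le> K * ((1 + e) * tail H u) * \<delta>"
      proof (rule mult_mono)
        show "K * tail H c \<le> K * ((1 + e) * tail H u)"
          using K lt(2) by (intro mult_left_mono) (auto simp: c_def algebra_simps)
        show "0 \<le> hit Q (map (tilt d) ps) r"
          using Q.lists_steps_measurable(2)[OF \<G> ps(1)] by (intro Q.hit_nonneg)
      qed (use K e ps cross in \<open>auto simp: tail_nonneg\<close>)
      finally have "hit Q ps u \<le> (C + e) * ((1 + e) * tail H u) + K * ((C + e) * (e * ((1 + e) * tail H u)))
          + K * ((1 + e) * tail H u) * \<delta>"
        using K by (simp add: mult_left_mono)
      also have "\<dots> = ((C + e) * (1 + e) + K * ((C + e) * (e * (1 + e)) + \<delta> * (1 + e))) * tail H u"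
        by (simp add: algebra_simps)
      also have "\<dots> \<le> (C + \<epsilon> + K * (\<delta> + \<epsilon>)) * tail H u"
        using e1 mult_left_mono[OF e2 K] by (intro mult_right_mono tail_nonneg) linarith
      finally show "hit Q ps u \<le> (C + \<epsilon> + K * (\<delta> + \<epsilon>)) * tail H u" .
    qed
  qed
qed

text \<open>Strong induction on the length, with a constant that \<open>hit_improve\<close> does not
  increase: \<open>C + \<epsilon> + K * (\<delta> + \<epsilon>) \<le> K\<close> holds once
  \<open>K\<close> is at least \<open>(C + \<epsilon>) / (1 - \<delta> - \<epsilon>)\<close>. The
  other entry of the maximum settles the levels below \<open>u0\<close>, where 1 is a sufficient
  bound for the probability.\<close>

lemma hit_bounded_by_tail:
  obtains K where "0 \<le> K" "\<And>ps u. ps \<in> lists \<G> \<Longrightarrow> hit Q ps u \<le> K * tail H u"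
proof -
  interpret Q: prob_space Q by fact
  define \<epsilon> where "\<epsilon> = (1 - \<delta>) / 2"
  have \<epsilon>: "0 < \<epsilon>" "\<delta> + \<epsilon> < 1" using \<delta> by (auto simp: \<epsilon>_def field_simps)
  obtain A where "\<forall>\<^sub>F u in at_top. \<forall>K\<ge>0. \<forall>N.
     (\<forall>gs\<in>lists \<G>. length gs < N \<longrightarrow> (\<forall>v\<ge>A. hit Q gs v \<le> K * tail H v)) \<longrightarrow>
     (\<forall>ps\<in>lists \<G>. length ps \<le> N \<longrightarrow> hit Q ps u \<le> (C + \<epsilon> + K * (\<delta> + \<epsilon>)) * tail H u)"
    using hit_improve[OF \<epsilon>(1)] by blast
  then obtain u0 where u0: "\<forall>u\<ge>u0. \<forall>K\<ge>0. \<forall>N.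
     (\<forall>gs\<in>lists \<G>. length gs < N \<longrightarrow> (\<forall>v\<ge>A. hit Q gs v \<le> K * tail H v)) \<longrightarrow>
     (\<forall>ps\<in>lists \<G>. length ps \<le> N \<longrightarrow> hit Q ps u \<le> (C + \<epsilon> + K * (\<delta> + \<epsilon>)) * tail H u)"
    unfolding eventually_at_top_linorder ..
  define K where "K = max (1 / tail H u0) ((C + \<epsilon>) / (1 - \<delta> - \<epsilon>))"
  have K: "0 \<le> K" "1 / tail H u0 \<le> K" "C + \<epsilon> + K * (\<delta> + \<epsilon>) \<le> K"
  proof -
    show "1 / tail H u0 \<le> K" by (simp add: K_def)
    moreover have "0 \<le> 1 / tail H u0" by (simp add: tail_nonneg)
    ultimately show "0 \<le> K" by linarith
    have "(C + \<epsilon>) / (1 - \<delta> - \<epsilon>) \<le> K" by (simp add: K_def)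
    then show "C + \<epsilon> + K * (\<delta> + \<epsilon>) \<le> K" using \<epsilon> by (simp add: pos_divide_le_eq algebra_simps)
  qed
  have "\<forall>ps\<in>lists \<G>. length ps = N \<longrightarrow> (\<forall>u. hit Q ps u \<le> K * tail H u)" for N
  proof (induction N rule: less_induct)
    case (less N)
    show ?case
    proof (intro ballI impI allI)
      fix ps u assume ps: "ps \<in> lists \<G>" "length ps = N"
      show "hit Q ps u \<le> K * tail H u"
      proof (cases "u0 \<le> u")
        case True
        have "hit Q ps u \<le> (C + \<epsilon> + K * (\<delta> + \<epsilon>)) * tail H u"
          using u0[THEN spec, THEN mp, OF True, THEN spec, THEN mp, OF K(1), THEN spec[of _ N]] less ps
          by blast
        also have "\<dots> \<le> K * tail H u"
          by (intro mult_right_mono K tail_nonneg)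
        finally show ?thesis .
      next
        case False
        have "hit Q ps u \<le> 1"
          using Q.lists_steps_measurable[OF \<G> ps(1)] by (intro Q.hit_le_1) auto
        also have "1 \<le> 1 / tail H u0 * tail H u"
          using tail_pos[of u0] tail_antimono[of u u0] False by (simp add: field_simps)
        also have "\<dots> \<le> K * tail H u"
          by (intro mult_right_mono K tail_nonneg)
        finally show ?thesis .
      qed
    qed
  qed
  then show ?thesis using K by (intro that[of K]) auto
qed

text \<open>By \<open>hit_improve\<close> the set of admissible asymptotic constants is mapped into itself by
  \<open>K \<mapsto> C + \<epsilon> + K * (\<delta> + \<epsilon>)\<close>, so its infimum is at most \<open>C / (1 - \<delta>)\<close>.\<close>

lemma hit_upper:
  assumes L: "C / (1 - \<delta>) < L"
  shows "\<forall>\<^sub>F u in at_top. \<forall>ps\<in>lists \<G>. hit Q ps u \<le> L * tail H u"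
proof -
  define \<K> where "\<K> = {K. 0 \<le> K \<and> (\<forall>\<^sub>F u in at_top. \<forall>ps\<in>lists \<G>. hit Q ps u \<le> K * tail H u)}"
  obtain K0 where K0': "0 \<le> K0" "\<And>ps u. ps \<in> lists \<G> \<Longrightarrow> hit Q ps u \<le> K0 * tail H u"
    by (rule hit_bounded_by_tail) blast
  then have K0: "K0 \<in> \<K>"
    unfolding \<K>_def by (intro CollectI conjI always_eventually allI ballI)
  have bdd: "bdd_below \<K>" by (rule bdd_belowI[of _ 0]) (auto simp: \<K>_def)
  have step: "C + \<epsilon> + K * (\<delta> + \<epsilon>) \<in> \<K>" if K: "K \<in> \<K>" and \<epsilon>: "0 < \<epsilon>" for K \<epsilon>
  proof -
    obtain A1 where A1: "\<And>u ps. A1 \<le> u \<Longrightarrow> ps \<in> lists \<G> \<Longrightarrow> hit Q ps u \<le> K * tail H u" and K0: "0 \<le> K"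
      using K unfolding \<K>_def eventually_at_top_linorder by blast
    obtain A0 where A0: "\<And>A. A0 \<le> A \<Longrightarrow> \<forall>\<^sub>F u in at_top. \<forall>K\<ge>0. \<forall>N.
     (\<forall>gs\<in>lists \<G>. length gs < N \<longrightarrow> (\<forall>v\<ge>A. hit Q gs v \<le> K * tail H v)) \<longrightarrow>
     (\<forall>ps\<in>lists \<G>. length ps \<le> N \<longrightarrow> hit Q ps u \<le> (C + \<epsilon> + K * (\<delta> + \<epsilon>)) * tail H u)"
      using hit_improve[OF \<epsilon>] by blast
    have "\<forall>\<^sub>F u in at_top. \<forall>ps\<in>lists \<G>. hit Q ps u \<le> (C + \<epsilon> + K * (\<delta> + \<epsilon>)) * tail H u"
      using A0[of "max A0 A1", OF max.cobounded1]
    proof eventually_elim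
      case (elim u)
      have "hit Q ps u \<le> (C + \<epsilon> + K * (\<delta> + \<epsilon>)) * tail H u" if ps: "ps \<in> lists \<G>" for ps
      proof -
        have "\<forall>gs\<in>lists \<G>. length gs < length ps \<longrightarrow> (\<forall>v\<ge>max A0 A1. hit Q gs v \<le> K * tail H v)"
          using A1 by simp
        with elim K0 ps show ?thesis by blast
      qed
      then show ?case by blast
    qed
    moreover have "0 \<le> C + \<epsilon> + K * (\<delta> + \<epsilon>)" using C \<epsilon> K0 \<delta> by simp
    ultimately show ?thesis by (simp add: \<K>_def)
  qed
  define I where "I = Inf \<K>"
  have le1: "I \<le> C + \<epsilon> + K * (\<delta> + \<epsilon>)" if "K \<in> \<K>" "0 < \<epsilon>" for K \<epsilon>
    unfolding I_def using step[OF that] bdd by (rule cInf_lower)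
  have le2: "I \<le> C + K * \<delta>" if K: "K \<in> \<K>" for K
  proof (rule tendsto_le[OF trivial_limit_at_right_real _ tendsto_const])
    show "((\<lambda>\<epsilon>. C + \<epsilon> + K * (\<delta> + \<epsilon>)) \<longlongrightarrow> C + K * \<delta>) (at_right 0)"
      by (auto intro!: tendsto_eq_intros)
    show "\<forall>\<^sub>F \<epsilon> in at_right 0. I \<le> C + \<epsilon> + K * (\<delta> + \<epsilon>)"
      using eventually_at_right_less[of 0] by eventually_elim (rule le1[OF K])
  qed
  \<comment> \<open>After division by \<delta> the bound \<open>le2\<close> passes to the infimum
    over \<open>K\<close>; for \<open>\<delta> = 0\<close> its right-hand side is free of
    \<open>K\<close>.\<close>
  have "I \<le> C + I * \<delta>"
  proof (cases "\<delta> = 0")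
    case False
    then have "(I - C) / \<delta> \<le> K" if "K \<in> \<K>" for K
      using le2[OF that] \<delta> by (simp add: divide_le_eq algebra_simps)
    then have "(I - C) / \<delta> \<le> I"
      unfolding I_def[symmetric] using K0 by (subst (2) I_def, intro cInf_greatest) auto
    then show ?thesis using False \<delta> by (simp add: divide_le_eq algebra_simps)
  qed (use le2[OF K0] in simp)
  then have "I \<le> C / (1 - \<delta>)" using \<delta> by (simp add: pos_le_divide_eq algebra_simps)
  then have "Inf \<K> < L" using L by (simp add: I_def)
  then obtain K where "K \<in> \<K>" "K < L" using K0 by (subst (asm) cInf_less_iff) (auto intro: bdd)
  then have "\<forall>\<^sub>F u in at_top. \<forall>ps\<in>lists \<G>. hit Q ps u \<le> K * tail H u" by (simp add: \<K>_def)
  then show ?thesis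
  proof eventually_elim
    case (elim u)
    have "K * tail H u \<le> L * tail H u" using \<open>K < L\<close> by (intro mult_right_mono tail_nonneg) auto
    with elim show ?case by (meson order_trans)
  qed
qed

end

end

section \<open>Negative drift\<close>

lemma exp_le_quadratic:
  fixes x :: real
  assumes "\<bar>x\<bar> \<le> 1"
  shows "exp x \<le> 1 + x + x\<^sup>2"
proof (cases "0 \<le> x")
  case True
  then show ?thesis using assms by (intro exp_bound) auto
next
  case False
  define y where "y = - x"
  have y: "0 < y" using False by (simp add: y_def)
  have "exp x = 1 / exp y" by (simp add: y_def exp_minus field_simps)
  also have "\<dots> \<le> 1 / (1 + y)"
    using y exp_ge_add_one_self[of y] by (intro divide_left_mono) (auto simp: add_pos_pos)
  also have "\<dots> \<le> 1 - y + y\<^sup>2"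
  proof -
    \<comment> \<open>The product equals \<open>1 + y^3\<close>.\<close>
    have "1 \<le> (1 - y + y\<^sup>2) * (1 + y)"
      using y by (simp add: algebra_simps power2_eq_square)
    then show ?thesis using y by (simp add: divide_le_eq)
  qed
  finally show ?thesis by (simp add: y_def)
qed

context prob_space
begin

lemma integrable_max0: "integrable M f \<Longrightarrow> integrable M (\<lambda>\<omega>. max 0 (f \<omega> - a :: real))"
  by (intro integrable_max) auto

lemma expected_excess_tendsto_0:
  fixes \<psi> :: "'a \<Rightarrow> real"
  assumes [measurable]: "integrable M \<psi>"
  shows "((\<lambda>A. \<integral>\<omega>. max 0 (\<psi> \<omega> - A) \<partial>M) \<longlongrightarrow> 0) at_top"
proof -
  have [measurable]: "\<psi> \<in> borel_measurable M" using assms by auto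
  have "((\<lambda>A. \<integral>\<omega>. max 0 (\<psi> \<omega> - A) \<partial>M) \<longlongrightarrow> (\<integral>\<omega>. 0 \<partial>M)) at_top"
  proof (rule integral_dominated_convergence_at_top[where w="\<lambda>\<omega>. \<bar>\<psi> \<omega>\<bar>"])
    show "AE \<omega> in M. ((\<lambda>A. max 0 (\<psi> \<omega> - A)) \<longlongrightarrow> 0) at_top"
    proof (rule AE_I2)
      fix \<omega>
      have "\<forall>\<^sub>F A in at_top. max 0 (\<psi> \<omega> - A) = 0"
        using eventually_ge_at_top[of "\<psi> \<omega>"] by eventually_elim auto
      then show "((\<lambda>A. max 0 (\<psi> \<omega> - A)) \<longlongrightarrow> 0) at_top" by (rule tendsto_eventually)
    qed
    show "\<forall>\<^sub>F A in at_top. AE \<omega> in M. norm (max 0 (\<psi> \<omega> - A)) \<le> \<bar>\<psi> \<omega>\<bar>"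
      using eventually_ge_at_top[of 0] by eventually_elim auto
  qed (use assms in auto)
  then show ?thesis by simp
qed

lemma truncated_mean_tendsto:
  fixes Y :: "'a \<Rightarrow> real"
  assumes "integrable M Y"
  shows "((\<lambda>\<beta>. \<integral>\<omega>. max (Y \<omega>) (- \<beta>) \<partial>M) \<longlongrightarrow> (\<integral>\<omega>. Y \<omega> \<partial>M)) at_top"
proof -
  have "((\<lambda>\<beta>. (\<integral>\<omega>. Y \<omega> \<partial>M) + (\<integral>\<omega>. max 0 (- Y \<omega> - \<beta>) \<partial>M)) \<longlongrightarrow> (\<integral>\<omega>. Y \<omega> \<partial>M) + 0) at_top"
    using assms by (intro tendsto_intros expected_excess_tendsto_0) auto
  moreover have "(\<integral>\<omega>. max (Y \<omega>) (- \<beta>) \<partial>M) = (\<integral>\<omega>. Y \<omega> \<partial>M) + (\<integral>\<omega>. max 0 (- Y \<omega> - \<beta>) \<partial>M)" for \<beta>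
  proof -
    have "(\<integral>\<omega>. max (Y \<omega>) (- \<beta>) \<partial>M) = (\<integral>\<omega>. Y \<omega> + max 0 (- Y \<omega> - \<beta>) \<partial>M)"
      by (intro Bochner_Integration.integral_cong) auto
    also have "\<dots> = (\<integral>\<omega>. Y \<omega> \<partial>M) + (\<integral>\<omega>. max 0 (- Y \<omega> - \<beta>) \<partial>M)"
      using assms by (intro Bochner_Integration.integral_add integrable_max0) auto
    finally show ?thesis .
  qed
  ultimately show ?thesis by simp
qed

lemma prob_gt_eq_integral:
  fixes \<zeta> :: "'a \<Rightarrow> real"
  assumes [measurable]: "\<zeta> \<in> borel_measurable M"
  shows "integrable M (\<lambda>\<omega>. if z < \<zeta> \<omega> then 1 else 0 :: real)"
    and "(\<integral>\<omega>. (if z < \<zeta> \<omega> then 1 else 0 :: real) \<partial>M) = prob {\<omega> \<in> space M. z < \<zeta> \<omega>}"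
proof -
  have "(\<lambda>\<omega>. if z < \<zeta> \<omega> then 1 else 0 :: real) \<in> borel_measurable M"
    by measurable
  then show "integrable M (\<lambda>\<omega>. if z < \<zeta> \<omega> then 1 else 0 :: real)"
    by (rule integrable_bounded[where B=1]) auto
  have "{\<omega> \<in> space M. z < \<zeta> \<omega>} \<inter> space M = {\<omega> \<in> space M. z < \<zeta> \<omega>}" by auto
  moreover
  have "(\<integral>\<omega>. (if z < \<zeta> \<omega> then 1 else 0 :: real) \<partial>M) = (\<integral>\<omega>. indicator {\<omega> \<in> space M. z < \<zeta> \<omega>} \<omega> \<partial>M)"
    by (intro Bochner_Integration.integral_cong) (auto simp: indicator_def)
  ultimately show "(\<integral>\<omega>. (if z < \<zeta> \<omega> then 1 else 0 :: real) \<partial>M) = prob {\<omega> \<in> space M. z < \<zeta> \<omega>}" by simp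
qed

text \<open>A Riemann sum of mesh \<open>d\<close> for a decreasing function lies below its integral
  begun one mesh earlier, and the mean excess is the integral of the tail. Pathwise the induction
  uses that \<open>d\<close> times the indicator of \<open>z < \<zeta>\<close>, plus the excess over
  \<open>z\<close>, is at most the excess over \<open>z - d\<close>.\<close>

lemma tail_sum_le_excess:
  fixes \<zeta> :: "'a \<Rightarrow> real"
  assumes "0 \<le> d" and int: "integrable M \<zeta>"
    and "\<And>p. p \<in> set ps \<Longrightarrow> snd p \<in> borel_measurable M"
    and "\<And>p \<omega>. p \<in> set ps \<Longrightarrow> \<omega> \<in> space M \<Longrightarrow> snd p \<omega> \<le> \<zeta> \<omega>"
  shows "d * tail_sum M d ps z \<le> (\<integral>\<omega>. max 0 (\<zeta> \<omega> - (z - d)) \<partial>M)"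
  using assms(3,4)
proof (induction ps arbitrary: z)
  case (Cons p ps)
  have [measurable]: "\<zeta> \<in> borel_measurable M" "snd p \<in> borel_measurable M" using int Cons.prems(1)[of p] by auto
  have "d * tail_sum M d (p # ps) z \<le> d * (\<integral>\<omega>. (if z < \<zeta> \<omega> then 1 else 0) \<partial>M) + (\<integral>\<omega>. max 0 (\<zeta> \<omega> - (z + d - d)) \<partial>M)"
  proof -
    have "prob {\<omega> \<in> space M. z < snd p \<omega>} \<le> prob {\<omega> \<in> space M. z < \<zeta> \<omega>}"
      using Cons.prems(2)[of p] by (intro finite_measure_mono) (auto intro: less_le_trans)
    then have "d * prob {\<omega> \<in> space M. z < snd p \<omega>} \<le> d * (\<integral>\<omega>. (if z < \<zeta> \<omega> then 1 else 0) \<partial>M)"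
      using \<open>0 \<le> d\<close> by (simp add: prob_gt_eq_integral mult_left_mono)
    moreover have "d * tail_sum M d ps (z + d) \<le> (\<integral>\<omega>. max 0 (\<zeta> \<omega> - (z + d - d)) \<partial>M)"
      by (rule Cons.IH) (use Cons.prems in auto)
    ultimately show ?thesis by (simp add: distrib_left)
  qed
  also have "\<dots> = (\<integral>\<omega>. d * (if z < \<zeta> \<omega> then 1 else 0) + max 0 (\<zeta> \<omega> - z) \<partial>M)"
    using int by (subst Bochner_Integration.integral_add) (auto intro!: prob_gt_eq_integral integrable_max0)
  also have "\<dots> \<le> (\<integral>\<omega>. max 0 (\<zeta> \<omega> - (z - d)) \<partial>M)"
    using int \<open>0 \<le> d\<close>
    by (intro integral_mono Bochner_Integration.integrable_add integrable_max0 integrable_mult_right prob_gt_eq_integral) auto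
  finally show ?case .
qed (auto intro!: Bochner_Integration.integral_nonneg)

text \<open>The converse comparison: the same Riemann sum, begun at \<open>z\<close> itself,
  dominates the integral. The remaining excess vanishes as \<open>n\<close> grows.\<close>

lemma excess_le_tail_sum:
  fixes \<zeta> :: "'a \<Rightarrow> real"
  assumes "0 \<le> d" and int: "integrable M \<zeta>"
  shows "(\<integral>\<omega>. max 0 (\<zeta> \<omega> - z) \<partial>M) \<le> d * (\<Sum>k<n. prob {\<omega> \<in> space M. z + real k * d < \<zeta> \<omega>})
      + (\<integral>\<omega>. max 0 (\<zeta> \<omega> - (z + real n * d)) \<partial>M)"
proof (induction n)
  case (Suc n)
  have [measurable]: "\<zeta> \<in> borel_measurable M" using int by auto
  let ?z = "z + real n * d"
  have "(\<integral>\<omega>. max 0 (\<zeta> \<omega> - ?z) \<partial>M) \<le> (\<integral>\<omega>. d * (if ?z < \<zeta> \<omega> then 1 else 0) + max 0 (\<zeta> \<omega> - (?z + d)) \<partial>M)"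
    using int \<open>0 \<le> d\<close>
    by (intro integral_mono Bochner_Integration.integrable_add integrable_max0 integrable_mult_right prob_gt_eq_integral) auto
  also have "\<dots> = d * prob {\<omega> \<in> space M. ?z < \<zeta> \<omega>} + (\<integral>\<omega>. max 0 (\<zeta> \<omega> - (?z + d)) \<partial>M)"
    using int by (subst Bochner_Integration.integral_add) (auto intro!: prob_gt_eq_integral integrable_max0 simp: prob_gt_eq_integral)
  finally show ?case using Suc by (simp add: algebra_simps)
qed auto

lemma hit_replicate_mono:
  assumes "fst p \<in> borel_measurable M" "snd p \<in> borel_measurable M"
  shows "hit M (replicate n p) u \<le> hit M (replicate (Suc n) p) u"
proof (induction n arbitrary: u)
  case 0
  then show ?case by (auto intro!: Bochner_Integration.integral_nonneg)
next
  case (Suc n)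
  have *: "\<forall>q\<in>set (p # replicate n p). fst q \<in> borel_measurable M \<and> snd q \<in> borel_measurable M"
    "\<forall>q\<in>set (p # replicate (Suc n) p). fst q \<in> borel_measurable M \<and> snd q \<in> borel_measurable M"
    using assms by auto
  have "hit M (p # replicate n p) u \<le> hit M (p # replicate (Suc n) p) u"
    unfolding hit.simps(2)
    by (intro integral_mono integrable_hit[OF *(1)] integrable_hit[OF *(2)]) (use Suc in auto)
  then show ?case by simp
qed

lemma hit_replicate_mono':
  assumes "fst p \<in> borel_measurable M" "snd p \<in> borel_measurable M" "n \<le> m"
  shows "hit M (replicate n p) u \<le> hit M (replicate m p) u"
  by (rule lift_Suc_mono_le[where f="\<lambda>n. hit M (replicate n p) u", OF hit_replicate_mono]) (use assms in auto)

text \<open>The i.i.d. case of Hopf's maximal ergodic inequality. Summing over levels, \<open>J n = \<integral> h n v dv\<close> over \<open>v \<ge> 0\<close>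
  satisfies \<open>J (n + 1) + l * h (n + 1) 0 \<le> J n + E g\<close>.\<close>

lemma maximal_inequality:
  fixes g :: "'a \<Rightarrow> real"
  assumes int: "integrable M g" and g0: "\<And>\<omega>. \<omega> \<in> space M \<Longrightarrow> 0 \<le> g \<omega>" and l: "0 < l"
  shows "hit M (replicate n (\<lambda>\<omega>. g \<omega> - l, \<lambda>\<omega>. g \<omega> - l)) 0 \<le> (\<integral>\<omega>. g \<omega> \<partial>M) / l"
proof -
  have [measurable]: "g \<in> borel_measurable M" using int by auto
  interpret PL: pair_sigma_finite M lborel ..
  define Y where "Y \<omega> = g \<omega> - l" for \<omega>
  have [measurable]: "Y \<in> borel_measurable M" by (simp add: Y_def[abs_def])
  define h where "h n = hit M (replicate n (Y, Y))" for n
  \<comment> \<open>Extended by 1 to negative levels, so that the recursion of \<open>h\<close>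
    becomes the expectation of \<open>hb n (u - Y)\<close>.\<close>
  define hb where "hb n v = (if v < 0 then 1 else h n v)" for n v
  have mY: "\<forall>p\<in>set (replicate n (Y, Y)). fst p \<in> borel_measurable M \<and> snd p \<in> borel_measurable M" for n by auto
  have h01: "0 \<le> h n v" "h n v \<le> 1" "u \<le> v \<Longrightarrow> h n v \<le> h n u" for n u v
    unfolding h_def using hit_nonneg[OF mY] hit_le_1[OF mY] hit_antimono[OF mY] by auto
  have hb01: "0 \<le> hb n v" "hb n v \<le> 1" "u \<le> v \<Longrightarrow> hb n v \<le> hb n u" for n u v
    using h01 by (auto simp: hb_def)
  have [measurable]: "h n \<in> borel_measurable borel" "hb n \<in> borel_measurable borel" for n
    using h01 hb01 by (auto intro: borel_measurable_antimono)
  have hS: "ennreal (h (Suc n) u) = (\<integral>\<^sup>+\<omega>. ennreal (hb n (u - Y \<omega>)) \<partial>M)" for n u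
  proof -
    have "h (Suc n) u = (\<integral>\<omega>. hb n (u - Y \<omega>) \<partial>M)"
      unfolding h_def replicate_Suc hit.simps(2)
      by (intro Bochner_Integration.integral_cong) (auto simp: h_def hb_def)
    also have "ennreal \<dots> = (\<integral>\<^sup>+\<omega>. ennreal (hb n (u - Y \<omega>)) \<partial>M)"
      by (rule nn_integral_eq_integral[symmetric]) (auto intro!: integrable_bounded[where B=1] simp: hb01)
    finally show ?thesis .
  qed
  \<comment> \<open>By layers, \<open>J n\<close> is the expected maximum of the first
    \<open>n\<close> partial sums, the empty sum included.\<close>
  define J where "J n = (\<integral>\<^sup>+v. indicator {0..} v * ennreal (h n v) \<partial>lborel)" for n
  have path: "(\<integral>\<^sup>+v. indicator {0..} v * ennreal (hb n (v - Y \<omega>)) \<partial>lborel) + ennreal (l * hb n (- Y \<omega>)) \<le> J n + ennreal (g \<omega>)"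
    if \<omega>: "\<omega> \<in> space M" for n \<omega>
  proof -
    let ?y = "Y \<omega>"
    have "(\<integral>\<^sup>+v. indicator {0..} v * ennreal (hb n (v - ?y)) \<partial>lborel)
      = (\<integral>\<^sup>+w. indicator {0..} (?y + 1 * w) * ennreal (hb n (?y + 1 * w - ?y)) \<partial>lborel)"
      using nn_integral_real_affine[of "\<lambda>v. indicator {0..} v * ennreal (hb n (v - ?y))" 1 ?y] by simp
    also have "\<dots> = (\<integral>\<^sup>+w. indicator {- ?y..} w * ennreal (hb n w) \<partial>lborel)"
      by (intro nn_integral_cong) (auto split: split_indicator)
    finally have shift: "(\<integral>\<^sup>+v. indicator {0..} v * ennreal (hb n (v - ?y)) \<partial>lborel) = \<dots>" .
    \<comment> \<open>Shifting the levels by a step \<open>Y \<le> 0\<close> removes those below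
      \<open>- Y\<close> from \<open>J n\<close>, a loss of at least
      \<open>(- Y) * hb n (- Y)\<close> because \<open>hb n\<close> decreases; a step
      \<open>Y > 0\<close> adds at most \<open>Y\<close>. Since \<open>l = g - Y\<close>, in both
      cases \<open>l * hb n (- Y)\<close> is paid for by \<open>g\<close>.\<close>
    show ?thesis
    proof (cases "?y \<le> 0")
      case True
      have "(\<integral>\<^sup>+w. indicator {- ?y..} w * ennreal (hb n w) \<partial>lborel) + ennreal ((- ?y) * hb n (- ?y))
          = (\<integral>\<^sup>+w. indicator {- ?y..} w * ennreal (hb n w) \<partial>lborel) + (\<integral>\<^sup>+w. ennreal (hb n (- ?y)) * indicator {0..<- ?y} w \<partial>lborel)"
      proof -
        have "ennreal ((- ?y) * hb n (- ?y)) = ennreal (hb n (- ?y)) * emeasure lborel {0..<- ?y}"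
          using True hb01(1)[of n "- ?y"] by (subst mult.commute, subst ennreal_mult) auto
        then show ?thesis by (subst nn_integral_cmult_indicator) auto
      qed
      also have "\<dots> = (\<integral>\<^sup>+w. indicator {- ?y..} w * ennreal (hb n w) + ennreal (hb n (- ?y)) * indicator {0..<- ?y} w \<partial>lborel)"
        by (rule nn_integral_add[symmetric]) auto
      also have "\<dots> \<le> J n"
        unfolding J_def using True
        by (intro nn_integral_mono) (auto split: split_indicator simp: hb_def h01)
      finally have "(\<integral>\<^sup>+w. indicator {- ?y..} w * ennreal (hb n w) \<partial>lborel) + ennreal ((- ?y) * hb n (- ?y)) + ennreal (g \<omega> * hb n (- ?y)) \<le> J n + ennreal (g \<omega>)"
        using g0[OF \<omega>] hb01 by (intro add_mono ennreal_leI) (auto intro: mult_left_le)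
      moreover have "ennreal (l * hb n (- ?y)) = ennreal ((- ?y) * hb n (- ?y)) + ennreal (g \<omega> * hb n (- ?y))"
      proof -
        have "l * hb n (- ?y) = (- ?y) * hb n (- ?y) + g \<omega> * hb n (- ?y)"
          by (simp add: Y_def algebra_simps)
        moreover have "0 \<le> (- ?y) * hb n (- ?y)" "0 \<le> g \<omega> * hb n (- ?y)"
          using True g0[OF \<omega>] hb01(1) by (auto intro!: mult_nonneg_nonneg mult_nonpos_nonneg)
        ultimately show ?thesis by (simp only: ennreal_plus)
      qed
      ultimately show ?thesis by (simp add: shift add.assoc)
    next
      case False
      have "(\<integral>\<^sup>+w. indicator {- ?y..} w * ennreal (hb n w) \<partial>lborel) \<le> (\<integral>\<^sup>+w. indicator {0..} w * ennreal (h n w) + 1 * indicator {- ?y..<0} w \<partial>lborel)"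
        using False by (intro nn_integral_mono) (auto split: split_indicator simp: hb_def)
      also have "\<dots> = J n + (\<integral>\<^sup>+w. 1 * indicator {- ?y..<0} w \<partial>lborel)"
        unfolding J_def by (rule nn_integral_add) auto
      also have "\<dots> = J n + ennreal ?y"
        using False by (subst nn_integral_cmult_indicator) auto
      finally have "(\<integral>\<^sup>+w. indicator {- ?y..} w * ennreal (hb n w) \<partial>lborel) + ennreal (l * hb n (- ?y)) \<le> (J n + ennreal ?y) + ennreal l"
        using hb01 l by (intro add_mono ennreal_leI) (auto intro: mult_left_le)
      also have "\<dots> = J n + ennreal (g \<omega>)"
        using False l by (simp add: add.assoc ennreal_plus[symmetric] Y_def del: ennreal_plus)
      finally show ?thesis by (simp add: shift)
    qed
  qed
  have G: "(\<integral>\<^sup>+\<omega>. ennreal (g \<omega>) \<partial>M) = ennreal (\<integral>\<omega>. g \<omega> \<partial>M)"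
    using int g0 by (intro nn_integral_eq_integral) auto
  have main: "J (Suc n) + ennreal (l * h (Suc n) 0) \<le> J n + ennreal (\<integral>\<omega>. g \<omega> \<partial>M)" for n
  proof -
    have "J (Suc n) = (\<integral>\<^sup>+v. (\<integral>\<^sup>+\<omega>. indicator {0..} v * ennreal (hb n (v - Y \<omega>)) \<partial>M) \<partial>lborel)"
      unfolding J_def hS by (intro nn_integral_cong) (auto simp: nn_integral_cmult)
    also have "\<dots> = (\<integral>\<^sup>+\<omega>. (\<integral>\<^sup>+v. indicator {0..} v * ennreal (hb n (v - Y \<omega>)) \<partial>lborel) \<partial>M)"
      by (rule PL.Fubini') measurable
    finally have JS: "J (Suc n) = \<dots>" .
    have "ennreal (l * h (Suc n) 0) = (\<integral>\<^sup>+\<omega>. ennreal (l * hb n (- Y \<omega>)) \<partial>M)"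
      using l by (simp add: ennreal_mult' hS nn_integral_cmult)
    then have "J (Suc n) + ennreal (l * h (Suc n) 0) =
      (\<integral>\<^sup>+\<omega>. (\<integral>\<^sup>+v. indicator {0..} v * ennreal (hb n (v - Y \<omega>)) \<partial>lborel) + ennreal (l * hb n (- Y \<omega>)) \<partial>M)"
      unfolding JS by (subst nn_integral_add) auto
    also have "\<dots> \<le> (\<integral>\<^sup>+\<omega>. J n + ennreal (g \<omega>) \<partial>M)"
      by (rule nn_integral_mono) (rule path)
    also have "\<dots> = J n + ennreal (\<integral>\<omega>. g \<omega> \<partial>M)"
      by (subst nn_integral_add) (auto simp: emeasure_space_1 G)
    finally show ?thesis .
  qed
  \<comment> \<open>Finiteness permits cancelling \<open>J n\<close>, which does not decrease in
    \<open>n\<close>, from \<open>main\<close>.\<close>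
  have fin: "J n < \<infinity>" for n
  proof (induction n)
    case 0
    then show ?case by (simp add: J_def h_def)
  next
    case (Suc n)
    have "J (Suc n) \<le> J n + ennreal (\<integral>\<omega>. g \<omega> \<partial>M)"
      by (rule order_trans[OF _ main]) simp
    also have "\<dots> < \<infinity>" using Suc by simp
    finally show ?case .
  qed
  have "h n 0 \<le> h (Suc n) 0" for n unfolding h_def by (rule hit_replicate_mono) auto
  moreover have "h (Suc n) 0 \<le> (\<integral>\<omega>. g \<omega> \<partial>M) / l" for n
  proof -
    have "J n \<le> J (Suc n)"
      unfolding J_def h_def by (intro nn_integral_mono mult_left_mono ennreal_leI hit_replicate_mono) auto
    then have "J n + ennreal (l * h (Suc n) 0) \<le> J n + ennreal (\<integral>\<omega>. g \<omega> \<partial>M)"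
      using main[of n] by (meson add_right_mono order_trans)
    then have "ennreal (l * h (Suc n) 0) \<le> ennreal (\<integral>\<omega>. g \<omega> \<partial>M)"
      using fin[of n] by (auto simp: ennreal_add_left_cancel_le)
    moreover have "0 \<le> (\<integral>\<omega>. g \<omega> \<partial>M)" using g0 by (intro Bochner_Integration.integral_nonneg) auto
    ultimately show ?thesis using l by (simp add: pos_le_divide_eq mult.commute)
  qed
  ultimately have "h n 0 \<le> (\<integral>\<omega>. g \<omega> \<partial>M) / l" by (meson order_trans)
  then show ?thesis by (simp add: h_def Y_def[abs_def])
qed

text \<open>Three ways to cross: the part \<open>l\<close> of the steps with an exponential moment (Chernoff's bound), the
  remainder \<open>g\<close>, or the overshoot of a single step.\<close>

lemma hit_tilt_split:
  fixes g \<zeta> :: "'a \<Rightarrow> real"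
  assumes [measurable]: "g \<in> borel_measurable M" "\<zeta> \<in> borel_measurable M"
    and \<G>: "\<And>p. p \<in> \<G> \<Longrightarrow> fst p \<in> borel_measurable M \<and> snd p \<in> borel_measurable M"
    and Z: "\<And>p \<omega>. p \<in> \<G> \<Longrightarrow> \<omega> \<in> space M \<Longrightarrow> snd p \<omega> \<le> \<zeta> \<omega>"
    and l: "\<And>p. p \<in> \<G> \<Longrightarrow> \<exists>l. integrable M (\<lambda>\<omega>. exp (s * l \<omega>)) \<and> (\<integral>\<omega>. exp (s * l \<omega>) \<partial>M) \<le> 1
        \<and> (\<forall>\<omega>\<in>space M. fst p \<omega> + d \<le> l \<omega> + g \<omega> - e)"
    and s: "0 \<le> s"
    and "set ps \<subseteq> \<G>" "0 \<le> u1" "0 \<le> u2"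
  shows "hit M (map (tilt d) ps) (u1 + u2 + u3) \<le> exp (- s * u1) + hit M (replicate (length ps) (g, g)) u2
      + tail_sum M e (replicate (length ps) (g, \<zeta>)) u3"
  using assms(7-9)
proof (induction ps arbitrary: u1 u2 u3)
  case (Cons p ps)
  have p: "p \<in> \<G>" "set ps \<subseteq> \<G>" using Cons.prems by auto
  obtain l where l: "integrable M (\<lambda>\<omega>. exp (s * l \<omega>))" "(\<integral>\<omega>. exp (s * l \<omega>) \<partial>M) \<le> 1"
    "\<And>\<omega>. \<omega> \<in> space M \<Longrightarrow> fst p \<omega> + d \<le> l \<omega> + g \<omega> - e"
    using l[OF p(1)] by blast
  have [measurable]: "fst p \<in> borel_measurable M" "snd p \<in> borel_measurable M" using \<G>[OF p(1)] by auto
  have mp: "\<forall>q\<in>set (tilt d p # map (tilt d) ps). fst q \<in> borel_measurable M \<and> snd q \<in> borel_measurable M"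
    using \<G> Cons.prems by (auto simp: tilt_def subset_iff intro!: borel_measurable_add)
  then have mp': "\<forall>q\<in>set (map (tilt d) ps). fst q \<in> borel_measurable M \<and> snd q \<in> borel_measurable M" by auto
  have mg: "\<forall>q\<in>set (replicate n (g, g)). fst q \<in> borel_measurable M \<and> snd q \<in> borel_measurable M"
   "\<forall>q\<in>set ((g, g) # replicate n (g, g)). fst q \<in> borel_measurable M \<and> snd q \<in> borel_measurable M" for n by auto
  let ?n = "length ps" and ?u = "u1 + u2 + u3"
  \<comment> \<open>Chernoff's bound in recursive form: the factor
    \<open>exp (s * l \<omega>)\<close> has mean at most 1, so every step preserves the bound
    \<open>exp (- s * u1)\<close>.\<close>
  define a where "a \<omega> = exp (- s * u1) * exp (s * l \<omega>)" for \<omega>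
  define b where "b \<omega> = (if u2 < snd (g, g) \<omega> then 1 else hit M (replicate ?n (g, g)) (u2 - fst (g, g) \<omega>))" for \<omega>
  define c where "c \<omega> = (if u3 < \<zeta> \<omega> then 1 else 0 :: real)" for \<omega>
  have inta: "integrable M a" unfolding a_def using l(1) by simp
  have intb: "integrable M b" unfolding b_def by (rule integrable_hit[OF mg(2)])
  have intc: "integrable M c" unfolding c_def by (rule prob_gt_eq_integral) simp
  let ?ts = "tail_sum M e (replicate ?n (g, \<zeta>)) (u3 + e)"
  have key: "(if ?u < snd (tilt d p) \<omega> then 1 else hit M (map (tilt d) ps) (?u - fst (tilt d p) \<omega>)) \<le> a \<omega> + b \<omega> + c \<omega> + ?ts"
    (is "?L \<le> _") if \<omega>: "\<omega> \<in> space M" for \<omega>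
  proof -
    have nn: "0 \<le> a \<omega>" "0 \<le> b \<omega>" "0 \<le> c \<omega>" "0 \<le> ?ts"
      using hit_nonneg[OF mg(1)] by (auto simp: a_def b_def c_def tail_sum_nonneg)
    have L1: "?L \<le> 1" using hit_le_1[OF mp'] by auto
    consider "?u < snd p \<omega>" | "u1 < l \<omega>" | "u2 < g \<omega>" | "snd p \<omega> \<le> ?u" "l \<omega> \<le> u1" "g \<omega> \<le> u2" by linarith
    then show ?thesis
    proof cases
      case 1
      then have "c \<omega> = 1" using Z[OF p(1) \<omega>] Cons.prems by (auto simp: c_def)
      with L1 nn show ?thesis by linarith
    next
      case 2
      have "a \<omega> = exp (s * (l \<omega> - u1))" by (simp add: a_def exp_add[symmetric] algebra_simps)
      also have "\<dots> \<ge> 1" using 2 s by simp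
      finally show ?thesis using L1 nn by linarith
    next
      case 3
      then have "b \<omega> = 1" by (simp add: b_def)
      with L1 nn show ?thesis by linarith
    next
      case 4
      have "?L = hit M (map (tilt d) ps) (?u - (fst p \<omega> + d))" using 4 by (simp add: tilt_def)
      \<comment> \<open>Each share of the level is reduced by its own part of the step. The surplus
        \<open>e\<close> of the drift is credited to the third share, so the overshoots have to
        exceed a line that rises with slope \<open>e\<close>, and their expected number stays
        bounded.\<close>
      also have "\<dots> \<le> hit M (map (tilt d) ps) ((u1 - l \<omega>) + (u2 - g \<omega>) + (u3 + e))"
        using l(3)[OF \<omega>] by (intro hit_antimono[OF mp']) auto
      also have "\<dots> \<le> exp (- s * (u1 - l \<omega>)) + hit M (replicate ?n (g, g)) (u2 - g \<omega>) + ?ts"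
        using p 4 by (intro Cons.IH) auto
      also have "\<dots> = a \<omega> + b \<omega> + ?ts"
        using 4 by (simp add: a_def b_def exp_add[symmetric] algebra_simps)
      finally show ?thesis using nn by linarith
    qed
  qed
  have "hit M (map (tilt d) (p # ps)) ?u \<le> (\<integral>\<omega>. a \<omega> + b \<omega> + c \<omega> + ?ts \<partial>M)"
    unfolding list.map hit.simps
    by (rule integral_mono[OF integrable_hit[OF mp] _ key]) (use inta intb intc in auto)
  also have "\<dots> = (\<integral>\<omega>. a \<omega> \<partial>M) + (\<integral>\<omega>. b \<omega> \<partial>M) + (\<integral>\<omega>. c \<omega> \<partial>M) + ?ts"
    using inta intb intc by (simp add: prob_space)
  also have "(\<integral>\<omega>. a \<omega> \<partial>M) \<le> exp (- s * u1) * 1"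
    unfolding a_def using l(1,2) by (simp add: mult_left_le)
  also have "(\<integral>\<omega>. b \<omega> \<partial>M) = hit M (replicate (length (p # ps)) (g, g)) u2"
    by (simp add: b_def)
  also have "(\<integral>\<omega>. c \<omega> \<partial>M) = prob {\<omega> \<in> space M. u3 < \<zeta> \<omega>}"
    unfolding c_def by (rule prob_gt_eq_integral) simp
  finally show ?case by simp
qed auto

text \<open>One level \<open>R\<close> serves all lists of any length. Truncation below at
  \<open>- \<beta>\<close> and above at \<open>A\<close> confines the main part of every step to one
  interval, so a single exponent \<open>s\<close> works for the whole class; what lies above
  \<open>A\<close> is dominated by \<psi> and left to the maximal inequality. Each of the three ways
  to cross receives \<open>\<delta> / 3\<close>.\<close>

lemma hit_tilt_small:
  fixes \<psi> \<zeta> :: "'a \<Rightarrow> real"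
  assumes \<G>: "\<And>p. p \<in> \<G> \<Longrightarrow> fst p \<in> borel_measurable M \<and> snd p \<in> borel_measurable M"
    and int: "integrable M \<psi>" "integrable M \<zeta>"
    and Y: "\<And>p \<omega>. p \<in> \<G> \<Longrightarrow> \<omega> \<in> space M \<Longrightarrow> fst p \<omega> \<le> \<psi> \<omega>"
    and Z: "\<And>p \<omega>. p \<in> \<G> \<Longrightarrow> \<omega> \<in> space M \<Longrightarrow> snd p \<omega> \<le> \<zeta> \<omega>"
    and mean: "\<And>p. p \<in> \<G> \<Longrightarrow> (\<integral>\<omega>. max (fst p \<omega>) (- \<beta>) \<partial>M) \<le> - \<eta>"
    and d: "d < \<eta>" and \<delta>: "0 < \<delta>"
  shows "\<exists>R\<ge>0. \<forall>ps\<in>lists \<G>. hit M (map (tilt d) ps) R \<le> \<delta>"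
proof -
  have [measurable]: "\<psi> \<in> borel_measurable M" "\<zeta> \<in> borel_measurable M" using int by auto
  \<comment> \<open>Of the spare drift \<open>\<eta> - d\<close>, two quarters make the mean of
    \<open>l\<close> at most \<open>- 2 * e\<close>, one gives \<open>g\<close> its negative drift,
    and one raises the line for the overshoots.\<close>
  define e where "e = (\<eta> - d) / 4"
  have e: "0 < e" "\<eta> = d + 4 * e" using d by (auto simp: e_def field_simps)
  have "\<forall>\<^sub>F A in at_top. (\<integral>\<omega>. max 0 (\<psi> \<omega> - A) \<partial>M) < e * \<delta> / 3 \<and> 0 \<le> A"
    by (intro eventually_conj order_tendstoD(2)[OF expected_excess_tendsto_0] int eventually_ge_at_top) (use e \<delta> in auto)
  then obtain A where A: "(\<integral>\<omega>. max 0 (\<psi> \<omega> - A) \<partial>M) < e * \<delta> / 3" "0 \<le> A"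
    using eventually_happens by (metis (no_types, lifting) trivial_limit_at_top_linorder)
  have "\<forall>\<^sub>F u in at_top. (\<integral>\<omega>. max 0 (\<zeta> \<omega> - u) \<partial>M) < e * \<delta> / 3 \<and> 0 \<le> u"
    by (intro eventually_conj order_tendstoD(2)[OF expected_excess_tendsto_0] int eventually_ge_at_top) (use e \<delta> in auto)
  then obtain u3' where u3': "(\<integral>\<omega>. max 0 (\<zeta> \<omega> - u3') \<partial>M) < e * \<delta> / 3" "0 \<le> u3'"
    using eventually_happens by (metis (no_types, lifting) trivial_limit_at_top_linorder)
  define g where "g \<omega> = max 0 (\<psi> \<omega> - A) - e" for \<omega>
  have [measurable]: "g \<in> borel_measurable M" unfolding g_def by measurable
  define B where "B = A + \<bar>\<beta>\<bar> + \<bar>d\<bar> + 2 * e"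
  have B: "0 < B" using A e by (simp add: B_def)
  \<comment> \<open>The first bound keeps \<open>s * l \<omega>\<close> in the range of
    \<open>exp_le_quadratic\<close>; the second makes the quadratic term at most
    \<open>s * (2 * e)\<close>, which the negative mean of \<open>l\<close> cancels.\<close>
  define s where "s = min (1 / B) (2 * e / B\<^sup>2)"
  have s: "0 < s" "s * B \<le> 1" "s * B\<^sup>2 \<le> 2 * e"
  proof -
    show "0 < s" using B e by (simp add: s_def)
    have "s \<le> 1 / B" by (simp add: s_def)
    then show "s * B \<le> 1" using B by (simp add: pos_le_divide_eq)
    have "s \<le> 2 * e / B\<^sup>2" by (simp add: s_def)
    then show "s * B\<^sup>2 \<le> 2 * e" using B by (simp add: pos_le_divide_eq)
  qed
  have l: "\<exists>l. integrable M (\<lambda>\<omega>. exp (s * l \<omega>)) \<and> (\<integral>\<omega>. exp (s * l \<omega>) \<partial>M) \<le> 1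
        \<and> (\<forall>\<omega>\<in>space M. fst p \<omega> + d \<le> l \<omega> + g \<omega> - e)" if p: "p \<in> \<G>" for p
  proof -
    have [measurable]: "fst p \<in> borel_measurable M" using \<G>[OF p] by auto
    define l where "l \<omega> = max (min (fst p \<omega>) A) (- \<beta>) + d + 2 * e" for \<omega>
    have [measurable]: "l \<in> borel_measurable M" unfolding l_def by measurable
    have lB: "\<bar>l \<omega>\<bar> \<le> B" for \<omega>
      using A e by (auto simp: l_def B_def)
    have intl: "integrable M l" by (rule integrable_bounded[OF _ lB]) simp
    have bnd: "\<bar>s * l \<omega>\<bar> \<le> 1" for \<omega>
      using order_trans[OF mult_left_mono[OF lB[of \<omega>], of s] s(2)] s(1) by (simp add: abs_mult)
    have intp: "integrable M (\<lambda>\<omega>. max (fst p \<omega>) (- \<beta>))"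
    proof (rule Bochner_Integration.integrable_bound)
      show "integrable M (\<lambda>\<omega>. \<bar>\<psi> \<omega>\<bar> + \<bar>\<beta>\<bar>)" using int by simp
      show "AE \<omega> in M. norm (max (fst p \<omega>) (- \<beta>)) \<le> norm (\<bar>\<psi> \<omega>\<bar> + \<bar>\<beta>\<bar>)"
        using Y[OF p] by (intro AE_I2) (fastforce simp: max_def abs_if)
    qed simp
    have El: "(\<integral>\<omega>. l \<omega> \<partial>M) \<le> - 2 * e"
    proof -
      have "(\<integral>\<omega>. l \<omega> \<partial>M) \<le> (\<integral>\<omega>. max (fst p \<omega>) (- \<beta>) + (d + 2 * e) \<partial>M)"
        using intp by (intro integral_mono[OF intl] Bochner_Integration.integrable_add) (auto simp: l_def)
      also have "\<dots> = (\<integral>\<omega>. max (fst p \<omega>) (- \<beta>) \<partial>M) + (d + 2 * e)"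
        using intp by (simp add: prob_space)
      finally show ?thesis using mean[OF p] e by simp
    qed
    have ie: "integrable M (\<lambda>\<omega>. exp (s * l \<omega>))"
      by (rule integrable_bounded[where B="exp 1"]) (use bnd abs_le_D1 in auto)
    have "(\<integral>\<omega>. exp (s * l \<omega>) \<partial>M) \<le> (\<integral>\<omega>. 1 + s * l \<omega> + s * (2 * e) \<partial>M)"
    proof (rule integral_mono[OF ie])
      show "integrable M (\<lambda>\<omega>. 1 + s * l \<omega> + s * (2 * e))" using intl by simp
      fix \<omega>
      have "exp (s * l \<omega>) \<le> 1 + s * l \<omega> + (s * l \<omega>)\<^sup>2" by (rule exp_le_quadratic[OF bnd])
      also have "(s * l \<omega>)\<^sup>2 = s * (s * (l \<omega>)\<^sup>2)" by (simp add: power2_eq_square)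
      also have "\<dots> \<le> s * (s * B\<^sup>2)"
        using s(1) lB[of \<omega>] abs_le_square_iff[of "l \<omega>" B] B by (intro mult_left_mono) auto
      also have "\<dots> \<le> s * (2 * e)" using s by (intro mult_left_mono) auto
      finally show "exp (s * l \<omega>) \<le> 1 + s * l \<omega> + s * (2 * e)" by simp
    qed
    also have "\<dots> = 1 + s * (\<integral>\<omega>. l \<omega> \<partial>M) + s * (2 * e)" using intl by (simp add: prob_space)
    also have "\<dots> \<le> 1 + s * (- 2 * e) + s * (2 * e)" using El s by (intro add_mono mult_left_mono) auto
    finally have "(\<integral>\<omega>. exp (s * l \<omega>) \<partial>M) \<le> 1" by simp
    moreover have "\<forall>\<omega>\<in>space M. fst p \<omega> + d \<le> l \<omega> + g \<omega> - e"
    proof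
      fix \<omega> assume "\<omega> \<in> space M"
      then show "fst p \<omega> + d \<le> l \<omega> + g \<omega> - e"
        using Y[OF p, of \<omega>] by (auto simp: l_def g_def max_def min_def)
    qed
    ultimately show ?thesis using ie by blast
  qed
  define u1 where "u1 = max 0 (- ln (\<delta> / 3) / s)"
  have u1: "0 \<le> u1" "exp (- s * u1) \<le> \<delta> / 3"
  proof -
    show "0 \<le> u1" by (simp add: u1_def)
    have "- ln (\<delta> / 3) / s \<le> u1" by (simp add: u1_def)
    then have "- s * u1 \<le> ln (\<delta> / 3)" using s(1) by (simp only: pos_divide_le_eq) (simp add: mult.commute)
    then have "exp (- s * u1) \<le> exp (ln (\<delta> / 3))" by (subst exp_le_cancel_iff)
    then show "exp (- s * u1) \<le> \<delta> / 3" using \<delta> by simp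
  qed
  show ?thesis
  proof (intro exI[of _ "u1 + 0 + (u3' + e)"] conjI ballI)
    show "0 \<le> u1 + 0 + (u3' + e)" using u1 u3' e by simp
    fix ps assume ps: "ps \<in> lists \<G>"
    have "hit M (map (tilt d) ps) (u1 + 0 + (u3' + e)) \<le> exp (- s * u1) + hit M (replicate (length ps) (g, g)) 0
      + tail_sum M e (replicate (length ps) (g, \<zeta>)) (u3' + e)"
      using ps s u1 by (intro hit_tilt_split[where \<G>=\<G>] \<G> Z l) auto
    also have "hit M (replicate (length ps) (g, g)) 0 \<le> (\<integral>\<omega>. max 0 (\<psi> \<omega> - A) \<partial>M) / e"
      unfolding g_def using int e by (intro maximal_inequality) (auto intro: integrable_max0)
    also have "\<dots> \<le> \<delta> / 3" using A e by (simp add: field_simps)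
    also have "tail_sum M e (replicate (length ps) (g, \<zeta>)) (u3' + e) \<le> \<delta> / 3"
    proof -
      have "e * tail_sum M e (replicate (length ps) (g, \<zeta>)) (u3' + e) \<le> (\<integral>\<omega>. max 0 (\<zeta> \<omega> - (u3' + e - e)) \<partial>M)"
        using e int by (intro tail_sum_le_excess) auto
      also have "\<dots> \<le> e * (\<delta> / 3)" using u3' by simp
      finally show ?thesis using e by simp
    qed
    finally show "hit M (map (tilt d) ps) (u1 + 0 + (u3' + e)) \<le> \<delta>" using u1 by simp
  qed
qed

text \<open>The walk crosses \<open>y\<close> by one jump at time \<open>k\<close> if it has stayed above the line \<open>- l - k * d\<close> until then;
  \<open>q\<close> is the reflected walk measured against that line.\<close>

lemma hit_replicate_lower:
  fixes p :: "'a step" and d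
  defines "q \<equiv> (\<lambda>\<omega>. - fst p \<omega> - d, \<lambda>\<omega>. - fst p \<omega> - d)"
  assumes [measurable]: "fst p \<in> borel_measurable M" "snd p \<in> borel_measurable M" and l: "0 \<le> l"
  shows "(\<Sum>k<n. (1 - hit M (replicate k q) l - hit M (replicate k p) y) * prob {\<omega> \<in> space M. y + l + real k * d < snd p \<omega>})
     \<le> hit M (replicate n p) y"
  using l
proof (induction n arbitrary: y l)
  case (Suc n)
  have [measurable]: "fst q \<in> borel_measurable M" "snd q \<in> borel_measurable M" by (auto simp: q_def)
  have mp: "\<forall>r\<in>set (replicate k p). fst r \<in> borel_measurable M \<and> snd r \<in> borel_measurable M"
    "\<forall>r\<in>set (p # replicate k p). fst r \<in> borel_measurable M \<and> snd r \<in> borel_measurable M"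
    "\<forall>r\<in>set (replicate k q). fst r \<in> borel_measurable M \<and> snd r \<in> borel_measurable M"
    "\<forall>r\<in>set (q # replicate k q). fst r \<in> borel_measurable M \<and> snd r \<in> borel_measurable M" for k
    by auto
  define G where "G k = prob {\<omega> \<in> space M. y + l + real k * d < snd p \<omega>}" for k
  define s where "s k \<omega> = (if l < snd q \<omega> then 1 else hit M (replicate k q) (l - fst q \<omega>))" for k \<omega>
  define t where "t k \<omega> = (if y < snd p \<omega> then 1 else hit M (replicate k p) (y - fst p \<omega>))" for k \<omega>
  define c where "c \<omega> = (if y + l < snd p \<omega> then 1 else 0::real)" for \<omega>
  have ints: "integrable M (s k)" and intt: "integrable M (t k)" for k
    unfolding s_def t_def by (rule integrable_hit[OF mp(4)] integrable_hit[OF mp(2)])+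
  have intc: "integrable M c" unfolding c_def by (rule prob_gt_eq_integral) simp
  have st0: "0 \<le> s k \<omega>" "0 \<le> t k \<omega>" for k \<omega>
    using hit_nonneg[OF mp(1)] hit_nonneg[OF mp(3)] by (auto simp: s_def t_def)
  have key: "c \<omega> + (\<Sum>k<n. (1 - s k \<omega> - t k \<omega>) * G (Suc k)) \<le> t n \<omega>" if \<omega>: "\<omega> \<in> space M" for \<omega>
  proof -
    \<comment> \<open>If the first step already crosses one of the two levels, every factor
      \<open>1 - s k \<omega> - t k \<omega>\<close> is at most 0, so such paths only lower the
      sum.\<close>
    have bad: "(\<Sum>k<n. (1 - s k \<omega> - t k \<omega>) * G (Suc k)) \<le> 0" if "y < snd p \<omega> \<or> l < snd q \<omega>"
    proof (intro sum_nonpos mult_nonpos_nonneg)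
      fix k
      have "s k \<omega> = 1 \<or> t k \<omega> = 1" using that by (auto simp: s_def t_def)
      then show "1 - s k \<omega> - t k \<omega> \<le> 0" using st0[of k \<omega>] by linarith
    qed (simp add: G_def)
    show ?thesis
    proof (cases "y < snd p \<omega>")
      case True
      then show ?thesis using bad by (auto simp: c_def t_def)
    next
      case False
      have c0: "c \<omega> = 0" using False Suc.prems by (auto simp: c_def)
      show ?thesis
      proof (cases "l < snd q \<omega>")
        case True
        then show ?thesis using bad st0[of n \<omega>] c0 by auto
      next
        case lq: False
        have "(\<Sum>k<n. (1 - hit M (replicate k q) (l - fst q \<omega>) - hit M (replicate k p) (y - fst p \<omega>))
            * prob {\<omega>' \<in> space M. (y - fst p \<omega>) + (l - fst q \<omega>) + real k * d < snd p \<omega>'})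
          \<le> hit M (replicate n p) (y - fst p \<omega>)"
          using lq by (intro Suc.IH) (auto simp: q_def)
        \<comment> \<open>The reflected step is \<open>- Y - d\<close>, so the two levels together
          grow by exactly \<open>d\<close> per step, and the position of the walk drops out of the
          jump levels.\<close>
        moreover have "(y - fst p \<omega>) + (l - fst q \<omega>) + real k * d = y + l + real (Suc k) * d" for k
          by (simp add: q_def algebra_simps)
        ultimately show ?thesis using False lq c0 by (simp add: s_def t_def G_def)
      qed
    qed
  qed
  have S: "(\<integral>\<omega>. s k \<omega> \<partial>M) = hit M (replicate (Suc k) q) l" "(\<integral>\<omega>. t k \<omega> \<partial>M) = hit M (replicate (Suc k) p) y" for k
    by (simp_all add: s_def t_def)
  have "(\<Sum>k<Suc n. (1 - hit M (replicate k q) l - hit M (replicate k p) y) * G k)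
      = G 0 + (\<Sum>k<n. (1 - hit M (replicate (Suc k) q) l - hit M (replicate (Suc k) p) y) * G (Suc k))"
    by (subst sum.lessThan_Suc_shift) simp
  also have "\<dots> = (\<integral>\<omega>. c \<omega> + (\<Sum>k<n. (1 - s k \<omega> - t k \<omega>) * G (Suc k)) \<partial>M)"
  proof -
    have "(\<integral>\<omega>. (1 - s k \<omega> - t k \<omega>) * G (Suc k) \<partial>M) = (1 - hit M (replicate (Suc k) q) l - hit M (replicate (Suc k) p) y) * G (Suc k)" for k
    proof -
      have "(\<integral>\<omega>. (1 - s k \<omega> - t k \<omega>) * G (Suc k) \<partial>M) = (1 - (\<integral>\<omega>. s k \<omega> \<partial>M) - (\<integral>\<omega>. t k \<omega> \<partial>M)) * G (Suc k)"
        using ints intt by (simp add: prob_space)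
      then show ?thesis unfolding S .
    qed
    moreover have "(\<integral>\<omega>. c \<omega> \<partial>M) = G 0"
      unfolding c_def G_def by (subst prob_gt_eq_integral) auto
    moreover have "(\<integral>\<omega>. c \<omega> + (\<Sum>k<n. (1 - s k \<omega> - t k \<omega>) * G (Suc k)) \<partial>M)
        = (\<integral>\<omega>. c \<omega> \<partial>M) + (\<Sum>k<n. \<integral>\<omega>. (1 - s k \<omega> - t k \<omega>) * G (Suc k) \<partial>M)"
      using ints intt intc
      by (subst Bochner_Integration.integral_add, simp, simp) (subst Bochner_Integration.integral_sum, auto)
    ultimately show ?thesis by presburger
  qed
  also have "\<dots> \<le> (\<integral>\<omega>. t n \<omega> \<partial>M)"
    using key ints intt intc by (intro integral_mono Bochner_Integration.integrable_add Bochner_Integration.integrable_sum) auto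
  also have "\<dots> = hit M (replicate (Suc n) p) y" by (rule S)
  finally show ?case by (simp add: G_def)
qed simp

end

section \<open>The i.i.d. case\<close>

context subexp_law
begin

lemma tail_shift_ratio: "((\<lambda>y. tail H (y + s) / tail H y) \<longlongrightarrow> 1) at_top"
proof (rule order_tendstoI)
  fix a :: real assume a: "a < 1"
  have "\<forall>\<^sub>F y in at_top. (1 - (1 - a) / 2) * tail H y \<le> tail H (y + s)"
    by (rule long_tailed_lower) (use a in auto)
  then show "\<forall>\<^sub>F y in at_top. a < tail H (y + s) / tail H y"
  proof eventually_elim
    case (elim y)
    have "a * tail H y < (1 - (1 - a) / 2) * tail H y"
      using a by (intro mult_strict_right_mono tail_pos) (simp add: field_simps)
    from less_le_trans[OF this elim] show ?case by (simp add: pos_less_divide_eq tail_pos)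
  qed
next
  fix a :: real assume a: "1 < a"
  have "\<forall>\<^sub>F y in at_top. tail H (y - (- s)) \<le> (1 + (a - 1) / 2) * tail H y"
    by (rule long_tailed) (use a in auto)
  then show "\<forall>\<^sub>F y in at_top. tail H (y + s) / tail H y < a"
  proof eventually_elim
    case (elim y)
    have "(1 + (a - 1) / 2) * tail H y < a * tail H y"
      using a by (intro mult_strict_right_mono tail_pos) (simp add: field_simps)
    from le_less_trans[OF _ this] elim show ?case by (simp add: pos_divide_less_eq tail_pos)
  qed
qed

lemma ratio_shift:
  assumes "((\<lambda>y. f y / tail H y) \<longlongrightarrow> C) at_top"
  shows "((\<lambda>y. f (y + s) / tail H y) \<longlongrightarrow> C) at_top"
proof -
  have "filterlim (\<lambda>y::real. y + s) at_top at_top" by real_asymp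
  with assms have "((\<lambda>y. f (y + s) / tail H (y + s)) \<longlongrightarrow> C) at_top"
    by (rule filterlim_compose)
  from tendsto_mult[OF this tail_shift_ratio[of s]] show ?thesis
    by (simp add: tail_pos less_imp_neq[OF tail_pos, symmetric])
qed

lemma eventually_ratio_less:
  assumes "((\<lambda>y. f y / tail H y) \<longlongrightarrow> C) at_top" "C < L"
  shows "\<forall>\<^sub>F y in at_top. f y < L * tail H y"
  using order_tendstoD(2)[OF assms] by eventually_elim (simp add: pos_divide_less_eq tail_pos)

lemma eventually_ratio_greater:
  assumes "((\<lambda>y. f y / tail H y) \<longlongrightarrow> C) at_top" "L < C"
  shows "\<forall>\<^sub>F y in at_top. L * tail H y < f y"
  using order_tendstoD(1)[OF assms] by eventually_elim (simp add: pos_less_divide_eq tail_pos)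

text \<open>The classical asymptotics for the supremum of a random walk with negative drift, with
  the mean excess of the overshoot as input. The tail of the overshoot enters through its sums along
  lines, which \<open>tail_sum_le_excess\<close> and \<open>excess_le_tail_sum\<close> compare with
  the mean excess.\<close>

lemma hit_iid_asymptotics:
  fixes Q :: "'a measure" and p :: "'a step"
  assumes Q: "prob_space Q" and p: "p \<in> steps Q"
    and int: "integrable Q (fst p)" "integrable Q (snd p)"
    and mean: "(\<integral>\<omega>. fst p \<omega> \<partial>Q) = - m" and m: "0 < m"
    and excess: "((\<lambda>y. (\<integral>\<omega>. max 0 (snd p \<omega> - y) \<partial>Q) / tail H y) \<longlongrightarrow> C) at_top"
  shows "((\<lambda>y. (SUP n. hit Q (replicate n p) y) / tail H y) \<longlongrightarrow> C / m) at_top"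
proof -
  interpret Q: prob_space Q by fact
  have mp[measurable]: "fst p \<in> borel_measurable Q" "snd p \<in> borel_measurable Q" using p by (auto simp: steps_def)
  have mps: "\<forall>r\<in>set (replicate k p). fst r \<in> borel_measurable Q \<and> snd r \<in> borel_measurable Q" for k by auto
  define E where "E y = (\<integral>\<omega>. max 0 (snd p \<omega> - y) \<partial>Q)" for y
  have E0: "0 \<le> E y" for y by (auto simp: E_def intro!: Bochner_Integration.integral_nonneg)
  have Elim: "((\<lambda>y. E (y + s) / tail H y) \<longlongrightarrow> C) at_top" for s
    using ratio_shift[OF excess] by (simp add: E_def)
  have C: "0 \<le> C"
    using Elim[of 0] by (rule tendsto_lowerbound) (auto simp: E0 tail_nonneg)
  define v where "v y = (SUP n. hit Q (replicate n p) y)" for y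
  have bdd: "bdd_above (range (\<lambda>n. hit Q (replicate n p) y))" for y
    by (rule bdd_aboveI[of _ 1]) (auto simp: Q.hit_le_1[OF mps])
  have le_v: "hit Q (replicate n p) y \<le> v y" for n y
    unfolding v_def by (rule cSUP_upper[OF UNIV_I bdd])
  have upper: "\<forall>\<^sub>F y in at_top. v y \<le> L * tail H y" if L: "C / m < L" for L
  proof -
    \<comment> \<open>This is the constant that \<open>hit_upper\<close> yields for the slope
      \<open>m * (1 - t)\<close> and crossing probability \<open>t\<close>; it tends to
      \<open>C / m\<close>.\<close>
    have "((\<lambda>t. C / (m * (1 - t)) / (1 - t)) \<longlongrightarrow> C / (m * (1 - 0)) / (1 - 0)) (at_right 0)"
      using m by (intro tendsto_intros) auto
    then have "\<forall>\<^sub>F t in at_right 0. C / (m * (1 - t)) / (1 - t) < L"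
      by (rule order_tendstoD) (use L in auto)
    moreover have "\<forall>\<^sub>F t in at_right 0. t < (1::real)"
      by (rule eventually_at_rightI[of _ 1]) auto
    ultimately have "\<forall>\<^sub>F t in at_right 0. 0 < t \<and> t < (1::real) \<and> C / (m * (1 - t)) / (1 - t) < L"
      using eventually_at_right_less[of "0::real"] by eventually_elim auto
    then obtain t where t: "0 < t" "t < 1" "C / (m * (1 - t)) / (1 - t) < L"
      using eventually_happens by (metis (no_types, lifting) trivial_limit_at_right_real)
    define d where "d = m * (1 - t)"
    have d: "0 < d" "d < m" using m t by (auto simp: d_def)
    have jump: "\<forall>\<^sub>F z in at_top. \<forall>ps\<in>lists {p}. tail_sum Q d ps z \<le> C' * tail H z" if C': "C / d < C'" for C'
    proof -
      have "\<forall>\<^sub>F z in at_top. E (z + (- d)) < (d * C') * tail H z"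
        using C' d by (intro eventually_ratio_less[OF Elim]) (simp add: divide_less_eq mult.commute)
      then show ?thesis
      proof (eventually_elim, intro ballI)
        fix z ps assume z: "E (z + - d) < d * C' * tail H z" and ps: "ps \<in> lists {p}"
        have "d * tail_sum Q d ps z \<le> (\<integral>\<omega>. max 0 (snd p \<omega> - (z - d)) \<partial>Q)"
          using ps d int by (intro Q.tail_sum_le_excess) auto
        also have "\<dots> = E (z + - d)" by (simp add: E_def)
        finally have "d * tail_sum Q d ps z \<le> d * (C' * tail H z)" using z by (simp add: mult.assoc)
        then show "tail_sum Q d ps z \<le> C' * tail H z" using d by simp
      qed
    qed
    \<comment> \<open>The midpoint leaves room on both sides: it lies above \<open>d\<close>, as
      \<open>hit_tilt_small\<close> requires, and below \<open>m\<close>, so that some truncated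
      mean is below its negative.\<close>
    have "- m < - ((m + d) / 2)" using d by simp
    then have "\<forall>\<^sub>F \<beta> in at_top. (\<integral>\<omega>. max (fst p \<omega>) (- \<beta>) \<partial>Q) < - ((m + d) / 2)"
      using Q.truncated_mean_tendsto[OF int(1)] mean by (intro order_tendstoD(2)) auto
    then obtain \<beta> where \<beta>: "(\<integral>\<omega>. max (fst p \<omega>) (- \<beta>) \<partial>Q) < - ((m + d) / 2)"
      using eventually_happens by (metis (no_types, lifting) trivial_limit_at_top_linorder)
    have "\<exists>R\<ge>0. \<forall>ps\<in>lists {p}. hit Q (map (tilt d) ps) R \<le> t"
      by (rule Q.hit_tilt_small[where \<psi>="fst p" and \<zeta>="snd p" and \<beta>=\<beta> and \<eta>="(m + d) / 2"])
        (use mp int \<beta> t d in auto)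
    then obtain R where R: "0 \<le> R" "\<And>ps. ps \<in> lists {p} \<Longrightarrow> hit Q (map (tilt d) ps) R \<le> t" by blast
    have "\<forall>\<^sub>F u in at_top. \<forall>ps\<in>lists {p}. hit Q ps u \<le> L * tail H u"
      by (rule hit_upper[where C="C / d" and d=d and r=R and \<delta>=t])
        (use Q p d R C t jump in \<open>auto simp: d_def\<close>)
    then show ?thesis
    proof eventually_elim
      case (elim u)
      show ?case unfolding v_def
        by (rule cSUP_least) (use elim in auto)
    qed
  qed
  have v_small: "\<forall>\<^sub>F y in at_top. v y \<le> t" if t: "0 < t" for t
  proof -
    have "((\<lambda>y. (C / m + 1) * tail H y) \<longlongrightarrow> (C / m + 1) * 0) at_top"
      by (intro tendsto_intros tail_tendsto_0)
    then have "\<forall>\<^sub>F y in at_top. (C / m + 1) * tail H y < t"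
      by (rule order_tendstoD) (use t in auto)
    with upper[of "C / m + 1"] show ?thesis
      by (auto elim: eventually_elim2)
  qed
  have lower: "\<forall>\<^sub>F y in at_top. L * tail H y < v y" if L: "L < C / m" for L
  proof -
    \<comment> \<open>The factor \<open>1 - 2 * t\<close> loses one \<open>t\<close> for paths that
      have fallen below the line and one for paths that have crossed \<open>y\<close> before. The
      slope \<open>m * (1 + t)\<close> is slightly steeper than the drift, which gives the reflected
      walk a negative drift.\<close>
    have "((\<lambda>t. (1 - 2 * t) / (m * (1 + t)) * C) \<longlongrightarrow> (1 - 2 * 0) / (m * (1 + 0)) * C) (at_right 0)"
      using m by (intro tendsto_intros) auto
    then have "\<forall>\<^sub>F t in at_right 0. L < (1 - 2 * t) / (m * (1 + t)) * C"
      by (rule order_tendstoD) (use L in auto)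
    moreover have "\<forall>\<^sub>F t in at_right 0. t < (1/2::real)"
      by (rule eventually_at_rightI[of _ "1/2"]) auto
    ultimately have "\<forall>\<^sub>F t in at_right 0. 0 < t \<and> t < (1/2::real) \<and> L < (1 - 2 * t) / (m * (1 + t)) * C"
      using eventually_at_right_less[of "0::real"] by eventually_elim auto
    then obtain t where t: "0 < t" "t < 1/2" "L < (1 - 2 * t) / (m * (1 + t)) * C"
      using eventually_happens by (metis (no_types, lifting) trivial_limit_at_right_real)
    define d where "d = m * (1 + t)"
    have d: "0 < d" "m < d" using m t by (auto simp: d_def)
    define q where "q = (\<lambda>\<omega>. - fst p \<omega> - d, \<lambda>\<omega>. - fst p \<omega> - d)"
    have intq: "integrable Q (\<lambda>\<omega>. - fst p \<omega> - d)" using int by auto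
    have "(\<integral>\<omega>. - fst p \<omega> - d \<partial>Q) = m - d"
      using int mean by (simp add: Q.prob_space)
    then have "\<forall>\<^sub>F \<beta> in at_top. (\<integral>\<omega>. max (- fst p \<omega> - d) (- \<beta>) \<partial>Q) < - ((d - m) / 2)"
      using d by (intro order_tendstoD(2)[OF Q.truncated_mean_tendsto[OF intq]]) (simp add: field_simps)
    then obtain \<beta> where \<beta>: "(\<integral>\<omega>. max (- fst p \<omega> - d) (- \<beta>) \<partial>Q) < - ((d - m) / 2)"
      using eventually_happens by (metis (no_types, lifting) trivial_limit_at_top_linorder)
    have "\<exists>R\<ge>0. \<forall>ps\<in>lists {q}. hit Q (map (tilt 0) ps) R \<le> t"
      by (rule Q.hit_tilt_small[where \<psi>="\<lambda>\<omega>. - fst p \<omega> - d" and \<zeta>="\<lambda>\<omega>. - fst p \<omega> - d" and \<beta>=\<beta> and \<eta>="(d - m) / 2"])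
        (use mp intq \<beta> t d in \<open>auto simp: q_def\<close>)
    then obtain R where R: "0 \<le> R" "\<And>ps. ps \<in> lists {q} \<Longrightarrow> hit Q (map (tilt 0) ps) R \<le> t" by blast
    have "tilt 0 q = q" by (simp add: tilt_def q_def)
    then have Rk: "hit Q (replicate k q) R \<le> t" for k
      using R(2)[of "replicate k q"] by (auto simp: in_lists_conv_set)
    \<comment> \<open>Letting \<open>n\<close> tend to infinity removes the remaining excess, so the
      Riemann sum is compared with the whole mean excess.\<close>
    have main: "(1 - 2 * t) / d * E (y + R) \<le> v y" if vy: "v y \<le> t" for y
    proof (rule tendsto_le[OF sequentially_bot tendsto_const])
      have "filterlim (\<lambda>n. y + R + real n * d) at_top sequentially"
        using d by real_asymp
      with Q.expected_excess_tendsto_0[OF int(2)] have "(\<lambda>n. E (y + R + real n * d)) \<longlonglongrightarrow> 0"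
        unfolding E_def by (rule filterlim_compose)
      then show "(\<lambda>n. (1 - 2 * t) / d * (E (y + R) - E (y + R + real n * d))) \<longlonglongrightarrow> (1 - 2 * t) / d * E (y + R)"
        using d by (auto intro!: tendsto_eq_intros)
      show "\<forall>\<^sub>F n in sequentially. (1 - 2 * t) / d * (E (y + R) - E (y + R + real n * d)) \<le> v y"
      proof (intro always_eventually allI)
        fix n
        let ?P = "\<lambda>k. measure Q {\<omega> \<in> space Q. y + R + real k * d < snd p \<omega>}"
        have "E (y + R) - E (y + R + real n * d) \<le> d * (\<Sum>k<n. ?P k)"
          using Q.excess_le_tail_sum[of d "snd p" "y + R" n] int d by (simp add: E_def)
        then have "(1 - 2 * t) / d * (E (y + R) - E (y + R + real n * d)) \<le> (1 - 2 * t) / d * (d * (\<Sum>k<n. ?P k))"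
          using t d by (intro mult_left_mono) auto
        also have "\<dots> = (\<Sum>k<n. (1 - 2 * t) * ?P k)" using d by (simp add: sum_distrib_left)
        also have "\<dots> \<le> (\<Sum>k<n. (1 - hit Q (replicate k q) R - hit Q (replicate k p) y) * ?P k)"
        proof (intro sum_mono mult_right_mono)
          fix k
          show "1 - 2 * t \<le> 1 - hit Q (replicate k q) R - hit Q (replicate k p) y"
            using Rk[of k] le_v[of k y] vy by simp
        qed simp
        also have "\<dots> \<le> hit Q (replicate n p) y"
          unfolding q_def by (rule Q.hit_replicate_lower) (use R in auto)
        also have "\<dots> \<le> v y" by (rule le_v)
        finally show "(1 - 2 * t) / d * (E (y + R) - E (y + R + real n * d)) \<le> v y" .
      qed
    qed
    have "((\<lambda>y. (1 - 2 * t) / d * E (y + R) / tail H y) \<longlongrightarrow> (1 - 2 * t) / d * C) at_top"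
      using tendsto_mult[OF tendsto_const Elim[of R], of "(1 - 2 * t) / d"] by simp
    then have "\<forall>\<^sub>F y in at_top. L * tail H y < (1 - 2 * t) / d * E (y + R)"
      by (rule eventually_ratio_greater) (use t in \<open>auto simp: d_def\<close>)
    then show ?thesis
      using v_small[OF t(1)] by eventually_elim (use main in fastforce)
  qed
  show ?thesis
    unfolding v_def[symmetric]
  proof (rule order_tendstoI)
    fix L assume "L < C / m"
    from lower[OF this] show "\<forall>\<^sub>F y in at_top. L < v y / tail H y"
      by eventually_elim (simp add: pos_less_divide_eq tail_pos)
  next
    fix L assume "C / m < L"
    then obtain L' where L': "C / m < L'" "L' < L" using dense by blast
    from upper[OF L'(1)] show "\<forall>\<^sub>F y in at_top. v y / tail H y < L"
    proof eventually_elim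
      case (elim y)
      have "L' * tail H y < L * tail H y" using L' by (intro mult_strict_right_mono tail_pos)
      from le_less_trans[OF elim this] show ?case by (simp add: pos_divide_less_eq tail_pos)
    qed
  qed
qed

end

section \<open>Maxima of partial sums\<close>

text \<open>The largest partial sum, the empty one included, computed from the front: this order
  matches the recursion of \<open>hit\<close>.\<close>

primrec wmax :: "('a \<Rightarrow> real) list \<Rightarrow> (nat \<Rightarrow> 'a) \<Rightarrow> real" where
  "wmax [] v = 0"
| "wmax (f # fs) v = max 0 (f (v 0) + wmax fs (\<lambda>i. v (Suc i)))"

primrec wsum :: "('a \<Rightarrow> real) list \<Rightarrow> (nat \<Rightarrow> 'a) \<Rightarrow> real" where
  "wsum [] v = 0"
| "wsum (f # fs) v = f (v 0) + wsum fs (\<lambda>i. v (Suc i))"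

definition diag :: "('a \<Rightarrow> real) \<Rightarrow> 'a step" where
  "diag f = (f, f)"

lemma fst_diag: "fst (diag f) = f" and snd_diag: "snd (diag f) = f"
  by (simp_all add: diag_def)

lemma wmax_nonneg: "0 \<le> wmax fs v"
  by (cases fs) auto

lemma wsum_le_wmax: "wsum fs v \<le> wmax fs v"
proof (induction fs arbitrary: v)
  case (Cons f fs)
  show ?case using Cons[of "\<lambda>i. v (Suc i)"] by (simp add: le_max_iff_disj)
qed simp

abbreviation seqs :: "'a measure \<Rightarrow> (nat \<Rightarrow> 'a) measure" where
  "seqs M \<equiv> \<Pi>\<^sub>M i\<in>(UNIV :: nat set). M"

lemma measurable_shift_seq: "(\<lambda>v i. v (Suc i)) \<in> measurable (seqs M) (seqs M)"
  by (rule measurable_PiM_single') (auto simp: space_PiM PiE_def Pi_def)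

lemma measurable_wmax:
  assumes "\<And>f. f \<in> set fs \<Longrightarrow> f \<in> borel_measurable M"
  shows "wmax fs \<in> borel_measurable (seqs M)"
  using assms
proof (induction fs)
  case (Cons f fs)
  have fs: "f \<in> borel_measurable M" "wmax fs \<in> borel_measurable (seqs M)" using Cons by auto
  have "(\<lambda>v. f (v 0)) \<in> borel_measurable (seqs M)"
    using measurable_compose[OF measurable_component_singleton[of 0 UNIV "\<lambda>_. M"] fs(1)] by simp
  moreover have "(\<lambda>v. wmax fs (\<lambda>i. v (Suc i))) \<in> borel_measurable (seqs M)"
    by (rule measurable_compose[OF measurable_shift_seq fs(2)])
  ultimately show ?case by simp
qed (simp add: wmax.simps(1)[abs_def])

lemma measurable_wsum:
  assumes "\<And>f. f \<in> set fs \<Longrightarrow> f \<in> borel_measurable M"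
  shows "wsum fs \<in> borel_measurable (seqs M)"
  using assms
proof (induction fs)
  case (Cons f fs)
  have fs: "f \<in> borel_measurable M" "wsum fs \<in> borel_measurable (seqs M)" using Cons by auto
  have "(\<lambda>v. f (v 0)) \<in> borel_measurable (seqs M)"
    using measurable_compose[OF measurable_component_singleton[of 0 UNIV "\<lambda>_. M"] fs(1)] by simp
  moreover have "(\<lambda>v. wsum fs (\<lambda>i. v (Suc i))) \<in> borel_measurable (seqs M)"
    by (rule measurable_compose[OF measurable_shift_seq fs(2)])
  ultimately show ?case by simp
qed (simp add: wsum.simps(1)[abs_def])

lemma (in pair_prob_space)
  fixes f :: "_ \<Rightarrow> real"
  shows integrable_pair_fst: "integrable M1 f \<Longrightarrow> integrable (M1 \<Otimes>\<^sub>M M2) (\<lambda>x. f (fst x))"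
    and integrable_pair_snd: "integrable M2 h \<Longrightarrow> integrable (M1 \<Otimes>\<^sub>M M2) (\<lambda>x. h (snd x) :: real)"
  by (rule Fubini_integrable; auto simp: M2.prob_space)+

section \<open>Integration over sequences of independent variables\<close>

context prob_space
begin

lemma prob_space_seqs: "prob_space (seqs M)"
  by (rule prob_space_PiM) (rule prob_space_axioms)

lemma measurable_case_nat_pair: "(\<lambda>x. case_nat (fst x) (snd x)) \<in> measurable (M \<Otimes>\<^sub>M seqs M) (seqs M)"
  by measurable

lemma distr_case_nat: "distr (M \<Otimes>\<^sub>M seqs M) (seqs M) (\<lambda>x. case_nat (fst x) (snd x)) = seqs M"
proof -
  interpret sequence_space M by standard
  show ?thesis using PiM_iter by (simp add: case_prod_beta')
qed

lemma integrable_seqs_iff: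
  fixes F :: "(nat \<Rightarrow> 'a) \<Rightarrow> real"
  assumes "F \<in> borel_measurable (seqs M)"
  shows "integrable (seqs M) F \<longleftrightarrow> integrable (M \<Otimes>\<^sub>M seqs M) (\<lambda>x. F (case_nat (fst x) (snd x)))"
  using integrable_distr_eq[OF measurable_case_nat_pair assms] by (simp only: distr_case_nat)

text \<open>An i.i.d. sequence is a first entry followed by an independent sequence of the same law.
  Expectations over sequences thus obey the recursion of \<open>hit\<close>, \<open>wmax\<close> and
  \<open>wsum\<close>.\<close>

lemma integral_seqs:
  fixes F :: "(nat \<Rightarrow> 'a) \<Rightarrow> real"
  assumes "integrable (seqs M) F"
  shows "(\<integral>v. F v \<partial>seqs M) = (\<integral>s. (\<integral>w. F (case_nat s w) \<partial>seqs M) \<partial>M)"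
    and "integrable M (\<lambda>s. \<integral>w. F (case_nat s w) \<partial>seqs M)"
proof -
  interpret S: prob_space "seqs M" by (rule prob_space_seqs)
  interpret MS: pair_prob_space M "seqs M" ..
  have F: "F \<in> borel_measurable (seqs M)" using assms by auto
  have int: "integrable (M \<Otimes>\<^sub>M seqs M) (\<lambda>x. F (case_nat (fst x) (snd x)))"
    using assms integrable_seqs_iff[OF F] by blast
  have "(\<integral>v. F v \<partial>seqs M) = (\<integral>x. F (case_nat (fst x) (snd x)) \<partial>(M \<Otimes>\<^sub>M seqs M))"
    using integral_distr[OF measurable_case_nat_pair F] by (simp only: distr_case_nat)
  also have "\<dots> = (\<integral>s. (\<integral>w. F (case_nat s w) \<partial>seqs M) \<partial>M)"
    using MS.integral_fst'[OF int] by simp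
  finally show "(\<integral>v. F v \<partial>seqs M) = (\<integral>s. (\<integral>w. F (case_nat s w) \<partial>seqs M) \<partial>M)" .
  show "integrable M (\<lambda>s. \<integral>w. F (case_nat s w) \<partial>seqs M)"
    using MS.integrable_fst'[OF int] by simp
qed

lemma integrable_wmax:
  assumes "\<And>f. f \<in> set fs \<Longrightarrow> integrable M f"
  shows "integrable (seqs M) (wmax fs)"
  using assms
proof (induction fs)
  case Nil
  interpret S: prob_space "seqs M" by (rule prob_space_seqs)
  show ?case by (simp add: wmax.simps(1)[abs_def])
next
  case (Cons f fs)
  interpret S: prob_space "seqs M" by (rule prob_space_seqs)
  interpret MS: pair_prob_space M "seqs M" ..
  have f: "integrable M f" and [measurable]: "f \<in> borel_measurable M" using Cons.prems by auto
  have fs: "integrable (seqs M) (wmax fs)" using Cons by auto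
  have "integrable (M \<Otimes>\<^sub>M seqs M) (\<lambda>x. f (fst x))" "integrable (M \<Otimes>\<^sub>M seqs M) (\<lambda>x. wmax fs (snd x))"
    using f fs by (auto intro: MS.integrable_pair_fst MS.integrable_pair_snd)
  then have "integrable (M \<Otimes>\<^sub>M seqs M) (\<lambda>x. wmax (f # fs) (case_nat (fst x) (snd x)))"
    by (auto intro!: integrable_max)
  moreover have "wmax (f # fs) \<in> borel_measurable (seqs M)"
    using Cons.prems by (intro measurable_wmax) auto
  ultimately show ?case using integrable_seqs_iff by blast
qed

text \<open>Through this reading of \<open>hit\<close>, pathwise inequalities between maxima become
  inequalities between crossing probabilities.\<close>

lemma prob_wmax:
  assumes "\<And>f. f \<in> set fs \<Longrightarrow> f \<in> borel_measurable M" "0 \<le> u"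
  shows "measure (seqs M) {v \<in> space (seqs M). u < wmax fs v} = hit M (map diag fs) u"
  using assms
proof (induction fs arbitrary: u)
  case (Cons f fs)
  interpret S: prob_space "seqs M" by (rule prob_space_seqs)
  have [measurable]: "f \<in> borel_measurable M" "wmax (f # fs) \<in> borel_measurable (seqs M)" "wmax fs \<in> borel_measurable (seqs M)"
    using Cons.prems by (auto intro!: measurable_wmax simp del: wmax.simps)
  let ?F = "\<lambda>v. if u < wmax (f # fs) v then 1 else 0 :: real"
  have "measure (seqs M) {v \<in> space (seqs M). u < wmax (f # fs) v} = (\<integral>v. ?F v \<partial>seqs M)"
    by (rule S.prob_gt_eq_integral(2)[symmetric]) measurable
  also have "\<dots> = (\<integral>s. (\<integral>w. ?F (case_nat s w) \<partial>seqs M) \<partial>M)"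
    by (rule integral_seqs) (rule S.prob_gt_eq_integral(1), measurable)
  also have "\<dots> = (\<integral>s. (if u < f s then 1 else hit M (map diag fs) (u - f s)) \<partial>M)"
  proof (intro Bochner_Integration.integral_cong refl)
    fix s
    have "(\<integral>w. ?F (case_nat s w) \<partial>seqs M) = (\<integral>w. (if u - f s < wmax fs w then 1 else 0) \<partial>seqs M)"
      using Cons.prems by (intro Bochner_Integration.integral_cong) auto
    also have "\<dots> = measure (seqs M) {w \<in> space (seqs M). u - f s < wmax fs w}"
      by (rule S.prob_gt_eq_integral) measurable
    also have "\<dots> = (if u < f s then 1 else hit M (map diag fs) (u - f s))"
    proof (cases "u < f s")
      case True
      then have "{w \<in> space (seqs M). u - f s < wmax fs w} = space (seqs M)"
        using wmax_nonneg[of fs] by (auto intro: less_le_trans[of _ 0])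
      then show ?thesis using True by (simp add: S.prob_space)
    next
      case False
      then show ?thesis using Cons by auto
    qed
    finally show "(\<integral>w. ?F (case_nat s w) \<partial>seqs M) = (if u < f s then 1 else hit M (map diag fs) (u - f s))" .
  qed
  finally show ?case unfolding list.map hit.simps fst_diag snd_diag .
qed auto

definition excess :: "('a \<Rightarrow> real) list \<Rightarrow> real \<Rightarrow> real" where
  "excess fs y = (\<integral>v. max 0 (wmax fs v - y) \<partial>seqs M)"

lemma excess_Nil [simp]: "0 \<le> y \<Longrightarrow> excess [] y = 0"
  by (simp add: excess_def max_def)

lemma excess_nonneg: "0 \<le> excess fs y"
  by (auto simp: excess_def intro!: Bochner_Integration.integral_nonneg)

lemma excess_antimono:
  assumes "\<And>f. f \<in> set fs \<Longrightarrow> integrable M f" "u \<le> v"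
  shows "excess fs v \<le> excess fs u"
proof -
  interpret S: prob_space "seqs M" by (rule prob_space_seqs)
  show ?thesis unfolding excess_def
    using assms by (intro integral_mono S.integrable_max0 integrable_wmax) auto
qed

text \<open>For \<open>W \<ge> 0\<close> the excess of \<open>f + W\<close> over \<open>y\<close>
  splits exactly into the excess of \<open>f\<close> over \<open>y\<close> and that of
  \<open>W\<close> over the level \<open>max 0 (y - f)\<close> still to be passed. This exact
  additivity is what lets the contributions of the states of an environment be summed.\<close>

lemma excess_Cons:
  assumes int: "\<And>g. g \<in> set (f # fs) \<Longrightarrow> integrable M g" and y: "0 \<le> y"
  shows "excess (f # fs) y = (\<integral>s. max 0 (f s - y) \<partial>M) + (\<integral>s. excess fs (max 0 (y - f s)) \<partial>M)"
    and "integrable M (\<lambda>s. excess fs (max 0 (y - f s)))"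
proof -
  interpret S: prob_space "seqs M" by (rule prob_space_seqs)
  have iw: "integrable (seqs M) (wmax fs)" "integrable (seqs M) (wmax (f # fs))"
    using int by (auto intro!: integrable_wmax simp del: wmax.simps)
  have f: "integrable M f" using int by auto
  have [measurable]: "f \<in> borel_measurable M" using f by auto
  show i: "integrable M (\<lambda>s. excess fs (max 0 (y - f s)))"
  proof (rule integrable_bounded[where B="excess fs 0"])
    have [measurable]: "excess fs \<in> borel_measurable borel"
      by (rule borel_measurable_antimono) (rule excess_antimono, use int in auto)
    show "(\<lambda>s. excess fs (max 0 (y - f s))) \<in> borel_measurable M" by measurable
    show "\<bar>excess fs (max 0 (y - f s))\<bar> \<le> excess fs 0" for s
      using excess_nonneg excess_antimono[of fs 0] int by auto
  qed
  have "excess (f # fs) y = (\<integral>s. (\<integral>w. max 0 (wmax (f # fs) (case_nat s w) - y) \<partial>seqs M) \<partial>M)"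
    unfolding excess_def by (rule integral_seqs) (rule S.integrable_max0[OF iw(2)])
  also have "\<dots> = (\<integral>s. max 0 (f s - y) + excess fs (max 0 (y - f s)) \<partial>M)"
  proof (intro Bochner_Integration.integral_cong refl)
    fix s
    have "(\<integral>w. max 0 (wmax (f # fs) (case_nat s w) - y) \<partial>seqs M)
        = (\<integral>w. max 0 (f s - y) + max 0 (wmax fs w - max 0 (y - f s)) \<partial>seqs M)"
    proof (intro Bochner_Integration.integral_cong refl)
      fix w
      show "max 0 (wmax (f # fs) (case_nat s w) - y) = max 0 (f s - y) + max 0 (wmax fs w - max 0 (y - f s))"
        using y wmax_nonneg[of fs w] by (auto simp: max_def)
    qed
    also have "\<dots> = max 0 (f s - y) + excess fs (max 0 (y - f s))"
      using S.integrable_max0[OF iw(1)] by (simp add: excess_def S.prob_space)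
    finally show "(\<integral>w. max 0 (wmax (f # fs) (case_nat s w) - y) \<partial>seqs M) = max 0 (f s - y) + excess fs (max 0 (y - f s))" .
  qed
  also have "\<dots> = (\<integral>s. max 0 (f s - y) \<partial>M) + (\<integral>s. excess fs (max 0 (y - f s)) \<partial>M)"
    using i integrable_max0[OF f] by (rule Bochner_Integration.integral_add[rotated])
  finally show "excess (f # fs) y = (\<integral>s. max 0 (f s - y) \<partial>M) + (\<integral>s. excess fs (max 0 (y - f s)) \<partial>M)" .
qed

end

section \<open>The walk in a fixed environment\<close>

text \<open>The integrand is the length of the set of \<open>t\<close> with
  \<open>A < t \<le> w\<close> and \<open>y - t < D\<close>. Each layer \<open>t\<close> contributes
  a tail probability of \<open>D\<close>, so that a bound on the tails suffices for the comparison
  that follows.\<close>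

lemma (in prob_space) excess_layers:
  fixes D :: "'a \<Rightarrow> real"
  assumes [measurable]: "D \<in> borel_measurable M" and A: "0 \<le> A"
  shows "(\<integral>\<^sup>+\<omega>. ennreal (max 0 (w - max (y - D \<omega>) A)) \<partial>M)
     = (\<integral>\<^sup>+t. indicator {A<..w} t * ennreal (prob {\<omega> \<in> space M. y - t < D \<omega>}) \<partial>lborel)"
proof -
  interpret PL: pair_sigma_finite M lborel ..
  have "(\<integral>\<^sup>+\<omega>. ennreal (max 0 (w - max (y - D \<omega>) A)) \<partial>M)
      = (\<integral>\<^sup>+\<omega>. (\<integral>\<^sup>+t. indicator {A<..w} t * indicator {y<..} (t + D \<omega>) \<partial>lborel) \<partial>M)"
  proof (intro nn_integral_cong)
    fix \<omega>
    have "(\<integral>\<^sup>+t. indicator {A<..w} t * indicator {y<..} (t + D \<omega>) \<partial>lborel) = (\<integral>\<^sup>+t. indicator {max (y - D \<omega>) A<..w} t \<partial>lborel)"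
      by (intro nn_integral_cong) (auto split: split_indicator)
    also have "\<dots> = ennreal (max 0 (w - max (y - D \<omega>) A))"
      by (cases "max (y - D \<omega>) A \<le> w") (auto simp: ennreal_eq_0_iff)
    finally show "ennreal (max 0 (w - max (y - D \<omega>) A)) = (\<integral>\<^sup>+t. indicator {A<..w} t * indicator {y<..} (t + D \<omega>) \<partial>lborel)" ..
  qed
  also have "\<dots> = (\<integral>\<^sup>+t. (\<integral>\<^sup>+\<omega>. indicator {A<..w} t * indicator {y<..} (t + D \<omega>) \<partial>M) \<partial>lborel)"
    by (rule PL.Fubini'[symmetric]) measurable
  also have "\<dots> = (\<integral>\<^sup>+t. indicator {A<..w} t * ennreal (prob {\<omega> \<in> space M. y - t < D \<omega>}) \<partial>lborel)"
  proof (intro nn_integral_cong)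
    fix t
    have "(\<integral>\<^sup>+\<omega>. indicator {A<..w} t * indicator {y<..} (t + D \<omega>) \<partial>M)
       = indicator {A<..w} t * (\<integral>\<^sup>+\<omega>. indicator {y<..} (t + D \<omega>) \<partial>M)"
      by (rule nn_integral_cmult) measurable
    also have "(\<integral>\<^sup>+\<omega>. indicator {y<..} (t + D \<omega>) \<partial>M) = (\<integral>\<^sup>+\<omega>. indicator {\<omega> \<in> space M. y - t < D \<omega>} \<omega> \<partial>M)"
      by (intro nn_integral_cong) (auto split: split_indicator)
    also have "\<dots> = ennreal (prob {\<omega> \<in> space M. y - t < D \<omega>})"
      by (simp add: emeasure_eq_measure)
    finally show "(\<integral>\<^sup>+\<omega>. indicator {A<..w} t * indicator {y<..} (t + D \<omega>) \<partial>M)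
      = indicator {A<..w} t * ennreal (prob {\<omega> \<in> space M. y - t < D \<omega>})" .
  qed
  finally show ?thesis .
qed

lemma (in prob_space) excess_dominated:
  fixes D :: "'a \<Rightarrow> real"
  assumes H: "real_distribution H" and D: "D \<in> borel_measurable M" and A: "0 \<le> A" and K: "0 \<le> K"
    and le: "\<And>v. prob {\<omega> \<in> space M. v < D \<omega>} \<le> K * tail H v"
  shows "(\<integral>\<omega>. max 0 (w - max (y - D \<omega>) A) \<partial>M) \<le> K * (\<integral>h. max 0 (w - max (y - h) A) \<partial>H)"
proof -
  interpret H: real_distribution H by fact
  have [measurable]: "D \<in> borel_measurable M" by fact
  have [measurable]: "(\<lambda>h. h) \<in> borel_measurable H" by simp
  have bd: "\<bar>max 0 (w - max (y - d) A)\<bar> \<le> \<bar>w\<bar>" for d using A by auto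
  have "ennreal (\<integral>\<omega>. max 0 (w - max (y - D \<omega>) A) \<partial>M) = (\<integral>\<^sup>+\<omega>. ennreal (max 0 (w - max (y - D \<omega>) A)) \<partial>M)"
    by (rule nn_integral_eq_integral[symmetric], rule integrable_bounded[where B="\<bar>w\<bar>"]) (use bd in auto)
  also have "\<dots> = (\<integral>\<^sup>+t. indicator {A<..w} t * ennreal (prob {\<omega> \<in> space M. y - t < D \<omega>}) \<partial>lborel)"
    by (rule excess_layers[OF D A])
  also have "\<dots> \<le> (\<integral>\<^sup>+t. ennreal K * (indicator {A<..w} t * ennreal (H.prob {h \<in> space H. y - t < h})) \<partial>lborel)"
  proof (rule nn_integral_mono)
    fix t
    have "ennreal (prob {\<omega> \<in> space M. y - t < D \<omega>}) \<le> ennreal (K * tail H (y - t))"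
      by (rule ennreal_leI[OF le])
    also have "\<dots> = ennreal K * ennreal (H.prob {h \<in> space H. y - t < h})"
    proof -
      have "{h \<in> space H. y - t < h} = {y - t<..}" by auto
      then show ?thesis using K by (simp add: ennreal_mult tail_def)
    qed
    finally show "indicator {A<..w} t * ennreal (prob {\<omega> \<in> space M. y - t < D \<omega>})
       \<le> ennreal K * (indicator {A<..w} t * ennreal (H.prob {h \<in> space H. y - t < h}))"
      by (auto split: split_indicator)
  qed
  also have "\<dots> = ennreal K * (\<integral>\<^sup>+t. indicator {A<..w} t * ennreal (H.prob {h \<in> space H. y - t < h}) \<partial>lborel)"
  proof (rule nn_integral_cmult)
    have "{h \<in> space H. y - t < h} = {y - t<..}" for t by auto
    then show "(\<lambda>t. indicator {A<..w} t * ennreal (H.prob {h \<in> space H. y - t < h})) \<in> borel_measurable lborel"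
      using H.borel_measurable_tail by (simp add: tail_def[symmetric])
  qed
  also have "(\<integral>\<^sup>+t. indicator {A<..w} t * ennreal (H.prob {h \<in> space H. y - t < h}) \<partial>lborel)
     = (\<integral>\<^sup>+h. ennreal (max 0 (w - max (y - h) A)) \<partial>H)"
    by (rule H.excess_layers[symmetric, OF _ A]) simp
  also have "\<dots> = ennreal (\<integral>h. max 0 (w - max (y - h) A) \<partial>H)"
    by (rule nn_integral_eq_integral, rule H.integrable_bounded[where B="\<bar>w\<bar>"]) (use bd in auto)
  also have "ennreal K * \<dots> = ennreal (K * (\<integral>h. max 0 (w - max (y - h) A) \<partial>H))"
    using K by (simp add: ennreal_mult')
  finally show ?thesis
    using K by (subst (asm) ennreal_le_iff) (auto intro!: mult_nonneg_nonneg Bochner_Integration.integral_nonneg)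
qed

text \<open>The coupled walk in abstract form: \<open>g x u\<close> is the increment in state
  \<open>x\<close> produced by the driving variable \<open>u\<close>, and \<open>G u\<close> the
  reference increment. (D1) has become the pointwise bound \<open>g_le\<close>, (D2) the limit
  \<open>g_excess\<close>, and \<open>b > \<kappa>\<close> the uniform bound \<open>drift\<close>.
  Equality in \<open>G_excess\<close> is eventual because an integrated tail is capped at 1.\<close>

locale modulated_walk = subexp_law H + Q: prob_space Q
  for H :: "real measure" and Q :: "'u measure" +
  fixes SX :: "'x measure" and g :: "'x \<Rightarrow> 'u \<Rightarrow> real" and G :: "'u \<Rightarrow> real" and c :: "'x \<Rightarrow> real"
    and \<beta> b \<eta> :: real
  assumes g_meas: "(\<lambda>p. g (fst p) (snd p)) \<in> borel_measurable (SX \<Otimes>\<^sub>M Q)"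
    and g_int: "x \<in> space SX \<Longrightarrow> integrable Q (g x)"
    and G_int: "integrable Q G"
    and g_le: "x \<in> space SX \<Longrightarrow> u \<in> space Q \<Longrightarrow> g x u \<le> G u"
    and G_excess: "\<forall>\<^sub>F y in at_top. (\<integral>u. max 0 (G u - y) \<partial>Q) = tail H y"
    and g_excess: "x \<in> space SX \<Longrightarrow> ((\<lambda>y. (\<integral>u. max 0 (g x u - y) \<partial>Q) / tail H y) \<longlongrightarrow> c x) at_top"
    and \<beta>: "0 \<le> \<beta>" and b: "0 \<le> b" and \<eta>: "0 < \<eta>"
    and drift: "x \<in> space SX \<Longrightarrow> (\<integral>u. max (g x u) (- \<beta>) \<partial>Q) \<le> b - \<eta>"
begin

text \<open>Lowering the truncated increments by \<open>b\<close> gives them drift at most \<open>- \<eta>\<close> in every state; over a cycle of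
  length \<open>n\<close> this is paid back by the term \<open>b * n\<close>, which is negligible by (D4).\<close>

definition \<zeta> :: "'x \<Rightarrow> 'u \<Rightarrow> real" where
  "\<zeta> x u = max (g x u) (- \<beta>) - b"

text \<open>Truncation at \<open>- \<beta>\<close> can lift an increment above \<open>G\<close>; the
  positive part restores a common majorant.\<close>

definition G1 :: "'u \<Rightarrow> real" where
  "G1 u = max (G u) 0"

lemma g_measurable: "x \<in> space SX \<Longrightarrow> g x \<in> borel_measurable Q"
  using g_int by auto

lemma \<zeta>_int: "x \<in> space SX \<Longrightarrow> integrable Q (\<zeta> x)"
  unfolding \<zeta>_def using g_int by (auto intro!: integrable_max)

lemma \<zeta>_measurable: "x \<in> space SX \<Longrightarrow> \<zeta> x \<in> borel_measurable Q"
  using \<zeta>_int by auto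

lemma G1_int: "integrable Q G1"
  unfolding G1_def using G_int by (auto intro!: integrable_max)

lemma \<zeta>_le: "x \<in> space SX \<Longrightarrow> u \<in> space Q \<Longrightarrow> \<zeta> x u \<le> G1 u"
  using g_le[of x u] b \<beta> by (auto simp: \<zeta>_def G1_def)

lemma G1_excess: "\<forall>\<^sub>F y in at_top. (\<integral>u. max 0 (G1 u - y) \<partial>Q) = tail H y"
  using G_excess eventually_ge_at_top[of 0]
proof eventually_elim
  case (elim y)
  have "max 0 (G1 u - y) = max 0 (G u - y)" for u using elim(2) by (auto simp: G1_def)
  then show ?case using elim by simp
qed

lemma G1_ratio: "((\<lambda>y. (\<integral>u. max 0 (G1 u - y) \<partial>Q) / tail H y) \<longlongrightarrow> 1) at_top"
proof (rule tendsto_eventually)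
  show "\<forall>\<^sub>F y in at_top. (\<integral>u. max 0 (G1 u - y) \<partial>Q) / tail H y = 1"
    using G1_excess by eventually_elim (simp add: less_imp_neq[OF tail_pos, symmetric])
qed

text \<open>A tail is negligible against its integral when the integral is long-tailed: the
  probability of \<open>v < G1\<close> is at most the difference of the mean excesses over
  \<open>v - 1\<close> and over \<open>v\<close>.\<close>

lemma G1_tail_small:
  assumes "0 < \<epsilon>"
  shows "\<forall>\<^sub>F v in at_top. measure Q {u \<in> space Q. v < G1 u} \<le> \<epsilon> * tail H v"
proof -
  let ?E = "\<lambda>y. \<integral>u. max 0 (G1 u - y) \<partial>Q"
  have "((\<lambda>y. ?E (y + (- 1)) / tail H y - ?E y / tail H y) \<longlongrightarrow> 1 - 1) at_top"
    by (intro tendsto_diff G1_ratio ratio_shift[where f="?E", OF G1_ratio])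
  then have "((\<lambda>y. (?E (y + (- 1)) - ?E y) / tail H y) \<longlongrightarrow> 0) at_top"
    by (simp add: diff_divide_distrib)
  from eventually_ratio_less[OF this assms] show ?thesis
  proof eventually_elim
    case (elim v)
    have [measurable]: "G1 \<in> borel_measurable Q" using G1_int by auto
    have "measure Q {u \<in> space Q. v < G1 u} = (\<integral>u. (if v < G1 u then 1 else 0) \<partial>Q)"
      by (rule Q.prob_gt_eq_integral(2)[symmetric]) simp
    also have "\<dots> \<le> (\<integral>u. max 0 (G1 u - (v + (- 1))) - max 0 (G1 u - v) \<partial>Q)"
      using G1_int by (intro integral_mono Q.prob_gt_eq_integral Bochner_Integration.integrable_diff Q.integrable_max0) auto
    also have "\<dots> = ?E (v + (- 1)) - ?E v"
      using G1_int by (intro Bochner_Integration.integral_diff Q.integrable_max0)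
    finally show ?case using elim by simp
  qed
qed

lemma tail_small_dominated:
  assumes "0 < \<epsilon>" "\<And>u. u \<in> space Q \<Longrightarrow> f u \<le> G1 u"
  shows "\<forall>\<^sub>F v in at_top. measure Q {u \<in> space Q. v < f u} \<le> \<epsilon> * tail H v"
  using G1_tail_small[OF assms(1)]
proof eventually_elim
  case (elim v)
  have [measurable]: "G1 \<in> borel_measurable Q" using G1_int by auto
  have "measure Q {u \<in> space Q. v < f u} \<le> measure Q {u \<in> space Q. v < G1 u}"
    by (intro Q.finite_measure_mono) (auto intro: less_le_trans assms(2))
  with elim show ?case by simp
qed

lemma \<zeta>_excess_le:
  assumes "x \<in> space SX" "0 \<le> y"
  shows "(\<integral>u. max 0 (\<zeta> x u - y) \<partial>Q) \<le> (\<integral>u. max 0 (g x u - y) \<partial>Q)"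
  using assms b \<beta> by (intro integral_mono Q.integrable_max0 \<zeta>_int g_int) (auto simp: \<zeta>_def)

lemma lists_ms:
  assumes "xs \<in> lists (space SX)"
  shows "\<forall>p\<in>set (map (\<lambda>x. diag (\<zeta> x)) xs). fst p \<in> borel_measurable Q \<and> snd p \<in> borel_measurable Q"
  using assms \<zeta>_measurable by (auto simp: fst_diag snd_diag)

text \<open>Lowering by \<open>b\<close> gives every state the same negative drift, so the renewal
  argument applies to the class of all states at once. The resulting constant depends neither on the
  environment nor on its length.\<close>

lemma hit_\<zeta>_bounded:
  obtains K where "1 \<le> K" "\<And>xs u. xs \<in> lists (space SX) \<Longrightarrow> hit Q (map (\<lambda>x. diag (\<zeta> x)) xs) u \<le> K * tail H u"
proof -
  let ?\<G> = "(\<lambda>x. diag (\<zeta> x)) ` space SX"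
  let ?E = "\<lambda>y. \<integral>u. max 0 (G1 u - y) \<partial>Q"
  define d where "d = \<eta> / 2"
  have d: "0 < d" "d < \<eta>" using \<eta> by (auto simp: d_def)
  have "\<exists>R\<ge>0. \<forall>ps\<in>lists ?\<G>. hit Q (map (tilt d) ps) R \<le> 1/2"
  proof (rule Q.hit_tilt_small[where \<psi>=G1 and \<zeta>=G1 and \<beta>="\<beta> + b" and \<eta>=\<eta>])
    fix p assume "p \<in> ?\<G>"
    then obtain x where x: "x \<in> space SX" "p = diag (\<zeta> x)" by auto
    \<comment> \<open>\<zeta> never falls below \<open>- (\<beta> + b)\<close>, so truncation there
      changes nothing and \<open>drift\<close> gives the mean.\<close>
    have "(\<integral>u. max (fst p u) (- (\<beta> + b)) \<partial>Q) = (\<integral>u. max (g x u) (- \<beta>) - b \<partial>Q)"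
      by (intro Bochner_Integration.integral_cong) (auto simp: x(2) fst_diag \<zeta>_def)
    also have "\<dots> = (\<integral>u. max (g x u) (- \<beta>) \<partial>Q) - b"
      using g_int[OF x(1)] by (subst Bochner_Integration.integral_diff) (auto simp: Q.prob_space)
    finally show "(\<integral>u. max (fst p u) (- (\<beta> + b)) \<partial>Q) \<le> - \<eta>" using drift[OF x(1)] by simp
  qed (use d G1_int \<zeta>_measurable \<zeta>_le in \<open>auto simp: fst_diag snd_diag\<close>)
  then obtain R where R: "0 \<le> R" "\<And>ps. ps \<in> lists ?\<G> \<Longrightarrow> hit Q (map (tilt d) ps) R \<le> 1/2" by blast
  have jump: "\<forall>\<^sub>F z in at_top. \<forall>ps\<in>lists ?\<G>. tail_sum Q d ps z \<le> C' * tail H z" if C': "1 / d < C'" for C'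
  proof -
    have "\<forall>\<^sub>F z in at_top. ?E (z + (- d)) < (d * C') * tail H z"
      using C' d by (intro eventually_ratio_less[OF ratio_shift[where f="?E", OF G1_ratio]])
        (simp add: divide_less_eq mult.commute)
    then show ?thesis
    proof (eventually_elim, intro ballI)
      fix z ps assume z: "?E (z + - d) < d * C' * tail H z" and ps: "ps \<in> lists ?\<G>"
      have "d * tail_sum Q d ps z \<le> (\<integral>u. max 0 (G1 u - (z - d)) \<partial>Q)"
        using ps d G1_int \<zeta>_measurable \<zeta>_le by (intro Q.tail_sum_le_excess) (auto simp: snd_diag in_lists_conv_set)
      also have "\<dots> = ?E (z + - d)" by simp
      finally have "d * tail_sum Q d ps z \<le> d * (C' * tail H z)" using z by (simp add: mult.assoc)
      then show "tail_sum Q d ps z \<le> C' * tail H z" using d by simp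
    qed
  qed
  have st: "?\<G> \<subseteq> steps Q" using \<zeta>_measurable by (auto simp: steps_def fst_diag snd_diag)
  obtain K where K: "0 \<le> K" "\<And>ps u. ps \<in> lists ?\<G> \<Longrightarrow> hit Q ps u \<le> K * tail H u"
    by (rule hit_bounded_by_tail[where Q=Q and \<G>="?\<G>" and d=d and r=R and \<delta>="1/2" and C="1/d"])
      (use Q.prob_space_axioms st d R jump in auto)
  show ?thesis
  proof (rule that[of "max 1 K"])
    fix xs u assume "xs \<in> lists (space SX)"
    then have "hit Q (map (\<lambda>x. diag (\<zeta> x)) xs) u \<le> K * tail H u" by (intro K) (auto simp: in_lists_conv_set)
    also have "\<dots> \<le> max 1 K * tail H u" by (intro mult_right_mono tail_nonneg) auto
    finally show "hit Q (map (\<lambda>x. diag (\<zeta> x)) xs) u \<le> max 1 K * tail H u" .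
  qed auto
qed

text \<open>In a fixed environment finitely many increments, each with a tail of smaller order than
  that of \<open>H\<close>, are added. The threshold depends on \<open>xs\<close>;
  \<open>hit_\<zeta>_bounded\<close> provides the domination when \<open>xs\<close> becomes
  random.\<close>

lemma hit_\<zeta>_small:
  assumes "xs \<in> lists (space SX)" "0 < \<epsilon>"
  shows "\<forall>\<^sub>F u in at_top. hit Q (map (\<lambda>x. diag (\<zeta> x)) xs) u \<le> \<epsilon> * tail H u"
  using assms
proof (induction xs arbitrary: \<epsilon> rule: list.induct)
  case (Cons x xs)
  have x: "x \<in> space SX" "xs \<in> lists (space SX)" using Cons.prems by auto
  have [measurable]: "\<zeta> x \<in> borel_measurable Q" by (rule \<zeta>_measurable[OF x(1)])
  note ms = lists_ms[OF x(2)] lists_ms[OF Cons.prems(1)]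
  let ?h = "hit Q (map (\<lambda>x. diag (\<zeta> x)) xs)"
  have [measurable]: "?h \<in> borel_measurable borel" by (rule Q.borel_measurable_hit[OF ms(1)])
  have "\<forall>\<^sub>F y in at_top. (\<integral>u. ?h (max 0 (y - \<zeta> x u)) \<partial>Q) \<le> \<epsilon> / 2 * tail H y"
  proof (rule smoothing_upper[where k=0])
    fix \<epsilon>' :: real assume e: "0 < \<epsilon>'"
    show "\<forall>\<^sub>F v in at_top. measure Q {\<omega> \<in> space Q. v < \<zeta> x \<omega>} \<le> \<epsilon>' * tail H v"
      by (rule tail_small_dominated[OF e \<zeta>_le[OF x(1)]])
    show "\<forall>\<^sub>F v in at_top. ?h v \<le> \<epsilon>' * tail H v"
      by (rule Cons.IH[OF x(2) e])
  qed (use Cons.prems Q.hit_nonneg[OF ms(1)] Q.hit_antimono[OF ms(1)] Q.prob_space_axioms in auto)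
  moreover have "\<forall>\<^sub>F v in at_top. measure Q {u \<in> space Q. v < \<zeta> x u} \<le> \<epsilon> / 2 * tail H v"
    using Cons.prems by (intro tail_small_dominated \<zeta>_le x) auto
  ultimately show ?case
  proof eventually_elim
    case (elim y)
    have "hit Q (map (\<lambda>x. diag (\<zeta> x)) (x # xs)) y
       \<le> (\<integral>u. (if y < \<zeta> x u then 1 else 0) + ?h (max 0 (y - \<zeta> x u)) \<partial>Q)"
      unfolding list.map hit.simps
    proof (rule integral_mono)
      show "integrable Q (\<lambda>\<omega>. if y < snd (diag (\<zeta> x)) \<omega> then 1 else ?h (y - fst (diag (\<zeta> x)) \<omega>))"
        by (rule Q.integrable_hit) (use ms(2) in simp)
      show "integrable Q (\<lambda>u. (if y < \<zeta> x u then 1 else 0) + ?h (max 0 (y - \<zeta> x u)))"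
        by (intro Bochner_Integration.integrable_add Q.prob_gt_eq_integral Q.integrable_bounded[where B=1])
          (auto simp: Q.hit_nonneg[OF ms(1)] Q.hit_le_1[OF ms(1)])
      show "(if y < snd (diag (\<zeta> x)) u then 1 else ?h (y - fst (diag (\<zeta> x)) u))
         \<le> (if y < \<zeta> x u then 1 else 0) + ?h (max 0 (y - \<zeta> x u))" for u
        using Q.hit_nonneg[OF ms(1)] by (auto simp: fst_diag snd_diag)
    qed
    also have "\<dots> = measure Q {u \<in> space Q. y < \<zeta> x u} + (\<integral>u. ?h (max 0 (y - \<zeta> x u)) \<partial>Q)"
      by (subst Bochner_Integration.integral_add)
        (auto intro!: Q.prob_gt_eq_integral Q.integrable_bounded[where B=1] simp: Q.prob_gt_eq_integral Q.hit_nonneg[OF ms(1)] Q.hit_le_1[OF ms(1)])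
    finally show ?case using elim by linarith
  qed
qed (auto simp: tail_nonneg)

lemma c_nonneg: "x \<in> space SX \<Longrightarrow> 0 \<le> c x"
  by (rule tendsto_lowerbound[OF g_excess])
    (auto simp: tail_nonneg intro!: always_eventually divide_nonneg_nonneg Bochner_Integration.integral_nonneg)

text \<open>By \<open>excess_Cons\<close> the constants of the states add up, since the shift caused
  by the preceding increment is free by \<open>smoothing_upper\<close>.\<close>

lemma excess_\<zeta>_limsup:
  assumes "xs \<in> lists (space SX)" "(\<Sum>x\<leftarrow>xs. c x) < L"
  shows "\<forall>\<^sub>F y in at_top. Q.excess (map \<zeta> xs) y \<le> L * tail H y"
  using assms
proof (induction xs arbitrary: L rule: list.induct)
  case Nil
  show ?case using eventually_ge_at_top[of 0]
    by eventually_elim (use Nil in \<open>auto simp: tail_nonneg\<close>)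
next
  case (Cons x xs)
  have x: "x \<in> space SX" "xs \<in> lists (space SX)" using Cons.prems by auto
  have i: "f \<in> set (map \<zeta> (x # xs)) \<Longrightarrow> integrable Q f" for f
    using Cons.prems by (auto simp: in_lists_conv_set intro: \<zeta>_int)
  define \<epsilon> where "\<epsilon> = (L - (\<Sum>x\<leftarrow>x # xs. c x)) / 2"
  have \<epsilon>: "0 < \<epsilon>" "L = (c x + \<epsilon>) + ((\<Sum>x\<leftarrow>xs. c x) + \<epsilon>)" using Cons.prems by (auto simp: \<epsilon>_def field_simps)
  have "\<forall>\<^sub>F y in at_top. (\<integral>u. Q.excess (map \<zeta> xs) (max 0 (y - \<zeta> x u)) \<partial>Q) \<le> ((\<Sum>x\<leftarrow>xs. c x) + \<epsilon>) * tail H y"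
  proof (rule smoothing_upper[where k="\<Sum>x\<leftarrow>xs. c x"])
    fix \<epsilon>' :: real assume e: "0 < \<epsilon>'"
    show "\<forall>\<^sub>F v in at_top. measure Q {\<omega> \<in> space Q. v < \<zeta> x \<omega>} \<le> \<epsilon>' * tail H v"
      by (rule tail_small_dominated[OF e \<zeta>_le[OF x(1)]])
  next
    show "0 \<le> (\<Sum>x\<leftarrow>xs. c x)" using x(2) by (intro sum_list_nonneg) (auto simp: in_lists_conv_set c_nonneg)
  qed (use \<epsilon> Cons.IH[OF x(2)] i Q.excess_nonneg Q.excess_antimono[of "map \<zeta> xs"] Q.prob_space_axioms \<zeta>_measurable[OF x(1)] in auto)
  moreover have "\<forall>\<^sub>F y in at_top. (\<integral>u. max 0 (g x u - y) \<partial>Q) < (c x + \<epsilon>) * tail H y"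
    using \<epsilon> by (intro eventually_ratio_less[OF g_excess[OF x(1)]]) auto
  ultimately show ?case using eventually_ge_at_top[of 0]
  proof eventually_elim
    case (elim y)
    have "Q.excess (map \<zeta> (x # xs)) y = (\<integral>u. max 0 (\<zeta> x u - y) \<partial>Q) + (\<integral>u. Q.excess (map \<zeta> xs) (max 0 (y - \<zeta> x u)) \<partial>Q)"
      using i elim(3) unfolding list.map by (intro Q.excess_Cons(1)) auto
    also have "\<dots> \<le> (c x + \<epsilon>) * tail H y + ((\<Sum>x\<leftarrow>xs. c x) + \<epsilon>) * tail H y"
      using \<zeta>_excess_le[OF x(1) elim(3)] elim by (intro add_mono) auto
    also have "\<dots> = L * tail H y" unfolding \<epsilon>(2) by (simp add: algebra_simps)
    finally show ?case .
  qed
qed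

text \<open>The preceding increment is at least \<open>- v\<close> with probability close to 1, and
  raising the level by \<open>v\<close> costs nothing in the limit. It is stated for
  \<open>g\<close> itself; for the upper bound \<open>excess_g_le\<close> relates \<open>g\<close>
  to \<zeta>.\<close>

lemma excess_g_liminf:
  assumes "xs \<in> lists (space SX)" "L < (\<Sum>x\<leftarrow>xs. c x)"
  shows "\<forall>\<^sub>F y in at_top. L * tail H y \<le> Q.excess (map g xs) y"
  using assms
proof (induction xs arbitrary: L rule: list.induct)
  case Nil
  show ?case using eventually_ge_at_top[of 0]
    by eventually_elim (use Nil in \<open>auto simp: tail_nonneg mult_nonpos_nonneg\<close>)
next
  case (Cons x xs)
  have x: "x \<in> space SX" "xs \<in> lists (space SX)" using Cons.prems by auto
  have i: "f \<in> set (map g (x # xs)) \<Longrightarrow> integrable Q f" for f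
    using Cons.prems by (auto simp: in_lists_conv_set intro: g_int)
  have [measurable]: "g x \<in> borel_measurable Q" by (rule g_measurable[OF x(1)])
  define S where "S = (\<Sum>x\<leftarrow>xs. c x)"
  define \<epsilon> where "\<epsilon> = (c x + S - L) / 2"
  have \<epsilon>: "0 < \<epsilon>" "L = (c x - \<epsilon>) + (S - \<epsilon>)" using Cons.prems by (auto simp: \<epsilon>_def S_def field_simps)
  let ?e = "Q.excess (map g xs)"
  have part2: "\<forall>\<^sub>F y in at_top. (S - \<epsilon>) * tail H y \<le> (\<integral>u. ?e (max 0 (y - g x u)) \<partial>Q)"
  proof -
    \<comment> \<open>One factor \<open>1 - t\<close> is lost to the event \<open>B\<close>, one to
      the shift of the level by \<open>v\<close>, and \<open>t\<close> in the constant of the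
      induction hypothesis.\<close>
    have "((\<lambda>t. (1 - t) * ((S - t) * (1 - t))) \<longlongrightarrow> (1 - 0) * ((S - 0) * (1 - 0))) (at_right 0)"
      by (intro tendsto_intros)
    then have "\<forall>\<^sub>F t in at_right 0. S - \<epsilon> < (1 - t) * ((S - t) * (1 - t))"
      by (rule order_tendstoD) (use \<epsilon> in auto)
    moreover have "\<forall>\<^sub>F t in at_right 0. t < (1::real)"
      by (rule eventually_at_rightI[of _ 1]) auto
    ultimately have "\<forall>\<^sub>F t in at_right 0. 0 < t \<and> t < (1::real) \<and> S - \<epsilon> < (1 - t) * ((S - t) * (1 - t))"
      using eventually_at_right_less[of "0::real"] by eventually_elim auto
    then obtain t where t: "0 < t" "t < 1" "S - \<epsilon> < (1 - t) * ((S - t) * (1 - t))"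
      using eventually_happens by (metis (no_types, lifting) trivial_limit_at_right_real)
    have "((\<lambda>v. tail (distr Q borel (\<lambda>u. - g x u)) v) \<longlongrightarrow> 0) at_top"
      by (intro real_distribution.tail_tendsto_0 Q.real_distribution_distr) simp
    then have "\<forall>\<^sub>F v in at_top. tail (distr Q borel (\<lambda>u. - g x u)) v < t"
      by (rule order_tendstoD) (use t in auto)
    then obtain v where v: "tail (distr Q borel (\<lambda>u. - g x u)) v < t"
      using eventually_happens by (metis (no_types, lifting) trivial_limit_at_top_linorder)
    define B where "B = {u \<in> space Q. - g x u \<le> v}"
    have [measurable]: "B \<in> sets Q" unfolding B_def by measurable
    have B: "1 - t \<le> measure Q B"
    proof -
      have "tail (distr Q borel (\<lambda>u. - g x u)) v = measure Q (space Q - B)"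
        unfolding tail_def B_def by (subst measure_distr) (auto intro!: arg_cong[where f="measure Q"])
      then show ?thesis using v Q.prob_compl[of B] by simp
    qed
    have ev1: "\<forall>\<^sub>F y in at_top. (S - t) * tail H y \<le> ?e y"
      using Cons.IH[OF x(2), of "S - t"] t by (simp add: S_def)
    have "filterlim (\<lambda>y::real. y + v) at_top at_top" by real_asymp
    from eventually_compose_filterlim[OF ev1 this] have ev1': "\<forall>\<^sub>F y in at_top. (S - t) * tail H (y + v) \<le> ?e (y + v)" .
    show ?thesis
      using ev1' long_tailed_lower[OF t(1), of v] eventually_ge_at_top[of "max 0 (- v)"]
    proof eventually_elim
      case (elim y)
      show ?case
      \<comment> \<open>Multiplying inequalities needs a positive constant \<open>S - t\<close>;
        otherwise the claimed bound is at most 0.\<close>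
      proof (cases "S - t \<le> 0")
        case True
        have "S - \<epsilon> < (1 - t) * ((S - t) * (1 - t))" by (rule t)
        also have "\<dots> \<le> 0" using t True by (simp add: mult_nonneg_nonpos mult_nonpos_nonneg)
        finally have "(S - \<epsilon>) * tail H y \<le> 0" by (intro mult_nonpos_nonneg tail_nonneg) auto
        also have "0 \<le> (\<integral>u. ?e (max 0 (y - g x u)) \<partial>Q)"
          by (intro Bochner_Integration.integral_nonneg Q.excess_nonneg)
        finally show ?thesis .
      next
        case False
        have "(S - \<epsilon>) * tail H y \<le> (1 - t) * ((S - t) * (1 - t)) * tail H y"
          using t by (intro mult_right_mono tail_nonneg) auto
        also have "\<dots> = (1 - t) * ((S - t) * ((1 - t) * tail H y))" by (simp add: mult_ac)
        also have "\<dots> \<le> (1 - t) * ((S - t) * tail H (y + v))"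
          using elim t False by (intro mult_left_mono) auto
        also have "\<dots> \<le> measure Q B * ?e (y + v)"
          using elim t False B by (intro mult_mono) (auto simp: tail_nonneg Q.excess_nonneg)
        also have "\<dots> = (\<integral>u. indicator B u * ?e (y + v) \<partial>Q)" by simp
        also have "\<dots> \<le> (\<integral>u. ?e (max 0 (y - g x u)) \<partial>Q)"
        proof (rule integral_mono)
          show "integrable Q (\<lambda>u. ?e (max 0 (y - g x u)))"
            using i elim(3) by (intro Q.excess_Cons(2)) auto
          show "integrable Q (\<lambda>u. indicator B u * ?e (y + v))"
            by (intro Q.integrable_bounded[where B="?e (y + v)"]) (auto simp: indicator_def Q.excess_nonneg)
          show "indicator B u * ?e (y + v) \<le> ?e (max 0 (y - g x u))" for u
          proof (cases "u \<in> B")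
            case True
            then have "max 0 (y - g x u) \<le> y + v" using elim(3) by (auto simp: B_def)
            then show ?thesis using True i by (auto intro!: Q.excess_antimono)
          qed (simp add: Q.excess_nonneg)
        qed
        finally show ?thesis .
      qed
    qed
  qed
  have "\<forall>\<^sub>F y in at_top. (c x - \<epsilon>) * tail H y < (\<integral>u. max 0 (g x u - y) \<partial>Q)"
    using \<epsilon> by (intro eventually_ratio_greater[OF g_excess[OF x(1)]]) auto
  then show ?case using part2 eventually_ge_at_top[of 0]
  proof eventually_elim
    case (elim y)
    have "L * tail H y = (c x - \<epsilon>) * tail H y + (S - \<epsilon>) * tail H y" unfolding \<epsilon>(2) by (simp add: algebra_simps)
    also have "\<dots> \<le> (\<integral>u. max 0 (g x u - y) \<partial>Q) + (\<integral>u. ?e (max 0 (y - g x u)) \<partial>Q)"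
      using elim by (intro add_mono) auto
    also have "\<dots> = Q.excess (map g (x # xs)) y"
      using i elim(3) unfolding list.map by (intro Q.excess_Cons(1)[symmetric]) auto
    finally show ?case .
  qed
qed

lemma wmax_g_le:
  "wmax (map g xs) v \<le> b * real (length xs) + wmax (map \<zeta> xs) v"
proof (induction xs arbitrary: v)
  case (Cons x xs)
  have "g x (v 0) \<le> \<zeta> x (v 0) + b" by (auto simp: \<zeta>_def)
  moreover have "0 \<le> b * (1 + real (length xs))" using b by simp
  ultimately show ?case using Cons[of "\<lambda>i. v (Suc i)"]
    by (auto simp: algebra_simps max_def)
qed simp

end

lemma measurable_wmax_param:
  assumes f: "(\<lambda>p. f (fst p) (snd p)) \<in> borel_measurable (SX \<Otimes>\<^sub>M Q)"
    and x: "\<And>i. i \<in> set is \<Longrightarrow> x i \<in> measurable N SX"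
  shows "(\<lambda>p. wmax (map (\<lambda>i. f (x i (fst p))) is) (snd p)) \<in> borel_measurable (N \<Otimes>\<^sub>M seqs Q)"
    and "(\<lambda>p. wsum (map (\<lambda>i. f (x i (fst p))) is) (snd p)) \<in> borel_measurable (N \<Otimes>\<^sub>M seqs Q)"
proof -
  have "(\<lambda>p. wmax (map (\<lambda>i. f (x i (fst p))) is) (snd p)) \<in> borel_measurable (N \<Otimes>\<^sub>M seqs Q)
    \<and> (\<lambda>p. wsum (map (\<lambda>i. f (x i (fst p))) is) (snd p)) \<in> borel_measurable (N \<Otimes>\<^sub>M seqs Q)"
    using x
  proof (induction "is")
    case (Cons i "is")
    have xi: "x i \<in> measurable N SX" using Cons by auto
    have "(\<lambda>p. (x i (fst p), snd p 0)) \<in> measurable (N \<Otimes>\<^sub>M seqs Q) (SX \<Otimes>\<^sub>M Q)"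
    proof (rule measurable_Pair)
      show "(\<lambda>p. x i (fst p)) \<in> measurable (N \<Otimes>\<^sub>M seqs Q) SX"
        by (rule measurable_compose[OF measurable_fst xi])
      show "(\<lambda>p. snd p 0) \<in> measurable (N \<Otimes>\<^sub>M seqs Q) Q"
        using measurable_compose[OF measurable_snd measurable_component_singleton[of 0 UNIV "\<lambda>_. Q"]] by simp
    qed
    from measurable_compose[OF this f] have h: "(\<lambda>p. f (x i (fst p)) (snd p 0)) \<in> borel_measurable (N \<Otimes>\<^sub>M seqs Q)"
      by simp
    have sh: "(\<lambda>p. (fst p, (\<lambda>j. snd p (Suc j)))) \<in> measurable (N \<Otimes>\<^sub>M seqs Q) (N \<Otimes>\<^sub>M seqs Q)"
      by (intro measurable_Pair measurable_fst measurable_compose[OF measurable_snd measurable_shift_seq])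
    have IH: "(\<lambda>p. wmax (map (\<lambda>i. f (x i (fst p))) is) (snd p)) \<in> borel_measurable (N \<Otimes>\<^sub>M seqs Q)"
       "(\<lambda>p. wsum (map (\<lambda>i. f (x i (fst p))) is) (snd p)) \<in> borel_measurable (N \<Otimes>\<^sub>M seqs Q)"
      using Cons by auto
    have "(\<lambda>p. wmax (map (\<lambda>i. f (x i (fst p))) is) (\<lambda>j. snd p (Suc j))) \<in> borel_measurable (N \<Otimes>\<^sub>M seqs Q)"
         "(\<lambda>p. wsum (map (\<lambda>i. f (x i (fst p))) is) (\<lambda>j. snd p (Suc j))) \<in> borel_measurable (N \<Otimes>\<^sub>M seqs Q)"
      using measurable_compose[OF sh IH(1)] measurable_compose[OF sh IH(2)] by simp_all
    with h show ?case by simp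
  qed simp
  then show "(\<lambda>p. wmax (map (\<lambda>i. f (x i (fst p))) is) (snd p)) \<in> borel_measurable (N \<Otimes>\<^sub>M seqs Q)"
    and "(\<lambda>p. wsum (map (\<lambda>i. f (x i (fst p))) is) (snd p)) \<in> borel_measurable (N \<Otimes>\<^sub>M seqs Q)" by auto
qed

section \<open>Bounds uniform over all environments\<close>

context modulated_walk
begin

lemma \<zeta>_joint: "(\<lambda>p. \<zeta> (fst p) (snd p)) \<in> borel_measurable (SX \<Otimes>\<^sub>M Q)"
  unfolding \<zeta>_def using g_meas by simp

text \<open>Linear growth in the length supplies the integrable majorant over a random cycle. An
  increment contributes at most \<open>K0\<close> times the tail of \<open>H\<close> at the level
  still to be passed. Reading that tail as the probability that an independent \<open>h\<close> of
  law \<open>H\<close> passes the level, the contribution of increment \<open>j\<close> is at most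
  \<open>K0\<close> times the probability that the earlier increments followed by \<open>h\<close>
  pass \<open>y\<close>; this is of the order of \<open>tail H y\<close>, uniformly in
  \<open>j\<close>.\<close>

lemma excess_\<zeta>_linear:
  obtains K where "0 \<le> K"
    "\<And>xs y. xs \<in> lists (space SX) \<Longrightarrow> 0 \<le> y \<Longrightarrow> Q.excess (map \<zeta> xs) y \<le> K * real (length xs) * tail H y"
proof -
  have [measurable_cong]: "sets H = sets borel" by simp
  have [measurable]: "G1 \<in> borel_measurable Q" using G1_int by auto
  interpret QH: pair_prob_space Q H ..
  have "\<forall>\<^sub>F v in at_top. (\<integral>u. max 0 (G1 u - max v 0) \<partial>Q) \<le> 1 * tail H v"
    using G1_excess eventually_ge_at_top[of 0] by eventually_elim (simp add: max_def)
  moreover have "(\<integral>u. max 0 (G1 u - max v 0) \<partial>Q) \<le> (\<integral>u. max 0 (G1 u - 0) \<partial>Q)" for v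
    using G1_int by (intro integral_mono Q.integrable_max0) auto
  ultimately obtain K0 where K0: "0 \<le> K0" "\<And>v. (\<integral>u. max 0 (G1 u - max v 0) \<partial>Q) \<le> K0 * tail H v"
    by (rule bounded_by_tail) blast
  obtain K where K: "1 \<le> K" "\<And>xs u. xs \<in> lists (space SX) \<Longrightarrow> hit Q (map (\<lambda>x. diag (\<zeta> x)) xs) u \<le> K * tail H u"
    using hit_\<zeta>_bounded by blast
  obtain K3 where K3: "1 \<le> K3" "\<And>y. (\<integral>h. tail H (y - h) \<partial>H) \<le> K3 * tail H y"
    using conv_le by blast
  \<comment> \<open>Extended by 1 below 0, as \<open>h\<close> may exceed \<open>y\<close> on its
    own.\<close>
  define hb where "hb xs v = (if v < 0 then 1 else hit Q (map (\<lambda>x. diag (\<zeta> x)) xs) v)" for xs v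
  have hb01: "0 \<le> hb xs v" "hb xs v \<le> 1" "u \<le> v \<Longrightarrow> hb xs v \<le> hb xs u" if "xs \<in> lists (space SX)" for xs u v
    using Q.hit_nonneg[OF lists_ms[OF that]] Q.hit_le_1[OF lists_ms[OF that]] Q.hit_antimono[OF lists_ms[OF that]]
    by (auto simp: hb_def)
  have mhb: "hb xs \<in> borel_measurable borel" if "xs \<in> lists (space SX)" for xs
    by (rule borel_measurable_antimono) (rule hb01[OF that])
  have hbK: "hb xs v \<le> K * tail H v" if "xs \<in> lists (space SX)" for xs v
    using K(1) K(2)[OF that] tail_neg by (auto simp: hb_def)
  have inthb: "integrable H (\<lambda>h. hb xs (y - h))" if "xs \<in> lists (space SX)" for xs y
  proof (rule integrable_bounded[where B=1])
    have [measurable]: "hb xs \<in> borel_measurable borel" by (rule mhb[OF that])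
    show "(\<lambda>h. hb xs (y - h)) \<in> borel_measurable H" by measurable
  qed (use hb01[OF that] in auto)
  have claim: "Q.excess (map \<zeta> xs) y \<le> K0 * (\<Sum>j<length xs. \<integral>h. hb (take j xs) (y - h) \<partial>H)"
    if "xs \<in> lists (space SX)" "0 \<le> y" for xs y
    using that
  proof (induction xs arbitrary: y rule: list.induct)
    case (Cons x xs)
    have x: "x \<in> space SX" "xs \<in> lists (space SX)" using Cons.prems by auto
    have [measurable]: "\<zeta> x \<in> borel_measurable Q" by (rule \<zeta>_measurable[OF x(1)])
    have i: "f \<in> set (map \<zeta> (x # xs)) \<Longrightarrow> integrable Q f" for f
      using Cons.prems by (auto simp: in_lists_conv_set intro: \<zeta>_int)
    have tk: "take j xs \<in> lists (space SX)" for j using x(2) by (auto simp: in_lists_conv_set dest: in_set_takeD)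
    have step: "(\<integral>u. (\<integral>h. hb (take j xs) (max 0 (y - \<zeta> x u) - h) \<partial>H) \<partial>Q) \<le> (\<integral>h. hb (x # take j xs) (y - h) \<partial>H)"
      and stepi: "integrable Q (\<lambda>u. \<integral>h. hb (take j xs) (max 0 (y - \<zeta> x u) - h) \<partial>H)" for j
    proof -
      have [measurable]: "hb (take j xs) \<in> borel_measurable borel" by (rule mhb[OF tk])
      have xt: "x # take j xs \<in> lists (space SX)" using x tk by auto
      have int: "integrable (Q \<Otimes>\<^sub>M H) (\<lambda>(u, h). hb (take j xs) (max 0 (y - \<zeta> x u) - h))"
        by (rule QH.integrable_bounded[where B=1]) (auto simp: hb01[OF tk])
      show "integrable Q (\<lambda>u. \<integral>h. hb (take j xs) (max 0 (y - \<zeta> x u) - h) \<partial>H)"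
        using QH.integrable_fst'[OF int] by simp
      have "(\<integral>u. (\<integral>h. hb (take j xs) (max 0 (y - \<zeta> x u) - h) \<partial>H) \<partial>Q)
         = (\<integral>h. (\<integral>u. hb (take j xs) (max 0 (y - \<zeta> x u) - h) \<partial>Q) \<partial>H)"
        by (rule QH.Fubini_integral[OF int, symmetric])
      also have "\<dots> \<le> (\<integral>h. hb (x # take j xs) (y - h) \<partial>H)"
      proof (rule integral_mono_AE')
        show "AE h in H. 0 \<le> hb (x # take j xs) (y - h)" using hb01[OF xt] by auto
        show "AE h in H. (\<integral>u. hb (take j xs) (max 0 (y - \<zeta> x u) - h) \<partial>Q) \<le> hb (x # take j xs) (y - h)"
          using AE_nonneg
        proof eventually_elim
          case (elim h)
          show ?case
          proof (cases "y < h")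
            case True
            have "(\<integral>u. hb (take j xs) (max 0 (y - \<zeta> x u) - h) \<partial>Q) \<le> 1"
              by (rule Q.integral_le_bound) (use hb01[OF tk] in auto)
            then show ?thesis using True by (simp add: hb_def)
          next
            case False
            have ms: "\<forall>p\<in>set (diag (\<zeta> x) # map (\<lambda>x. diag (\<zeta> x)) (take j xs)). fst p \<in> borel_measurable Q \<and> snd p \<in> borel_measurable Q"
              using lists_ms[OF xt] by simp
            have "(\<integral>u. hb (take j xs) (max 0 (y - \<zeta> x u) - h) \<partial>Q)
              \<le> (\<integral>u. (if y - h < snd (diag (\<zeta> x)) u then 1 else hit Q (map (\<lambda>x. diag (\<zeta> x)) (take j xs)) (y - h - fst (diag (\<zeta> x)) u)) \<partial>Q)"
            proof (rule integral_mono[OF _ Q.integrable_hit[OF ms]])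
              show "integrable Q (\<lambda>u. hb (take j xs) (max 0 (y - \<zeta> x u) - h))"
                by (rule Q.integrable_bounded[where B=1]) (use hb01[OF tk] in auto)
              fix u
              show "hb (take j xs) (max 0 (y - \<zeta> x u) - h)
                \<le> (if y - h < snd (diag (\<zeta> x)) u then 1 else hit Q (map (\<lambda>x. diag (\<zeta> x)) (take j xs)) (y - h - fst (diag (\<zeta> x)) u))"
              proof (cases "y - h < \<zeta> x u")
                case True
                then show ?thesis using hb01(2)[OF tk] by (simp add: snd_diag)
              next
                case F: False
                \<comment> \<open>Here \<open>y - \<zeta> x u \<ge> h \<ge> 0\<close>, so the cut at
                  0 has no effect.\<close>
                then have "max 0 (y - \<zeta> x u) - h = y - h - \<zeta> x u" using elim by auto
                then show ?thesis using F by (simp only: hb_def snd_diag fst_diag) auto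
              qed
            qed
            then show ?thesis using False by (simp add: hb_def)
          qed
        qed
      qed (rule inthb[OF xt])
      finally show "(\<integral>u. (\<integral>h. hb (take j xs) (max 0 (y - \<zeta> x u) - h) \<partial>H) \<partial>Q) \<le> (\<integral>h. hb (x # take j xs) (y - h) \<partial>H)" .
    qed
    have t0: "(\<integral>h. hb [] (y - h) \<partial>H) = tail H y"
    proof -
      have "(\<lambda>h. hb [] (y - h)) = indicator {y<..}" by (auto simp: hb_def indicator_def)
      then show ?thesis by (simp add: tail_def)
    qed
    have "Q.excess (map \<zeta> (x # xs)) y = (\<integral>u. max 0 (\<zeta> x u - y) \<partial>Q) + (\<integral>u. Q.excess (map \<zeta> xs) (max 0 (y - \<zeta> x u)) \<partial>Q)"
      using i Cons.prems unfolding list.map by (intro Q.excess_Cons(1)) auto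
    also have "(\<integral>u. max 0 (\<zeta> x u - y) \<partial>Q) \<le> (\<integral>u. max 0 (G1 u - max y 0) \<partial>Q)"
      using Cons.prems \<zeta>_le[OF x(1)]
      by (intro integral_mono Q.integrable_max0 \<zeta>_int x G1_int) (fastforce simp: max_def)
    also have "\<dots> \<le> K0 * tail H y" by (rule K0)
    also have "(\<integral>u. Q.excess (map \<zeta> xs) (max 0 (y - \<zeta> x u)) \<partial>Q)
        \<le> (\<integral>u. K0 * (\<Sum>j<length xs. \<integral>h. hb (take j xs) (max 0 (y - \<zeta> x u) - h) \<partial>H) \<partial>Q)"
    proof (rule integral_mono)
      show "integrable Q (\<lambda>u. Q.excess (map \<zeta> xs) (max 0 (y - \<zeta> x u)))"
        using i Cons.prems by (intro Q.excess_Cons(2)) auto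
      show "integrable Q (\<lambda>u. K0 * (\<Sum>j<length xs. \<integral>h. hb (take j xs) (max 0 (y - \<zeta> x u) - h) \<partial>H))"
        using stepi by (intro integrable_mult_right Bochner_Integration.integrable_sum)
    qed (use Cons.IH[OF x(2)] in auto)
    also have "\<dots> = K0 * (\<Sum>j<length xs. \<integral>u. (\<integral>h. hb (take j xs) (max 0 (y - \<zeta> x u) - h) \<partial>H) \<partial>Q)"
      using stepi by (simp add: Bochner_Integration.integral_sum)
    also have "\<dots> \<le> K0 * (\<Sum>j<length xs. \<integral>h. hb (x # take j xs) (y - h) \<partial>H)"
      using K0(1) step by (intro mult_left_mono sum_mono)
    finally have "Q.excess (map \<zeta> (x # xs)) y \<le> K0 * (tail H y + (\<Sum>j<length xs. \<integral>h. hb (x # take j xs) (y - h) \<partial>H))"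
      by (simp add: distrib_left)
    also have "tail H y + (\<Sum>j<length xs. \<integral>h. hb (x # take j xs) (y - h) \<partial>H)
       = (\<Sum>j<length (x # xs). \<integral>h. hb (take j (x # xs)) (y - h) \<partial>H)"
      using sum.lessThan_Suc_shift[of "\<lambda>j. \<integral>h. hb (take j (x # xs)) (y - h) \<partial>H" "length xs"] by (simp add: t0)
    finally show ?case .
  qed simp
  show ?thesis
  proof (rule that[of "K0 * (K * K3)"])
    fix xs y assume xs: "xs \<in> lists (space SX)" and y: "0 \<le> (y::real)"
    have "(\<integral>h. hb (take j xs) (y - h) \<partial>H) \<le> K * K3 * tail H y" for j
    proof -
      have tk: "take j xs \<in> lists (space SX)" using xs by (auto simp: in_lists_conv_set dest: in_set_takeD)
      have "(\<integral>h. hb (take j xs) (y - h) \<partial>H) \<le> (\<integral>h. K * tail H (y - h) \<partial>H)"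
        using inthb[OF tk] hbK[OF tk] integrable_tail_conv' by (intro integral_mono) auto
      also have "\<dots> = K * (\<integral>h. tail H (y - h) \<partial>H)" by simp
      also have "\<dots> \<le> K * (K3 * tail H y)" using K K3 by (intro mult_left_mono) auto
      finally show ?thesis by (simp add: mult.assoc)
    qed
    then have "(\<Sum>j<length xs. \<integral>h. hb (take j xs) (y - h) \<partial>H) \<le> real (length xs) * (K * K3 * tail H y)"
      using sum_bounded_above[of "{..<length xs}" "\<lambda>j. \<integral>h. hb (take j xs) (y - h) \<partial>H" "K * K3 * tail H y"] by simp
    then have "K0 * (\<Sum>j<length xs. \<integral>h. hb (take j xs) (y - h) \<partial>H) \<le> K0 * (real (length xs) * (K * K3 * tail H y))"
      using K0 by (intro mult_left_mono)
    with claim[OF xs y] show "Q.excess (map \<zeta> xs) y \<le> K0 * (K * K3) * real (length xs) * tail H y"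
      by (simp add: mult_ac)
  qed (use K0 K K3 in auto)
qed

text \<open>If \<open>Z\<close> is the maximum of the lowered walk and \<open>n\<close> the number
  of increments, the cost \<open>b * n\<close> is charged only as far as it exceeds both
  \<open>A\<close> and the remaining level \<open>y - Z\<close>; what is below \<open>A\<close> just
  lowers the level for \<open>Z\<close>. In the charged part \<open>Z\<close> is exchanged for an
  \<open>h\<close> of law \<open>H\<close> by \<open>excess_dominated\<close>, so that a random
  length can be averaged for fixed \<open>h\<close>.\<close>

lemma excess_g_le:
  obtains K where "0 \<le> K" "\<And>xs y A. xs \<in> lists (space SX) \<Longrightarrow> 0 \<le> A \<Longrightarrow>
     Q.excess (map g xs) y \<le> Q.excess (map \<zeta> xs) (y - A) + K * (\<integral>h. max 0 (b * real (length xs) - max (y - h) A) \<partial>H)"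
proof -
  interpret S: prob_space "seqs Q" by (rule Q.prob_space_seqs)
  obtain K where K: "1 \<le> K" "\<And>xs u. xs \<in> lists (space SX) \<Longrightarrow> hit Q (map (\<lambda>x. diag (\<zeta> x)) xs) u \<le> K * tail H u"
    using hit_\<zeta>_bounded by blast
  show ?thesis
  proof (rule that[of K])
    fix xs y A assume xs: "xs \<in> lists (space SX)" and A: "0 \<le> (A::real)"
    let ?n = "b * real (length xs)"
    have iz: "integrable (seqs Q) (wmax (map \<zeta> xs))" and ig: "integrable (seqs Q) (wmax (map g xs))"
      using xs by (auto intro!: Q.integrable_wmax simp: in_lists_conv_set \<zeta>_int g_int)
    have mz: "wmax (map \<zeta> xs) \<in> borel_measurable (seqs Q)" using iz by auto
    have i2: "integrable (seqs Q) (\<lambda>v. max 0 (?n - max (y - wmax (map \<zeta> xs) v) A))"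
      using mz A by (intro S.integrable_bounded[where B="\<bar>?n\<bar>"]) auto
    have "Q.excess (map g xs) y \<le> (\<integral>v. max 0 (wmax (map \<zeta> xs) v - (y - A)) + max 0 (?n - max (y - wmax (map \<zeta> xs) v) A) \<partial>seqs Q)"
      unfolding Q.excess_def
    proof (rule integral_mono)
      fix v
      show "max 0 (wmax (map g xs) v - y) \<le> max 0 (wmax (map \<zeta> xs) v - (y - A)) + max 0 (?n - max (y - wmax (map \<zeta> xs) v) A)"
        using wmax_g_le[of xs v] b A by (auto simp: max_def)
    qed (use ig iz i2 in \<open>auto intro!: S.integrable_max0 Bochner_Integration.integrable_add\<close>)
    also have "\<dots> = Q.excess (map \<zeta> xs) (y - A) + (\<integral>v. max 0 (?n - max (y - wmax (map \<zeta> xs) v) A) \<partial>seqs Q)"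
      unfolding Q.excess_def using i2 S.integrable_max0[OF iz] by (intro Bochner_Integration.integral_add)
    also have "(\<integral>v. max 0 (?n - max (y - wmax (map \<zeta> xs) v) A) \<partial>seqs Q) \<le> K * (\<integral>h. max 0 (?n - max (y - h) A) \<partial>H)"
    proof (rule S.excess_dominated[OF real_distribution_axioms mz A])
      fix v
      show "S.prob {\<omega> \<in> space (seqs Q). v < wmax (map \<zeta> xs) \<omega>} \<le> K * tail H v"
      proof (cases "v < 0")
        case True
        have "S.prob {\<omega> \<in> space (seqs Q). v < wmax (map \<zeta> xs) \<omega>} \<le> 1" by (rule S.prob_le_1)
        also have "1 \<le> K * tail H v" using True K by (simp add: tail_neg)
        finally show ?thesis .
      next
        case False
        have "S.prob {\<omega> \<in> space (seqs Q). v < wmax (map \<zeta> xs) \<omega>} = hit Q (map diag (map \<zeta> xs)) v"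
          using False xs by (intro Q.prob_wmax) (auto simp: in_lists_conv_set \<zeta>_measurable)
        also have "\<dots> \<le> K * tail H v" using K(2)[OF xs, of v] by (simp add: comp_def)
        finally show ?thesis .
      qed
    qed (use K in auto)
    finally show "Q.excess (map g xs) y \<le> Q.excess (map \<zeta> xs) (y - A) + K * (\<integral>h. max 0 (?n - max (y - h) A) \<partial>H)" by simp
  qed (use K in auto)
qed

lemma c_le_1: "x \<in> space SX \<Longrightarrow> c x \<le> 1"
proof (rule tendsto_le[OF _ G1_ratio g_excess])
  assume x: "x \<in> space SX"
  have "(\<integral>u. max 0 (g x u - y) \<partial>Q) \<le> (\<integral>u. max 0 (G1 u - y) \<partial>Q)" for y
    using g_le[OF x] G1_int g_int[OF x]
    by (intro integral_mono Q.integrable_max0) (fastforce simp: G1_def max_def)+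
  then show "\<forall>\<^sub>F y in at_top. (\<integral>u. max 0 (g x u - y) \<partial>Q) / tail H y \<le> (\<integral>u. max 0 (G1 u - y) \<partial>Q) / tail H y"
    by (intro always_eventually allI divide_right_mono tail_nonneg)
qed auto

end

section \<open>One cycle\<close>

definition block :: "(nat \<Rightarrow> 'n \<Rightarrow> 'x) \<Rightarrow> ('n \<Rightarrow> nat) \<Rightarrow> 'n \<Rightarrow> 'x list" where
  "block x len \<omega> = map (\<lambda>i. x i \<omega>) [0..<len \<omega>]"

lemma length_block [simp]: "length (block x len \<omega>) = len \<omega>"
  by (simp add: block_def)

lemma block_lists:
  assumes "\<And>i. x i \<in> measurable N SX" "\<omega> \<in> space N"
  shows "block x len \<omega> \<in> lists (space SX)"
  using assms by (auto simp: block_def in_lists_conv_set dest: measurable_space)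

lemma measurable_wmax_block:
  assumes f: "(\<lambda>p. f (fst p) (snd p)) \<in> borel_measurable (SX \<Otimes>\<^sub>M Q)"
    and x: "\<And>i. x i \<in> measurable N SX" and len: "len \<in> measurable N (count_space UNIV)"
  shows "(\<lambda>p. wmax (map f (block x len (fst p))) (snd p)) \<in> borel_measurable (N \<Otimes>\<^sub>M seqs Q)"
    and "(\<lambda>p. wsum (map f (block x len (fst p))) (snd p)) \<in> borel_measurable (N \<Otimes>\<^sub>M seqs Q)"
proof -
  have l: "(\<lambda>p. len (fst p)) \<in> measurable (N \<Otimes>\<^sub>M seqs Q) (count_space UNIV)"
    by (rule measurable_compose[OF measurable_fst len])
  have "(\<lambda>p. wmax (map (\<lambda>i. f (x i (fst p))) [0..<len (fst p)]) (snd p)) \<in> borel_measurable (N \<Otimes>\<^sub>M seqs Q)"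
    by (rule measurable_compose_countable[OF measurable_wmax_param(1)[OF f x] l])
  then show "(\<lambda>p. wmax (map f (block x len (fst p))) (snd p)) \<in> borel_measurable (N \<Otimes>\<^sub>M seqs Q)"
    by (simp add: block_def comp_def)
  have "(\<lambda>p. wsum (map (\<lambda>i. f (x i (fst p))) [0..<len (fst p)]) (snd p)) \<in> borel_measurable (N \<Otimes>\<^sub>M seqs Q)"
    by (rule measurable_compose_countable[OF measurable_wmax_param(2)[OF f x] l])
  then show "(\<lambda>p. wsum (map f (block x len (fst p))) (snd p)) \<in> borel_measurable (N \<Otimes>\<^sub>M seqs Q)"
    by (simp add: block_def comp_def)
qed

lemma measurable_sum_block:
  assumes f: "f \<in> borel_measurable SX"
    and x: "\<And>i. x i \<in> measurable N SX" and len: "len \<in> measurable N (count_space UNIV)"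
  shows "(\<lambda>\<omega>. \<Sum>z\<leftarrow>block x len \<omega>. f z :: real) \<in> borel_measurable N"
proof -
  have "(\<lambda>\<omega>. \<Sum>i<n. f (x i \<omega>)) \<in> borel_measurable N" for n
    by (intro borel_measurable_sum measurable_compose[OF x f])
  from measurable_compose_countable[OF this len]
  show ?thesis by (simp add: block_def comp_def sum_list_sum_nth atLeast0LessThan)
qed

section \<open>Averages over a random cycle\<close>

context modulated_walk
begin

lemma sum_c_bounds:
  assumes "xs \<in> lists (space SX)"
  shows "0 \<le> (\<Sum>x\<leftarrow>xs. c x)" "(\<Sum>x\<leftarrow>xs. c x) \<le> real (length xs)"
proof -
  show "0 \<le> (\<Sum>x\<leftarrow>xs. c x)"
    using assms by (intro sum_list_nonneg) (auto simp: in_lists_conv_set c_nonneg)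
  have "(\<Sum>x\<leftarrow>xs. c x) \<le> (\<Sum>x\<leftarrow>xs. 1)"
    using assms by (intro sum_list_mono) (auto simp: in_lists_conv_set c_le_1)
  then show "(\<Sum>x\<leftarrow>xs. c x) \<le> real (length xs)" by (simp add: sum_list_triv)
qed

context
  fixes N :: "'n measure" and len :: "'n \<Rightarrow> nat" and x :: "nat \<Rightarrow> 'n \<Rightarrow> 'x"
  assumes N: "prob_space N" and len: "len \<in> measurable N (count_space UNIV)"
    and x: "\<And>i. x i \<in> measurable N SX"
begin

lemma measurable_excess_block:
  assumes f: "(\<lambda>p. f (fst p) (snd p)) \<in> borel_measurable (SX \<Otimes>\<^sub>M Q)"
  shows "(\<lambda>\<omega>. Q.excess (map f (block x len \<omega>)) y) \<in> borel_measurable N"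
proof -
  interpret S: prob_space "seqs Q" by (rule Q.prob_space_seqs)
  have "(\<lambda>p. max 0 (wmax (map f (block x len (fst p))) (snd p) - y)) \<in> borel_measurable (N \<Otimes>\<^sub>M seqs Q)"
    using measurable_wmax_block(1)[OF f x len] by simp
  then show ?thesis
    unfolding Q.excess_def by (intro S.borel_measurable_lebesgue_integral) (simp add: case_prod_beta')
qed

lemma measurable_hit_block:
  assumes f: "(\<lambda>p. f (fst p) (snd p)) \<in> borel_measurable (SX \<Otimes>\<^sub>M Q)"
    and fx: "\<And>x. x \<in> space SX \<Longrightarrow> f x \<in> borel_measurable Q" and y: "0 \<le> y"
  shows "(\<lambda>\<omega>. hit Q (map (\<lambda>x. diag (f x)) (block x len \<omega>)) y) \<in> borel_measurable N"
proof -
  interpret S: prob_space "seqs Q" by (rule Q.prob_space_seqs)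
  have "(\<lambda>p. if y < wmax (map f (block x len (fst p))) (snd p) then 1 else 0 :: real) \<in> borel_measurable (N \<Otimes>\<^sub>M seqs Q)"
    using measurable_wmax_block(1)[OF f x len] by measurable
  then have "(\<lambda>\<omega>. \<integral>v. (if y < wmax (map f (block x len \<omega>)) v then 1 else 0 :: real) \<partial>seqs Q) \<in> borel_measurable N"
    by (intro S.borel_measurable_lebesgue_integral) (simp add: case_prod_beta')
  also have "?this \<longleftrightarrow> ?thesis"
  proof (rule measurable_cong)
    fix \<omega> assume \<omega>: "\<omega> \<in> space N"
    have m: "h \<in> borel_measurable Q" if "h \<in> set (map f (block x len \<omega>))" for h
      using that block_lists[of x, OF x \<omega>, of len] fx by (auto simp: in_lists_conv_set)
    have "(\<integral>v. (if y < wmax (map f (block x len \<omega>)) v then 1 else 0 :: real) \<partial>seqs Q)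
      = measure (seqs Q) {v \<in> space (seqs Q). y < wmax (map f (block x len \<omega>)) v}"
      by (rule S.prob_gt_eq_integral(2)) (rule measurable_wmax[OF m])
    also have "\<dots> = hit Q (map diag (map f (block x len \<omega>))) y"
      by (rule Q.prob_wmax[OF m y])
    finally show "(\<integral>v. (if y < wmax (map f (block x len \<omega>)) v then 1 else 0 :: real) \<partial>seqs Q)
       = hit Q (map (\<lambda>x. diag (f x)) (block x len \<omega>)) y" by (simp add: comp_def)
  qed
  finally show ?thesis .
qed

lemma integrable_excess_block:
  assumes len_int: "integrable N (\<lambda>\<omega>. real (len \<omega>))"
  shows "0 \<le> y \<Longrightarrow> integrable N (\<lambda>\<omega>. Q.excess (map \<zeta> (block x len \<omega>)) y)"
    and "0 \<le> y \<Longrightarrow> integrable N (\<lambda>\<omega>. Q.excess (map g (block x len \<omega>)) y)"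
proof -
  interpret N: prob_space N by (rule N)
  obtain K2 where K2: "0 \<le> K2"
    "\<And>xs y. xs \<in> lists (space SX) \<Longrightarrow> 0 \<le> y \<Longrightarrow> Q.excess (map \<zeta> xs) y \<le> K2 * real (length xs) * tail H y"
    using excess_\<zeta>_linear by blast
  obtain K where K: "0 \<le> K" "\<And>xs y A. xs \<in> lists (space SX) \<Longrightarrow> 0 \<le> A \<Longrightarrow>
     Q.excess (map g xs) y \<le> Q.excess (map \<zeta> xs) (y - A) + K * (\<integral>h. max 0 (b * real (length xs) - max (y - h) A) \<partial>H)"
    using excess_g_le by blast
  have z: "Q.excess (map \<zeta> (block x len \<omega>)) y \<le> K2 * real (len \<omega>)" if "\<omega> \<in> space N" "0 \<le> y" for \<omega> y
  proof -
    have "K2 * real (len \<omega>) * tail H y \<le> K2 * real (len \<omega>) * 1"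
      using K2(1) tail_le_1 by (intro mult_left_mono) auto
    with K2(2)[OF block_lists[of x, OF x that(1), of len] that(2)] show ?thesis by simp
  qed
  show "integrable N (\<lambda>\<omega>. Q.excess (map \<zeta> (block x len \<omega>)) y)" if "0 \<le> y"
  proof (rule Bochner_Integration.integrable_bound)
    show "integrable N (\<lambda>\<omega>. K2 * real (len \<omega>))" using len_int by simp
    show "AE \<omega> in N. norm (Q.excess (map \<zeta> (block x len \<omega>)) y) \<le> norm (K2 * real (len \<omega>))"
      using z that K2 Q.excess_nonneg by (intro AE_I2) (auto simp: abs_mult)
  qed (rule measurable_excess_block[OF \<zeta>_joint])
  show "integrable N (\<lambda>\<omega>. Q.excess (map g (block x len \<omega>)) y)" if y: "0 \<le> y"
  proof (rule Bochner_Integration.integrable_bound)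
    show "integrable N (\<lambda>\<omega>. K2 * real (len \<omega>) + K * (b * real (len \<omega>)))" using len_int by simp
    have "Q.excess (map g (block x len \<omega>)) y \<le> K2 * real (len \<omega>) + K * (b * real (len \<omega>))" if \<omega>: "\<omega> \<in> space N" for \<omega>
    proof -
      have "(\<integral>h. max 0 (b * real (len \<omega>) - max (y - h) 0) \<partial>H) \<le> b * real (len \<omega>)"
        using b by (intro integral_le_bound) auto
      then have "K * (\<integral>h. max 0 (b * real (len \<omega>) - max (y - h) 0) \<partial>H) \<le> K * (b * real (len \<omega>))"
        using K by (intro mult_left_mono)
      with K(2)[OF block_lists[of x, OF x \<omega>, of len], of 0 y] z[OF \<omega> y] show ?thesis by simp
    qed
    then show "AE \<omega> in N. norm (Q.excess (map g (block x len \<omega>)) y) \<le> norm (K2 * real (len \<omega>) + K * (b * real (len \<omega>)))"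
      using Q.excess_nonneg K K2 b by (intro AE_I2) (auto simp: abs_of_nonneg)
  qed (rule measurable_excess_block[OF g_meas])
qed

text \<open>The limits in a fixed environment are averaged by dominated convergence: for the upper
  bound on \<zeta> the majorant comes from \<open>excess_\<zeta>_linear\<close>. The passage from
  \<zeta> to \<open>g\<close> costs a mean excess of \<open>b * len\<close>, which
  \<open>len_excess\<close> makes negligible even after convolution with \<open>H\<close>.\<close>

theorem mean_excess_asymptotics:
  assumes len_int: "integrable N (\<lambda>\<omega>. real (len \<omega>))"
    and c_meas: "c \<in> borel_measurable SX"
    and len_excess: "\<And>\<epsilon>. 0 < \<epsilon> \<Longrightarrow> \<forall>\<^sub>F v in at_top. (\<integral>\<omega>. max 0 (b * real (len \<omega>) - v) \<partial>N) \<le> \<epsilon> * tail H v"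
  shows "((\<lambda>y. (\<integral>\<omega>. Q.excess (map g (block x len \<omega>)) y \<partial>N) / tail H y)
     \<longlongrightarrow> (\<integral>\<omega>. (\<Sum>z\<leftarrow>block x len \<omega>. c z) \<partial>N)) at_top"
proof -
  interpret N: prob_space N by (rule N)
  interpret HN: pair_prob_space H N ..
  have [measurable_cong]: "sets H = sets borel" by simp
  have [measurable]: "len \<in> measurable N (count_space UNIV)" by (rule len)
  let ?bl = "block x len"
  define e\<zeta> where "e\<zeta> y \<omega> = Q.excess (map \<zeta> (?bl \<omega>)) y" for y \<omega>
  define eg where "eg y \<omega> = Q.excess (map g (?bl \<omega>)) y" for y \<omega>
  define sc where "sc \<omega> = (\<Sum>z\<leftarrow>?bl \<omega>. c z)" for \<omega>
  have [measurable]: "e\<zeta> y \<in> borel_measurable N" "eg y \<in> borel_measurable N" "sc \<in> borel_measurable N" for y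
    unfolding e\<zeta>_def eg_def sc_def
    using measurable_excess_block[OF \<zeta>_joint] measurable_excess_block[OF g_meas] measurable_sum_block[OF c_meas x len] by auto
  note bl = block_lists[of x N SX, OF x]
  have sc01: "0 \<le> sc \<omega>" "sc \<omega> \<le> real (len \<omega>)" if "\<omega> \<in> space N" for \<omega>
    using sum_c_bounds[OF bl[OF that, of len]] by (auto simp: sc_def)
  have sc_int: "integrable N sc"
    by (rule Bochner_Integration.integrable_bound[OF len_int]) (use sc01 in auto)
  define C where "C = (\<integral>\<omega>. sc \<omega> \<partial>N)"
  have C0: "0 \<le> C" unfolding C_def using sc01 by (intro Bochner_Integration.integral_nonneg) auto
  obtain K2 where K2: "0 \<le> K2"
    "\<And>xs y. xs \<in> lists (space SX) \<Longrightarrow> 0 \<le> y \<Longrightarrow> Q.excess (map \<zeta> xs) y \<le> K2 * real (length xs) * tail H y"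
    using excess_\<zeta>_linear by blast
  obtain K where K: "0 \<le> K" "\<And>xs y A. xs \<in> lists (space SX) \<Longrightarrow> 0 \<le> A \<Longrightarrow>
     Q.excess (map g xs) y \<le> Q.excess (map \<zeta> xs) (y - A) + K * (\<integral>h. max 0 (b * real (length xs) - max (y - h) A) \<partial>H)"
    using excess_g_le by blast
  obtain K3 where K3: "1 \<le> K3" "\<And>y. (\<integral>h. tail H (y - h) \<partial>H) \<le> K3 * tail H y"
    using conv_le by blast
  have upper\<zeta>: "\<forall>\<^sub>F y in at_top. (\<integral>\<omega>. e\<zeta> y \<omega> \<partial>N) < L * tail H y" if L: "C < L" for L
  proof -
    \<comment> \<open>Pathwise only an upper bound on the limit superior is known; the maximum with
      that bound does converge.\<close>
    have "((\<lambda>y. \<integral>\<omega>. max (e\<zeta> y \<omega> / tail H y) (sc \<omega>) \<partial>N) \<longlongrightarrow> (\<integral>\<omega>. sc \<omega> \<partial>N)) at_top"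
    proof (rule integral_dominated_convergence_at_top[where w="\<lambda>\<omega>. (K2 + 1) * real (len \<omega>)"])
      show "AE \<omega> in N. ((\<lambda>y. max (e\<zeta> y \<omega> / tail H y) (sc \<omega>)) \<longlongrightarrow> sc \<omega>) at_top"
      proof (rule AE_I2)
        fix \<omega> assume \<omega>: "\<omega> \<in> space N"
        show "((\<lambda>y. max (e\<zeta> y \<omega> / tail H y) (sc \<omega>)) \<longlongrightarrow> sc \<omega>) at_top"
        proof (rule order_tendstoI)
          fix a assume a: "sc \<omega> < a"
          then obtain a' where a': "sc \<omega> < a'" "a' < a" using dense by blast
          from excess_\<zeta>_limsup[OF bl[OF \<omega>] a'(1)[unfolded sc_def]]
          show "\<forall>\<^sub>F y in at_top. max (e\<zeta> y \<omega> / tail H y) (sc \<omega>) < a"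
          proof eventually_elim
            case (elim y)
            then have "e\<zeta> y \<omega> / tail H y \<le> a'" by (simp add: e\<zeta>_def pos_divide_le_eq tail_pos)
            with a a' show ?case by simp
          qed
        qed (auto simp: less_max_iff_disj)
      qed
      show "\<forall>\<^sub>F y in at_top. AE \<omega> in N. norm (max (e\<zeta> y \<omega> / tail H y) (sc \<omega>)) \<le> (K2 + 1) * real (len \<omega>)"
        using eventually_ge_at_top[of 0]
      proof (eventually_elim, intro AE_I2)
        fix y \<omega> assume y: "0 \<le> (y::real)" and \<omega>: "\<omega> \<in> space N"
        have "e\<zeta> y \<omega> / tail H y \<le> K2 * real (len \<omega>)"
          using K2(2)[OF bl[OF \<omega>, of len] y] by (simp add: e\<zeta>_def pos_divide_le_eq tail_pos)
        moreover have "0 \<le> K2 * real (len \<omega>)" using K2(1) by simp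
        moreover have "(K2 + 1) * real (len \<omega>) = K2 * real (len \<omega>) + real (len \<omega>)" by (simp add: algebra_simps)
        ultimately have "max (e\<zeta> y \<omega> / tail H y) (sc \<omega>) \<le> (K2 + 1) * real (len \<omega>)"
          using sc01[OF \<omega>] by (auto intro: max.boundedI)
        then show "norm (max (e\<zeta> y \<omega> / tail H y) (sc \<omega>)) \<le> (K2 + 1) * real (len \<omega>)"
          using sc01(1)[OF \<omega>] by (simp add: abs_of_nonneg max.coboundedI2)
      qed
    qed (use len_int in auto)
    then have "\<forall>\<^sub>F y in at_top. (\<integral>\<omega>. max (e\<zeta> y \<omega> / tail H y) (sc \<omega>) \<partial>N) < L"
      by (rule order_tendstoD) (use L in \<open>simp add: C_def\<close>)
    then show ?thesis using eventually_ge_at_top[of 0]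
    proof eventually_elim
      case (elim y)
      have ie: "integrable N (\<lambda>\<omega>. e\<zeta> y \<omega> / tail H y)"
        using integrable_excess_block(1)[OF len_int elim(2)] by (simp add: e\<zeta>_def)
      have "(\<integral>\<omega>. e\<zeta> y \<omega> \<partial>N) / tail H y = (\<integral>\<omega>. e\<zeta> y \<omega> / tail H y \<partial>N)" by simp
      also have "\<dots> \<le> (\<integral>\<omega>. max (e\<zeta> y \<omega> / tail H y) (sc \<omega>) \<partial>N)"
        using ie sc_int by (intro integral_mono integrable_max) auto
      finally have "(\<integral>\<omega>. e\<zeta> y \<omega> \<partial>N) / tail H y \<le> (\<integral>\<omega>. max (e\<zeta> y \<omega> / tail H y) (sc \<omega>) \<partial>N)" .
      from le_less_trans[OF this elim(1)] show ?case by (simp add: pos_divide_less_eq tail_pos)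
    qed
  qed
  have upper: "\<forall>\<^sub>F y in at_top. (\<integral>\<omega>. eg y \<omega> \<partial>N) < L * tail H y" if L: "C < L" for L
  proof -
    define t where "t = (L - C) / 4"
    have t: "0 < t" "L = C + 4 * t" using L by (auto simp: t_def field_simps)
    define \<epsilon> where "\<epsilon> = t / ((K + 1) * K3)"
    have KK: "0 < (K + 1) * K3" using K K3 by (intro mult_pos_pos) auto
    have \<epsilon>: "0 < \<epsilon>" using t KK by (simp add: \<epsilon>_def)
    have \<epsilon>2: "K * (\<epsilon> * K3) \<le> t"
    proof -
      have "K * (\<epsilon> * K3) \<le> (K + 1) * (\<epsilon> * K3)" using \<epsilon> K3 by (intro mult_right_mono) auto
      also have "\<dots> = t"
      proof -
        have "K + 1 \<noteq> 0" "K3 \<noteq> 0" using K(1) K3(1) by auto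
        then show ?thesis by (simp add: \<epsilon>_def)
      qed
      finally show ?thesis .
    qed
    define \<epsilon>' where "\<epsilon>' = t / (C + t)"
    have \<epsilon>': "0 < \<epsilon>'" "(C + t) * (1 + \<epsilon>') = C + 2 * t" using t C0 by (auto simp: \<epsilon>'_def field_simps)
    obtain A0 where A0: "\<And>v. A0 \<le> v \<Longrightarrow> (\<integral>\<omega>. max 0 (b * real (len \<omega>) - v) \<partial>N) \<le> \<epsilon> * tail H v"
      using len_excess[OF \<epsilon>] by (auto simp: eventually_at_top_linorder)
    define A where "A = max 0 A0"
    have "filterlim (\<lambda>y. y - A) at_top at_top" by real_asymp
    from eventually_compose_filterlim[OF upper\<zeta>[of "C + t"] this] t
    have "\<forall>\<^sub>F y in at_top. (\<integral>\<omega>. e\<zeta> (y - A) \<omega> \<partial>N) < (C + t) * tail H (y - A)" by simp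
    then show ?thesis using long_tailed[OF \<epsilon>'(1), of A] eventually_ge_at_top[of A]
    proof eventually_elim
      case (elim y)
      define r where "r h \<omega> = max 0 (b * real (len \<omega>) - max (y - h) A)" for h \<omega>
      have rb: "0 \<le> r h \<omega>" "r h \<omega> \<le> b * real (len \<omega>)" for h \<omega>
        using b by (auto simp: r_def A_def)
      have [measurable]: "(\<lambda>(h, \<omega>). r h \<omega>) \<in> borel_measurable (H \<Otimes>\<^sub>M N)"
        unfolding r_def by measurable
      have int: "integrable (H \<Otimes>\<^sub>M N) (\<lambda>(h, \<omega>). r h \<omega>)"
      proof (rule Bochner_Integration.integrable_bound)
        show "integrable (H \<Otimes>\<^sub>M N) (\<lambda>p. b * real (len (snd p)))"
          using len_int by (intro HN.integrable_pair_snd) simp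
        show "AE p in H \<Otimes>\<^sub>M N. norm (case p of (h, \<omega>) \<Rightarrow> r h \<omega>) \<le> norm (b * real (len (snd p)))"
        proof (rule AE_I2)
          fix p
          show "norm (case p of (h, \<omega>) \<Rightarrow> r h \<omega>) \<le> norm (b * real (len (snd p)))"
            using rb[of "fst p" "snd p"] b by (simp add: case_prod_beta abs_of_nonneg)
        qed
      qed measurable
      have ir: "integrable N (\<lambda>\<omega>. \<integral>h. r h \<omega> \<partial>H)"
        using HN.integrable_snd[OF int] by simp
      have ie: "integrable N (e\<zeta> (y - A))"
        using integrable_excess_block(1)[OF len_int, of "y - A"] elim(3) by (simp add: e\<zeta>_def[abs_def])
      have "0 \<le> y" using elim(3) by (simp add: A_def)
      then have ig: "integrable N (eg y)"
        using integrable_excess_block(2)[OF len_int] by (simp add: eg_def[abs_def])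
      have "(\<integral>\<omega>. eg y \<omega> \<partial>N) \<le> (\<integral>\<omega>. e\<zeta> (y - A) \<omega> + K * (\<integral>h. r h \<omega> \<partial>H) \<partial>N)"
      proof (rule integral_mono[OF ig])
        show "integrable N (\<lambda>\<omega>. e\<zeta> (y - A) \<omega> + K * (\<integral>h. r h \<omega> \<partial>H))" using ir ie by simp
        show "eg y \<omega> \<le> e\<zeta> (y - A) \<omega> + K * (\<integral>h. r h \<omega> \<partial>H)" if "\<omega> \<in> space N" for \<omega>
          using K(2)[OF bl[OF that, of len], of A y] by (simp add: eg_def e\<zeta>_def r_def A_def)
      qed
      also have "\<dots> = (\<integral>\<omega>. e\<zeta> (y - A) \<omega> \<partial>N) + K * (\<integral>\<omega>. (\<integral>h. r h \<omega> \<partial>H) \<partial>N)"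
        using ir ie by simp
      also have "(\<integral>\<omega>. (\<integral>h. r h \<omega> \<partial>H) \<partial>N) = (\<integral>h. (\<integral>\<omega>. r h \<omega> \<partial>N) \<partial>H)"
        by (rule HN.Fubini_integral[OF int])
      also have "\<dots> \<le> (\<integral>h. \<epsilon> * tail H (y - h) \<partial>H)"
      proof (rule integral_mono)
        show "integrable H (\<lambda>h. \<integral>\<omega>. r h \<omega> \<partial>N)" using HN.integrable_fst[OF int] by simp
        show "integrable H (\<lambda>h. \<epsilon> * tail H (y - h))" using integrable_tail_conv' by simp
        fix h
        \<comment> \<open>For fixed \<open>h\<close> this is the mean excess of
          \<open>b * len\<close> over a level that is at least \<open>A0\<close> for every
          \<open>h\<close>: the purpose of the cut at \<open>A\<close>.\<close>
        have "(\<integral>\<omega>. r h \<omega> \<partial>N) \<le> \<epsilon> * tail H (max (y - h) A)"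
          unfolding r_def by (rule A0) (simp add: A_def)
        also have "\<dots> \<le> \<epsilon> * tail H (y - h)" using \<epsilon> by (intro mult_left_mono tail_antimono) auto
        finally show "(\<integral>\<omega>. r h \<omega> \<partial>N) \<le> \<epsilon> * tail H (y - h)" .
      qed
      also have "\<dots> \<le> \<epsilon> * (K3 * tail H y)" using \<epsilon> K3(2)[of y] by simp
      finally have "(\<integral>\<omega>. eg y \<omega> \<partial>N) \<le> (C + t) * tail H (y - A) + K * (\<epsilon> * (K3 * tail H y))"
        using elim(1) K by (simp add: mult_left_mono)
      also have "\<dots> \<le> (C + t) * ((1 + \<epsilon>') * tail H y) + t * tail H y"
      proof (rule add_mono)
        show "(C + t) * tail H (y - A) \<le> (C + t) * ((1 + \<epsilon>') * tail H y)"
          using elim(2) C0 t by (intro mult_left_mono) auto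
        have "K * (\<epsilon> * K3) * tail H y \<le> t * tail H y" by (intro mult_right_mono \<epsilon>2 tail_nonneg)
        then show "K * (\<epsilon> * (K3 * tail H y)) \<le> t * tail H y" by (simp add: mult_ac)
      qed
      also have "\<dots> = ((C + t) * (1 + \<epsilon>') + t) * tail H y" by (simp add: algebra_simps)
      also have "\<dots> < L * tail H y" unfolding \<epsilon>'(2) using t by (intro mult_strict_right_mono tail_pos) auto
      finally show ?case .
    qed
  qed
  have lower: "\<forall>\<^sub>F y in at_top. L * tail H y < (\<integral>\<omega>. eg y \<omega> \<partial>N)" if L: "L < C" for L
  proof -
    \<comment> \<open>The minimum turns the one-sided limit into a limit and is dominated by the
      length of the cycle.\<close>
    have "((\<lambda>y. \<integral>\<omega>. min (eg y \<omega> / tail H y) (sc \<omega>) \<partial>N) \<longlongrightarrow> (\<integral>\<omega>. sc \<omega> \<partial>N)) at_top"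
    proof (rule integral_dominated_convergence_at_top[where w="\<lambda>\<omega>. real (len \<omega>)"])
      show "AE \<omega> in N. ((\<lambda>y. min (eg y \<omega> / tail H y) (sc \<omega>)) \<longlongrightarrow> sc \<omega>) at_top"
      proof (rule AE_I2)
        fix \<omega> assume \<omega>: "\<omega> \<in> space N"
        show "((\<lambda>y. min (eg y \<omega> / tail H y) (sc \<omega>)) \<longlongrightarrow> sc \<omega>) at_top"
        proof (rule order_tendstoI)
          fix a assume a: "a < sc \<omega>"
          then obtain a' where a': "a' < sc \<omega>" "a < a'" using dense by blast
          from excess_g_liminf[OF bl[OF \<omega>] a'(1)[unfolded sc_def]]
          show "\<forall>\<^sub>F y in at_top. a < min (eg y \<omega> / tail H y) (sc \<omega>)"
          proof eventually_elim
            case (elim y)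
            then have "a' \<le> eg y \<omega> / tail H y" by (simp add: eg_def pos_le_divide_eq tail_pos)
            with a a' show ?case by simp
          qed
        qed (auto simp: min_less_iff_disj)
      qed
      show "\<forall>\<^sub>F y in at_top. AE \<omega> in N. norm (min (eg y \<omega> / tail H y) (sc \<omega>)) \<le> real (len \<omega>)"
      proof (rule always_eventually, rule allI, rule AE_I2)
        fix y \<omega> assume \<omega>: "\<omega> \<in> space N"
        have "0 \<le> eg y \<omega> / tail H y" by (simp add: eg_def Q.excess_nonneg tail_nonneg)
        then show "norm (min (eg y \<omega> / tail H y) (sc \<omega>)) \<le> real (len \<omega>)"
          using sc01[OF \<omega>] by (auto simp: min_def abs_of_nonneg)
      qed
    qed (use len_int in auto)
    then have "\<forall>\<^sub>F y in at_top. L < (\<integral>\<omega>. min (eg y \<omega> / tail H y) (sc \<omega>) \<partial>N)"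
      by (rule order_tendstoD) (use L in \<open>simp add: C_def\<close>)
    then show ?thesis using eventually_ge_at_top[of 0]
    proof eventually_elim
      case (elim y)
      have ie: "integrable N (\<lambda>\<omega>. eg y \<omega> / tail H y)"
        using integrable_excess_block(2)[OF len_int elim(2)] by (simp add: eg_def)
      have "(\<integral>\<omega>. min (eg y \<omega> / tail H y) (sc \<omega>) \<partial>N) \<le> (\<integral>\<omega>. eg y \<omega> / tail H y \<partial>N)"
        using ie sc_int by (intro integral_mono integrable_min) auto
      also have "\<dots> = (\<integral>\<omega>. eg y \<omega> \<partial>N) / tail H y" by simp
      finally have "(\<integral>\<omega>. min (eg y \<omega> / tail H y) (sc \<omega>) \<partial>N) \<le> (\<integral>\<omega>. eg y \<omega> \<partial>N) / tail H y" .
      from less_le_trans[OF elim(1) this] show ?case by (simp add: pos_less_divide_eq tail_pos)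
    qed
  qed
  show ?thesis
    unfolding eg_def[symmetric] sc_def[symmetric] C_def[symmetric]
  proof (rule order_tendstoI)
    fix L assume "L < C"
    from lower[OF this] show "\<forall>\<^sub>F y in at_top. L < (\<integral>\<omega>. eg y \<omega> \<partial>N) / tail H y"
      by eventually_elim (simp add: pos_less_divide_eq tail_pos)
  next
    fix L assume "C < L"
    from upper[OF this] show "\<forall>\<^sub>F y in at_top. (\<integral>\<omega>. eg y \<omega> \<partial>N) / tail H y < L"
      by eventually_elim (simp add: pos_divide_less_eq tail_pos)
  qed
qed

text \<open>For the initial cycle, which occurs once, the tail of the maximum matters rather than
  its mean excess. Accordingly the tail of \<open>b * len\<close>, not its mean excess, is compared
  with the tail of \<open>H\<close>.\<close>

theorem block_tail_small:
  assumes len_tail: "\<And>\<epsilon>. 0 < \<epsilon> \<Longrightarrow> \<forall>\<^sub>F v in at_top. measure N {\<omega> \<in> space N. v < b * real (len \<omega>)} \<le> \<epsilon> * tail H v"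
    and \<epsilon>: "0 < \<epsilon>"
  shows "\<forall>\<^sub>F y in at_top. (\<integral>\<omega>. hit Q (map (\<lambda>x. diag (g x)) (block x len \<omega>)) y \<partial>N) \<le> \<epsilon> * tail H y"
proof -
  interpret N: prob_space N by (rule N)
  have [measurable]: "len \<in> measurable N (count_space UNIV)" by (rule len)
  let ?bl = "block x len"
  define hz where "hz y \<omega> = hit Q (map (\<lambda>x. diag (\<zeta> x)) (?bl \<omega>)) y" for y \<omega>
  define hg where "hg y \<omega> = hit Q (map (\<lambda>x. diag (g x)) (?bl \<omega>)) y" for y \<omega>
  have mz[measurable]: "hz y \<in> borel_measurable N" and mg[measurable]: "hg y \<in> borel_measurable N" if "0 \<le> y" for y
    unfolding hz_def hg_def using measurable_hit_block[OF \<zeta>_joint \<zeta>_measurable that] measurable_hit_block[OF g_meas g_measurable that]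
    by auto
  note bl = block_lists[of x N SX, OF x]
  have ms: "\<forall>p\<in>set (map (\<lambda>x. diag (g x)) (?bl \<omega>)). fst p \<in> borel_measurable Q \<and> snd p \<in> borel_measurable Q" if "\<omega> \<in> space N" for \<omega>
    using bl[OF that, of len] g_measurable by (auto simp: fst_diag snd_diag)
  have g01: "0 \<le> hg y \<omega>" "hg y \<omega> \<le> 1" and z01: "0 \<le> hz y \<omega>" "hz y \<omega> \<le> 1"
    and z_anti: "\<And>u. u \<le> y \<Longrightarrow> hz y \<omega> \<le> hz u \<omega>" if "\<omega> \<in> space N" for y \<omega>
    unfolding hg_def hz_def
    using Q.hit_nonneg[OF ms[OF that]] Q.hit_le_1[OF ms[OF that]] Q.hit_nonneg[OF lists_ms[OF bl[OF that]]]
      Q.hit_le_1[OF lists_ms[OF bl[OF that]]] Q.hit_antimono[OF lists_ms[OF bl[OF that]]] by auto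
  obtain K where K: "1 \<le> K" "\<And>xs u. xs \<in> lists (space SX) \<Longrightarrow> hit Q (map (\<lambda>x. diag (\<zeta> x)) xs) u \<le> K * tail H u"
    using hit_\<zeta>_bounded by blast
  obtain K3 where K3: "1 \<le> K3" "\<And>y. (\<integral>h. tail H (y - h) \<partial>H) \<le> K3 * tail H y"
    using conv_le by blast
  have hz_small: "\<forall>\<^sub>F y in at_top. (\<integral>\<omega>. hz (max y 0) \<omega> \<partial>N) \<le> \<epsilon> * tail H y" if \<epsilon>: "0 < \<epsilon>" for \<epsilon>
  proof -
    have "((\<lambda>y. \<integral>\<omega>. hz (max y 0) \<omega> / tail H y \<partial>N) \<longlongrightarrow> (\<integral>\<omega>. 0 \<partial>N)) at_top"
    proof (rule integral_dominated_convergence_at_top[where w="\<lambda>\<omega>. K"])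
      show "AE \<omega> in N. ((\<lambda>y. hz (max y 0) \<omega> / tail H y) \<longlongrightarrow> 0) at_top"
      proof (rule AE_I2)
        fix \<omega> assume \<omega>: "\<omega> \<in> space N"
        show "((\<lambda>y. hz (max y 0) \<omega> / tail H y) \<longlongrightarrow> 0) at_top"
        proof (rule order_tendstoI)
          fix a :: real assume a: "0 < a"
          have "\<forall>\<^sub>F y in at_top. hit Q (map (\<lambda>x. diag (\<zeta> x)) (?bl \<omega>)) y \<le> a / 2 * tail H y"
            by (rule hit_\<zeta>_small[OF bl[OF \<omega>]]) (use a in simp)
          then show "\<forall>\<^sub>F y in at_top. hz (max y 0) \<omega> / tail H y < a"
            using eventually_ge_at_top[of 0]
          proof (eventually_elim, goal_cases)
            case (1 y)
            then have "hz (max y 0) \<omega> \<le> a / 2 * tail H y" by (simp add: hz_def max_def)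
            also have "\<dots> < a * tail H y" using a by (intro mult_strict_right_mono tail_pos) auto
            finally show ?case by (simp add: pos_divide_less_eq tail_pos)
          qed
        next
          fix a :: real assume a: "a < 0"
          have "a < hz (max y 0) \<omega> / tail H y" for y
            by (rule less_le_trans[OF a]) (simp add: z01[OF \<omega>] tail_nonneg)
          then show "\<forall>\<^sub>F y in at_top. a < hz (max y 0) \<omega> / tail H y" by simp
        qed
      qed
      show "\<forall>\<^sub>F y in at_top. AE \<omega> in N. norm (hz (max y 0) \<omega> / tail H y) \<le> K"
        using eventually_ge_at_top[of 0]
      proof (eventually_elim, intro AE_I2)
        fix y \<omega> assume "0 \<le> (y::real)" "\<omega> \<in> space N"
        then show "norm (hz (max y 0) \<omega> / tail H y) \<le> K"
          using K(2)[OF bl[of \<omega> len], of y] z01[of \<omega> y]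
          by (simp add: hz_def max_def pos_divide_le_eq tail_pos tail_nonneg abs_of_nonneg)
      qed
    qed auto
    then have "((\<lambda>y. (\<integral>\<omega>. hz (max y 0) \<omega> \<partial>N) / tail H y) \<longlongrightarrow> 0) at_top" by simp
    from eventually_ratio_less[OF this \<epsilon>] show ?thesis by eventually_elim simp
  qed
  \<comment> \<open>The first two terms give \<open>2 * t\<close> at the level \<open>y - A\<close>,
    hence at most \<open>4 * t\<close> at \<open>y\<close>; the convolution term adds one more
    \<open>t\<close>.\<close>
  define t where "t = \<epsilon> / 6"
  have t: "0 < t" "6 * t = \<epsilon>" using \<epsilon> by (auto simp: t_def)
  define \<delta> where "\<delta> = t / (K * K3)"
  have \<delta>: "0 < \<delta>" "K * (\<delta> * K3) = t" using t K K3 by (auto simp: \<delta>_def)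
  obtain A0 where A0: "\<And>v. A0 \<le> v \<Longrightarrow> measure N {\<omega> \<in> space N. v < b * real (len \<omega>)} \<le> \<delta> * tail H v"
    using len_tail[OF \<delta>(1)] by (auto simp: eventually_at_top_linorder)
  define A where "A = max 0 A0"
  have fl: "filterlim (\<lambda>y. y - A) at_top at_top" by real_asymp
  note ev1 = eventually_compose_filterlim[OF len_tail[OF t(1)] fl]
  note ev2 = eventually_compose_filterlim[OF hz_small[OF t(1)] fl]
  show ?thesis using ev1 ev2 long_tailed[of 1 A, OF zero_less_one] eventually_ge_at_top[of A]
  proof eventually_elim
    case (elim y)
    let ?L = "\<lambda>\<omega>. b * real (len \<omega>)"
    let ?E = "{\<omega> \<in> space N. A < ?L \<omega>}"
    have y: "0 \<le> y" using elim(4) by (simp add: A_def)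
    have [measurable]: "?E \<in> sets N" "hg y \<in> borel_measurable N" "hz (max (y - A) 0) \<in> borel_measurable N"
      using mg[OF y] mz[of "max (y - A) 0"] by auto
    \<comment> \<open>The cost \<open>b * len\<close> exceeds \<open>y - A\<close>, or is at most
      \<open>A\<close>, or lies between: then the uniform bound \<open>K * tail H\<close> is used at
      the level \<open>y - b * len\<close>.\<close>
    have path: "hg y \<omega> \<le> (if y - A < ?L \<omega> then 1 else 0) + hz (max (y - A) 0) \<omega> + K * (indicator ?E \<omega> * tail H (y - ?L \<omega>))"
      if \<omega>: "\<omega> \<in> space N" for \<omega>
    proof -
      have nn: "0 \<le> K * (indicator ?E \<omega> * tail H (y - ?L \<omega>))" using K by (simp add: tail_nonneg)
      show ?thesis
      proof (cases "y - A < ?L \<omega>")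
        case True
        then show ?thesis using g01[OF \<omega>, of y] z01[OF \<omega>, of "max (y - A) 0"] nn by simp
      next
        case False
        then have y2: "0 \<le> y - ?L \<omega>" by (simp add: A_def)
        have "hg y \<omega> \<le> hz (y - ?L \<omega>) \<omega>"
        proof -
          interpret S: prob_space "seqs Q" by (rule Q.prob_space_seqs)
          have m: "h \<in> borel_measurable Q" if "h \<in> set (map g (?bl \<omega>)) \<or> h \<in> set (map \<zeta> (?bl \<omega>))" for h
            using that bl[OF \<omega>, of len] by (auto simp: in_lists_conv_set g_measurable \<zeta>_measurable)
          have "hg y \<omega> = S.prob {v \<in> space (seqs Q). y < wmax (map g (?bl \<omega>)) v}"
            using Q.prob_wmax[of "map g (?bl \<omega>)", OF m y] by (simp add: hg_def comp_def)
          also have "\<dots> \<le> S.prob {v \<in> space (seqs Q). y - ?L \<omega> < wmax (map \<zeta> (?bl \<omega>)) v}"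
          proof (rule S.finite_measure_mono)
            have mm: "wmax (map \<zeta> (?bl \<omega>)) \<in> borel_measurable (seqs Q)"
              by (rule measurable_wmax) (rule m, simp)
            then show "{v \<in> space (seqs Q). y - ?L \<omega> < wmax (map \<zeta> (?bl \<omega>)) v} \<in> S.events" by measurable
            show "{v \<in> space (seqs Q). y < wmax (map g (?bl \<omega>)) v} \<subseteq> {v \<in> space (seqs Q). y - ?L \<omega> < wmax (map \<zeta> (?bl \<omega>)) v}"
            proof (intro Collect_mono impI conjI)
              fix v assume v: "v \<in> space (seqs Q) \<and> y < wmax (map g (?bl \<omega>)) v"
              then show "v \<in> space (seqs Q)" by simp
              have "wmax (map g (?bl \<omega>)) v \<le> ?L \<omega> + wmax (map \<zeta> (?bl \<omega>)) v"
                using wmax_g_le[of "?bl \<omega>" v] by (simp only: length_block)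
              with v show "y - ?L \<omega> < wmax (map \<zeta> (?bl \<omega>)) v" by linarith
            qed
          qed
          also have "\<dots> = hz (y - ?L \<omega>) \<omega>"
            using Q.prob_wmax[of "map \<zeta> (?bl \<omega>)", OF m y2] by (simp add: hz_def comp_def)
          finally show ?thesis .
        qed
        also have "\<dots> \<le> hz (max (y - A) 0) \<omega> + K * (indicator ?E \<omega> * tail H (y - ?L \<omega>))"
        proof (cases "A < ?L \<omega>")
          case True
          then show ?thesis using K(2)[OF bl[OF \<omega>, of len], of "y - ?L \<omega>"] z01[OF \<omega>, of "max (y - A) 0"] \<omega> by (simp add: hz_def)
        next
          case F: False
          then have "max (y - A) 0 \<le> y - ?L \<omega>" using y2 by simp
          from z_anti[OF \<omega> this] nn show ?thesis by simp
        qed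
        finally show ?thesis using False by simp
      qed
    qed
    have i3: "integrable N (\<lambda>\<omega>. indicator ?E \<omega> * tail H (y - ?L \<omega>))"
      by (rule N.integrable_bounded[where B=1]) (auto simp: indicator_def tail_nonneg tail_le_1)
    have i2: "integrable N (hz (max (y - A) 0))"
      by (rule N.integrable_bounded[where B=1]) (auto simp: z01)
    have i1: "integrable N (\<lambda>\<omega>. if y - A < ?L \<omega> then 1 else 0 :: real)"
      by (rule N.prob_gt_eq_integral) simp
    have "(\<integral>\<omega>. hg y \<omega> \<partial>N) \<le> (\<integral>\<omega>. (if y - A < ?L \<omega> then 1 else 0) + hz (max (y - A) 0) \<omega> + K * (indicator ?E \<omega> * tail H (y - ?L \<omega>)) \<partial>N)"
    proof (rule integral_mono[OF _ _ path])
      show "integrable N (hg y)" by (rule N.integrable_bounded[where B=1]) (auto simp: g01)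
    qed (use i1 i2 i3 in \<open>auto intro!: Bochner_Integration.integrable_add\<close>)
    also have "\<dots> = measure N {\<omega> \<in> space N. y - A < ?L \<omega>} + (\<integral>\<omega>. hz (max (y - A) 0) \<omega> \<partial>N)
        + K * (\<integral>\<omega>. indicator ?E \<omega> * tail H (y - ?L \<omega>) \<partial>N)"
    proof -
      have "(\<integral>\<omega>. (if y - A < ?L \<omega> then 1 else 0 :: real) \<partial>N) = measure N {\<omega> \<in> space N. y - A < ?L \<omega>}"
        by (rule N.prob_gt_eq_integral) simp
      then show ?thesis using i1 i2 i3 by simp
    qed
    also have "(\<integral>\<omega>. indicator ?E \<omega> * tail H (y - ?L \<omega>) \<partial>N)
        = (\<integral>h. measure N {\<omega> \<in> space N. \<omega> \<in> ?E \<and> y - h < ?L \<omega>} \<partial>H)"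
      by (rule integral_tail_shift[OF N]) auto
    also have "\<dots> \<le> (\<integral>h. \<delta> * tail H (y - h) \<partial>H)"
    proof (rule integral_mono_AE')
      show "integrable H (\<lambda>h. \<delta> * tail H (y - h))" using integrable_tail_conv' by simp
      show "AE h in H. 0 \<le> \<delta> * tail H (y - h)" using \<delta> by (auto simp: tail_nonneg)
      show "AE h in H. measure N {\<omega> \<in> space N. \<omega> \<in> ?E \<and> y - h < ?L \<omega>} \<le> \<delta> * tail H (y - h)"
      proof (rule AE_I2)
        fix h
        have "measure N {\<omega> \<in> space N. \<omega> \<in> ?E \<and> y - h < ?L \<omega>} = measure N {\<omega> \<in> space N. max A (y - h) < ?L \<omega>}"
          by (rule arg_cong[where f="measure N"]) auto
        also have "\<dots> \<le> \<delta> * tail H (max A (y - h))" by (rule A0) (simp add: A_def)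
        also have "\<dots> \<le> \<delta> * tail H (y - h)" using \<delta> by (intro mult_left_mono tail_antimono) auto
        finally show "measure N {\<omega> \<in> space N. \<omega> \<in> ?E \<and> y - h < ?L \<omega>} \<le> \<delta> * tail H (y - h)" .
      qed
    qed
    also have "\<dots> \<le> \<delta> * (K3 * tail H y)" using \<delta> K3(2)[of y] by simp
    finally have "(\<integral>\<omega>. hg y \<omega> \<partial>N) \<le> t * tail H (y - A) + t * tail H (y - A) + K * (\<delta> * (K3 * tail H y))"
      using elim(1,2) K by (simp add: mult_left_mono add_mono)
    also have "K * (\<delta> * (K3 * tail H y)) = t * tail H y" using \<delta>(2) by (metis mult.assoc)
    also have "t * tail H (y - A) \<le> t * ((1 + 1) * tail H y)" using elim(3) t by (intro mult_left_mono) auto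
    finally have "(\<integral>\<omega>. hg y \<omega> \<partial>N) \<le> 5 * (t * tail H y)" by simp
    also have "\<dots> \<le> 6 * (t * tail H y)" using t by (intro mult_right_mono) (auto simp: tail_nonneg)
    also have "\<dots> = \<epsilon> * tail H y" using t by simp
    finally show ?case by (simp add: hg_def)
  qed
qed

end

end

section \<open>Concatenated cycles\<close>

text \<open>A whole segment acts as one step that moves by its sum and reaches up to its maximum.
  This is the origin of the pair \<open>cyc_step\<close>.\<close>

lemma (in prob_space) hit_append:
  assumes "\<And>f. f \<in> set fs \<Longrightarrow> f \<in> borel_measurable M" "\<forall>p\<in>set ps. fst p \<in> borel_measurable M \<and> snd p \<in> borel_measurable M"
    and "0 \<le> y"
  shows "hit M (map diag fs @ ps) y = (\<integral>v. (if y < wmax fs v then 1 else hit M ps (y - wsum fs v)) \<partial>seqs M)"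
  using assms
proof (induction fs arbitrary: y)
  case Nil
  interpret S: prob_space "seqs M" by (rule prob_space_seqs)
  show ?case using Nil by (simp add: S.prob_space)
next
  case (Cons f fs)
  interpret S: prob_space "seqs M" by (rule prob_space_seqs)
  have [measurable]: "f \<in> borel_measurable M" "wmax (f # fs) \<in> borel_measurable (seqs M)" "wsum (f # fs) \<in> borel_measurable (seqs M)"
    using Cons.prems by (auto intro!: measurable_wmax measurable_wsum simp del: wmax.simps wsum.simps)
  have [measurable]: "hit M ps \<in> borel_measurable borel" by (rule borel_measurable_hit) (rule Cons.prems)
  note h01 = hit_nonneg[OF Cons.prems(2)] hit_le_1[OF Cons.prems(2)]
  let ?F = "\<lambda>v. if y < wmax (f # fs) v then 1 else hit M ps (y - wsum (f # fs) v)"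
  have "?F \<in> borel_measurable (seqs M)" by (simp del: wmax.simps wsum.simps)
  then have int: "integrable (seqs M) ?F"
    by (rule S.integrable_bounded[where B=1]) (use h01 in auto)
  have "hit M (map diag (f # fs) @ ps) y = (\<integral>s. (if y < f s then 1 else hit M (map diag fs @ ps) (y - f s)) \<partial>M)"
    unfolding list.map append.simps hit.simps fst_diag snd_diag ..
  also have "\<dots> = (\<integral>s. (\<integral>w. ?F (case_nat s w) \<partial>seqs M) \<partial>M)"
  proof (intro Bochner_Integration.integral_cong refl)
    fix s
    show "(if y < f s then 1 else hit M (map diag fs @ ps) (y - f s)) = (\<integral>w. ?F (case_nat s w) \<partial>seqs M)"
    proof (cases "y < f s")
      case True
      have "?F (case_nat s w) = 1" for w
        using True wmax_nonneg[of fs w] by (simp add: max_def)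
      then show ?thesis using True by (simp add: S.prob_space)
    next
      case False
      have "hit M (map diag fs @ ps) (y - f s) = (\<integral>w. (if y - f s < wmax fs w then 1 else hit M ps (y - f s - wsum fs w)) \<partial>seqs M)"
        using False Cons.prems by (intro Cons.IH) auto
      also have "\<dots> = (\<integral>w. ?F (case_nat s w) \<partial>seqs M)"
        using Cons.prems(3) by (intro Bochner_Integration.integral_cong) (auto simp: algebra_simps max_def)
      finally show ?thesis using False by simp
    qed
  qed
  also have "\<dots> = (\<integral>v. ?F v \<partial>seqs M)"
    by (rule integral_seqs(1)[symmetric, OF int])
  finally show ?case .
qed

lemma measurable_hit_param:
  assumes Q: "prob_space Q" and f: "(\<lambda>p. f (fst p) (snd p)) \<in> borel_measurable (SX \<Otimes>\<^sub>M Q)"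
    and x: "\<And>i. i \<in> set is \<Longrightarrow> x i \<in> measurable N SX"
  shows "(\<lambda>p. hit Q (map (\<lambda>i. diag (f (x i (fst p)))) is) (snd p)) \<in> borel_measurable (N \<Otimes>\<^sub>M borel)"
  using x
proof (induction "is")
  case (Cons i "is")
  interpret Q: prob_space Q by fact
  have xi: "x i \<in> measurable N SX" using Cons by auto
  let ?P = "(N \<Otimes>\<^sub>M borel) \<Otimes>\<^sub>M Q"
  have "(\<lambda>p. (x i (fst (fst p)), snd p)) \<in> measurable ?P (SX \<Otimes>\<^sub>M Q)"
    by (intro measurable_Pair measurable_snd measurable_compose[OF measurable_fst measurable_compose[OF measurable_fst xi]])
  from measurable_compose[OF this f] have [measurable]: "(\<lambda>p. f (x i (fst (fst p))) (snd p)) \<in> borel_measurable ?P"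
    by simp
  have IH: "(\<lambda>p. hit Q (map (\<lambda>i. diag (f (x i (fst p)))) is) (snd p)) \<in> borel_measurable (N \<Otimes>\<^sub>M borel)"
    using Cons by auto
  have sh: "(\<lambda>p. (fst (fst p), snd (fst p) - f (x i (fst (fst p))) (snd p))) \<in> measurable ?P (N \<Otimes>\<^sub>M borel)"
    by measurable
  have [measurable]: "(\<lambda>p. hit Q (map (\<lambda>i. diag (f (x i (fst (fst p))))) is) (snd (fst p) - f (x i (fst (fst p))) (snd p))) \<in> borel_measurable ?P"
    using measurable_compose[OF sh IH] by simp
  have "(\<lambda>p. if snd (fst p) < f (x i (fst (fst p))) (snd p) then 1
      else hit Q (map (\<lambda>i. diag (f (x i (fst (fst p))))) is) (snd (fst p) - f (x i (fst (fst p))) (snd p))) \<in> borel_measurable ?P"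
    by measurable
  then have "(\<lambda>p. \<integral>u. (if snd p < f (x i (fst p)) u then 1
      else hit Q (map (\<lambda>i. diag (f (x i (fst p)))) is) (snd p - f (x i (fst p)) u)) \<partial>Q) \<in> borel_measurable (N \<Otimes>\<^sub>M borel)"
    by (intro Q.borel_measurable_lebesgue_integral) (simp add: case_prod_beta')
  then show ?case unfolding list.map hit.simps fst_diag snd_diag .
qed simp

lemma measurable_hit_block_joint:
  assumes Q: "prob_space Q" and f: "(\<lambda>p. f (fst p) (snd p)) \<in> borel_measurable (SX \<Otimes>\<^sub>M Q)"
    and x: "\<And>i. x i \<in> measurable N SX" and len: "len \<in> measurable N (count_space UNIV)"
  shows "(\<lambda>p. hit Q (map (\<lambda>z. diag (f z)) (block x len (fst p))) (snd p)) \<in> borel_measurable (N \<Otimes>\<^sub>M borel)"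
proof -
  have l: "(\<lambda>p. len (fst p)) \<in> measurable (N \<Otimes>\<^sub>M borel) (count_space UNIV)"
    by (rule measurable_compose[OF measurable_fst len])
  have "(\<lambda>p. hit Q (map (\<lambda>i. diag (f (x i (fst p)))) [0..<len (fst p)]) (snd p)) \<in> borel_measurable (N \<Otimes>\<^sub>M borel)"
    by (rule measurable_compose_countable[OF measurable_hit_param[OF Q f x] l])
  then show ?thesis by (simp add: block_def comp_def)
qed

text \<open>A concatenation of blocks of random length is again a block, with positions read off
  from the first or the second part. Measurability for any number of cycles thereby reduces to that
  of a single block.\<close>

lemma block_append:
  assumes x: "\<And>i. x i \<in> measurable N SX" and len: "len \<in> measurable N (count_space UNIV)"
    and y: "\<And>i. y i \<in> measurable N SX" and len': "len' \<in> measurable N (count_space UNIV)"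
  obtains z where "\<And>i. z i \<in> measurable N SX" "(\<lambda>\<omega>. len \<omega> + len' \<omega>) \<in> measurable N (count_space UNIV)"
    "\<And>\<omega>. block x len \<omega> @ block y len' \<omega> = block z (\<lambda>\<omega>. len \<omega> + len' \<omega>) \<omega>"
proof (rule that)
  fix i
  have "(\<lambda>\<omega>. if i < n then x i \<omega> else y (i - n) \<omega>) \<in> measurable N SX" for n
    using x y by (cases "i < n") auto
  from measurable_compose_countable[OF this len]
  show "(\<lambda>\<omega>. if i < len \<omega> then x i \<omega> else y (i - len \<omega>) \<omega>) \<in> measurable N SX" .
next
  show "(\<lambda>\<omega>. len \<omega> + len' \<omega>) \<in> measurable N (count_space UNIV)" using len len' by simp
  fix \<omega>
  show "block x len \<omega> @ block y len' \<omega> = block (\<lambda>i \<omega>. if i < len \<omega> then x i \<omega> else y (i - len \<omega>) \<omega>) (\<lambda>\<omega>. len \<omega> + len' \<omega>) \<omega>"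
    by (rule nth_equalityI) (auto simp: block_def nth_append)
qed

definition blocks :: "(nat \<Rightarrow> 'n \<Rightarrow> 'x) \<Rightarrow> ('n \<Rightarrow> nat) \<Rightarrow> nat \<Rightarrow> (nat \<Rightarrow> 'n) \<Rightarrow> 'x list" where
  "blocks x len m cs = concat (map (\<lambda>k. block x len (cs k)) [0..<m])"

lemma blocks_Suc: "blocks x len (Suc m) (case_nat c cs) = block x len c @ blocks x len m cs"
proof -
  have "[0..<Suc m] = 0 # map Suc [0..<m]" by (simp add: upt_conv_Cons map_Suc_upt del: upt_Suc)
  then show ?thesis by (simp add: blocks_def comp_def del: upt_Suc)
qed

lemma blocks_eq_block:
  assumes x: "\<And>i. x i \<in> measurable N SX" and len: "len \<in> measurable N (count_space UNIV)"
  obtains z l where "\<And>i. z i \<in> measurable (seqs N) SX" "l \<in> measurable (seqs N) (count_space UNIV)"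
    "\<And>cs. blocks x len m cs = block z l cs"
proof -
  have "\<exists>z l. (\<forall>i. z i \<in> measurable (seqs N) SX) \<and> l \<in> measurable (seqs N) (count_space UNIV) \<and> (\<forall>cs. blocks x len m cs = block z l cs)"
  proof (induction m)
    case 0
    have "(\<lambda>cs. x i (cs 0)) \<in> measurable (seqs N) SX" for i
      using measurable_compose[OF measurable_component_singleton[of 0 UNIV "\<lambda>_. N"] x] by simp
    then show ?case
      by (intro exI[of _ "\<lambda>i cs. x i (cs 0)"] exI[of _ "\<lambda>_. 0"]) (auto simp: blocks_def block_def)
  next
    case (Suc m)
    then obtain z l where zl: "\<And>i. z i \<in> measurable (seqs N) SX" "l \<in> measurable (seqs N) (count_space UNIV)"
      "\<And>cs. blocks x len m cs = block z l cs" by blast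
    have xm: "(\<lambda>cs. x i (cs m)) \<in> measurable (seqs N) SX" for i
      using measurable_compose[OF measurable_component_singleton[of m UNIV "\<lambda>_. N"] x] by simp
    have lm: "(\<lambda>cs. len (cs m)) \<in> measurable (seqs N) (count_space UNIV)"
      using measurable_compose[OF measurable_component_singleton[of m UNIV "\<lambda>_. N"] len] by simp
    obtain z' where z': "\<And>i. z' i \<in> measurable (seqs N) SX" "(\<lambda>cs. l cs + len (cs m)) \<in> measurable (seqs N) (count_space UNIV)"
      "\<And>cs. block z l cs @ block (\<lambda>i cs. x i (cs m)) (\<lambda>cs. len (cs m)) cs = block z' (\<lambda>cs. l cs + len (cs m)) cs"
      by (rule block_append[of z "seqs N" SX l "\<lambda>i cs. x i (cs m)", OF zl(1,2) xm lm]) blast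
    have "blocks x len (Suc m) cs = block z' (\<lambda>cs. l cs + len (cs m)) cs" for cs
      using z'(3)[of cs] zl(3)[of cs] by (simp add: blocks_def block_def)
    with z' show ?case by blast
  qed
  then show ?thesis using that by blast
qed

context modulated_walk
begin

abbreviation hitg :: "'x list \<Rightarrow> real \<Rightarrow> real" where
  "hitg xs y \<equiv> hit Q (map (\<lambda>z. diag (g z)) xs) y"

definition cyc_step :: "(nat \<Rightarrow> 'n \<Rightarrow> 'x) \<Rightarrow> ('n \<Rightarrow> nat) \<Rightarrow> ('n \<times> (nat \<Rightarrow> 'u)) step" where
  "cyc_step x len = (\<lambda>p. wsum (map g (block x len (fst p))) (snd p), \<lambda>p. wmax (map g (block x len (fst p))) (snd p))"

lemma lists_mg:
  assumes "xs \<in> lists (space SX)"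
  shows "\<forall>p\<in>set (map (\<lambda>x. diag (g x)) xs). fst p \<in> borel_measurable Q \<and> snd p \<in> borel_measurable Q"
  using assms g_measurable by (auto simp: fst_diag snd_diag)

lemma hitg_append:
  assumes "xs \<in> lists (space SX)" "ys \<in> lists (space SX)" "0 \<le> y"
  shows "hitg (xs @ ys) y = (\<integral>v. (if y < wmax (map g xs) v then 1 else hitg ys (y - wsum (map g xs) v)) \<partial>seqs Q)"
proof -
  have "hitg (xs @ ys) y = hit Q (map diag (map g xs) @ map (\<lambda>z. diag (g z)) ys) y"
    by (simp add: comp_def)
  also have "\<dots> = (\<integral>v. (if y < wmax (map g xs) v then 1 else hitg ys (y - wsum (map g xs) v)) \<partial>seqs Q)"
    using assms by (intro Q.hit_append lists_mg) (auto simp: in_lists_conv_set intro: g_measurable)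
  finally show ?thesis .
qed

lemma blocks_lists:
  assumes "\<And>i. x i \<in> measurable N SX" "cs \<in> space (seqs N)"
  shows "blocks x len m cs \<in> lists (space SX)"
proof -
  have "block x len (cs k) \<in> lists (space SX)" for k
    using assms by (intro block_lists) (auto simp: space_PiM PiE_def Pi_def)
  then show ?thesis by (auto simp: blocks_def in_lists_conv_set)
qed

text \<open>The first block and its driving variables become one step of type
  \<open>cyc_step\<close>. Fubini integrates out the later environment before the driving variables
  of the first block, leaving a recursion in the level alone.\<close>

lemma integral_first_block:
  fixes N0 :: "'n0 measure" and N1 :: "'n1 measure"
  assumes N0: "prob_space N0" and x0: "\<And>i. x0 i \<in> measurable N0 SX" and len0: "len0 \<in> measurable N0 (count_space UNIV)"
    and N1: "prob_space N1" and z: "\<And>i. z i \<in> measurable N1 SX" and l: "l \<in> measurable N1 (count_space UNIV)"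
    and y: "0 \<le> y"
  shows "(\<integral>c. (\<integral>cs. hitg (block x0 len0 c @ block z l cs) y \<partial>N1) \<partial>N0)
     = (\<integral>p. (if y < snd (cyc_step x0 len0) p then 1 else (\<integral>cs. hitg (block z l cs) (y - fst (cyc_step x0 len0) p) \<partial>N1)) \<partial>(N0 \<Otimes>\<^sub>M seqs Q))"
proof -
  interpret N0: prob_space N0 by fact
  interpret N1: prob_space N1 by fact
  interpret S: prob_space "seqs Q" by (rule Q.prob_space_seqs)
  interpret SN: pair_prob_space "seqs Q" N1 ..
  interpret NS: pair_prob_space N0 "seqs Q" ..
  let ?W = "\<lambda>c. wmax (map g (block x0 len0 c))" and ?Y = "\<lambda>c. wsum (map g (block x0 len0 c))"
  have hj: "(\<lambda>p. hitg (block z l (fst p)) (snd p)) \<in> borel_measurable (N1 \<Otimes>\<^sub>M borel)"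
    by (rule measurable_hit_block_joint[OF Q.prob_space_axioms g_meas z l])
  have h01: "0 \<le> hitg (block z l cs) u" "hitg (block z l cs) u \<le> 1" if "cs \<in> space N1" for cs u
    using Q.hit_nonneg[OF lists_mg[OF block_lists[of z, OF z that, of l]]] Q.hit_le_1[OF lists_mg[OF block_lists[of z, OF z that, of l]]] by auto
  have mW: "(\<lambda>p. ?W (fst p) (snd p)) \<in> borel_measurable (N0 \<Otimes>\<^sub>M seqs Q)" and mY: "(\<lambda>p. ?Y (fst p) (snd p)) \<in> borel_measurable (N0 \<Otimes>\<^sub>M seqs Q)"
    by (rule measurable_wmax_block[OF g_meas x0 len0])+
  have "(\<integral>c. (\<integral>cs. hitg (block x0 len0 c @ block z l cs) y \<partial>N1) \<partial>N0)
     = (\<integral>c. (\<integral>v. (if y < ?W c v then 1 else (\<integral>cs. hitg (block z l cs) (y - ?Y c v) \<partial>N1)) \<partial>seqs Q) \<partial>N0)"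
  proof (intro Bochner_Integration.integral_cong refl)
    fix c assume c: "c \<in> space N0"
    note bl0 = block_lists[of x0, OF x0 c, of len0]
    have mc: "?W c \<in> borel_measurable (seqs Q)" "?Y c \<in> borel_measurable (seqs Q)"
      using bl0 by (auto intro!: measurable_wmax measurable_wsum g_measurable simp: in_lists_conv_set)
    have [measurable]: "(\<lambda>p. ?W c (fst p)) \<in> borel_measurable (seqs Q \<Otimes>\<^sub>M N1)"
      by (rule measurable_compose[OF measurable_fst mc(1)])
    have "(\<lambda>p. (snd p, y - ?Y c (fst p))) \<in> measurable (seqs Q \<Otimes>\<^sub>M N1) (N1 \<Otimes>\<^sub>M borel)"
      by (intro measurable_Pair measurable_snd borel_measurable_diff borel_measurable_const measurable_compose[OF measurable_fst mc(2)])
    from measurable_compose[OF this hj]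
    have [measurable]: "(\<lambda>p. hitg (block z l (snd p)) (y - ?Y c (fst p))) \<in> borel_measurable (seqs Q \<Otimes>\<^sub>M N1)" by simp
    have m: "(\<lambda>p. if y < ?W c (fst p) then 1 else hitg (block z l (snd p)) (y - ?Y c (fst p))) \<in> borel_measurable (seqs Q \<Otimes>\<^sub>M N1)"
      by measurable
    have int: "integrable (seqs Q \<Otimes>\<^sub>M N1) (\<lambda>(v, cs). if y < ?W c v then 1 else hitg (block z l cs) (y - ?Y c v))"
    proof (rule SN.integrable_bounded[where B=1])
      show "(\<lambda>(v, cs). if y < ?W c v then 1 else hitg (block z l cs) (y - ?Y c v)) \<in> borel_measurable (seqs Q \<Otimes>\<^sub>M N1)"
        using m by (simp add: case_prod_beta')
    qed (use h01 in \<open>auto simp: space_pair_measure\<close>)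
    have "(\<integral>cs. hitg (block x0 len0 c @ block z l cs) y \<partial>N1)
       = (\<integral>cs. (\<integral>v. (if y < ?W c v then 1 else hitg (block z l cs) (y - ?Y c v)) \<partial>seqs Q) \<partial>N1)"
      by (intro Bochner_Integration.integral_cong refl hitg_append bl0 block_lists[of z, OF z] y)
    also have "\<dots> = (\<integral>v. (\<integral>cs. (if y < ?W c v then 1 else hitg (block z l cs) (y - ?Y c v)) \<partial>N1) \<partial>seqs Q)"
      by (rule SN.Fubini_integral[OF int])
    also have "\<dots> = (\<integral>v. (if y < ?W c v then 1 else (\<integral>cs. hitg (block z l cs) (y - ?Y c v) \<partial>N1)) \<partial>seqs Q)"
      by (intro Bochner_Integration.integral_cong) (auto simp: N1.prob_space)
    finally show "(\<integral>cs. hitg (block x0 len0 c @ block z l cs) y \<partial>N1)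
      = (\<integral>v. (if y < ?W c v then 1 else (\<integral>cs. hitg (block z l cs) (y - ?Y c v) \<partial>N1)) \<partial>seqs Q)" .
  qed
  also have "\<dots> = (\<integral>p. (if y < ?W (fst p) (snd p) then 1 else (\<integral>cs. hitg (block z l cs) (y - ?Y (fst p) (snd p)) \<partial>N1)) \<partial>(N0 \<Otimes>\<^sub>M seqs Q))"
  proof -
    have "(\<lambda>p. (snd p, fst p)) \<in> measurable (borel \<Otimes>\<^sub>M N1) (N1 \<Otimes>\<^sub>M borel)" by measurable
    from measurable_compose[OF this hj] have "(\<lambda>u. \<integral>cs. hitg (block z l cs) u \<partial>N1) \<in> borel_measurable borel"
      by (intro N1.borel_measurable_lebesgue_integral) (simp add: case_prod_beta')
    note mu = this
    have "(\<lambda>p. y - ?Y (fst p) (snd p)) \<in> borel_measurable (N0 \<Otimes>\<^sub>M seqs Q)"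
      using mY by (intro borel_measurable_diff borel_measurable_const)
    from measurable_compose[OF this mu]
    have [measurable]: "(\<lambda>p. \<integral>cs. hitg (block z l cs) (y - ?Y (fst p) (snd p)) \<partial>N1) \<in> borel_measurable (N0 \<Otimes>\<^sub>M seqs Q)" .
    have "integrable (N0 \<Otimes>\<^sub>M seqs Q) (\<lambda>p. if y < ?W (fst p) (snd p) then 1 else (\<integral>cs. hitg (block z l cs) (y - ?Y (fst p) (snd p)) \<partial>N1))"
    proof (rule NS.integrable_bounded[where B=1])
      show "(\<lambda>p. if y < ?W (fst p) (snd p) then 1 else (\<integral>cs. hitg (block z l cs) (y - ?Y (fst p) (snd p)) \<partial>N1)) \<in> borel_measurable (N0 \<Otimes>\<^sub>M seqs Q)"
        using mW by measurable
      have "\<bar>\<integral>cs. hitg (block z l cs) u \<partial>N1\<bar> \<le> 1" for u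
      proof -
        have "(\<lambda>cs. (cs, u)) \<in> measurable N1 (N1 \<Otimes>\<^sub>M borel)" by measurable
        from measurable_compose[OF this hj] have "(\<integral>cs. hitg (block z l cs) u \<partial>N1) \<le> 1"
          by (intro N1.integral_le_bound h01) simp_all
        moreover have "0 \<le> (\<integral>cs. hitg (block z l cs) u \<partial>N1)"
          by (intro Bochner_Integration.integral_nonneg_AE AE_I2 h01)
        ultimately show ?thesis by simp
      qed
      then show "\<bar>if y < ?W (fst p) (snd p) then 1 else (\<integral>cs. hitg (block z l cs) (y - ?Y (fst p) (snd p)) \<partial>N1)\<bar> \<le> 1" for p
        by auto
    qed
    from NS.integral_fst'[OF this] show ?thesis unfolding fst_conv snd_conv .
  qed
  finally show ?thesis unfolding cyc_step_def fst_conv snd_conv .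
qed

text \<open>With independent cycles of a common law the modulated walk, observed cycle by cycle, has
  i.i.d. steps on the product of the cycle law and the law of the driving sequence.\<close>

lemma hit_blocks:
  assumes N: "prob_space N" and x: "\<And>i. x i \<in> measurable N SX" and len: "len \<in> measurable N (count_space UNIV)"
    and y: "0 \<le> y"
  shows "(\<integral>cs. hitg (blocks x len m cs) y \<partial>seqs N) = hit (N \<Otimes>\<^sub>M seqs Q) (replicate m (cyc_step x len)) y"
  using y
proof (induction m arbitrary: y)
  case 0
  then show ?case by (simp add: blocks_def)
next
  case (Suc m)
  interpret N: prob_space N by fact
  interpret SN: prob_space "seqs N" by (rule N.prob_space_seqs)
  obtain z l where zl: "\<And>i. z i \<in> measurable (seqs N) SX" "l \<in> measurable (seqs N) (count_space UNIV)"
    "\<And>cs. blocks x len m cs = block z l cs" by (rule blocks_eq_block[where x=x and N=N and SX=SX and len=len and m=m, OF x len]) blast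
  obtain z' l' where zl': "\<And>i. z' i \<in> measurable (seqs N) SX" "l' \<in> measurable (seqs N) (count_space UNIV)"
    "\<And>cs. blocks x len (Suc m) cs = block z' l' cs" by (rule blocks_eq_block[where x=x and N=N and SX=SX and len=len and m="Suc m", OF x len]) blast
  have "(\<lambda>cs. hitg (blocks x len (Suc m) cs) y) \<in> borel_measurable (seqs N)"
    unfolding zl'(3) using measurable_compose[of "\<lambda>cs. (cs, y)", OF _ measurable_hit_block_joint[OF Q.prob_space_axioms g_meas zl'(1,2)]]
    by simp
  then have int: "integrable (seqs N) (\<lambda>cs. hitg (blocks x len (Suc m) cs) y)"
  proof (rule SN.integrable_bounded[where B=1])
    fix cs assume "cs \<in> space (seqs N)"
    from lists_mg[OF blocks_lists[of x, OF x this, of len "Suc m"]]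
    show "\<bar>hitg (blocks x len (Suc m) cs) y\<bar> \<le> 1" by (simp only: abs_of_nonneg Q.hit_nonneg Q.hit_le_1)
  qed
  have "(\<integral>cs. hitg (blocks x len (Suc m) cs) y \<partial>seqs N) = (\<integral>c. (\<integral>cs. hitg (blocks x len (Suc m) (case_nat c cs)) y \<partial>seqs N) \<partial>N)"
    by (rule N.integral_seqs(1)[OF int])
  also have "\<dots> = (\<integral>c. (\<integral>cs. hitg (block x len c @ block z l cs) y \<partial>seqs N) \<partial>N)"
    unfolding blocks_Suc zl(3) ..
  also have "\<dots> = (\<integral>p. (if y < snd (cyc_step x len) p then 1 else (\<integral>cs. hitg (block z l cs) (y - fst (cyc_step x len) p) \<partial>seqs N)) \<partial>(N \<Otimes>\<^sub>M seqs Q))"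
    by (rule integral_first_block[OF N x len SN.prob_space_axioms zl(1,2) Suc.prems])
  also have "\<dots> = (\<integral>p. (if y < snd (cyc_step x len) p then 1 else hit (N \<Otimes>\<^sub>M seqs Q) (replicate m (cyc_step x len)) (y - fst (cyc_step x len) p)) \<partial>(N \<Otimes>\<^sub>M seqs Q))"
  proof (intro Bochner_Integration.integral_cong refl if_cong)
    fix p assume "\<not> y < snd (cyc_step x len) p"
    \<comment> \<open>The induction hypothesis asks for a nonnegative level; without a crossing it
      is nonnegative because \<open>wsum\<close> is at most \<open>wmax\<close>.\<close>
    then have "0 \<le> y - fst (cyc_step x len) p"
      using wsum_le_wmax[of "map g (block x len (fst p))" "snd p"] by (simp add: cyc_step_def)
    from Suc.IH[OF this] show "(\<integral>cs. hitg (block z l cs) (y - fst (cyc_step x len) p) \<partial>seqs N)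
      = hit (N \<Otimes>\<^sub>M seqs Q) (replicate m (cyc_step x len)) (y - fst (cyc_step x len) p)" by (simp only: zl(3))
  qed
  finally show ?case by simp
qed

end

section \<open>Regenerative environments\<close>

lemma (in prob_space) integral_wsum:
  assumes "\<And>f. f \<in> set fs \<Longrightarrow> integrable M f"
  shows "integrable (seqs M) (wsum fs)" "(\<integral>v. wsum fs v \<partial>seqs M) = (\<Sum>f\<leftarrow>fs. \<integral>\<omega>. f \<omega> \<partial>M)"
proof -
  have "integrable (seqs M) (wsum fs) \<and> (\<integral>v. wsum fs v \<partial>seqs M) = (\<Sum>f\<leftarrow>fs. \<integral>\<omega>. f \<omega> \<partial>M)"
    using assms
  proof (induction fs)
    case Nil
    interpret S: prob_space "seqs M" by (rule prob_space_seqs)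
    show ?case by (simp add: wsum.simps(1)[abs_def])
  next
    case (Cons f fs)
    interpret S: prob_space "seqs M" by (rule prob_space_seqs)
    interpret MS: pair_prob_space M "seqs M" ..
    have f: "integrable M f" using Cons.prems by auto
    have fs: "integrable (seqs M) (wsum fs)" "(\<integral>v. wsum fs v \<partial>seqs M) = (\<Sum>f\<leftarrow>fs. \<integral>\<omega>. f \<omega> \<partial>M)" using Cons by auto
    have "integrable (M \<Otimes>\<^sub>M seqs M) (\<lambda>x. f (fst x))" "integrable (M \<Otimes>\<^sub>M seqs M) (\<lambda>x. wsum fs (snd x))"
      using f fs by (auto intro: MS.integrable_pair_fst MS.integrable_pair_snd)
    then have "integrable (M \<Otimes>\<^sub>M seqs M) (\<lambda>x. wsum (f # fs) (case_nat (fst x) (snd x)))" by simp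
    moreover have "wsum (f # fs) \<in> borel_measurable (seqs M)"
      using Cons.prems by (intro measurable_wsum) auto
    ultimately have int: "integrable (seqs M) (wsum (f # fs))" using integrable_seqs_iff by blast
    have "(\<integral>v. wsum (f # fs) v \<partial>seqs M) = (\<integral>s. (\<integral>w. f s + wsum fs w \<partial>seqs M) \<partial>M)"
      using integral_seqs(1)[OF int] by simp
    also have "\<dots> = (\<integral>s. f s + (\<integral>w. wsum fs w \<partial>seqs M) \<partial>M)"
      using fs by (simp add: S.prob_space)
    also have "\<dots> = (\<Sum>f\<leftarrow>f # fs. \<integral>\<omega>. f \<omega> \<partial>M)"
      using f fs by (simp add: prob_space)
    finally show ?case using int by blast
  qed
  then show "integrable (seqs M) (wsum fs)" "(\<integral>v. wsum fs v \<partial>seqs M) = (\<Sum>f\<leftarrow>fs. \<integral>\<omega>. f \<omega> \<partial>M)" by auto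
qed

lemma abs_wsum_le: "\<bar>wsum fs v\<bar> \<le> wsum (map (\<lambda>f u. \<bar>f u\<bar>) fs) v"
proof (induction fs arbitrary: v)
  case (Cons f fs)
  from Cons[of "\<lambda>i. v (Suc i)"] show ?case by simp
qed simp

context modulated_walk
begin

context
  fixes N :: "'n measure" and len :: "'n \<Rightarrow> nat" and x :: "nat \<Rightarrow> 'n \<Rightarrow> 'x"
  assumes N: "prob_space N" and len: "len \<in> measurable N (count_space UNIV)"
    and x: "\<And>i. x i \<in> measurable N SX"
begin

lemma cyc_step_in_steps: "cyc_step x len \<in> steps (N \<Otimes>\<^sub>M seqs Q)"
  using measurable_wmax_block[OF g_meas x len] by (simp add: steps_def cyc_step_def wsum_le_wmax)

lemma prob_cyc_step:
  assumes y: "0 \<le> y"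
  shows "measure (N \<Otimes>\<^sub>M seqs Q) {p \<in> space (N \<Otimes>\<^sub>M seqs Q). y < snd (cyc_step x len) p} = (\<integral>\<omega>. hitg (block x len \<omega>) y \<partial>N)"
proof -
  interpret N: prob_space N by (rule N)
  interpret S: prob_space "seqs Q" by (rule Q.prob_space_seqs)
  interpret NS: pair_prob_space N "seqs Q" ..
  have m: "snd (cyc_step x len) \<in> borel_measurable (N \<Otimes>\<^sub>M seqs Q)" using cyc_step_in_steps by (simp add: steps_def)
  have "measure (N \<Otimes>\<^sub>M seqs Q) {p \<in> space (N \<Otimes>\<^sub>M seqs Q). y < snd (cyc_step x len) p}
     = (\<integral>p. (if y < snd (cyc_step x len) p then 1 else 0) \<partial>(N \<Otimes>\<^sub>M seqs Q))"
    by (rule NS.prob_gt_eq_integral(2)[symmetric, OF m])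
  also have "\<dots> = (\<integral>\<omega>. (\<integral>v. (if y < snd (cyc_step x len) (\<omega>, v) then 1 else 0) \<partial>seqs Q) \<partial>N)"
    by (rule NS.integral_fst'[symmetric, OF NS.prob_gt_eq_integral(1)[OF m]])
  also have "\<dots> = (\<integral>\<omega>. hitg (block x len \<omega>) y \<partial>N)"
  proof (intro Bochner_Integration.integral_cong refl)
    fix \<omega> assume \<omega>: "\<omega> \<in> space N"
    have h: "h \<in> borel_measurable Q" if "h \<in> set (map g (block x len \<omega>))" for h
      using that block_lists[of x, OF x \<omega>, of len] by (auto simp: in_lists_conv_set g_measurable)
    have "(\<integral>v. (if y < snd (cyc_step x len) (\<omega>, v) then 1 else 0) \<partial>seqs Q)
      = S.prob {v \<in> space (seqs Q). y < wmax (map g (block x len \<omega>)) v}"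
      unfolding cyc_step_def snd_conv fst_conv
      by (rule S.prob_gt_eq_integral(2)) (rule measurable_wmax[OF h])
    also have "\<dots> = hit Q (map diag (map g (block x len \<omega>))) y"
      by (rule Q.prob_wmax[OF h y])
    also have "\<dots> = hitg (block x len \<omega>) y" by (simp add: comp_def)
    finally show "(\<integral>v. (if y < snd (cyc_step x len) (\<omega>, v) then 1 else 0) \<partial>seqs Q) = hitg (block x len \<omega>) y" .
  qed
  finally show ?thesis .
qed

lemma cyc_step_snd:
  assumes len_int: "integrable N (\<lambda>\<omega>. real (len \<omega>))"
  shows "integrable (N \<Otimes>\<^sub>M seqs Q) (snd (cyc_step x len))"
    and "0 \<le> y \<Longrightarrow> (\<integral>p. max 0 (snd (cyc_step x len) p - y) \<partial>(N \<Otimes>\<^sub>M seqs Q)) = (\<integral>\<omega>. Q.excess (map g (block x len \<omega>)) y \<partial>N)"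
proof -
  interpret N: prob_space N by (rule N)
  interpret S: prob_space "seqs Q" by (rule Q.prob_space_seqs)
  interpret NS: pair_prob_space N "seqs Q" ..
  have m: "snd (cyc_step x len) \<in> borel_measurable (N \<Otimes>\<^sub>M seqs Q)" using cyc_step_in_steps by (simp add: steps_def)
  have iw: "integrable (seqs Q) (wmax (map g (block x len \<omega>)))" if "\<omega> \<in> space N" for \<omega>
    using block_lists[of x, OF x that, of len] by (intro Q.integrable_wmax) (auto simp: in_lists_conv_set g_int)
  have ex0: "(\<integral>v. norm (snd (cyc_step x len) (\<omega>, v)) \<partial>seqs Q) = Q.excess (map g (block x len \<omega>)) 0" for \<omega>
    by (simp add: cyc_step_def Q.excess_def wmax_nonneg abs_of_nonneg)
  show int: "integrable (N \<Otimes>\<^sub>M seqs Q) (snd (cyc_step x len))"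
  proof (rule NS.Fubini_integrable[OF m])
    show "integrable N (\<lambda>\<omega>. \<integral>v. norm (snd (cyc_step x len) (\<omega>, v)) \<partial>seqs Q)"
      unfolding ex0 by (rule integrable_excess_block(2)[OF N len x len_int]) simp
    show "AE \<omega> in N. integrable (seqs Q) (\<lambda>v. snd (cyc_step x len) (\<omega>, v))"
      unfolding cyc_step_def snd_conv fst_conv by (rule AE_I2) (rule iw)
  qed
  show "(\<integral>p. max 0 (snd (cyc_step x len) p - y) \<partial>(N \<Otimes>\<^sub>M seqs Q)) = (\<integral>\<omega>. Q.excess (map g (block x len \<omega>)) y \<partial>N)" if "0 \<le> y"
    using NS.integral_fst'[OF NS.integrable_max0[OF int, of y]]
    by (simp add: cyc_step_def Q.excess_def)
qed

text \<open>(D3) controls the means along a cycle, whereas the cycle sum has to be integrable. As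
  \<open>g\<close> is at most \<open>G1\<close>, its absolute value is at most
  \<open>2 * G1 - g\<close>, whose mean is under control.\<close>

lemma abs_g_le:
  assumes z: "z \<in> space SX"
  shows "(\<integral>u. \<bar>g z u\<bar> \<partial>Q) \<le> 2 * (\<integral>u. G1 u \<partial>Q) + \<bar>\<integral>u. g z u \<partial>Q\<bar>"
proof -
  have "(\<integral>u. \<bar>g z u\<bar> \<partial>Q) \<le> (\<integral>u. 2 * G1 u - g z u \<partial>Q)"
  proof (rule integral_mono)
    fix u assume "u \<in> space Q"
    then show "\<bar>g z u\<bar> \<le> 2 * G1 u - g z u" using g_le[OF z, of u] by (auto simp: G1_def)
  qed (use g_int[OF z] G1_int in auto)
  also have "\<dots> = 2 * (\<integral>u. G1 u \<partial>Q) - (\<integral>u. g z u \<partial>Q)"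
    using g_int[OF z] G1_int by simp
  finally show ?thesis by simp
qed

lemma cyc_step_fst:
  assumes len_int: "integrable N (\<lambda>\<omega>. real (len \<omega>))"
    and a_int: "integrable N (\<lambda>\<omega>. \<Sum>z\<leftarrow>block x len \<omega>. \<bar>\<integral>u. g z u \<partial>Q\<bar>)"
  shows "integrable (N \<Otimes>\<^sub>M seqs Q) (fst (cyc_step x len))"
    and "(\<integral>p. fst (cyc_step x len) p \<partial>(N \<Otimes>\<^sub>M seqs Q)) = (\<integral>\<omega>. (\<Sum>z\<leftarrow>block x len \<omega>. \<integral>u. g z u \<partial>Q) \<partial>N)"
proof -
  interpret N: prob_space N by (rule N)
  interpret S: prob_space "seqs Q" by (rule Q.prob_space_seqs)
  interpret NS: pair_prob_space N "seqs Q" ..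
  have m: "fst (cyc_step x len) \<in> borel_measurable (N \<Otimes>\<^sub>M seqs Q)" using cyc_step_in_steps by (simp add: steps_def)
  note bl = block_lists[of x N SX, OF x]
  have ig: "f \<in> set (map g (block x len \<omega>)) \<Longrightarrow> integrable Q f" if "\<omega> \<in> space N" for \<omega> f
    using bl[OF that, of len] by (auto simp: in_lists_conv_set g_int)
  show int: "integrable (N \<Otimes>\<^sub>M seqs Q) (fst (cyc_step x len))"
  proof (rule NS.Fubini_integrable[OF m])
    show "AE \<omega> in N. integrable (seqs Q) (\<lambda>v. fst (cyc_step x len) (\<omega>, v))"
      unfolding cyc_step_def snd_conv fst_conv by (rule AE_I2) (rule Q.integral_wsum(1), rule ig)
    show "integrable N (\<lambda>\<omega>. \<integral>v. norm (fst (cyc_step x len) (\<omega>, v)) \<partial>seqs Q)"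
    proof (rule Bochner_Integration.integrable_bound)
      show "integrable N (\<lambda>\<omega>. 2 * (\<integral>u. G1 u \<partial>Q) * real (len \<omega>) + (\<Sum>z\<leftarrow>block x len \<omega>. \<bar>\<integral>u. g z u \<partial>Q\<bar>))"
        using len_int a_int by simp
      have "(\<lambda>p. norm (fst (cyc_step x len) p)) \<in> borel_measurable (N \<Otimes>\<^sub>M seqs Q)" using m by measurable
      then show "(\<lambda>\<omega>. \<integral>v. norm (fst (cyc_step x len) (\<omega>, v)) \<partial>seqs Q) \<in> borel_measurable N"
        by (intro S.borel_measurable_lebesgue_integral) (simp add: case_prod_beta')
      show "AE \<omega> in N. norm (\<integral>v. norm (fst (cyc_step x len) (\<omega>, v)) \<partial>seqs Q)
        \<le> norm (2 * (\<integral>u. G1 u \<partial>Q) * real (len \<omega>) + (\<Sum>z\<leftarrow>block x len \<omega>. \<bar>\<integral>u. g z u \<partial>Q\<bar>))"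
      proof (rule AE_I2)
        fix \<omega> assume \<omega>: "\<omega> \<in> space N"
        let ?b = "block x len \<omega>"
        have ia: "f \<in> set (map (\<lambda>f u. \<bar>f u\<bar>) (map g ?b)) \<Longrightarrow> integrable Q f" for f
          using ig[OF \<omega>] by auto
        have "(\<integral>v. \<bar>wsum (map g ?b) v\<bar> \<partial>seqs Q) \<le> (\<integral>v. wsum (map (\<lambda>f u. \<bar>f u\<bar>) (map g ?b)) v \<partial>seqs Q)"
        proof (rule integral_mono[OF _ _ abs_wsum_le])
          show "integrable (seqs Q) (\<lambda>v. \<bar>wsum (map g ?b) v\<bar>)"
            by (rule integrable_abs, rule Q.integral_wsum(1), rule ig[OF \<omega>])
          show "integrable (seqs Q) (wsum (map (\<lambda>f u. \<bar>f u\<bar>) (map g ?b)))"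
            by (rule Q.integral_wsum(1), rule ia)
        qed
        also have "\<dots> = (\<Sum>z\<leftarrow>?b. \<integral>u. \<bar>g z u\<bar> \<partial>Q)"
          by (subst Q.integral_wsum(2)[OF ia]) (auto simp: comp_def)
        also have "\<dots> \<le> (\<Sum>z\<leftarrow>?b. 2 * (\<integral>u. G1 u \<partial>Q) + \<bar>\<integral>u. g z u \<partial>Q\<bar>)"
          using bl[OF \<omega>, of len] by (intro sum_list_mono abs_g_le) (auto simp: in_lists_conv_set)
        also have "\<dots> = 2 * (\<integral>u. G1 u \<partial>Q) * real (len \<omega>) + (\<Sum>z\<leftarrow>?b. \<bar>\<integral>u. g z u \<partial>Q\<bar>)"
          by (simp add: sum_list_addf sum_list_triv)
        finally show "norm (\<integral>v. norm (fst (cyc_step x len) (\<omega>, v)) \<partial>seqs Q)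
          \<le> norm (2 * (\<integral>u. G1 u \<partial>Q) * real (len \<omega>) + (\<Sum>z\<leftarrow>?b. \<bar>\<integral>u. g z u \<partial>Q\<bar>))"
          by (simp add: cyc_step_def abs_of_nonneg)
      qed
    qed
  qed
  have "(\<integral>p. fst (cyc_step x len) p \<partial>(N \<Otimes>\<^sub>M seqs Q)) = (\<integral>\<omega>. (\<integral>v. wsum (map g (block x len \<omega>)) v \<partial>seqs Q) \<partial>N)"
    using NS.integral_fst'[OF int] by (simp add: cyc_step_def)
  also have "\<dots> = (\<integral>\<omega>. (\<Sum>z\<leftarrow>block x len \<omega>. \<integral>u. g z u \<partial>Q) \<partial>N)"
    by (intro Bochner_Integration.integral_cong refl, subst Q.integral_wsum(2), rule ig) (auto simp: comp_def)
  finally show "(\<integral>p. fst (cyc_step x len) p \<partial>(N \<Otimes>\<^sub>M seqs Q)) = (\<integral>\<omega>. (\<Sum>z\<leftarrow>block x len \<omega>. \<integral>u. g z u \<partial>Q) \<partial>N)" .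
qed

end

text \<open>The i.i.d. theorem gives the limit for the walk after the initial cycle. In front of it
  the initial cycle only shifts the level: its maximum has a tail of smaller order, which settles
  the upper bound, and its displacement is bounded below with high probability, which settles the
  lower one.\<close>

theorem regenerative_asymptotics:
  fixes N0 :: "'n0 measure" and N1 :: "'n1 measure"
  assumes N0: "prob_space N0" and len0: "len0 \<in> measurable N0 (count_space UNIV)" and x0: "\<And>i. x0 i \<in> measurable N0 SX"
    and N1: "prob_space N1" and len: "len \<in> measurable N1 (count_space UNIV)" and x: "\<And>i. x i \<in> measurable N1 SX"
    and len0_tail: "\<And>\<epsilon>. 0 < \<epsilon> \<Longrightarrow> \<forall>\<^sub>F v in at_top. measure N0 {\<omega> \<in> space N0. v < b * real (len0 \<omega>)} \<le> \<epsilon> * tail H v"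
    and len_excess: "\<And>\<epsilon>. 0 < \<epsilon> \<Longrightarrow> \<forall>\<^sub>F v in at_top. (\<integral>\<omega>. max 0 (b * real (len \<omega>) - v) \<partial>N1) \<le> \<epsilon> * tail H v"
    and len_int: "integrable N1 (\<lambda>\<omega>. real (len \<omega>))"
    and c_meas: "c \<in> borel_measurable SX"
    and a_int: "integrable N1 (\<lambda>\<omega>. \<Sum>z\<leftarrow>block x len \<omega>. \<bar>\<integral>u. g z u \<partial>Q\<bar>)"
    and mean: "(\<integral>\<omega>. (\<Sum>z\<leftarrow>block x len \<omega>. \<integral>u. g z u \<partial>Q) \<partial>N1) = - \<mu>" and \<mu>: "0 < \<mu>"
  shows "((\<lambda>y. (SUP m. \<integral>\<omega>. (\<integral>cs. hitg (block x0 len0 \<omega> @ blocks x len m cs) y \<partial>seqs N1) \<partial>N0) / tail H y)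
     \<longlongrightarrow> (\<integral>\<omega>. (\<Sum>z\<leftarrow>block x len \<omega>. c z) \<partial>N1) / \<mu>) at_top"
proof -
  interpret N0: prob_space N0 by fact
  interpret N1: prob_space N1 by fact
  interpret S: prob_space "seqs Q" by (rule Q.prob_space_seqs)
  interpret SN: prob_space "seqs N1" by (rule N1.prob_space_seqs)
  interpret R: pair_prob_space N0 "seqs Q" ..
  interpret Q1: pair_prob_space N1 "seqs Q" ..
  define C where "C = (\<integral>\<omega>. (\<Sum>z\<leftarrow>block x len \<omega>. c z) \<partial>N1)"
  define p where "p = cyc_step x len"
  define p0 where "p0 = cyc_step x0 len0"
  have ps: "p \<in> steps (N1 \<Otimes>\<^sub>M seqs Q)" unfolding p_def by (rule cyc_step_in_steps[OF N1 len x])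
  have p0s: "p0 \<in> steps (N0 \<Otimes>\<^sub>M seqs Q)" unfolding p0_def by (rule cyc_step_in_steps[OF N0 len0 x0])
  have mp: "fst p \<in> borel_measurable (N1 \<Otimes>\<^sub>M seqs Q)" "snd p \<in> borel_measurable (N1 \<Otimes>\<^sub>M seqs Q)"
    using ps by (auto simp: steps_def)
  have mp0[measurable]: "fst p0 \<in> borel_measurable (N0 \<Otimes>\<^sub>M seqs Q)" "snd p0 \<in> borel_measurable (N0 \<Otimes>\<^sub>M seqs Q)"
    and YZ0: "\<And>q. q \<in> space (N0 \<Otimes>\<^sub>M seqs Q) \<Longrightarrow> fst p0 q \<le> snd p0 q"
    using p0s by (auto simp: steps_def)
  have mps: "\<forall>r\<in>set (replicate k p). fst r \<in> borel_measurable (N1 \<Otimes>\<^sub>M seqs Q) \<and> snd r \<in> borel_measurable (N1 \<Otimes>\<^sub>M seqs Q)" for k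
    using mp by auto
  define h where "h m = hit (N1 \<Otimes>\<^sub>M seqs Q) (replicate m p)" for m
  have h01: "0 \<le> h m u" "h m u \<le> 1" "u \<le> w \<Longrightarrow> h m w \<le> h m u" "m \<le> k \<Longrightarrow> h m u \<le> h k u" for m k u w
    unfolding h_def using Q1.P.hit_nonneg[OF mps] Q1.P.hit_le_1[OF mps] Q1.P.hit_antimono[OF mps] Q1.P.hit_replicate_mono'[OF mp] by auto
  define v where "v u = (SUP m. h m u)" for u
  have bdd: "bdd_above (range (\<lambda>m. h m u))" for u by (rule bdd_aboveI[of _ 1]) (auto simp: h01)
  have le_v: "h m u \<le> v u" for m u unfolding v_def by (rule cSUP_upper[OF UNIV_I bdd])
  have v01: "0 \<le> v u" "v u \<le> 1" for u
    using order_trans[OF h01(1) le_v] by (auto simp: v_def h01 intro: cSUP_least)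
  have v_anti: "v w \<le> v u" if "u \<le> w" for u w
    unfolding v_def using that by (intro cSUP_mono bdd) (auto intro: h01)
  have v_lim: "(\<lambda>m. h m u) \<longlonglongrightarrow> v u" for u
    unfolding v_def by (rule LIMSEQ_incseq_SUP[OF bdd]) (auto simp: incseq_def h01)
  have [measurable]: "v \<in> borel_measurable borel" "h m \<in> borel_measurable borel" for m
    using v_anti h01 by (auto intro: borel_measurable_antimono)
  have v_asym: "((\<lambda>y. v y / tail H y) \<longlongrightarrow> C / \<mu>) at_top"
    unfolding v_def h_def
  proof (rule hit_iid_asymptotics)
    show "prob_space (N1 \<Otimes>\<^sub>M seqs Q)" by (rule Q1.P.prob_space_axioms)
    show "integrable (N1 \<Otimes>\<^sub>M seqs Q) (fst p)" unfolding p_def by (rule cyc_step_fst(1)[OF N1 len x len_int a_int])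
    show "integrable (N1 \<Otimes>\<^sub>M seqs Q) (snd p)" unfolding p_def by (rule cyc_step_snd(1)[OF N1 len x len_int])
    show "(\<integral>q. fst p q \<partial>(N1 \<Otimes>\<^sub>M seqs Q)) = - \<mu>" unfolding p_def cyc_step_fst(2)[OF N1 len x len_int a_int] by (rule mean)
    have "((\<lambda>y. (\<integral>\<omega>. Q.excess (map g (block x len \<omega>)) y \<partial>N1) / tail H y) \<longlongrightarrow> C) at_top"
      unfolding C_def by (rule mean_excess_asymptotics[OF N1 len x len_int c_meas len_excess])
    moreover have "\<forall>\<^sub>F y in at_top. (\<integral>\<omega>. Q.excess (map g (block x len \<omega>)) y \<partial>N1) / tail H y
       = (\<integral>q. max 0 (snd p q - y) \<partial>(N1 \<Otimes>\<^sub>M seqs Q)) / tail H y"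
      using eventually_ge_at_top[of 0]
    proof eventually_elim
      case (elim y)
      show ?case unfolding p_def cyc_step_snd(2)[OF N1 len x len_int elim] ..
    qed
    ultimately show "((\<lambda>y. (\<integral>q. max 0 (snd p q - y) \<partial>(N1 \<Otimes>\<^sub>M seqs Q)) / tail H y) \<longlongrightarrow> C) at_top"
      by (rule Lim_transform_eventually)
  qed (use ps \<mu> in auto)
  have C\<mu>: "0 \<le> C / \<mu>" using v_asym by (rule tendsto_lowerbound) (auto simp: v01 tail_nonneg)
  define tot where "tot m y = (\<integral>\<omega>. (\<integral>cs. hitg (block x0 len0 \<omega> @ blocks x len m cs) y \<partial>seqs N1) \<partial>N0)" for m y
  have tot_eq: "tot m y = (\<integral>q. (if y < snd p0 q then 1 else h m (y - fst p0 q)) \<partial>(N0 \<Otimes>\<^sub>M seqs Q))" if y: "0 \<le> y" for m y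
  proof -
    obtain z l where zl: "\<And>i. z i \<in> measurable (seqs N1) SX" "l \<in> measurable (seqs N1) (count_space UNIV)"
      "\<And>cs. blocks x len m cs = block z l cs" by (rule blocks_eq_block[where x=x and N=N1 and SX=SX and len=len and m=m, OF x len]) blast
    have "tot m y = (\<integral>q. (if y < snd p0 q then 1 else (\<integral>cs. hitg (block z l cs) (y - fst p0 q) \<partial>seqs N1)) \<partial>(N0 \<Otimes>\<^sub>M seqs Q))"
      unfolding tot_def zl(3) p0_def by (rule integral_first_block[OF N0 x0 len0 SN.prob_space_axioms zl(1,2) y])
    also have "\<dots> = (\<integral>q. (if y < snd p0 q then 1 else h m (y - fst p0 q)) \<partial>(N0 \<Otimes>\<^sub>M seqs Q))"
    proof (intro Bochner_Integration.integral_cong refl if_cong)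
      fix q assume "q \<in> space (N0 \<Otimes>\<^sub>M seqs Q)" "\<not> y < snd p0 q"
      then have "0 \<le> y - fst p0 q" using YZ0[of q] by linarith
      from hit_blocks[where x=x and m=m, OF N1 x len this]
      show "(\<integral>cs. hitg (block z l cs) (y - fst p0 q) \<partial>seqs N1) = h m (y - fst p0 q)" by (simp only: zl(3) h_def p_def)
    qed
    finally show ?thesis .
  qed
  define T where "T y = (\<integral>q. (if y < snd p0 q then 1 else v (y - fst p0 q)) \<partial>(N0 \<Otimes>\<^sub>M seqs Q))" for y
  have iT: "integrable (N0 \<Otimes>\<^sub>M seqs Q) (\<lambda>q. if y < snd p0 q then 1 else v (y - fst p0 q))" for y
    by (rule R.P.integrable_bounded[where B=1]) (auto simp: v01)
  have ih: "integrable (N0 \<Otimes>\<^sub>M seqs Q) (\<lambda>q. if y < snd p0 q then 1 else h m (y - fst p0 q))" for y m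
    by (rule R.P.integrable_bounded[where B=1]) (auto simp: h01)
  \<comment> \<open>The probabilities increase in \<open>m\<close> and are at most 1, so the
    supremum is a limit and passes inside the integral over the initial cycle.\<close>
  have SUP_T: "(SUP m. tot m y) = T y" if y: "0 \<le> y" for y
  proof (rule LIMSEQ_unique)
    show "(\<lambda>m. tot m y) \<longlonglongrightarrow> (SUP m. tot m y)"
    proof (rule LIMSEQ_incseq_SUP)
      show "bdd_above (range (\<lambda>m. tot m y))"
      proof (rule bdd_aboveI[of _ 1])
        fix r assume "r \<in> range (\<lambda>m. tot m y)"
        then obtain m where r: "r = tot m y" by auto
        show "r \<le> 1" unfolding r tot_eq[OF y] by (rule R.P.integral_le_bound) (auto simp: h01)
      qed
      show "incseq (\<lambda>m. tot m y)"
        unfolding incseq_def tot_eq[OF y] using ih by (auto intro!: integral_mono simp: h01)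
    qed
    show "(\<lambda>m. tot m y) \<longlonglongrightarrow> T y"
      unfolding tot_eq[OF y] T_def
    proof (rule integral_dominated_convergence[where w="\<lambda>_. 1"])
      show "AE q in N0 \<Otimes>\<^sub>M seqs Q. (\<lambda>m. if y < snd p0 q then 1 else h m (y - fst p0 q)) \<longlonglongrightarrow> (if y < snd p0 q then 1 else v (y - fst p0 q))"
        using v_lim by (intro AE_I2) auto
    qed (auto simp: h01)
  qed
  have upper: "\<forall>\<^sub>F y in at_top. T y \<le> k' * tail H y" if k': "C / \<mu> < k'" for k'
  proof -
    define t where "t = (k' - C / \<mu>) / 2"
    have t: "0 < t" "k' = t + (C / \<mu> + t)" using k' by (auto simp: t_def field_simps)
    have tl: "\<forall>\<^sub>F y in at_top. measure (N0 \<Otimes>\<^sub>M seqs Q) {q \<in> space (N0 \<Otimes>\<^sub>M seqs Q). y < snd p0 q} \<le> \<epsilon> * tail H y" if \<epsilon>: "0 < \<epsilon>" for \<epsilon>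
    proof -
      have "\<forall>\<^sub>F y in at_top. (\<integral>\<omega>. hitg (block x0 len0 \<omega>) y \<partial>N0) \<le> \<epsilon> * tail H y"
        by (rule block_tail_small[where x=x0, OF N0 len0 x0 _ \<epsilon>]) (rule len0_tail)
      then show ?thesis using eventually_ge_at_top[of 0]
    proof eventually_elim
      case (elim y)
      show ?case unfolding p0_def prob_cyc_step[where x=x0, OF N0 len0 x0 elim(2)] by (rule elim(1))
    qed
    qed
    have "\<forall>\<^sub>F y in at_top. (\<integral>q. v (max 0 (y - snd p0 q)) \<partial>(N0 \<Otimes>\<^sub>M seqs Q)) \<le> (C / \<mu> + t) * tail H y"
    proof (rule smoothing_upper[where k="C / \<mu>"])
      fix k' assume "C / \<mu> < k'"
      from eventually_ratio_less[OF v_asym this] show "\<forall>\<^sub>F y in at_top. v y \<le> k' * tail H y" by eventually_elim simp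
    qed (use t C\<mu> tl v01 v_anti R.P.prob_space_axioms in auto)
    then show ?thesis using tl[OF t(1)]
    proof eventually_elim
      case (elim y)
      have "T y \<le> (\<integral>q. (if y < snd p0 q then 1 else 0) + v (max 0 (y - snd p0 q)) \<partial>(N0 \<Otimes>\<^sub>M seqs Q))"
        unfolding T_def
      proof (rule integral_mono[OF iT])
        show "integrable (N0 \<Otimes>\<^sub>M seqs Q) (\<lambda>q. (if y < snd p0 q then 1 else 0) + v (max 0 (y - snd p0 q)))"
          by (intro Bochner_Integration.integrable_add R.P.prob_gt_eq_integral R.P.integrable_bounded[where B=1]) (auto simp: v01)
        fix q assume q: "q \<in> space (N0 \<Otimes>\<^sub>M seqs Q)"
        show "(if y < snd p0 q then 1 else v (y - fst p0 q)) \<le> (if y < snd p0 q then 1 else 0) + v (max 0 (y - snd p0 q))"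
          using YZ0[OF q] v01(1)[of "max 0 (y - snd p0 q)"] by (auto intro!: v_anti)
      qed
      also have "\<dots> = measure (N0 \<Otimes>\<^sub>M seqs Q) {q \<in> space (N0 \<Otimes>\<^sub>M seqs Q). y < snd p0 q} + (\<integral>q. v (max 0 (y - snd p0 q)) \<partial>(N0 \<Otimes>\<^sub>M seqs Q))"
        by (subst Bochner_Integration.integral_add)
          (auto intro!: R.P.prob_gt_eq_integral R.P.integrable_bounded[where B=1] simp: v01 R.P.prob_gt_eq_integral(2)[OF mp0(2)])
      also have "\<dots> \<le> t * tail H y + (C / \<mu> + t) * tail H y" using elim by (intro add_mono)
      also have "\<dots> = k' * tail H y" unfolding t(2) by (simp add: algebra_simps)
      finally show ?case .
    qed
  qed
  have lower: "\<forall>\<^sub>F y in at_top. k' * tail H y < T y" if k': "k' < C / \<mu>" for k'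
  proof -
    have "((\<lambda>t. (1 - t) * (C / \<mu>)) \<longlongrightarrow> (1 - 0) * (C / \<mu>)) (at_right 0)" by (intro tendsto_intros)
    then have "\<forall>\<^sub>F t in at_right 0. k' < (1 - t) * (C / \<mu>)"
      by (rule order_tendstoD) (use k' in auto)
    moreover have "\<forall>\<^sub>F t in at_right 0. t < (1::real)"
      by (rule eventually_at_rightI[of _ 1]) auto
    ultimately have "\<forall>\<^sub>F t in at_right 0. 0 < t \<and> t < (1::real) \<and> k' < (1 - t) * (C / \<mu>)"
      using eventually_at_right_less[of "0::real"] by eventually_elim auto
    then obtain t where t: "0 < t" "t < 1" "k' < (1 - t) * (C / \<mu>)"
      using eventually_happens by (metis (no_types, lifting) trivial_limit_at_right_real)
    \<comment> \<open>Choose \<open>l\<close> such that the initial cycle moves the walk down by at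
      most \<open>l\<close> with probability above \<open>1 - t\<close>; on that event the level
      still to be passed is at most \<open>y + l\<close>.\<close>
    have "((\<lambda>l. tail (distr (N0 \<Otimes>\<^sub>M seqs Q) borel (\<lambda>q. - fst p0 q)) l) \<longlongrightarrow> 0) at_top"
      by (intro real_distribution.tail_tendsto_0 R.P.real_distribution_distr) simp
    then have "\<forall>\<^sub>F l in at_top. tail (distr (N0 \<Otimes>\<^sub>M seqs Q) borel (\<lambda>q. - fst p0 q)) l < t"
      by (rule order_tendstoD) (use t in auto)
    then obtain l where l: "tail (distr (N0 \<Otimes>\<^sub>M seqs Q) borel (\<lambda>q. - fst p0 q)) l < t"
      using eventually_happens by (metis (no_types, lifting) trivial_limit_at_top_linorder)
    define B where "B = {q \<in> space (N0 \<Otimes>\<^sub>M seqs Q). - fst p0 q \<le> l}"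
    have [measurable]: "B \<in> sets (N0 \<Otimes>\<^sub>M seqs Q)" unfolding B_def by measurable
    have B: "1 - t \<le> measure (N0 \<Otimes>\<^sub>M seqs Q) B"
    proof -
      have "tail (distr (N0 \<Otimes>\<^sub>M seqs Q) borel (\<lambda>q. - fst p0 q)) l = measure (N0 \<Otimes>\<^sub>M seqs Q) (space (N0 \<Otimes>\<^sub>M seqs Q) - B)"
        unfolding tail_def B_def by (subst measure_distr) (auto intro!: arg_cong[where f="measure (N0 \<Otimes>\<^sub>M seqs Q)"])
      then show ?thesis using l R.P.prob_compl[of B] by simp
    qed
    have TB: "(1 - t) * v (y + l) \<le> T y" for y
    proof -
      have "(1 - t) * v (y + l) \<le> measure (N0 \<Otimes>\<^sub>M seqs Q) B * v (y + l)"
        using B by (intro mult_right_mono v01)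
      also have "\<dots> = (\<integral>q. indicator B q * v (y + l) \<partial>(N0 \<Otimes>\<^sub>M seqs Q))" by simp
      also have "\<dots> \<le> T y"
        unfolding T_def
      proof (rule integral_mono[OF _ iT])
        show "integrable (N0 \<Otimes>\<^sub>M seqs Q) (\<lambda>q. indicator B q * v (y + l))"
          by (intro R.P.integrable_bounded[where B=1]) (auto simp: indicator_def v01)
        show "indicator B q * v (y + l) \<le> (if y < snd p0 q then 1 else v (y - fst p0 q))" for q
          using v01 by (auto simp: indicator_def B_def intro!: v_anti)
      qed
      finally show ?thesis .
    qed
    have "((\<lambda>y. (1 - t) * v (y + l) / tail H y) \<longlongrightarrow> (1 - t) * (C / \<mu>)) at_top"
      using tendsto_mult[OF tendsto_const ratio_shift[OF v_asym], of "1 - t" l] by simp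
    from eventually_ratio_greater[OF this t(3)] show ?thesis
      by eventually_elim (use TB in \<open>auto intro: less_le_trans\<close>)
  qed
  have "((\<lambda>y. T y / tail H y) \<longlongrightarrow> C / \<mu>) at_top"
  proof (rule order_tendstoI)
    fix L assume "L < C / \<mu>"
    from lower[OF this] show "\<forall>\<^sub>F y in at_top. L < T y / tail H y"
      by eventually_elim (simp add: pos_less_divide_eq tail_pos)
  next
    fix L assume "C / \<mu> < L"
    then obtain L' where L': "C / \<mu> < L'" "L' < L" using dense by blast
    from upper[OF L'(1)] show "\<forall>\<^sub>F y in at_top. T y / tail H y < L"
    proof eventually_elim
      case (elim y)
      have "L' * tail H y < L * tail H y" using L' by (intro mult_strict_right_mono tail_pos)
      from le_less_trans[OF elim this] show ?case by (simp add: pos_divide_less_eq tail_pos)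
    qed
  qed
  moreover have "\<forall>\<^sub>F y in at_top. T y / tail H y = (SUP m. tot m y) / tail H y"
    using eventually_ge_at_top[of 0] by eventually_elim (simp add: SUP_T)
  ultimately show ?thesis
    unfolding tot_def C_def by (rule Lim_transform_eventually)
qed

end

section \<open>Integrated tails and the quantile coupling\<close>

context real_distribution
begin

lemma nn_integrated_tail:
  assumes int: "integrable M (\<lambda>x. x)"
  shows "(\<integral>\<^sup>+z. ennreal (indicator {y..} z * tail M z) \<partial>lborel) = ennreal (\<integral>x. max 0 (x - y) \<partial>M)"
proof -
  interpret PL: pair_sigma_finite M lborel ..
  have [measurable_cong]: "sets M = sets borel" by simp
  have "(\<integral>\<^sup>+z. ennreal (indicator {y..} z * tail M z) \<partial>lborel)
     = (\<integral>\<^sup>+z. (\<integral>\<^sup>+x. indicator {y..} z * indicator {z<..} x \<partial>M) \<partial>lborel)"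
  proof (intro nn_integral_cong)
    fix z
    have "(\<integral>\<^sup>+x. indicator {y..} z * indicator {z<..} x \<partial>M) = indicator {y..} z * emeasure M {z<..}"
      by (subst nn_integral_cmult) auto
    also have "\<dots> = ennreal (indicator {y..} z * tail M z)"
      by (auto simp: indicator_def tail_def emeasure_eq_measure)
    finally show "ennreal (indicator {y..} z * tail M z) = (\<integral>\<^sup>+x. indicator {y..} z * indicator {z<..} x \<partial>M)" ..
  qed
  also have "\<dots> = (\<integral>\<^sup>+x. (\<integral>\<^sup>+z. indicator {y..} z * indicator {z<..} x \<partial>lborel) \<partial>M)"
    by (rule PL.Fubini') (simp add: indicator_def)
  also have "\<dots> = (\<integral>\<^sup>+x. ennreal (max 0 (x - y)) \<partial>M)"
  proof (intro nn_integral_cong)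
    fix x
    have "(\<integral>\<^sup>+z. indicator {y..} z * indicator {z<..} x \<partial>lborel) = (\<integral>\<^sup>+z. indicator {y..<x} z \<partial>lborel)"
      by (intro nn_integral_cong) (auto split: split_indicator)
    also have "\<dots> = ennreal (max 0 (x - y))" by (cases "y \<le> x") (auto simp: max_def)
    finally show "(\<integral>\<^sup>+z. indicator {y..} z * indicator {z<..} x \<partial>lborel) = ennreal (max 0 (x - y))" .
  qed
  also have "\<dots> = ennreal (\<integral>x. max 0 (x - y) \<partial>M)"
    using integrable_max0[OF int] by (intro nn_integral_eq_integral) auto
  finally show ?thesis .
qed

lemma integrated_tail:
  assumes int: "integrable M (\<lambda>x. x)"
  shows "(LINT z:{y..}|lborel. (1 - cdf M z)) = (\<integral>x. max 0 (x - y) \<partial>M)"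
proof -
  have "(LINT z:{y..}|lborel. (1 - cdf M z)) = (\<integral>z. indicator {y..} z * tail M z \<partial>lborel)"
    by (simp add: set_lebesgue_integral_def tail_eq_cdf)
  also have "\<dots> = enn2real (\<integral>\<^sup>+z. ennreal (indicator {y..} z * tail M z) \<partial>lborel)"
    by (rule integral_eq_nn_integral) (auto simp: tail_nonneg)
  also have "\<dots> = (\<integral>x. max 0 (x - y) \<partial>M)"
    unfolding nn_integrated_tail[OF int] by (auto intro!: enn2real_ennreal Bochner_Integration.integral_nonneg)
  finally show ?thesis .
qed

lemma itail_eq:
  assumes "integrable M (\<lambda>x. x)"
  shows "itail M y = min 1 (\<integral>x. max 0 (x - y) \<partial>M)"
  by (simp add: itail_def integrated_tail[OF assms])

lemma excess_ge_itail:
  assumes "integrable M (\<lambda>x. x)"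
  shows "\<forall>\<^sub>F y in at_top. (\<integral>x. max 0 (x - y) \<partial>M) = itail M y"
proof -
  have "\<forall>\<^sub>F y in at_top. (\<integral>x. max 0 (x - y) \<partial>M) < 1"
    by (rule order_tendstoD(2)[OF expected_excess_tendsto_0[OF assms]]) simp
  then show ?thesis by eventually_elim (simp add: itail_eq[OF assms])
qed

lemma itail_antimono:
  assumes "integrable M (\<lambda>x. x)" "u \<le> v"
  shows "itail M v \<le> itail M u"
  unfolding itail_eq[OF assms(1)]
  by (intro min.mono order_refl integral_mono integrable_max0 assms(1)) (use assms(2) in auto)

lemma itail_tendsto_0:
  assumes "integrable M (\<lambda>x. x)"
  shows "(itail M \<longlongrightarrow> 0) at_top"
  by (rule Lim_transform_eventually[OF expected_excess_tendsto_0[OF assms] excess_ge_itail[OF assms]])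

text \<open>The mean excess is 1-Lipschitz in its level. Continuity makes
  \<open>1 - itail M y\<close> right-continuous, as a distribution function must be.\<close>

lemma isCont_itail:
  assumes int: "integrable M (\<lambda>x. x)"
  shows "isCont (itail M) y"
proof -
  have lip: "\<bar>(\<integral>x. max 0 (x - u) \<partial>M) - (\<integral>x. max 0 (x - v) \<partial>M)\<bar> \<le> \<bar>u - v\<bar>" for u v
  proof -
    have "\<bar>(\<integral>x. max 0 (x - u) \<partial>M) - (\<integral>x. max 0 (x - v) \<partial>M)\<bar> = \<bar>\<integral>x. max 0 (x - u) - max 0 (x - v) \<partial>M\<bar>"
      using integrable_max0[OF int] by simp
    also have "\<dots> \<le> (\<integral>x. \<bar>max 0 (x - u) - max 0 (x - v)\<bar> \<partial>M)" by (rule integral_abs_bound)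
    also have "\<dots> \<le> (\<integral>x. \<bar>u - v\<bar> \<partial>M)"
      using integrable_max0[OF int] by (intro integral_mono integrable_abs Bochner_Integration.integrable_diff) auto
    finally show ?thesis using prob_space by simp
  qed
  have "(\<lambda>y. \<integral>x. max 0 (x - y) \<partial>M) \<midarrow>y\<rightarrow> (\<integral>x. max 0 (x - y) \<partial>M)"
  proof (rule LIM_I)
    fix r :: real assume r: "0 < r"
    show "\<exists>s>0. \<forall>v. v \<noteq> y \<and> norm (v - y) < s \<longrightarrow> norm ((\<integral>x. max 0 (x - v) \<partial>M) - (\<integral>x. max 0 (x - y) \<partial>M)) < r"
      using r le_less_trans[OF lip] by (intro exI[of _ r]) auto
  qed
  then have "isCont (\<lambda>y. \<integral>x. max 0 (x - y) \<partial>M) y" by (simp add: isCont_def)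
  then have "isCont (\<lambda>y. min 1 (\<integral>x. max 0 (x - y) \<partial>M)) y"
    by (intro continuous_intros)
  then show ?thesis by (simp add: itail_eq[OF int, abs_def])
qed

end

text \<open>The integrated tail distribution with its mass on the negative half-line moved to an
  atom at 0. It is the measure to which \<open>subexponential\<close> refers.\<close>

definition itail_law :: "real measure \<Rightarrow> real measure" where
  "itail_law F = interval_measure (pos_part_cdf (\<lambda>y. 1 - itail F y))"

lemma itail_law:
  assumes F: "real_distribution F" and int: "integrable F (\<lambda>x. x)"
  shows "real_distribution (itail_law F)" and "tail (itail_law F) v = (if v < 0 then 1 else itail F v)"
proof -
  interpret F: real_distribution F by fact
  let ?p = "pos_part_cdf (\<lambda>y. 1 - itail F y)"
  have i1: "itail F y \<le> 1" for y by (simp add: itail_def)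
  have mono: "?p u \<le> ?p v" if "u \<le> v" for u v
    using F.itail_antimono[OF int that] that i1 by (auto simp: pos_part_cdf_def)
  have cont: "continuous (at_right a) ?p" for a
  proof (cases "0 \<le> a")
    case True
    have "((\<lambda>y. 1 - itail F y) \<longlongrightarrow> 1 - itail F a) (at_right a)"
      using F.isCont_itail[OF int, of a] unfolding isCont_def
      by (intro tendsto_intros) (rule tendsto_within_subset, auto)
    moreover have "\<forall>\<^sub>F y in at_right a. 1 - itail F y = ?p y"
      using eventually_at_right_less[of a] by eventually_elim (use True in \<open>simp add: pos_part_cdf_def\<close>)
    ultimately have "(?p \<longlongrightarrow> 1 - itail F a) (at_right a)" by (rule Lim_transform_eventually)
    then show ?thesis using True by (simp add: continuous_within pos_part_cdf_def)
  next
    case False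
    then have "\<forall>\<^sub>F y in at_right a. 0 = ?p y"
      by (intro eventually_at_rightI[of _ 0]) (auto simp: pos_part_cdf_def)
    then have "(?p \<longlongrightarrow> 0) (at_right a)" by (rule Lim_transform_eventually[OF tendsto_const])
    then show ?thesis using False by (simp add: continuous_within pos_part_cdf_def)
  qed
  have bot: "(?p \<longlongrightarrow> 0) at_bot"
  proof (rule Lim_transform_eventually[OF tendsto_const])
    show "\<forall>\<^sub>F y in at_bot. 0 = ?p y"
      by (rule eventually_mono[OF eventually_le_at_bot[of "-1::real"]]) (auto simp: pos_part_cdf_def)
  qed
  have top: "(?p \<longlongrightarrow> 1) at_top"
  proof (rule Lim_transform_eventually)
    show "((\<lambda>y. 1 - itail F y) \<longlongrightarrow> 1) at_top"
      using tendsto_diff[OF tendsto_const F.itail_tendsto_0[OF int], of 1] by simp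
    show "\<forall>\<^sub>F y in at_top. 1 - itail F y = ?p y"
      using eventually_ge_at_top[of 0] by eventually_elim (simp add: pos_part_cdf_def)
  qed
  show rd: "real_distribution (itail_law F)"
    unfolding itail_law_def by (rule real_distribution_interval_measure[OF mono cont bot top])
  have "cdf (itail_law F) = ?p"
    unfolding itail_law_def by (rule cdf_interval_measure[OF mono cont bot])
  then show "tail (itail_law F) v = (if v < 0 then 1 else itail F v)"
    by (simp add: real_distribution.tail_eq_cdf[OF rd] pos_part_cdf_def)
qed

lemma subexp_law_itail:
  assumes F: "real_distribution F" and int: "integrable F (\<lambda>x. x)"
    and sub: "subexponential (\<lambda>y. 1 - itail F y)"
  shows "subexp_law (itail_law F)"
proof -
  let ?H = "itail_law F"
  interpret H: real_distribution ?H by (rule itail_law(1)[OF F int])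
  interpret HH: pair_prob_space ?H ?H ..
  note tl = itail_law(2)[OF F int]
  have [measurable_cong]: "sets ?H = sets borel" by simp
  have m: "1 - measure (?H \<star> ?H) {..y} = (\<integral>h. tail ?H (y - h) \<partial>?H)" for y
  proof -
    have "measure (?H \<star> ?H) {..y} = measure (?H \<Otimes>\<^sub>M ?H) ((\<lambda>(x, h). x + h) -` {..y} \<inter> space (?H \<Otimes>\<^sub>M ?H))"
      unfolding convolution_def by (rule measure_distr) auto
    also have "\<dots> = (\<integral>p. indicator ((\<lambda>(x, h). x + h) -` {..y} \<inter> space (?H \<Otimes>\<^sub>M ?H)) p \<partial>(?H \<Otimes>\<^sub>M ?H))"
      by simp
    also have "\<dots> = (\<integral>h. (\<integral>x. indicator ((\<lambda>(x, h). x + h) -` {..y} \<inter> space (?H \<Otimes>\<^sub>M ?H)) (h, x) \<partial>?H) \<partial>?H)"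
      by (rule HH.integral_fst'[symmetric], rule HH.integrable_bounded[where B=1]) (auto simp: indicator_def)
    also have "\<dots> = (\<integral>h. 1 - tail ?H (y - h) \<partial>?H)"
    proof (intro Bochner_Integration.integral_cong refl)
      fix h
      have "(\<lambda>x. indicator ((\<lambda>(x, h). x + h) -` {..y} \<inter> space (?H \<Otimes>\<^sub>M ?H)) (h, x) :: real) = indicator {..y - h}"
        by (auto simp: indicator_def space_pair_measure fun_eq_iff)
      then show "(\<integral>x. indicator ((\<lambda>(x, h). x + h) -` {..y} \<inter> space (?H \<Otimes>\<^sub>M ?H)) (h, x) \<partial>?H) = 1 - tail ?H (y - h)"
        by (simp add: H.tail_eq_cdf cdf_def)
    qed
    also have "\<dots> = 1 - (\<integral>h. tail ?H (y - h) \<partial>?H)"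
      using H.prob_space by (subst Bochner_Integration.integral_diff)
        (auto intro!: H.integrable_bounded[where B=1] simp: tail_nonneg H.tail_le_1)
    finally show ?thesis by simp
  qed
  have t: "1 - pos_part_cdf (\<lambda>y. 1 - itail F y) y = tail ?H y" for y
    by (simp add: pos_part_cdf_def tl)
  show ?thesis
  proof
    show "tail ?H v = 1" if "v < 0" for v using that by (simp add: tl)
    show "((\<lambda>y. (\<integral>h. tail ?H (y - h) \<partial>?H) / tail ?H y) \<longlongrightarrow> 2) at_top"
      using sub unfolding subexponential_def Let_def itail_law_def[symmetric] m t .
  qed
qed

section \<open>Quantile functions driven by a uniform variable\<close>

definition quantile :: "real measure \<Rightarrow> real \<Rightarrow> real" where
  "quantile F u = Inf {y. u \<le> cdf F y}"

abbreviation unit_uniform :: "real measure" where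
  "unit_uniform \<equiv> restrict_space lborel {0<..<1}"

lemma space_unit_uniform: "space unit_uniform = {0<..<1}"
  by (simp add: space_restrict_space)

lemma prob_space_unit_uniform: "prob_space unit_uniform"
  by (rule prob_spaceI) (simp add: emeasure_restrict_space space_restrict_space)

lemma quantile_le_iff:
  assumes "real_distribution F" "0 < u" "u < 1"
  shows "quantile F u \<le> y \<longleftrightarrow> u \<le> cdf F y"
proof -
  interpret cdf_distribution F by (simp add: cdf_distribution_def assms)
  show ?thesis unfolding quantile_def by (rule pseudoinverse[OF assms(2,3), symmetric])
qed

lemma distr_quantile:
  assumes "real_distribution F"
  shows "quantile F \<in> borel_measurable unit_uniform" "distr unit_uniform borel (quantile F) = F"
proof -
  interpret cdf_distribution F by (simp add: cdf_distribution_def assms)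
  have "quantile F \<in> borel_measurable (restrict_space borel {0<..<1})"
    using measurable_CI by (simp add: quantile_def[abs_def])
  also have "measurable (restrict_space borel {0<..<1}) (borel :: real measure) = measurable unit_uniform borel"
    by (rule measurable_cong_sets) (simp_all add: sets_restrict_space)
  finally show "quantile F \<in> borel_measurable unit_uniform" .
  show "distr unit_uniform borel (quantile F) = F"
    using distr_I_eq_M by (simp add: quantile_def[abs_def])
qed

lemma integral_quantile:
  fixes f :: "real \<Rightarrow> real"
  assumes F: "real_distribution F" and f: "f \<in> borel_measurable borel"
  shows "(\<integral>u. f (quantile F u) \<partial>unit_uniform) = (\<integral>x. f x \<partial>F)"
    and "integrable unit_uniform (\<lambda>u. f (quantile F u)) \<longleftrightarrow> integrable F f"
  using integral_distr[OF distr_quantile(1)[OF F] f] integrable_distr_eq[OF distr_quantile(1)[OF F] f]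
  unfolding distr_quantile(2)[OF F] by auto

lemma quantile_mono:
  assumes "real_distribution F" "real_distribution G" "\<And>y. 1 - cdf F y \<le> 1 - cdf G y" "0 < u" "u < 1"
  shows "quantile F u \<le> quantile G u"
proof -
  have "u \<le> cdf G (quantile G u)" using quantile_le_iff[OF assms(2,4,5)] by blast
  also have "\<dots> \<le> cdf F (quantile G u)" using assms(3)[of "quantile G u"] by simp
  finally show ?thesis using quantile_le_iff[OF assms(1,4,5)] by blast
qed

text \<open>By \<open>quantile_le_iff\<close> the sublevel sets in both variables are described by
  the distribution function at a fixed point, which is measurable in \<open>x\<close>.\<close>

lemma measurable_quantile:
  assumes F: "\<And>x. x \<in> space SX \<Longrightarrow> real_distribution (Fm x)" and m: "\<And>y. (\<lambda>x. cdf (Fm x) y) \<in> borel_measurable SX"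
  shows "(\<lambda>p. quantile (Fm (fst p)) (snd p)) \<in> borel_measurable (SX \<Otimes>\<^sub>M unit_uniform)"
proof (subst borel_measurable_iff_le, rule allI)
  fix a
  have [measurable]: "(\<lambda>p. snd p) \<in> borel_measurable (SX \<Otimes>\<^sub>M unit_uniform)"
  proof (rule measurable_compose[OF measurable_snd])
    show "(\<lambda>x. x) \<in> borel_measurable unit_uniform" by (rule measurable_restrict_space1) simp
  qed
  note [measurable] = m[of a]
  have "{p \<in> space (SX \<Otimes>\<^sub>M unit_uniform). quantile (Fm (fst p)) (snd p) \<le> a} = {p \<in> space (SX \<Otimes>\<^sub>M unit_uniform). snd p \<le> cdf (Fm (fst p)) a}"
    using quantile_le_iff[OF F] by (auto simp: space_pair_measure space_unit_uniform)
  also have "\<dots> \<in> sets (SX \<Otimes>\<^sub>M unit_uniform)" by measurable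
  finally show "{p \<in> space (SX \<Otimes>\<^sub>M unit_uniform). quantile (Fm (fst p)) (snd p) \<le> a} \<in> sets (SX \<Otimes>\<^sub>M unit_uniform)" .
qed

text \<open>Truncated means decrease in \<beta>, so the limit that defines \<kappa> is an infimum
  and some \<beta> has its supremum below \<open>b\<close>. A real \<open>s\<close> strictly between
  the two yields the gap \<open>b - s\<close>, the same for all states.\<close>

lemma kappa_less:
  assumes Fd: "\<And>x. x \<in> space SX \<Longrightarrow> real_distribution (Fm x)" and Fi: "\<And>x. x \<in> space SX \<Longrightarrow> integrable (Fm x) (\<lambda>y. y)"
    and k: "kappa SX Fm < ereal b"
  obtains \<beta> \<eta> where "0 \<le> \<beta>" "0 < \<eta>" "\<And>x. x \<in> space SX \<Longrightarrow> trunc_mean (Fm x) \<beta> \<le> b - \<eta>"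
proof -
  define f where "f \<beta> = (SUP x\<in>space SX. ereal (trunc_mean (Fm x) \<beta>))" for \<beta>
  have tm: "trunc_mean (Fm x) v \<le> trunc_mean (Fm x) u" if "u \<le> v" "x \<in> space SX" for u v x
  proof -
    interpret real_distribution "Fm x" by (rule Fd[OF that(2)])
    show ?thesis unfolding trunc_mean_def
      using Fi[OF that(2)] that by (intro integral_mono integrable_max) auto
  qed
  have anti: "f v \<le> f u" if "u \<le> v" for u v
    unfolding f_def using tm[OF that] by (intro SUP_mono) auto
  have "(f \<longlongrightarrow> (INF \<beta>. f \<beta>)) at_top"
  proof (rule order_tendstoI)
    fix a assume "a < (INF \<beta>. f \<beta>)"
    then show "\<forall>\<^sub>F \<beta> in at_top. a < f \<beta>" by (auto intro: always_eventually less_le_trans INF_lower)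
  next
    fix a assume "(INF \<beta>. f \<beta>) < a"
    then obtain \<beta>0 where "f \<beta>0 < a" by (auto simp: INF_less_iff)
    then show "\<forall>\<^sub>F \<beta> in at_top. f \<beta> < a"
      by (auto simp: eventually_at_top_linorder intro!: exI[of _ \<beta>0] intro: le_less_trans anti)
  qed
  then have "kappa SX Fm = (INF \<beta>. f \<beta>)"
    unfolding kappa_def f_def[symmetric] by (intro tendsto_Lim) auto
  with k have "(INF \<beta>. f \<beta>) < ereal b" by simp
  then obtain \<beta>0 where \<beta>0: "f \<beta>0 < ereal b" by (auto simp: INF_less_iff)
  define \<beta> where "\<beta> = max 0 \<beta>0"
  have "f \<beta> < ereal b" using \<beta>0 anti[of \<beta>0 \<beta>] by (auto simp: \<beta>_def intro: le_less_trans)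
  then obtain s where s: "f \<beta> < ereal s" "ereal s < ereal b" using ereal_dense2 by blast
  show ?thesis
  proof (rule that[of \<beta> "b - s"])
    show "0 \<le> \<beta>" by (simp add: \<beta>_def)
    show "0 < b - s" using s by simp
    fix x assume "x \<in> space SX"
    then have "ereal (trunc_mean (Fm x) \<beta>) \<le> f \<beta>" unfolding f_def by (rule SUP_upper)
    then have "ereal (trunc_mean (Fm x) \<beta>) < ereal s" using s(1) by (rule le_less_trans)
    then show "trunc_mean (Fm x) \<beta> \<le> b - (b - s)" by simp
  qed
qed

text \<open>Quantile coupling: driven by the same uniform variable, all increments are dominated by the reference one.\<close>

lemma modulated_walk_quantile:
  fixes SX :: "'x measure" and Fm :: "'x \<Rightarrow> real measure" and F :: "real measure" and c :: "'x \<Rightarrow> real"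
  assumes Fm_dist: "\<And>x. x \<in> space SX \<Longrightarrow> real_distribution (Fm x)"
    and Fm_mean: "\<And>x. x \<in> space SX \<Longrightarrow> integrable (Fm x) (\<lambda>y. y)"
    and Fm_meas: "\<And>y. (\<lambda>x. cdf (Fm x) y) \<in> borel_measurable SX"
    and F: "real_distribution F" and F_mean: "integrable F (\<lambda>y. y)"
    and sub: "subexponential (\<lambda>y. 1 - itail F y)"
    and D1: "\<And>x y. x \<in> space SX \<Longrightarrow> 1 - cdf (Fm x) y \<le> 1 - cdf F y"
    and D2: "\<And>x. x \<in> space SX \<Longrightarrow> ((\<lambda>y. itail (Fm x) y / itail F y) \<longlongrightarrow> c x) at_top"
    and b: "0 \<le> b" and \<beta>: "0 \<le> \<beta>" and \<eta>: "0 < \<eta>" and drift: "\<And>x. x \<in> space SX \<Longrightarrow> trunc_mean (Fm x) \<beta> \<le> b - \<eta>"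
  shows "modulated_walk (itail_law F) unit_uniform SX (\<lambda>x. quantile (Fm x)) (quantile F) c \<beta> b \<eta>"
proof -
  interpret H: subexp_law "itail_law F" by (rule subexp_law_itail[OF F F_mean sub])
  interpret Q: prob_space unit_uniform by (rule prob_space_unit_uniform)
  interpret F: real_distribution F by fact
  have mx: "(\<lambda>x::real. max 0 (x - y)) \<in> borel_measurable borel" "(\<lambda>x::real. max x y) \<in> borel_measurable borel" for y by measurable
  have id: "(\<lambda>x::real. x) \<in> borel_measurable borel" by simp
  have ev: "\<forall>\<^sub>F y in at_top. tail (itail_law F) y = itail F y"
    using eventually_ge_at_top[of 0] by eventually_elim (simp add: itail_law(2)[OF F F_mean])
  show ?thesis
  proof
    show "(\<lambda>p. quantile (Fm (fst p)) (snd p)) \<in> borel_measurable (SX \<Otimes>\<^sub>M unit_uniform)"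
      by (rule measurable_quantile[OF Fm_dist Fm_meas])
    show "integrable unit_uniform (quantile (Fm x))" if "x \<in> space SX" for x
      using integral_quantile(2)[OF Fm_dist[OF that] id] Fm_mean[OF that] by simp
    show "integrable unit_uniform (quantile F)"
      using integral_quantile(2)[OF F id] F_mean by simp
    show "quantile (Fm x) u \<le> quantile F u" if "x \<in> space SX" "u \<in> space unit_uniform" for x u
      using that by (intro quantile_mono Fm_dist F D1) (auto simp: space_unit_uniform)
    show "\<forall>\<^sub>F y in at_top. (\<integral>u. max 0 (quantile F u - y) \<partial>unit_uniform) = tail (itail_law F) y"
      using F.excess_ge_itail[OF F_mean] ev
      by eventually_elim (simp add: integral_quantile(1)[OF F mx(1)])
    show "((\<lambda>y. (\<integral>u. max 0 (quantile (Fm x) u - y) \<partial>unit_uniform) / tail (itail_law F) y) \<longlongrightarrow> c x) at_top" if x: "x \<in> space SX" for x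
    proof (rule Lim_transform_eventually[OF D2[OF x]])
      interpret Fx: real_distribution "Fm x" by (rule Fm_dist[OF x])
      show "\<forall>\<^sub>F y in at_top. itail (Fm x) y / itail F y = (\<integral>u. max 0 (quantile (Fm x) u - y) \<partial>unit_uniform) / tail (itail_law F) y"
        using Fx.excess_ge_itail[OF Fm_mean[OF x]] ev
        by eventually_elim (simp add: integral_quantile(1)[OF Fm_dist[OF x] mx(1)])
    qed
    show "(\<integral>u. max (quantile (Fm x) u) (- \<beta>) \<partial>unit_uniform) \<le> b - \<eta>" if x: "x \<in> space SX" for x
      using drift[OF x] integral_quantile(1)[OF Fm_dist[OF x] mx(2)] by (simp add: trunc_mean_def)
  qed (use b \<beta> \<eta> in auto)
qed

section \<open>The law of the increments\<close>

lemma less_wmax_iff: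
  assumes "0 \<le> y"
  shows "y < wmax (map h xs) v \<longleftrightarrow> (\<exists>k\<le>length xs. y < (\<Sum>j<k. h (xs ! j) (v j)))"
  using assms
proof (induction xs arbitrary: y v)
  case (Cons x xs)
  have shift: "(\<Sum>j<Suc k. h ((x # xs) ! j) (v j)) = h x (v 0) + (\<Sum>j<k. h (xs ! j) (v (Suc j)))" for k
    by (subst sum.lessThan_Suc_shift) simp
  have ex: "(\<exists>k\<le>length (x # xs). y < (\<Sum>j<k. h ((x # xs) ! j) (v j)))
      \<longleftrightarrow> (\<exists>k\<le>length xs. y - h x (v 0) < (\<Sum>j<k. h (xs ! j) (v (Suc j))))"
  proof
    assume "\<exists>k\<le>length (x # xs). y < (\<Sum>j<k. h ((x # xs) ! j) (v j))"
    then obtain k where k: "k \<le> Suc (length xs)" "y < (\<Sum>j<k. h ((x # xs) ! j) (v j))" by auto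
    \<comment> \<open>The empty sum cannot exceed \<open>y \<ge> 0\<close>, so \<open>k\<close> is
      positive.\<close>
    then obtain k' where k': "k = Suc k'" using Cons.prems by (cases k) auto
    show "\<exists>k\<le>length xs. y - h x (v 0) < (\<Sum>j<k. h (xs ! j) (v (Suc j)))"
      using k unfolding k' shift by (intro exI[of _ k']) auto
  next
    assume "\<exists>k\<le>length xs. y - h x (v 0) < (\<Sum>j<k. h (xs ! j) (v (Suc j)))"
    then obtain k where "k \<le> length xs" "y - h x (v 0) < (\<Sum>j<k. h (xs ! j) (v (Suc j)))" by auto
    then show "\<exists>k\<le>length (x # xs). y < (\<Sum>j<k. h ((x # xs) ! j) (v j))"
      using shift[of k] by (intro exI[of _ "Suc k"]) auto
  qed
  have "y < wmax (map h (x # xs)) v \<longleftrightarrow> y - h x (v 0) < wmax (map h xs) (\<lambda>i. v (Suc i))"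
    using Cons.prems by (auto simp: max_def)
  also have "\<dots> \<longleftrightarrow> (\<exists>k\<le>length xs. y - h x (v 0) < (\<Sum>j<k. h (xs ! j) (v (Suc j))))"
  proof (cases "0 \<le> y - h x (v 0)")
    case True
    then show ?thesis by (rule Cons.IH)
  next
    case False
    then have "y - h x (v 0) < wmax (map h xs) (\<lambda>i. v (Suc i))"
      using wmax_nonneg[of "map h xs"] by (meson less_le_trans not_le)
    moreover have "\<exists>k\<le>length xs. y - h x (v 0) < (\<Sum>j<k. h (xs ! j) (v (Suc j)))"
      using False by (intro exI[of _ 0]) auto
    ultimately show ?thesis by blast
  qed
  finally show ?case unfolding ex .
qed auto

text \<open>Lower orthants are stable under intersection and generate the product sigma-algebra, so
  a joint distribution function determines the law.\<close>

lemma PiM_borel_eqI: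
  fixes P Q :: "('i \<Rightarrow> real) measure"
  assumes I: "finite I" and P: "sets P = sets (\<Pi>\<^sub>M i\<in>I. borel)" "finite_measure P" and Q: "sets Q = sets (\<Pi>\<^sub>M i\<in>I. borel)"
    and eq: "\<And>y. emeasure P (\<Pi>\<^sub>E i\<in>I. {..y i}) = emeasure Q (\<Pi>\<^sub>E i\<in>I. {..y i})"
  shows "P = Q"
proof -
  interpret P: finite_measure P by fact
  let ?\<Omega> = "\<Pi>\<^sub>E i\<in>I. (UNIV :: real set)"
  define E where "E = range (\<lambda>y :: 'i \<Rightarrow> real. \<Pi>\<^sub>E i\<in>I. {..y i})"
  have EP: "E \<subseteq> Pow ?\<Omega>" by (auto simp: E_def PiE_def)
  have gen: "sets (\<Pi>\<^sub>M i\<in>I. borel :: real measure) = sigma_sets ?\<Omega> E"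
  proof
    show "sigma_sets ?\<Omega> E \<subseteq> sets (\<Pi>\<^sub>M i\<in>I. borel :: real measure)"
    proof (rule sets.sigma_sets_subset'[of E "\<Pi>\<^sub>M i\<in>I. borel :: real measure" ?\<Omega>])
      show "E \<subseteq> sets (\<Pi>\<^sub>M i\<in>I. borel)" using I by (auto simp: E_def intro!: sets_PiM_I_finite)
      show "?\<Omega> \<in> sets (\<Pi>\<^sub>M i\<in>I. borel)" using I by (intro sets_PiM_I_finite) auto
    qed
    have "sets (\<Pi>\<^sub>M i\<in>I. borel :: real measure) \<subseteq> sets (sigma ?\<Omega> E)"
    proof (rule sets_PiM_in_sets)
      show "space (sigma ?\<Omega> E) = (\<Pi>\<^sub>E i\<in>I. space (borel :: real measure))" using EP by (simp add: space_measure_of)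
      fix i A assume i: "i \<in> I" and A: "A \<in> sets (borel :: real measure)"
      have "(\<lambda>f. f i) \<in> borel_measurable (sigma ?\<Omega> E)"
      proof (subst borel_measurable_iff_le, rule allI)
        fix a
        \<comment> \<open>A half-space is a countable union of orthants: the other finitely many
          coordinates are bounded by some integer.\<close>
        have "{f \<in> space (sigma ?\<Omega> E). f i \<le> a} = (\<Union>n. \<Pi>\<^sub>E j\<in>I. {..(if j = i then a else real n)})"
        proof (intro equalityI subsetI)
          fix f assume f: "f \<in> {f \<in> space (sigma ?\<Omega> E). f i \<le> a}"
          then have f': "f \<in> ?\<Omega>" "f i \<le> a" using EP by (auto simp: space_measure_of)
          obtain n :: nat where n: "Max (insert 0 (f ` I)) \<le> real n" using real_arch_simple by blast
          have "f j \<le> real n" if "j \<in> I" for j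
            using that I n by (intro order_trans[OF Max_ge n]) auto
          then show "f \<in> (\<Union>n. \<Pi>\<^sub>E j\<in>I. {..(if j = i then a else real n)})"
            using f' by (intro UN_I[of n]) (auto simp: PiE_def)
        next
          fix f assume "f \<in> (\<Union>n. \<Pi>\<^sub>E j\<in>I. {..(if j = i then a else real n)})"
          then show "f \<in> {f \<in> space (sigma ?\<Omega> E). f i \<le> a}"
            using EP i by (auto simp: space_measure_of PiE_def Pi_def split: if_splits)
        qed
        also have "\<dots> \<in> sets (sigma ?\<Omega> E)"
          using EP by (intro sets.countable_UN) (auto simp: E_def intro!: in_measure_of)
        finally show "{f \<in> space (sigma ?\<Omega> E). f i \<le> a} \<in> sets (sigma ?\<Omega> E)" .
      qed
      then have "(\<lambda>f. f i) -` A \<inter> space (sigma ?\<Omega> E) \<in> sets (sigma ?\<Omega> E)" using A by (rule measurable_sets)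
      also have "(\<lambda>f. f i) -` A \<inter> space (sigma ?\<Omega> E) = {f \<in> space (sigma ?\<Omega> E). f i \<in> A}" by auto
      finally show "{f \<in> space (sigma ?\<Omega> E). f i \<in> A} \<in> sets (sigma ?\<Omega> E)" .
    qed
    then show "sets (\<Pi>\<^sub>M i\<in>I. borel :: real measure) \<subseteq> sigma_sets ?\<Omega> E" using EP by (simp add: sets_measure_of)
  qed
  show ?thesis
  proof (rule measure_eqI_generator_eq[where E=E and \<Omega>="?\<Omega>" and A="\<lambda>n. \<Pi>\<^sub>E i\<in>I. {..real n}"])
    show "Int_stable E"
    proof (rule Int_stableI)
      fix a b assume "a \<in> E" "b \<in> E"
      then obtain y z where "a = (\<Pi>\<^sub>E i\<in>I. {..y i})" "b = (\<Pi>\<^sub>E i\<in>I. {..z i})" by (auto simp: E_def)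
      then have "a \<inter> b = (\<Pi>\<^sub>E i\<in>I. {..min (y i) (z i)})" by (auto simp: PiE_def Pi_def)
      then show "a \<inter> b \<in> E" by (auto simp: E_def)
    qed
    show "(\<Union>n. \<Pi>\<^sub>E i\<in>I. {..real n}) = ?\<Omega>"
    proof (intro equalityI subsetI)
      fix f assume f: "f \<in> ?\<Omega>"
      obtain n :: nat where n: "Max (insert 0 (f ` I)) \<le> real n" using real_arch_simple by blast
      have "f j \<le> real n" if "j \<in> I" for j
        using that I n by (intro order_trans[OF Max_ge n]) auto
      then show "f \<in> (\<Union>n. \<Pi>\<^sub>E i\<in>I. {..real n})"
        using f by (intro UN_I[of n]) (auto simp: PiE_def)
    qed (auto simp: PiE_def)
    show "emeasure P (\<Pi>\<^sub>E i\<in>I. {..real n}) \<noteq> \<infinity>" for n by (simp add: P.emeasure_eq_measure)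
  qed (use EP gen P(1) Q eq in \<open>auto simp: E_def\<close>)
qed

text \<open>The increments \<xi> are known through the joint distribution functions averaged over
  the environment. The coupled increments have the same ones, hence the same finite-dimensional
  laws, and their maximum in a fixed environment is the maximum of a walk driven by independent
  uniform variables.\<close>

lemma increments_law:
  fixes M :: "'w measure" and X :: "nat \<Rightarrow> 'w \<Rightarrow> 'x" and Fm :: "'x \<Rightarrow> real measure" and \<xi> :: "nat \<Rightarrow> 'w \<Rightarrow> real"
  assumes M: "prob_space M" and X: "\<And>n. n \<ge> 1 \<Longrightarrow> X n \<in> measurable M SX"
    and Fd: "\<And>x. x \<in> space SX \<Longrightarrow> real_distribution (Fm x)" and Fm_meas: "\<And>y. (\<lambda>x. cdf (Fm x) y) \<in> borel_measurable SX"
    and \<xi>: "\<And>n. n \<ge> 1 \<Longrightarrow> \<xi> n \<in> borel_measurable M"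
    and law: "\<And>y :: nat \<Rightarrow> real. measure M {\<omega> \<in> space M. \<forall>i\<in>{1..n}. \<xi> i \<omega> \<le> y i} = (\<integral>\<omega>. (\<Prod>i\<in>{1..n}. cdf (Fm (X i \<omega>)) (y i)) \<partial>M)"
    and t: "0 \<le> t"
  shows "measure M {\<omega> \<in> space M. \<exists>k\<le>n. t < (\<Sum>i\<in>{1..k}. \<xi> i \<omega>)}
    = (\<integral>\<omega>. measure (seqs unit_uniform) {v \<in> space (seqs unit_uniform). t < wmax (map (\<lambda>z. quantile (Fm z)) (block (\<lambda>i. X (Suc i)) (\<lambda>_. n) \<omega>)) v} \<partial>M)"
proof -
  let ?U = unit_uniform
  let ?I = "{1..n}"
  let ?B = "\<Pi>\<^sub>M i\<in>?I. (borel :: real measure)"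
  interpret M: prob_space M by fact
  interpret U: prob_space ?U by (rule prob_space_unit_uniform)
  interpret S: prob_space "seqs ?U" by (rule U.prob_space_seqs)
  interpret US: product_prob_space "\<lambda>_. ?U" "UNIV :: nat set" ..
  interpret MS: pair_prob_space M "seqs ?U" ..
  \<comment> \<open>Increment \<open>i\<close> uses the coordinate \<open>i - 1\<close>, because
    \<open>wmax\<close> consumes the driving sequence from 0 on.\<close>
  define q where "q i p = quantile (Fm (X i (fst p))) (snd p (i - 1))" for i and p :: "'w \<times> (nat \<Rightarrow> real)"
  have mq: "q i \<in> borel_measurable (M \<Otimes>\<^sub>M seqs ?U)" if "i \<ge> 1" for i
  proof -
    have "(\<lambda>p. (X i (fst p), snd p (i - 1))) \<in> measurable (M \<Otimes>\<^sub>M seqs ?U) (SX \<Otimes>\<^sub>M ?U)"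
    proof (rule measurable_Pair)
      show "(\<lambda>p. X i (fst p)) \<in> measurable (M \<Otimes>\<^sub>M seqs ?U) SX"
        by (rule measurable_compose[OF measurable_fst X[OF that]])
      show "(\<lambda>p. snd p (i - 1)) \<in> measurable (M \<Otimes>\<^sub>M seqs ?U) ?U"
        using measurable_compose[OF measurable_snd measurable_component_singleton[of "i - 1" UNIV "\<lambda>_. ?U"]] by simp
    qed
    from measurable_compose[OF this measurable_quantile[of SX Fm, OF Fd Fm_meas]] show ?thesis
      unfolding q_def by simp
  qed
  define \<Xi> where "\<Xi> \<omega> = restrict (\<lambda>i. \<xi> i \<omega>) ?I" for \<omega>
  define \<Theta> where "\<Theta> p = restrict (\<lambda>i. q i p) ?I" for p
  have m\<Xi>: "\<Xi> \<in> measurable M ?B" unfolding \<Xi>_def by (rule measurable_restrict) (auto intro: \<xi>)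
  have m\<Theta>: "\<Theta> \<in> measurable (M \<Otimes>\<^sub>M seqs ?U) ?B" unfolding \<Theta>_def by (rule measurable_restrict) (auto intro: mq)
  have box: "(\<Pi>\<^sub>E i\<in>?I. {..y i}) \<in> sets ?B" for y by (rule sets_PiM_I_finite) auto
  have D: "distr M ?B \<Xi> = distr (M \<Otimes>\<^sub>M seqs ?U) ?B \<Theta>"
  proof (rule PiM_borel_eqI[where I="?I"])
    show "finite_measure (distr M ?B \<Xi>)" using m\<Xi> by (rule M.finite_measure_distr)
    fix y :: "nat \<Rightarrow> real"
    have 1: "emeasure (distr M ?B \<Xi>) (\<Pi>\<^sub>E i\<in>?I. {..y i}) = ennreal (\<integral>\<omega>. (\<Prod>i\<in>?I. cdf (Fm (X i \<omega>)) (y i)) \<partial>M)"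
    proof -
      have "\<Xi> -` (\<Pi>\<^sub>E i\<in>?I. {..y i}) \<inter> space M = {\<omega> \<in> space M. \<forall>i\<in>?I. \<xi> i \<omega> \<le> y i}"
        by (auto simp: \<Xi>_def PiE_def Pi_def)
      then have "emeasure (distr M ?B \<Xi>) (\<Pi>\<^sub>E i\<in>?I. {..y i}) = emeasure M {\<omega> \<in> space M. \<forall>i\<in>?I. \<xi> i \<omega> \<le> y i}"
        by (subst emeasure_distr[OF m\<Xi> box]) simp
      then show ?thesis by (simp only: M.emeasure_eq_measure law)
    qed
    have 2: "emeasure (distr (M \<Otimes>\<^sub>M seqs ?U) ?B \<Theta>) (\<Pi>\<^sub>E i\<in>?I. {..y i}) = ennreal (\<integral>\<omega>. (\<Prod>i\<in>?I. cdf (Fm (X i \<omega>)) (y i)) \<partial>M)"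
    proof -
      let ?W = "{p \<in> space (M \<Otimes>\<^sub>M seqs ?U). \<forall>i\<in>?I. q i p \<le> y i}"
      have W: "\<Theta> -` (\<Pi>\<^sub>E i\<in>?I. {..y i}) \<inter> space (M \<Otimes>\<^sub>M seqs ?U) = ?W"
        by (auto simp: \<Theta>_def PiE_def Pi_def)
      have mW: "?W \<in> sets (M \<Otimes>\<^sub>M seqs ?U)" using measurable_sets[OF m\<Theta> box[of y]] unfolding W .
      have "emeasure (distr (M \<Otimes>\<^sub>M seqs ?U) ?B \<Theta>) (\<Pi>\<^sub>E i\<in>?I. {..y i}) = ennreal (measure (M \<Otimes>\<^sub>M seqs ?U) ?W)"
        by (subst emeasure_distr[OF m\<Theta> box]) (simp only: W MS.P.emeasure_eq_measure)
      also have "measure (M \<Otimes>\<^sub>M seqs ?U) ?W = (\<integral>p. indicator ?W p \<partial>(M \<Otimes>\<^sub>M seqs ?U))"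
        using mW by simp
      also have "\<dots> = (\<integral>\<omega>. (\<integral>v. indicator ?W (\<omega>, v) \<partial>seqs ?U) \<partial>M)"
        by (rule MS.integral_fst'[symmetric], rule MS.integrable_bounded[where B=1]) (use mW in \<open>auto simp: indicator_def\<close>)
      also have "\<dots> = (\<integral>\<omega>. (\<Prod>i\<in>?I. cdf (Fm (X i \<omega>)) (y i)) \<partial>M)"
      proof (intro Bochner_Integration.integral_cong refl)
        fix \<omega> assume \<omega>: "\<omega> \<in> space M"
        let ?A = "\<lambda>j. {u \<in> space ?U. quantile (Fm (X (Suc j) \<omega>)) u \<le> y (Suc j)}"
        have sx: "X (Suc j) \<omega> \<in> space SX" for j using measurable_space[OF X \<omega>, of "Suc j"] by simp
        have mA: "?A j \<in> sets ?U" for j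
          using distr_quantile(1)[OF Fd[OF sx[of j]]] by measurable
        have A: "measure ?U (?A j) = cdf (Fm (X (Suc j) \<omega>)) (y (Suc j))" for j
        proof -
          have "cdf (distr ?U borel (quantile (Fm (X (Suc j) \<omega>)))) (y (Suc j)) = measure ?U (?A j)"
            unfolding cdf_def by (subst measure_distr[OF distr_quantile(1)[OF Fd[OF sx[of j]]]]) (auto intro!: arg_cong[where f="measure ?U"])
          then show ?thesis unfolding distr_quantile(2)[OF Fd[OF sx[of j]]] by simp
        qed
        have "(\<integral>v. indicator ?W (\<omega>, v) \<partial>seqs ?U) = (\<integral>v. indicator {v \<in> space (seqs ?U). \<forall>j\<in>{..<n}. v j \<in> ?A j} v \<partial>seqs ?U)"
        proof (intro Bochner_Integration.integral_cong refl)
          fix v assume v: "v \<in> space (seqs ?U)"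
          have vs: "v j \<in> space ?U" for j using v by (auto simp: space_PiM PiE_def Pi_def)
          have "(\<omega>, v) \<in> ?W \<longleftrightarrow> (\<forall>i\<in>?I. quantile (Fm (X i \<omega>)) (v (i - 1)) \<le> y i)"
            using \<omega> v by (simp add: q_def space_pair_measure)
          also have "\<dots> \<longleftrightarrow> (\<forall>j\<in>{..<n}. v j \<in> ?A j)"
          proof
            assume *: "\<forall>i\<in>?I. quantile (Fm (X i \<omega>)) (v (i - 1)) \<le> y i"
            show "\<forall>j\<in>{..<n}. v j \<in> ?A j"
            proof
              fix j assume "j \<in> {..<n}"
              with * have "quantile (Fm (X (Suc j) \<omega>)) (v (Suc j - 1)) \<le> y (Suc j)" by (intro bspec[OF *]) auto
              then show "v j \<in> ?A j" using vs by simp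
            qed
          next
            assume *: "\<forall>j\<in>{..<n}. v j \<in> ?A j"
            show "\<forall>i\<in>?I. quantile (Fm (X i \<omega>)) (v (i - 1)) \<le> y i"
            proof
              fix i assume "i \<in> ?I"
              then obtain j where j: "i = Suc j" "j < n" by (cases i) auto
              then show "quantile (Fm (X i \<omega>)) (v (i - 1)) \<le> y i" using * by auto
            qed
          qed
          finally show "indicator ?W (\<omega>, v) = indicator {v \<in> space (seqs ?U). \<forall>j\<in>{..<n}. v j \<in> ?A j} v"
            using v by (simp add: indicator_def)
        qed
        also have "\<dots> = measure (seqs ?U) {v \<in> space (seqs ?U). \<forall>j\<in>{..<n}. v j \<in> ?A j}"
        proof -
          have "{v \<in> space (seqs ?U). \<forall>j\<in>{..<n}. v j \<in> ?A j} \<inter> space (seqs ?U) = {v \<in> space (seqs ?U). \<forall>j\<in>{..<n}. v j \<in> ?A j}" by auto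
          then show ?thesis by simp
        qed
        also have "\<dots> = (\<Prod>j<n. measure ?U (?A j))"
        proof -
          have "emeasure (seqs ?U) {v \<in> space (seqs ?U). \<forall>j\<in>{..<n}. v j \<in> ?A j} = (\<Prod>j<n. emeasure ?U (?A j))"
            by (rule US.emeasure_PiM_Collect) (simp, simp, rule mA)
          also have "\<dots> = ennreal (\<Prod>j<n. measure ?U (?A j))"
            by (simp add: U.emeasure_eq_measure prod_ennreal)
          finally show ?thesis by (simp add: S.emeasure_eq_measure prod_nonneg)
        qed
        also have "\<dots> = (\<Prod>j<n. cdf (Fm (X (Suc j) \<omega>)) (y (Suc j)))" by (simp only: A)
        also have "\<dots> = (\<Prod>i\<in>?I. cdf (Fm (X i \<omega>)) (y i))"
          by (rule prod.reindex_bij_witness[of _ "\<lambda>i. i - 1" Suc]) auto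
        finally show "(\<integral>v. indicator ?W (\<omega>, v) \<partial>seqs ?U) = (\<Prod>i\<in>?I. cdf (Fm (X i \<omega>)) (y i))" .
      qed
      finally show ?thesis .
    qed
    show "emeasure (distr M ?B \<Xi>) (\<Pi>\<^sub>E i\<in>?I. {..y i}) = emeasure (distr (M \<Otimes>\<^sub>M seqs ?U) ?B \<Theta>) (\<Pi>\<^sub>E i\<in>?I. {..y i})"
      unfolding 1 2 ..
  qed auto
  let ?E = "{f \<in> space ?B. \<exists>k\<le>n. t < (\<Sum>i\<in>{1..k}. f i)}"
  have mE: "?E \<in> sets ?B"
  proof -
    have "(\<lambda>f. \<Sum>i\<in>{1..k}. f i) \<in> borel_measurable ?B" if "k \<le> n" for k
      using that by (intro borel_measurable_sum measurable_component_singleton) auto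
    then have "{f \<in> space ?B. t < (\<Sum>i\<in>{1..k}. f i)} \<in> sets ?B" if "k \<le> n" for k
      using that by measurable
    then have "(\<Union>k\<in>{..n}. {f \<in> space ?B. t < (\<Sum>i\<in>{1..k}. f i)}) \<in> sets ?B" by (intro sets.finite_UN) auto
    also have "(\<Union>k\<in>{..n}. {f \<in> space ?B. t < (\<Sum>i\<in>{1..k}. f i)}) = ?E" by auto
    finally show ?thesis .
  qed
  have "measure M {\<omega> \<in> space M. \<exists>k\<le>n. t < (\<Sum>i\<in>{1..k}. \<xi> i \<omega>)} = measure (distr M ?B \<Xi>) ?E"
  proof -
    have "\<Xi> -` ?E \<inter> space M = {\<omega> \<in> space M. \<exists>k\<le>n. t < (\<Sum>i\<in>{1..k}. \<xi> i \<omega>)}"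
    proof -
      have "(\<Sum>i\<in>{1..k}. \<Xi> \<omega> i) = (\<Sum>i\<in>{1..k}. \<xi> i \<omega>)" if "k \<le> n" for k \<omega>
        using that by (intro sum.cong) (auto simp: \<Xi>_def)
      then show ?thesis using measurable_space[OF m\<Xi>] by auto
    qed
    then show ?thesis by (subst measure_distr[OF m\<Xi> mE]) simp
  qed
  also have "\<dots> = measure (M \<Otimes>\<^sub>M seqs ?U) {p \<in> space (M \<Otimes>\<^sub>M seqs ?U). \<exists>k\<le>n. t < (\<Sum>i\<in>{1..k}. q i p)}"
  proof -
    have "\<Theta> -` ?E \<inter> space (M \<Otimes>\<^sub>M seqs ?U) = {p \<in> space (M \<Otimes>\<^sub>M seqs ?U). \<exists>k\<le>n. t < (\<Sum>i\<in>{1..k}. q i p)}"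
    proof -
      have "(\<Sum>i\<in>{1..k}. \<Theta> p i) = (\<Sum>i\<in>{1..k}. q i p)" if "k \<le> n" for k p
        using that by (intro sum.cong) (auto simp: \<Theta>_def)
      then show ?thesis using measurable_space[OF m\<Theta>] by auto
    qed
    then show ?thesis unfolding D by (subst measure_distr[OF m\<Theta> mE]) simp
  qed
  also have "{p \<in> space (M \<Otimes>\<^sub>M seqs ?U). \<exists>k\<le>n. t < (\<Sum>i\<in>{1..k}. q i p)}
     = {p \<in> space (M \<Otimes>\<^sub>M seqs ?U). t < wmax (map (\<lambda>z. quantile (Fm z)) (block (\<lambda>i. X (Suc i)) (\<lambda>_. n) (fst p))) (snd p)}" (is "_ = ?V")
  proof -
    have "(\<Sum>i\<in>{1..k}. q i p) = (\<Sum>j<k. quantile (Fm (block (\<lambda>i. X (Suc i)) (\<lambda>_. n) (fst p) ! j)) (snd p j))" if "k \<le> n" for k p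
      using that by (intro sum.reindex_bij_witness[of _ Suc "\<lambda>i. i - 1"]) (auto simp: q_def block_def)
    then have "(\<exists>k\<le>n. t < (\<Sum>i\<in>{1..k}. q i p))
        \<longleftrightarrow> t < wmax (map (\<lambda>z. quantile (Fm z)) (block (\<lambda>i. X (Suc i)) (\<lambda>_. n) (fst p))) (snd p)" for p
      unfolding less_wmax_iff[OF t] length_block by (intro ex_cong1 conj_cong refl) (simp only:)
    then show ?thesis by (simp only:)
  qed
  also have "measure (M \<Otimes>\<^sub>M seqs ?U) ?V = (\<integral>\<omega>. measure (seqs ?U) {v \<in> space (seqs ?U). t < wmax (map (\<lambda>z. quantile (Fm z)) (block (\<lambda>i. X (Suc i)) (\<lambda>_. n) \<omega>)) v} \<partial>M)"
  proof -
    let ?w = "\<lambda>p. wmax (map (\<lambda>z. quantile (Fm z)) (block (\<lambda>i. X (Suc i)) (\<lambda>_. n) (fst p))) (snd p)"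
    have m: "?w \<in> borel_measurable (M \<Otimes>\<^sub>M seqs ?U)"
      by (rule measurable_wmax_block(1)[OF measurable_quantile[of SX Fm, OF Fd Fm_meas]]) (auto intro: X)
    have "measure (M \<Otimes>\<^sub>M seqs ?U) ?V = (\<integral>p. (if t < ?w p then 1 else 0) \<partial>(M \<Otimes>\<^sub>M seqs ?U))"
      by (rule MS.prob_gt_eq_integral(2)[symmetric, OF m])
    also have "\<dots> = (\<integral>\<omega>. (\<integral>v. (if t < ?w (\<omega>, v) then 1 else 0) \<partial>seqs ?U) \<partial>M)"
      by (rule MS.integral_fst'[symmetric, OF MS.prob_gt_eq_integral(1)[OF m]])
    also have "\<dots> = (\<integral>\<omega>. measure (seqs ?U) {v \<in> space (seqs ?U). t < wmax (map (\<lambda>z. quantile (Fm z)) (block (\<lambda>i. X (Suc i)) (\<lambda>_. n) \<omega>)) v} \<partial>M)"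
    proof (intro Bochner_Integration.integral_cong refl)
      fix \<omega> assume \<omega>: "\<omega> \<in> space M"
      have "(\<lambda>v. ?w (\<omega>, v)) \<in> borel_measurable (seqs ?U)"
        by (rule measurable_compose[OF measurable_Pair1'[OF \<omega>] m])
      from S.prob_gt_eq_integral(2)[OF this] show "(\<integral>v. (if t < ?w (\<omega>, v) then 1 else 0) \<partial>seqs ?U)
        = measure (seqs ?U) {v \<in> space (seqs ?U). t < wmax (map (\<lambda>z. quantile (Fm z)) (block (\<lambda>i. X (Suc i)) (\<lambda>_. n) \<omega>)) v}"
        unfolding fst_conv snd_conv .
    qed
    finally show ?thesis .
  qed
  finally show ?thesis .
qed

section \<open>Cycles and the stationary measure\<close>

lemma (in prob_space) hit_append_ge:
  assumes "\<forall>p\<in>set (ps @ qs). fst p \<in> borel_measurable M \<and> snd p \<in> borel_measurable M"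
  shows "hit M ps u \<le> hit M (ps @ qs) u"
  using assms
proof (induction ps arbitrary: u)
  case Nil
  then show ?case by (simp add: hit_nonneg)
next
  case (Cons p ps)
  have "hit M (p # ps) u \<le> hit M (p # (ps @ qs)) u"
    unfolding hit.simps
    by (intro integral_mono integrable_hit) (use Cons in auto)
  then show ?case by simp
qed

text \<open>Sums over a cycle are written with \<open>X (Suc n)\<close>, since \<open>X 0\<close> need not be measurable.\<close>

lemma stat_measure_integral:
  fixes M :: "'w measure" and SX :: "'x measure" and f :: "'x \<Rightarrow> real"
  assumes M: "prob_space M" and X: "\<And>n. n \<ge> 1 \<Longrightarrow> X n \<in> measurable M SX"
    and T: "\<And>k. T k \<in> measurable M (count_space UNIV)"
    and T_mono: "\<And>\<omega>. \<omega> \<in> space M \<Longrightarrow> strict_mono (\<lambda>k. T k \<omega>)"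
    and tau: "integrable M (\<lambda>\<omega>. real (T 1 \<omega> - T 0 \<omega>))"
    and f: "f \<in> borel_measurable SX"
  defines "\<tau> \<equiv> \<integral>\<omega>. real (T 1 \<omega> - T 0 \<omega>) \<partial>M"
  shows stat_measure_integral_pos: "0 < \<tau>"
    and stat_measure_integrable: "integrable (stat_measure M SX X T) f \<Longrightarrow> integrable M (\<lambda>\<omega>. \<Sum>n\<in>{T 0 \<omega>..<T 1 \<omega>}. f (X (Suc n) \<omega>))"
    and stat_measure_integral_eq: "integrable (stat_measure M SX X T) f \<Longrightarrow>
        (\<integral>x. f x \<partial>stat_measure M SX X T) = (\<integral>\<omega>. (\<Sum>n\<in>{T 0 \<omega>..<T 1 \<omega>}. f (X (Suc n) \<omega>)) \<partial>M) / \<tau>"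
    and stat_measure_integrable_bounded: "(\<And>x. x \<in> space SX \<Longrightarrow> \<bar>f x\<bar> \<le> 1) \<Longrightarrow> integrable (stat_measure M SX X T) f"
proof -
  interpret M: prob_space M by fact
  let ?C = "count_space (UNIV :: nat set)"
  interpret C: sigma_finite_measure ?C by (rule sigma_finite_measure_count_space)
  interpret MC: pair_sigma_finite M ?C ..
  note [measurable] = T
  have T01: "T 0 \<omega> < T 1 \<omega>" if "\<omega> \<in> space M" for \<omega>
    using strict_monoD[OF T_mono[OF that], of 0 1] by simp
  show \<tau>: "0 < \<tau>"
  proof -
    have "(\<integral>\<omega>. 1 \<partial>M) \<le> \<tau>"
      unfolding \<tau>_def using tau by (intro integral_mono) (use T01 in \<open>auto simp: Suc_leI\<close>)
    then show ?thesis by (simp add: M.prob_space)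
  qed
  \<comment> \<open>The weight marks the indices of the first cycle, so that the stationary measure
    becomes the image of a weighted product measure under the map \<open>Y\<close> from time and
    path to state.\<close>
  define w where "w p = (if T 0 (fst p) \<le> snd p \<and> snd p < T 1 (fst p) then 1 / \<tau> else 0)" for p :: "'w \<times> nat"
  have w0: "0 \<le> w p" for p using \<tau> by (simp add: w_def)
  have mT: "(\<lambda>p. T k (fst p)) \<in> measurable (M \<Otimes>\<^sub>M ?C) (count_space UNIV)" for k
    by (rule measurable_compose[OF measurable_fst T])
  have mw[measurable]: "w \<in> borel_measurable (M \<Otimes>\<^sub>M ?C)"
  proof -
    have 1: "(\<lambda>p. if i \<le> snd p \<and> snd p < j then 1 / \<tau> else 0) \<in> borel_measurable (M \<Otimes>\<^sub>M ?C)" for i j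
      by (rule measurable_compose[OF measurable_snd, of "\<lambda>n. if i \<le> n \<and> n < j then 1 / \<tau> else 0"]) simp
    have 2: "(\<lambda>p. if T 0 (fst p) \<le> snd p \<and> snd p < j then 1 / \<tau> else 0) \<in> borel_measurable (M \<Otimes>\<^sub>M ?C)" for j
      by (rule measurable_compose_countable[OF 1 mT])
    show ?thesis unfolding w_def by (rule measurable_compose_countable[OF 2 mT])
  qed
  define Y where "Y p = X (Suc (snd p)) (fst p)" for p
  have mY[measurable]: "Y \<in> measurable (M \<Otimes>\<^sub>M ?C) SX"
    unfolding Y_def
    by (rule measurable_compose_countable[where g=snd and f="\<lambda>n p. X (Suc n) (fst p)"])
      (auto intro!: measurable_compose[OF measurable_fst X])
  have inner: "(\<integral>n. w (\<omega>, n) * h (X (Suc n) \<omega>) \<partial>?C) = (\<Sum>n\<in>{T 0 \<omega>..<T 1 \<omega>}. h (X (Suc n) \<omega>)) / \<tau>"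
    "integrable ?C (\<lambda>n. w (\<omega>, n) * h (X (Suc n) \<omega>))" for h :: "'x \<Rightarrow> real" and \<omega>
  proof -
    have z: "w (\<omega>, n) * h (X (Suc n) \<omega>) = 0" if "n \<notin> {T 0 \<omega>..<T 1 \<omega>}" for n
      using that by (auto simp: w_def)
    show i: "integrable ?C (\<lambda>n. w (\<omega>, n) * h (X (Suc n) \<omega>))"
      unfolding integrable_count_space_nat_iff
      by (rule summable_finite[of "{T 0 \<omega>..<T 1 \<omega>}"]) (auto simp: z)
    have "(\<integral>n. w (\<omega>, n) * h (X (Suc n) \<omega>) \<partial>?C) = (\<Sum>n\<in>{T 0 \<omega>..<T 1 \<omega>}. w (\<omega>, n) * h (X (Suc n) \<omega>))"
      unfolding integral_count_space_nat[OF i] by (rule suminf_finite) (auto simp: z)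
    also have "\<dots> = (\<Sum>n\<in>{T 0 \<omega>..<T 1 \<omega>}. h (X (Suc n) \<omega>) / \<tau>)"
      by (intro sum.cong) (auto simp: w_def)
    also have "\<dots> = (\<Sum>n\<in>{T 0 \<omega>..<T 1 \<omega>}. h (X (Suc n) \<omega>)) / \<tau>"
      by (rule sum_divide_distrib[symmetric])
    finally show "(\<integral>n. w (\<omega>, n) * h (X (Suc n) \<omega>) \<partial>?C) = (\<Sum>n\<in>{T 0 \<omega>..<T 1 \<omega>}. h (X (Suc n) \<omega>)) / \<tau>" .
  qed
  have prod_eq: "(\<integral>p. w p * h (Y p) \<partial>(M \<Otimes>\<^sub>M ?C)) = (\<integral>\<omega>. (\<Sum>n\<in>{T 0 \<omega>..<T 1 \<omega>}. h (X (Suc n) \<omega>)) \<partial>M) / \<tau>"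
    and prod_int: "integrable M (\<lambda>\<omega>. \<Sum>n\<in>{T 0 \<omega>..<T 1 \<omega>}. h (X (Suc n) \<omega>))"
    if "integrable (M \<Otimes>\<^sub>M ?C) (\<lambda>p. w p * h (Y p))" for h
  proof -
    have "(\<integral>p. w p * h (Y p) \<partial>(M \<Otimes>\<^sub>M ?C)) = (\<integral>\<omega>. (\<Sum>n\<in>{T 0 \<omega>..<T 1 \<omega>}. h (X (Suc n) \<omega>)) / \<tau> \<partial>M)"
      using MC.integral_fst'[OF that] by (simp add: Y_def inner)
    then show "(\<integral>p. w p * h (Y p) \<partial>(M \<Otimes>\<^sub>M ?C)) = (\<integral>\<omega>. (\<Sum>n\<in>{T 0 \<omega>..<T 1 \<omega>}. h (X (Suc n) \<omega>)) \<partial>M) / \<tau>" by simp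
    have "integrable M (\<lambda>\<omega>. \<tau> * ((\<Sum>n\<in>{T 0 \<omega>..<T 1 \<omega>}. h (X (Suc n) \<omega>)) / \<tau>))"
      using MC.integrable_fst'[OF that] by (intro integrable_mult_right) (simp add: Y_def inner)
    then show "integrable M (\<lambda>\<omega>. \<Sum>n\<in>{T 0 \<omega>..<T 1 \<omega>}. h (X (Suc n) \<omega>))" using \<tau> by simp
  qed
  have bounded: "integrable (M \<Otimes>\<^sub>M ?C) (\<lambda>p. w p * h (Y p))"
    if h: "h \<in> borel_measurable SX" "\<And>x. x \<in> space SX \<Longrightarrow> \<bar>h x\<bar> \<le> 1" for h
  proof (rule MC.Fubini_integrable)
    have [measurable]: "(\<lambda>p. h (Y p)) \<in> borel_measurable (M \<Otimes>\<^sub>M ?C)" by (rule measurable_compose[OF mY h(1)])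
    show m: "(\<lambda>p. w p * h (Y p)) \<in> borel_measurable (M \<Otimes>\<^sub>M ?C)" by measurable
    have n: "norm (w (\<omega>, k) * h (Y (\<omega>, k))) = w (\<omega>, k) * \<bar>h (X (Suc k) \<omega>)\<bar>" for \<omega> k
      using w0[of "(\<omega>, k)"] by (simp add: Y_def abs_mult)
    note innerabs = inner(1)[of _ "\<lambda>x. \<bar>h x\<bar>"]
    have "integrable M (\<lambda>\<omega>. (\<Sum>n\<in>{T 0 \<omega>..<T 1 \<omega>}. \<bar>h (X (Suc n) \<omega>)\<bar>) / \<tau>)"
    proof (rule Bochner_Integration.integrable_bound)
      show "integrable M (\<lambda>\<omega>. real (T 1 \<omega> - T 0 \<omega>) / \<tau>)" using tau by simp
      have "(\<lambda>p. norm (w p * h (Y p))) \<in> borel_measurable (M \<Otimes>\<^sub>M ?C)" using m by measurable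
      then have "(\<lambda>\<omega>. \<integral>k. norm (w (\<omega>, k) * h (Y (\<omega>, k))) \<partial>?C) \<in> borel_measurable M"
        by (intro C.borel_measurable_lebesgue_integral) (simp add: case_prod_beta')
      then show "(\<lambda>\<omega>. (\<Sum>n\<in>{T 0 \<omega>..<T 1 \<omega>}. \<bar>h (X (Suc n) \<omega>)\<bar>) / \<tau>) \<in> borel_measurable M"
        unfolding n innerabs .
      show "AE \<omega> in M. norm ((\<Sum>n\<in>{T 0 \<omega>..<T 1 \<omega>}. \<bar>h (X (Suc n) \<omega>)\<bar>) / \<tau>) \<le> norm (real (T 1 \<omega> - T 0 \<omega>) / \<tau>)"
      proof (rule AE_I2)
        fix \<omega> assume \<omega>: "\<omega> \<in> space M"
        have "(\<Sum>n\<in>{T 0 \<omega>..<T 1 \<omega>}. \<bar>h (X (Suc n) \<omega>)\<bar>) \<le> (\<Sum>n\<in>{T 0 \<omega>..<T 1 \<omega>}. 1)"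
          using measurable_space[OF X \<omega>] by (intro sum_mono h(2)) auto
        then have "(\<Sum>n\<in>{T 0 \<omega>..<T 1 \<omega>}. \<bar>h (X (Suc n) \<omega>)\<bar>) / \<tau> \<le> real (T 1 \<omega> - T 0 \<omega>) / \<tau>"
          using \<tau> by (intro divide_right_mono) auto
        then show "norm ((\<Sum>n\<in>{T 0 \<omega>..<T 1 \<omega>}. \<bar>h (X (Suc n) \<omega>)\<bar>) / \<tau>) \<le> norm (real (T 1 \<omega> - T 0 \<omega>) / \<tau>)"
          using \<tau> by (simp add: sum_nonneg abs_of_nonneg)
      qed
    qed
    then show "integrable M (\<lambda>\<omega>. \<integral>k. norm (w (\<omega>, k) * h (Y (\<omega>, k))) \<partial>?C)"
      unfolding n innerabs .
    show "AE \<omega> in M. integrable ?C (\<lambda>k. w (\<omega>, k) * h (Y (\<omega>, k)))"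
      by (rule AE_I2) (simp add: Y_def inner)
  qed
  define N where "N = distr (density (M \<Otimes>\<^sub>M ?C) (\<lambda>p. ennreal (w p))) SX Y"
  have N_space: "space N = space SX" "sets N = sets SX" by (simp_all add: N_def)
  have NB: "emeasure N B = ennreal ((\<integral>\<omega>. (\<Sum>n\<in>{T 0 \<omega><..T 1 \<omega>}. indicator B (X n \<omega>)) \<partial>M) / (\<integral>\<omega>. real (T 1 \<omega> - T 0 \<omega>) \<partial>M))"
    if B: "B \<in> sets SX" for B
  proof -
    have [measurable]: "B \<in> sets SX" by fact
    have mB: "Y -` B \<inter> space (M \<Otimes>\<^sub>M ?C) \<in> sets (M \<Otimes>\<^sub>M ?C)" by (rule measurable_sets[OF mY B])
    have "emeasure N B = (\<integral>\<^sup>+p. ennreal (w p) * indicator (Y -` B \<inter> space (M \<Otimes>\<^sub>M ?C)) p \<partial>(M \<Otimes>\<^sub>M ?C))"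
      unfolding N_def using mB by (subst emeasure_distr) (auto simp: emeasure_density)
    also have "\<dots> = (\<integral>\<^sup>+p. ennreal (w p * indicator B (Y p)) \<partial>(M \<Otimes>\<^sub>M ?C))"
      by (intro nn_integral_cong) (auto simp: indicator_def)
    also have "\<dots> = ennreal (\<integral>p. w p * indicator B (Y p) \<partial>(M \<Otimes>\<^sub>M ?C))"
      by (intro nn_integral_eq_integral bounded) (auto simp: indicator_def w0)
    also have "(\<integral>p. w p * indicator B (Y p) \<partial>(M \<Otimes>\<^sub>M ?C)) = (\<integral>\<omega>. (\<Sum>n\<in>{T 0 \<omega>..<T 1 \<omega>}. indicator B (X (Suc n) \<omega>)) \<partial>M) / \<tau>"
      by (intro prod_eq bounded) (auto simp: indicator_def)
    also have "(\<lambda>\<omega>. \<Sum>n\<in>{T 0 \<omega>..<T 1 \<omega>}. indicator B (X (Suc n) \<omega>) :: real) = (\<lambda>\<omega>. \<Sum>n\<in>{T 0 \<omega><..T 1 \<omega>}. indicator B (X n \<omega>))"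
      by (intro ext sum.reindex_bij_witness[of _ "\<lambda>n. n - 1" Suc]) auto
    finally show ?thesis by (simp add: \<tau>_def)
  qed
  \<comment> \<open>\<open>measure_of\<close> returns the prescribed values only if they form a
    measure; agreement with \<open>N\<close> provides the countable additivity.\<close>
  have SN: "stat_measure M SX X T = N"
  proof -
    have "stat_measure M SX X T = measure_of (space SX) (sets SX) (emeasure N)"
      unfolding stat_measure_def by (rule measure_of_eq) (auto simp: sets.space_closed sets.sigma_sets_eq NB)
    also have "\<dots> = N" using measure_of_of_measure[of N] by (simp add: N_space)
    finally show ?thesis .
  qed
  have mfY: "(\<lambda>p. f (Y p)) \<in> borel_measurable (M \<Otimes>\<^sub>M ?C)" by (rule measurable_compose[OF mY f])
  have int_iff: "integrable (stat_measure M SX X T) f \<longleftrightarrow> integrable (M \<Otimes>\<^sub>M ?C) (\<lambda>p. w p * f (Y p))"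
    unfolding SN N_def using mfY f
    by (subst integrable_distr_eq) (auto simp: integrable_density w0)
  show "integrable M (\<lambda>\<omega>. \<Sum>n\<in>{T 0 \<omega>..<T 1 \<omega>}. f (X (Suc n) \<omega>))" if "integrable (stat_measure M SX X T) f"
    using that unfolding int_iff by (rule prod_int)
  show "(\<integral>x. f x \<partial>stat_measure M SX X T) = (\<integral>\<omega>. (\<Sum>n\<in>{T 0 \<omega>..<T 1 \<omega>}. f (X (Suc n) \<omega>)) \<partial>M) / \<tau>"
    if "integrable (stat_measure M SX X T) f"
  proof -
    have "(\<integral>x. f x \<partial>stat_measure M SX X T) = (\<integral>p. w p * f (Y p) \<partial>(M \<Otimes>\<^sub>M ?C))"
      unfolding SN N_def using mfY f by (subst integral_distr) (auto simp: integral_density w0)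
    then show ?thesis using prod_eq that unfolding int_iff by simp
  qed
  show "integrable (stat_measure M SX X T) f" if "\<And>x. x \<in> space SX \<Longrightarrow> \<bar>f x\<bar> \<le> 1"
    unfolding int_iff by (rule bounded[OF f that])
qed

text \<open>Rounding \<open>v\<close> down to an integer keeps it between \<open>v - 1\<close> and
  \<open>v\<close>; by monotonicity the bound for integers survives with a shift of the level by
  1.\<close>

lemma real_of_nat_bound_transfer:
  fixes f g :: "real \<Rightarrow> real"
  assumes f: "\<And>u v. u \<le> v \<Longrightarrow> f v \<le> f u" and g: "\<And>u v. u \<le> v \<Longrightarrow> g v \<le> g u"
    and "(\<lambda>n::nat. f (real n)) \<in> o[sequentially](\<lambda>n. g (real n))" and pos: "\<And>v. 0 \<le> g v" "\<And>v. 0 \<le> f v" and \<epsilon>: "0 < \<epsilon>"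
  shows "\<forall>\<^sub>F v in at_top. f v \<le> \<epsilon> * g (v - 1)"
proof -
  have "\<forall>\<^sub>F n in sequentially. norm (f (real n)) \<le> \<epsilon> * norm (g (real n))"
    using assms(3) \<epsilon> by (rule landau_o.smallD)
  then obtain n0 where n0: "\<And>n. n \<ge> n0 \<Longrightarrow> f (real n) \<le> \<epsilon> * g (real n)"
    unfolding eventually_sequentially using pos by force
  show ?thesis using eventually_ge_at_top[of "real n0 + 1"]
  proof eventually_elim
    case (elim v)
    define n where "n = nat \<lfloor>v\<rfloor>"
    have n: "real n \<le> v" "v - 1 \<le> real n" "n0 \<le> n" using elim by (auto simp: n_def le_nat_iff le_floor_iff)
    have "f v \<le> f (real n)" by (rule f[OF n(1)])
    also have "\<dots> \<le> \<epsilon> * g (real n)" by (rule n0[OF n(3)])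
    also have "\<dots> \<le> \<epsilon> * g (v - 1)" using \<epsilon> by (intro mult_left_mono g n) auto
    finally show ?case .
  qed
qed

text \<open>A bound on tails is integrated over all levels from \<open>v\<close> on; the mean excess
  is the integral of the tail.\<close>

lemma excess_le_of_tail_le:
  assumes F: "real_distribution F" "integrable F (\<lambda>x. x)" and G: "real_distribution G" "integrable G (\<lambda>x. x)"
    and \<epsilon>: "0 \<le> \<epsilon>" and le: "\<And>w. v \<le> w \<Longrightarrow> tail G w \<le> \<epsilon> * tail F (w - 1)"
  shows "(\<integral>x. max 0 (x - v) \<partial>G) \<le> \<epsilon> * (\<integral>x. max 0 (x - (v - 1)) \<partial>F)"
proof -
  interpret F: real_distribution F by fact
  interpret G: real_distribution G by fact
  have shift: "(\<lambda>x. x + 1) \<in> borel_measurable F" and ident: "(\<lambda>x. x) \<in> borel_measurable (borel :: real measure)" by simp_all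
  \<comment> \<open>Shifting \<open>F\<close> to the right by 1 absorbs the argument
    \<open>w - 1\<close>.\<close>
  define F1 where "F1 = distr F borel (\<lambda>x. x + 1)"
  interpret F1: real_distribution F1 unfolding F1_def by (rule F.real_distribution_distr) simp
  have t1: "tail F1 w = tail F (w - 1)" for w
  proof -
    have "(\<lambda>x. x + 1) -` {w<..} \<inter> space F = {w - 1<..}" by auto
    then show ?thesis unfolding tail_def F1_def by (subst measure_distr) auto
  qed
  have i1: "integrable F1 (\<lambda>x. x)" unfolding F1_def using F(2)
    by (simp only: integrable_distr_eq[OF shift ident] Bochner_Integration.integrable_add F.integrable_const)
  have e1: "(\<integral>x. max 0 (x - v) \<partial>F1) = (\<integral>x. max 0 (x - (v - 1)) \<partial>F)"
    unfolding F1_def by (subst integral_distr[OF shift]) (simp_all add: algebra_simps)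
  have "ennreal (\<integral>x. max 0 (x - v) \<partial>G) = (\<integral>\<^sup>+z. ennreal (indicator {v..} z * tail G z) \<partial>lborel)"
    by (rule G.nn_integrated_tail[symmetric, OF G(2)])
  also have "\<dots> \<le> (\<integral>\<^sup>+z. ennreal \<epsilon> * ennreal (indicator {v..} z * tail F1 z) \<partial>lborel)"
    using le \<epsilon> by (intro nn_integral_mono) (auto simp: t1 indicator_def ennreal_mult'[symmetric] intro!: ennreal_leI)
  also have "\<dots> = ennreal \<epsilon> * ennreal (\<integral>x. max 0 (x - v) \<partial>F1)"
    by (subst nn_integral_cmult) (auto simp: F1.nn_integrated_tail[OF i1])
  also have "\<dots> = ennreal (\<epsilon> * (\<integral>x. max 0 (x - (v - 1)) \<partial>F))"
    using \<epsilon> by (simp add: e1 ennreal_mult')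
  finally show ?thesis
    using \<epsilon> by (subst (asm) ennreal_le_iff) (auto intro!: mult_nonneg_nonneg Bochner_Integration.integral_nonneg)
qed

text \<open>\<open>block\<close> reads only the first \<open>len\<close> entries, so the padding
  point disappears. With \<open>X (Suc n)\<close>, the range \<open>T k \<le> n < T (k + 1)\<close>
  covers the indices of the next cycle, those above \<open>T k\<close> and up to
  \<open>T (k + 1)\<close>.\<close>

lemma block_cycle:
  "block (\<lambda>i c. snd c i) fst (cycle x0 X T 0 \<omega>) = map (\<lambda>n. X (Suc n) \<omega>) [0..<T 0 \<omega>]"
  "block (\<lambda>i c. snd c i) fst (cycle x0 X T (Suc k) \<omega>) = map (\<lambda>n. X (Suc n) \<omega>) [T k \<omega>..<T (Suc k) \<omega>]"
  by (rule nth_equalityI; simp add: block_def cycle_def Let_def)+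

lemma prefix_eq_blocks:
  assumes "strict_mono (\<lambda>k. T k \<omega>)"
  shows "map (\<lambda>n. X (Suc n) \<omega>) [0..<T m \<omega>]
    = block (\<lambda>i c. snd c i) fst (cycle x0 X T 0 \<omega>) @ blocks (\<lambda>i c. snd c i) fst m (\<lambda>k. cycle x0 X T (Suc k) \<omega>)"
proof (induction m)
  case 0
  show ?case by (simp add: block_cycle(1) blocks_def)
next
  case (Suc m)
  have le: "T m \<omega> \<le> T (Suc m) \<omega>" using strict_monoD[OF assms, of m "Suc m"] by simp
  have "map (\<lambda>n. X (Suc n) \<omega>) [0..<T (Suc m) \<omega>] = map (\<lambda>n. X (Suc n) \<omega>) [0..<T m \<omega>] @ map (\<lambda>n. X (Suc n) \<omega>) [T m \<omega>..<T (Suc m) \<omega>]"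
    using upt_add_eq_append[of 0 "T m \<omega>" "T (Suc m) \<omega> - T m \<omega>"] le by (simp add: map_append[symmetric] del: map_append)
  also have "\<dots> = block (\<lambda>i c. snd c i) fst (cycle x0 X T 0 \<omega>) @ blocks (\<lambda>i c. snd c i) fst (Suc m) (\<lambda>k. cycle x0 X T (Suc k) \<omega>)"
    unfolding Suc.IH by (simp add: blocks_def block_cycle(2))
  finally show ?case .
qed

text \<open>Joint independence turns the later cycles into a product of identical laws after a shift
  of indices, and splitting the index set at 1 separates the initial cycle from them.\<close>

lemma (in prob_space) distr_initial_and_iid:
  assumes ind: "indep_vars (\<lambda>_. S) C (UNIV :: nat set)"
    and ident: "\<And>k. k \<ge> 1 \<Longrightarrow> distr M S (C k) = distr M S (C 1)"
  shows "distr M (S \<Otimes>\<^sub>M seqs S) (\<lambda>\<omega>. (C 0 \<omega>, \<lambda>k. C (Suc k) \<omega>)) = distr M S (C 0) \<Otimes>\<^sub>M seqs (distr M S (C 1))"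
    and "(\<lambda>\<omega>. (C 0 \<omega>, \<lambda>k. C (Suc k) \<omega>)) \<in> measurable M (S \<Otimes>\<^sub>M seqs S)"
proof -
  have rv: "C k \<in> measurable M S" for k using ind by (auto simp: indep_vars_def)
  have mseq: "(\<lambda>\<omega> k. C (Suc k) \<omega>) \<in> measurable M (seqs S)"
    by (rule measurable_PiM_single') (use rv measurable_space[OF rv] in \<open>auto simp: space_PiM\<close>)
  show "(\<lambda>\<omega>. (C 0 \<omega>, \<lambda>k. C (Suc k) \<omega>)) \<in> measurable M (S \<Otimes>\<^sub>M seqs S)"
    by (rule measurable_Pair[OF rv mseq])
  have all: "distr M (\<Pi>\<^sub>M k\<in>UNIV. S) (\<lambda>\<omega>. \<lambda>k\<in>UNIV. C k \<omega>) = (\<Pi>\<^sub>M k\<in>UNIV. distr M S (C k))"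
    using ind rv by (subst (asm) indep_vars_iff_distr_eq_PiM) auto
  have seq: "distr M (seqs S) (\<lambda>\<omega> k. C (Suc k) \<omega>) = seqs (distr M S (C 1))"
  proof -
    interpret D: product_prob_space "\<lambda>k. distr M S (C k)" "UNIV :: nat set"
      by (intro product_prob_spaceI prob_space_distr rv)
    have "distr M (seqs S) (\<lambda>\<omega> k. C (Suc k) \<omega>) = distr (distr M (\<Pi>\<^sub>M k\<in>UNIV. S) (\<lambda>\<omega>. \<lambda>k\<in>UNIV. C k \<omega>)) (seqs S) (\<lambda>f k. f (Suc k))"
      using rv by (subst distr_distr) (auto simp: comp_def measurable_shift_seq intro!: measurable_restrict)
    also have "\<dots> = distr (\<Pi>\<^sub>M k\<in>UNIV. distr M S (C k)) (seqs S) (\<lambda>f k. f (Suc k))" unfolding all ..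
    also have "\<dots> = distr (\<Pi>\<^sub>M k\<in>UNIV. distr M S (C k)) (\<Pi>\<^sub>M k\<in>UNIV. distr M S (C (Suc k))) (\<lambda>f. \<lambda>k\<in>UNIV. f (Suc k))"
      by (rule distr_cong) (auto intro!: sets_PiM_cong)
    also have "\<dots> = (\<Pi>\<^sub>M k\<in>UNIV. distr M S (C (Suc k)))"
      by (rule distr_PiM_reindex) (auto intro!: prob_space_distr rv)
    also have "\<dots> = seqs (distr M S (C 1))"
      by (intro PiM_cong ident) auto
    finally show ?thesis .
  qed
  have iv: "indep_var (\<Pi>\<^sub>M k\<in>{0}. S) (\<lambda>\<omega>. \<lambda>k\<in>{0}. C k \<omega>) (\<Pi>\<^sub>M k\<in>{1..}. S) (\<lambda>\<omega>. \<lambda>k\<in>{1..}. C k \<omega>)"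
    by (rule indep_var_restrict[OF ind]) auto
  let ?L0 = "distr M (\<Pi>\<^sub>M k\<in>{0}. S) (\<lambda>\<omega>. \<lambda>k\<in>{0}. C k \<omega>)" and ?L1 = "distr M (\<Pi>\<^sub>M k\<in>{1..}. S) (\<lambda>\<omega>. \<lambda>k\<in>{1..}. C k \<omega>)"
  have m0: "(\<lambda>\<omega>. \<lambda>k\<in>{0}. C k \<omega>) \<in> measurable M (\<Pi>\<^sub>M k\<in>{0}. S)"
    and m1: "(\<lambda>\<omega>. \<lambda>k\<in>{1..}. C k \<omega>) \<in> measurable M (\<Pi>\<^sub>M k\<in>{1..}. S)"
    by (auto intro!: measurable_restrict rv)
  have p0: "(\<lambda>f. f 0) \<in> measurable (\<Pi>\<^sub>M k\<in>{0::nat}. S) S" by (rule measurable_component_singleton) simp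
  have p1: "(\<lambda>f k. f (Suc k)) \<in> measurable (\<Pi>\<^sub>M k\<in>{1::nat..}. S) (seqs S)"
    by (rule measurable_PiM_single') (auto simp: space_PiM PiE_def Pi_def)
  have d0: "distr M S (C 0) = distr ?L0 S (\<lambda>f. f 0)"
    by (subst distr_distr[OF p0 m0]) (simp add: comp_def)
  have d1: "distr M (seqs S) (\<lambda>\<omega> k. C (Suc k) \<omega>) = distr ?L1 (seqs S) (\<lambda>f k. f (Suc k))"
    by (subst distr_distr[OF p1 m1]) (simp add: comp_def)
  have p0': "(\<lambda>f. f 0) \<in> measurable ?L0 S" and p1': "(\<lambda>f k. f (Suc k)) \<in> measurable ?L1 (seqs S)"
    using p0 p1 by simp_all
  interpret L1: prob_space "distr ?L1 (seqs S) (\<lambda>f k. f (Suc k))"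
    unfolding d1[symmetric] by (rule prob_space_distr[OF mseq])
  have pp: "(\<lambda>(f, h). (f 0, \<lambda>k. h (Suc k))) \<in> measurable ((\<Pi>\<^sub>M k\<in>{0::nat}. S) \<Otimes>\<^sub>M (\<Pi>\<^sub>M k\<in>{1::nat..}. S)) (S \<Otimes>\<^sub>M seqs S)"
    unfolding case_prod_beta'
    by (intro measurable_Pair measurable_compose[OF measurable_fst p0] measurable_compose[OF measurable_snd p1])
  have "distr M S (C 0) \<Otimes>\<^sub>M distr M (seqs S) (\<lambda>\<omega> k. C (Suc k) \<omega>)
      = distr (?L0 \<Otimes>\<^sub>M ?L1) (S \<Otimes>\<^sub>M seqs S) (\<lambda>(f, h). (f 0, \<lambda>k. h (Suc k)))"
    unfolding d0 d1 by (rule pair_measure_distr[OF p0' p1' L1.sigma_finite_measure_axioms])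
  also have "?L0 \<Otimes>\<^sub>M ?L1 = distr M ((\<Pi>\<^sub>M k\<in>{0}. S) \<Otimes>\<^sub>M (\<Pi>\<^sub>M k\<in>{1..}. S)) (\<lambda>\<omega>. (\<lambda>k\<in>{0}. C k \<omega>, \<lambda>k\<in>{1..}. C k \<omega>))"
    using iv by (simp only: indep_var_distribution_eq)
  also have "distr \<dots> (S \<Otimes>\<^sub>M seqs S) (\<lambda>(f, h). (f 0, \<lambda>k. h (Suc k))) = distr M (S \<Otimes>\<^sub>M seqs S) (\<lambda>\<omega>. (C 0 \<omega>, \<lambda>k. C (Suc k) \<omega>))"
    by (subst distr_distr[OF pp measurable_Pair[OF m0 m1]]) (simp add: comp_def)
  finally show "distr M (S \<Otimes>\<^sub>M seqs S) (\<lambda>\<omega>. (C 0 \<omega>, \<lambda>k. C (Suc k) \<omega>)) = distr M S (C 0) \<Otimes>\<^sub>M seqs (distr M S (C 1))"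
    by (simp only: seq)
qed

lemma measurable_prefix_hit:
  assumes M: "prob_space M" and X: "\<And>n. n \<ge> 1 \<Longrightarrow> X n \<in> measurable M SX" and Q: "prob_space Q"
    and f: "(\<lambda>p. f (fst p) (snd p)) \<in> borel_measurable (SX \<Otimes>\<^sub>M Q)" and len: "len \<in> measurable M (count_space UNIV)"
  shows "(\<lambda>\<omega>. hit Q (map (\<lambda>z. diag (f z)) (block (\<lambda>i. X (Suc i)) len \<omega>)) y) \<in> borel_measurable M"
  using measurable_compose[OF _ measurable_hit_block_joint[OF Q f X len], of "\<lambda>\<omega>. (\<omega>, y)" M] by simp

text \<open>The law of the increments given \<open>X\<close> is prescribed at deterministic
  horizons, and the epochs \<open>T\<close> need not be functions of \<open>X\<close>. Once the
  increments are integrated out, the crossing probability in a given environment increases with the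
  horizon, so by \<open>m \<le> T m \<omega>\<close> the horizons \<open>m\<close> and
  \<open>T m \<omega>\<close> lead to the same supremum.\<close>

lemma sup_increments_eq:
  fixes M :: "'w measure" and X :: "nat \<Rightarrow> 'w \<Rightarrow> 'x" and Fm :: "'x \<Rightarrow> real measure" and \<xi> :: "nat \<Rightarrow> 'w \<Rightarrow> real" and T :: "nat \<Rightarrow> 'w \<Rightarrow> nat"
  assumes M: "prob_space M" and X: "\<And>n. n \<ge> 1 \<Longrightarrow> X n \<in> measurable M SX"
    and Fd: "\<And>x. x \<in> space SX \<Longrightarrow> real_distribution (Fm x)" and Fm_meas: "\<And>y. (\<lambda>x. cdf (Fm x) y) \<in> borel_measurable SX"
    and \<xi>: "\<And>n. n \<ge> 1 \<Longrightarrow> \<xi> n \<in> borel_measurable M"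
    and law: "\<And>n y. measure M {\<omega> \<in> space M. \<forall>i\<in>{1..n}. \<xi> i \<omega> \<le> y i} = (\<integral>\<omega>. (\<Prod>i\<in>{1..n}. cdf (Fm (X i \<omega>)) (y i)) \<partial>M)"
    and T: "\<And>k. T k \<in> measurable M (count_space UNIV)" and T_mono: "\<And>\<omega>. \<omega> \<in> space M \<Longrightarrow> strict_mono (\<lambda>k. T k \<omega>)"
    and t: "0 \<le> t"
  shows "measure M {\<omega> \<in> space M. (SUP n. ereal (\<Sum>i\<in>{1..n}. \<xi> i \<omega>)) > ereal t}
    = (SUP m. \<integral>\<omega>. hit unit_uniform (map (\<lambda>z. diag (quantile (Fm z))) (map (\<lambda>n. X (Suc n) \<omega>) [0..<T m \<omega>])) t \<partial>M)"
proof -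
  interpret M: prob_space M by fact
  interpret U: prob_space unit_uniform by (rule prob_space_unit_uniform)
  define h where "h n \<omega> = hit unit_uniform (map (\<lambda>z. diag (quantile (Fm z))) (map (\<lambda>i. X (Suc i) \<omega>) [0..<n])) t" for n \<omega>
  have joint: "(\<lambda>p. quantile (Fm (fst p)) (snd p)) \<in> borel_measurable (SX \<Otimes>\<^sub>M unit_uniform)"
    by (rule measurable_quantile[OF Fd Fm_meas])
  have mh: "(\<lambda>\<omega>. h (len \<omega>) \<omega>) \<in> borel_measurable M" if "len \<in> measurable M (count_space UNIV)" for len
    using measurable_prefix_hit[OF M X U.prob_space_axioms joint that, where y=t] by (simp add: h_def block_def)
  have mh0: "h n \<in> borel_measurable M" for n using mh[of "\<lambda>_. n"] by simp
  have ms: "\<forall>p\<in>set (map (\<lambda>z. diag (quantile (Fm z))) (map (\<lambda>i. X (Suc i) \<omega>) is)).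
      fst p \<in> borel_measurable unit_uniform \<and> snd p \<in> borel_measurable unit_uniform" if "\<omega> \<in> space M" for \<omega> "is"
    using distr_quantile(1)[OF Fd] measurable_space[OF X that] by (auto simp: fst_diag snd_diag)
  have h01: "0 \<le> h n \<omega>" "h n \<omega> \<le> 1" if "\<omega> \<in> space M" for n \<omega>
    unfolding h_def using U.hit_nonneg[OF ms[OF that]] U.hit_le_1[OF ms[OF that]] by auto
  have mono: "h n \<omega> \<le> h m \<omega>" if "\<omega> \<in> space M" "n \<le> m" for n m \<omega>
  proof -
    have "[0..<m] = [0..<n] @ [n..<m]" using upt_add_eq_append[of 0 n "m - n"] that by simp
    then show ?thesis unfolding h_def
      using U.hit_append_ge[of "map (\<lambda>z. diag (quantile (Fm z))) (map (\<lambda>i. X (Suc i) \<omega>) [0..<n])"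
          "map (\<lambda>z. diag (quantile (Fm z))) (map (\<lambda>i. X (Suc i) \<omega>) [n..<m])"] ms[OF that(1), of "[0..<m]"]
      by (simp only: map_append)
  qed
  define L where "L \<omega> = (SUP n. h n \<omega>)" for \<omega>
  have bdd: "bdd_above (range (\<lambda>n. h n \<omega>))" if "\<omega> \<in> space M" for \<omega>
    by (rule bdd_aboveI[of _ 1]) (auto simp: h01[OF that])
  have lim: "(\<lambda>n. h n \<omega>) \<longlonglongrightarrow> L \<omega>" if "\<omega> \<in> space M" for \<omega>
    unfolding L_def by (rule LIMSEQ_incseq_SUP[OF bdd[OF that]]) (auto simp: incseq_def mono[OF that])
  have le_L: "h n \<omega> \<le> L \<omega>" if "\<omega> \<in> space M" for n \<omega>
    unfolding L_def by (rule cSUP_upper[OF UNIV_I bdd[OF that]])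
  have L01: "0 \<le> L \<omega>" "L \<omega> \<le> 1" if "\<omega> \<in> space M" for \<omega>
    using order_trans[OF h01(1) le_L] that by (auto simp: L_def h01[OF that] intro: cSUP_least)
  have mL: "L \<in> borel_measurable M" by (rule borel_measurable_LIMSEQ_real[OF lim mh0])
  have iL: "integrable M L" by (rule M.integrable_bounded[OF mL, of 1]) (auto simp: L01)
  have ih: "integrable M (\<lambda>\<omega>. h (len \<omega>) \<omega>)" if "len \<in> measurable M (count_space UNIV)" for len
    by (rule M.integrable_bounded[OF mh[OF that], of 1]) (auto simp: h01)
  have Eh: "(\<lambda>n. \<integral>\<omega>. h n \<omega> \<partial>M) \<longlonglongrightarrow> (\<integral>\<omega>. L \<omega> \<partial>M)"
    by (rule integral_dominated_convergence[where w="\<lambda>_. 1"]) (use mL mh0 lim h01 in auto)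
  define A where "A n = {\<omega> \<in> space M. \<exists>k\<le>n. t < (\<Sum>i\<in>{1..k}. \<xi> i \<omega>)}" for n
  have PA: "measure M (A n) = (\<integral>\<omega>. h n \<omega> \<partial>M)" for n
    unfolding A_def
  proof (rule trans[OF increments_law[OF M X Fd Fm_meas \<xi> law t] Bochner_Integration.integral_cong[OF refl]], assumption, assumption, assumption)
    fix \<omega> assume \<omega>: "\<omega> \<in> space M"
    show "measure (seqs unit_uniform) {v \<in> space (seqs unit_uniform). t < wmax (map (\<lambda>z. quantile (Fm z)) (block (\<lambda>i. X (Suc i)) (\<lambda>_. n) \<omega>)) v} = h n \<omega>"
      using distr_quantile(1)[OF Fd] measurable_space[OF X \<omega>]
      by (subst U.prob_wmax[OF _ t]) (auto simp: h_def block_def comp_def)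
  qed
  have mA: "A n \<in> sets M" for n
  proof -
    have "(\<lambda>\<omega>. \<Sum>i\<in>{1..k}. \<xi> i \<omega>) \<in> borel_measurable M" for k
      by (intro borel_measurable_sum \<xi>) simp
    then show ?thesis unfolding A_def by measurable
  qed
  have "(\<lambda>n. measure M (A n)) \<longlonglongrightarrow> measure M (\<Union>n. A n)"
  proof (rule M.finite_Lim_measure_incseq)
    show "range A \<subseteq> sets M" using mA by blast
    show "incseq A" unfolding incseq_def A_def by (blast intro: order_trans)
  qed
  then have PU: "measure M (\<Union>n. A n) = (\<integral>\<omega>. L \<omega> \<partial>M)"
    unfolding PA using Eh by (rule LIMSEQ_unique)
  have "{\<omega> \<in> space M. (SUP n. ereal (\<Sum>i\<in>{1..n}. \<xi> i \<omega>)) > ereal t} = (\<Union>n. A n)"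
    by (auto simp: A_def less_SUP_iff)
  then have "measure M {\<omega> \<in> space M. (SUP n. ereal (\<Sum>i\<in>{1..n}. \<xi> i \<omega>)) > ereal t} = (\<integral>\<omega>. L \<omega> \<partial>M)"
    using PU by simp
  also have "\<dots> = (SUP m. \<integral>\<omega>. h (T m \<omega>) \<omega> \<partial>M)"
  proof (rule antisym)
    have up: "(\<integral>\<omega>. h (T m \<omega>) \<omega> \<partial>M) \<le> (\<integral>\<omega>. L \<omega> \<partial>M)" for m
      by (rule integral_mono[OF ih[OF T] iL le_L])
    then show "(SUP m. \<integral>\<omega>. h (T m \<omega>) \<omega> \<partial>M) \<le> (\<integral>\<omega>. L \<omega> \<partial>M)" by (intro cSUP_least) auto
    have bT: "bdd_above (range (\<lambda>m. \<integral>\<omega>. h (T m \<omega>) \<omega> \<partial>M))" using up by (intro bdd_aboveI) auto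
    have "(\<integral>\<omega>. h m \<omega> \<partial>M) \<le> (SUP m. \<integral>\<omega>. h (T m \<omega>) \<omega> \<partial>M)" for m
    proof (rule order_trans[OF _ cSUP_upper[OF UNIV_I bT, where x=m]])
      show "(\<integral>\<omega>. h m \<omega> \<partial>M) \<le> (\<integral>\<omega>. h (T m \<omega>) \<omega> \<partial>M)"
        using ih[of "\<lambda>_. m"] by (intro integral_mono ih[OF T] mono strict_mono_imp_increasing[OF T_mono]) auto
    qed
    then show "(\<integral>\<omega>. L \<omega> \<partial>M) \<le> (SUP m. \<integral>\<omega>. h (T m \<omega>) \<omega> \<partial>M)"
      by (intro LIMSEQ_le_const2[OF Eh]) auto
  qed
  finally show ?thesis by (simp only: h_def)
qed

lemma cycle_space_measurable:
  "(\<lambda>c. snd c i) \<in> measurable (cycle_space SX) SX" "fst \<in> measurable (cycle_space SX) (count_space UNIV)"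
  unfolding cycle_space_def
  by (rule measurable_compose[OF measurable_snd], rule measurable_component_singleton) simp_all

text \<open>The product law of the cycles replaces the underlying probability space. Joint
  measurability comes from rewriting the initial cycle and the \<open>m\<close> later ones as a
  single random block.\<close>

lemma integral_prefix_eq_blocks:
  fixes M :: "'w measure" and X :: "nat \<Rightarrow> 'w \<Rightarrow> 'x"
  assumes M: "prob_space M" and T_mono: "\<And>\<omega>. \<omega> \<in> space M \<Longrightarrow> strict_mono (\<lambda>k. T k \<omega>)"
    and ind: "prob_space.indep_vars M (\<lambda>_. cycle_space SX) (cycle x0 X T) UNIV"
    and ident: "\<And>k. k \<ge> 1 \<Longrightarrow> distr M (cycle_space SX) (cycle x0 X T k) = distr M (cycle_space SX) (cycle x0 X T 1)"
    and Q: "prob_space Q" and f: "(\<lambda>p. f (fst p) (snd p)) \<in> borel_measurable (SX \<Otimes>\<^sub>M Q)"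
    and fx: "\<And>x. x \<in> space SX \<Longrightarrow> f x \<in> borel_measurable Q"
  defines "x \<equiv> \<lambda>i c. snd c i"
  shows "(\<integral>\<omega>. hit Q (map (\<lambda>z. diag (f z)) (map (\<lambda>n. X (Suc n) \<omega>) [0..<T m \<omega>])) y \<partial>M)
    = (\<integral>c. (\<integral>cs. hit Q (map (\<lambda>z. diag (f z)) (block x fst c @ blocks x fst m cs)) y
        \<partial>seqs (distr M (cycle_space SX) (cycle x0 X T 1))) \<partial>distr M (cycle_space SX) (cycle x0 X T 0))"
proof -
  interpret M: prob_space M by fact
  interpret Q: prob_space Q by fact
  let ?S = "cycle_space SX"
  let ?C = "cycle x0 X T"
  let ?h = "\<lambda>xs. hit Q (map (\<lambda>z. diag (f z)) xs) y"
  have J: "distr M (?S \<Otimes>\<^sub>M seqs ?S) (\<lambda>\<omega>. (?C 0 \<omega>, \<lambda>k. ?C (Suc k) \<omega>)) = distr M ?S (?C 0) \<Otimes>\<^sub>M seqs (distr M ?S (?C 1))"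
    "(\<lambda>\<omega>. (?C 0 \<omega>, \<lambda>k. ?C (Suc k) \<omega>)) \<in> measurable M (?S \<Otimes>\<^sub>M seqs ?S)"
    by (rule M.distr_initial_and_iid[OF ind ident]; assumption)+
  have rv: "?C k \<in> measurable M ?S" for k using ind by (auto simp: M.indep_vars_def)
  interpret N0: prob_space "distr M ?S (?C 0)" by (rule M.prob_space_distr[OF rv])
  interpret N1: prob_space "distr M ?S (?C 1)" by (rule M.prob_space_distr[OF rv])
  interpret S1: prob_space "seqs (distr M ?S (?C 1))" by (rule N1.prob_space_seqs)
  interpret P: pair_prob_space "distr M ?S (?C 0)" "seqs (distr M ?S (?C 1))" ..
  have xm: "x i \<in> measurable ?S SX" for i unfolding x_def by (rule cycle_space_measurable)
  obtain z l where zl: "\<And>i. z i \<in> measurable (seqs ?S) SX" "l \<in> measurable (seqs ?S) (count_space UNIV)"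
      "\<And>cs. blocks x fst m cs = block z l cs"
    by (rule blocks_eq_block[of x ?S SX fst m, OF xm cycle_space_measurable(2)]) blast
  let ?P = "?S \<Otimes>\<^sub>M seqs ?S"
  obtain z' where z': "\<And>i. z' i \<in> measurable ?P SX" "(\<lambda>p. fst (fst p) + l (snd p)) \<in> measurable ?P (count_space UNIV)"
      "\<And>p. block (\<lambda>i p. x i (fst p)) (\<lambda>p. fst (fst p)) p @ block (\<lambda>i p. z i (snd p)) (\<lambda>p. l (snd p)) p = block z' (\<lambda>p. fst (fst p) + l (snd p)) p"
    by (rule block_append[of "\<lambda>i p. x i (fst p)" ?P SX "\<lambda>p. fst (fst p)" "\<lambda>i p. z i (snd p)" "\<lambda>p. l (snd p)",
          OF measurable_compose[OF measurable_fst xm] measurable_compose[OF measurable_fst cycle_space_measurable(2)]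
            measurable_compose[OF measurable_snd zl(1)] measurable_compose[OF measurable_snd zl(2)]]) blast
  define F where "F p = ?h (block x fst (fst p) @ blocks x fst m (snd p))" for p
  have Feq: "F p = ?h (block z' (\<lambda>p. fst (fst p) + l (snd p)) p)" for p
    using z'(3)[of p] by (simp add: F_def zl(3) block_def)
  have mF: "F \<in> borel_measurable ?P"
    unfolding Feq[abs_def]
    using measurable_compose[OF _ measurable_hit_block_joint[OF Q f z'(1,2)], of "\<lambda>p. (p, y)" ?P] by simp
  have F01: "norm (F p) \<le> 1" if "p \<in> space ?P" for p
  proof -
    have "block z' (\<lambda>p. fst (fst p) + l (snd p)) p \<in> lists (space SX)" by (rule block_lists[OF z'(1) that])
    then have "\<forall>q\<in>set (map (\<lambda>z. diag (f z)) (block z' (\<lambda>p. fst (fst p) + l (snd p)) p)).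
        fst q \<in> borel_measurable Q \<and> snd q \<in> borel_measurable Q"
      using fx by (auto simp: in_lists_conv_set fst_diag snd_diag)
    then show ?thesis unfolding Feq using Q.hit_nonneg[of _ y] Q.hit_le_1[of _ y] by simp
  qed
  have sets: "sets (distr M ?S (?C 0) \<Otimes>\<^sub>M seqs (distr M ?S (?C 1))) = sets ?P"
    by (intro sets_pair_measure_cong sets_PiM_cong) auto
  have mF': "F \<in> borel_measurable (distr M ?S (?C 0) \<Otimes>\<^sub>M seqs (distr M ?S (?C 1)))"
    using mF unfolding measurable_cong_sets[OF sets refl] .
  have iF: "integrable (distr M ?S (?C 0) \<Otimes>\<^sub>M seqs (distr M ?S (?C 1))) F"
    by (rule P.integrable_bounded[OF mF', of 1]) (use F01 sets_eq_imp_space_eq[OF sets] in auto)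
  have "(\<integral>\<omega>. ?h (map (\<lambda>n. X (Suc n) \<omega>) [0..<T m \<omega>]) \<partial>M) = (\<integral>\<omega>. F (?C 0 \<omega>, \<lambda>k. ?C (Suc k) \<omega>) \<partial>M)"
    by (intro Bochner_Integration.integral_cong refl) (simp only: F_def fst_conv snd_conv x_def prefix_eq_blocks[where ?x0.0=x0 and X=X and T=T, OF T_mono])
  also have "\<dots> = (\<integral>p. F p \<partial>(distr M ?S (?C 0) \<Otimes>\<^sub>M seqs (distr M ?S (?C 1))))"
    unfolding J(1)[symmetric] by (rule integral_distr[OF J(2) mF, symmetric])
  also have "\<dots> = (\<integral>c. (\<integral>cs. F (c, cs) \<partial>seqs (distr M ?S (?C 1))) \<partial>distr M ?S (?C 0))"
    by (rule P.integral_fst'[OF iF, symmetric])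
  finally show ?thesis by (simp only: F_def fst_conv snd_conv)
qed

lemma integral_first_cycle:
  fixes f :: "'x \<Rightarrow> real"
  assumes C: "cycle x0 X T 1 \<in> measurable M (cycle_space SX)" and f: "f \<in> borel_measurable SX"
  shows "(\<integral>c. (\<Sum>z\<leftarrow>block (\<lambda>i c. snd c i) fst c. f z) \<partial>distr M (cycle_space SX) (cycle x0 X T 1))
      = (\<integral>\<omega>. (\<Sum>n\<in>{T 0 \<omega>..<T 1 \<omega>}. f (X (Suc n) \<omega>)) \<partial>M)"
    and "integrable (distr M (cycle_space SX) (cycle x0 X T 1)) (\<lambda>c. \<Sum>z\<leftarrow>block (\<lambda>i c. snd c i) fst c. f z)
      \<longleftrightarrow> integrable M (\<lambda>\<omega>. \<Sum>n\<in>{T 0 \<omega>..<T 1 \<omega>}. f (X (Suc n) \<omega>))"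
proof -
  have m: "(\<lambda>c. \<Sum>z\<leftarrow>block (\<lambda>i c. snd c i) fst c. f z) \<in> borel_measurable (cycle_space SX)"
    by (rule measurable_sum_block[OF f cycle_space_measurable])
  have eq: "(\<Sum>z\<leftarrow>block (\<lambda>i c. snd c i) fst (cycle x0 X T 1 \<omega>). f z) = (\<Sum>n\<in>{T 0 \<omega>..<T 1 \<omega>}. f (X (Suc n) \<omega>))" for \<omega>
    using block_cycle(2)[of x0 X T 0 \<omega>] by (simp add: comp_def interv_sum_list_conv_sum_set_nat)
  show "(\<integral>c. (\<Sum>z\<leftarrow>block (\<lambda>i c. snd c i) fst c. f z) \<partial>distr M (cycle_space SX) (cycle x0 X T 1))
      = (\<integral>\<omega>. (\<Sum>n\<in>{T 0 \<omega>..<T 1 \<omega>}. f (X (Suc n) \<omega>)) \<partial>M)"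
    using integral_distr[OF C m] by (simp only: eq)
  show "integrable (distr M (cycle_space SX) (cycle x0 X T 1)) (\<lambda>c. \<Sum>z\<leftarrow>block (\<lambda>i c. snd c i) fst c. f z)
      \<longleftrightarrow> integrable M (\<lambda>\<omega>. \<Sum>n\<in>{T 0 \<omega>..<T 1 \<omega>}. f (X (Suc n) \<omega>))"
    using integrable_distr_eq[OF C m] by (simp only: eq)
qed

section \<open>Condition (D4) on the scale of the integrated tail\<close>

lemma tail_smallo_itail:
  assumes F: "real_distribution F" "integrable F (\<lambda>y. y)" and sub: "subexponential (\<lambda>y. 1 - itail F y)"
    and M: "prob_space M" and L: "L \<in> measurable M (count_space (UNIV :: nat set))"
    and o: "(\<lambda>n::nat. measure M {\<omega> \<in> space M. b * real (L \<omega>) > real n}) \<in> o[sequentially](\<lambda>n. itail F (real n))"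
    and \<epsilon>: "0 < \<epsilon>"
  shows "\<forall>\<^sub>F v in at_top. measure M {\<omega> \<in> space M. v < b * real (L \<omega>)} \<le> \<epsilon> * tail (itail_law F) v"
proof -
  interpret M: prob_space M by fact
  interpret F: real_distribution F by fact
  interpret H: subexp_law "itail_law F" by (rule subexp_law_itail[OF F sub])
  have [measurable]: "(\<lambda>\<omega>. real (L \<omega>)) \<in> borel_measurable M" using L by simp
  have it0: "0 \<le> itail F v" for v
    by (simp add: F.itail_eq[OF F(2)] Bochner_Integration.integral_nonneg)
  \<comment> \<open>Half of \<epsilon>, because undoing the shift by 1 costs a factor of at most
    2.\<close>
  have "\<forall>\<^sub>F v in at_top. measure M {\<omega> \<in> space M. v < b * real (L \<omega>)} \<le> \<epsilon> / 2 * itail F (v - 1)"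
  proof (rule real_of_nat_bound_transfer[OF _ _ o])
    show "measure M {\<omega> \<in> space M. v < b * real (L \<omega>)} \<le> measure M {\<omega> \<in> space M. u < b * real (L \<omega>)}" if "u \<le> v" for u v
      by (rule M.finite_measure_mono) (use that in auto)
  qed (use \<epsilon> it0 F.itail_antimono[OF F(2)] in auto)
  then show ?thesis using H.long_tailed[of 1 1, simplified] eventually_ge_at_top[of 1]
  proof eventually_elim
    case (elim v)
    have "\<epsilon> / 2 * itail F (v - 1) \<le> \<epsilon> / 2 * (2 * tail (itail_law F) v)"
      using elim(2,3) \<epsilon> by (intro mult_left_mono) (auto simp: itail_law(2)[OF F])
    then show ?case using elim(1) by simp
  qed
qed

text \<open>The second part of (D4) compares with the tail of \<open>F\<close> itself; integrating
  it gives a mean excess of the cycle length that is negligible against the integrated tail, as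
  \<open>mean_excess_asymptotics\<close> requires.\<close>

lemma excess_smallo_itail:
  assumes F: "real_distribution F" "integrable F (\<lambda>y. y)" and sub: "subexponential (\<lambda>y. 1 - itail F y)"
    and M: "prob_space M" and L: "L \<in> measurable M (count_space (UNIV :: nat set))" and Li: "integrable M (\<lambda>\<omega>. real (L \<omega>))"
    and o: "(\<lambda>n::nat. measure M {\<omega> \<in> space M. b * real (L \<omega>) > real n}) \<in> o[sequentially](\<lambda>n. 1 - cdf F (real n))"
    and \<epsilon>: "0 < \<epsilon>"
  shows "\<forall>\<^sub>F v in at_top. (\<integral>\<omega>. max 0 (b * real (L \<omega>) - v) \<partial>M) \<le> \<epsilon> * tail (itail_law F) v"
proof -
  interpret M: prob_space M by fact
  interpret F: real_distribution F by fact
  interpret H: subexp_law "itail_law F" by (rule subexp_law_itail[OF F sub])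
  have mL[measurable]: "(\<lambda>\<omega>. b * real (L \<omega>)) \<in> borel_measurable M" using L by simp
  define G where "G = distr M borel (\<lambda>\<omega>. b * real (L \<omega>))"
  interpret G: real_distribution G unfolding G_def by (rule M.real_distribution_distr[OF mL])
  have ident: "(\<lambda>x. x) \<in> borel_measurable (borel :: real measure)" by simp
  have Gi: "integrable G (\<lambda>x. x)"
    unfolding G_def integrable_distr_eq[OF mL ident] using Li by simp
  have tG: "tail G v = measure M {\<omega> \<in> space M. v < b * real (L \<omega>)}" for v
    unfolding tail_def G_def by (subst measure_distr[OF mL]) (auto intro!: arg_cong[where f="measure M"])
  have "\<forall>\<^sub>F v in at_top. tail G v \<le> \<epsilon> / 2 * tail F (v - 1)"
  proof (rule real_of_nat_bound_transfer)
    show "(\<lambda>n. tail G (real n)) \<in> o(\<lambda>n. tail F (real n))" unfolding tG F.tail_eq_cdf by (rule o)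
  qed (use \<epsilon> in \<open>simp_all add: G.tail_antimono F.tail_antimono tail_nonneg\<close>)
  then obtain v0 where v0: "\<And>v. v0 \<le> v \<Longrightarrow> tail G v \<le> \<epsilon> / 2 * tail F (v - 1)"
    unfolding eventually_at_top_linorder by blast
  obtain v1 where v1: "\<And>y. v1 \<le> y \<Longrightarrow> (\<integral>x. max 0 (x - y) \<partial>F) = itail F y"
    using F.excess_ge_itail[OF F(2)] unfolding eventually_at_top_linorder by blast
  show ?thesis using H.long_tailed[of 1 1, simplified] eventually_ge_at_top[of 1] eventually_ge_at_top[of v0] eventually_ge_at_top[of "v1 + 1"]
  proof eventually_elim
    case (elim v)
    have mx: "(\<lambda>x. max 0 (x - v)) \<in> borel_measurable borel" by simp
    have "(\<integral>\<omega>. max 0 (b * real (L \<omega>) - v) \<partial>M) = (\<integral>x. max 0 (x - v) \<partial>G)"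
      unfolding G_def by (rule integral_distr[OF mL mx, symmetric])
    also have "\<dots> \<le> \<epsilon> / 2 * (\<integral>x. max 0 (x - (v - 1)) \<partial>F)"
      by (rule excess_le_of_tail_le[OF F G.real_distribution_axioms Gi]) (use \<epsilon> v0 elim(3) in auto)
    also have "\<dots> = \<epsilon> / 2 * itail F (v - 1)" using elim(4) by (simp add: v1)
    also have "\<dots> \<le> \<epsilon> / 2 * (2 * tail (itail_law F) v)"
      using elim(1,2) \<epsilon> by (intro mult_left_mono) (auto simp: itail_law(2)[OF F])
    finally show ?case by simp
  qed
qed

theorem theorem2p2:
  fixes M :: "'w measure" and SX :: "'x measure"
    and X :: "nat \<Rightarrow> 'w \<Rightarrow> 'x" and T :: "nat \<Rightarrow> 'w \<Rightarrow> nat"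
    and \<xi> :: "nat \<Rightarrow> 'w \<Rightarrow> real"
    and Fm :: "'x \<Rightarrow> real measure" and F :: "real measure" and c :: "'x \<Rightarrow> real"
  assumes P: "prob_space M"
    \<comment> \<open>X = (X_n, n >= 1) regenerative with epochs 0 <= T_0 < T_1 < ...\<close>
    and X_meas: "\<And>n. n \<ge> 1 \<Longrightarrow> X n \<in> measurable M SX"
    and T_meas: "\<And>k. T k \<in> measurable M (count_space UNIV)"
    and T_mono: "\<And>\<omega>. \<omega> \<in> space M \<Longrightarrow> strict_mono (\<lambda>k. T k \<omega>)"
    and cyc_indep: "prob_space.indep_vars M (\<lambda>_. cycle_space SX)
                      (cycle (SOME x. x \<in> space SX) X T) UNIV"
    and cyc_ident: "\<And>k. k \<ge> 1 \<Longrightarrow>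
           distr M (cycle_space SX) (cycle (SOME x. x \<in> space SX) X T k)
         = distr M (cycle_space SX) (cycle (SOME x. x \<in> space SX) X T 1)"
    and tau_int: "integrable M (\<lambda>\<omega>. real (T 1 \<omega> - T 0 \<omega>))"
    \<comment> \<open>increment distributions F_x: distributions with finite mean, measurable in x\<close>
    and Fm_dist: "\<And>x. x \<in> space SX \<Longrightarrow> real_distribution (Fm x)"
    and Fm_mean: "\<And>x. x \<in> space SX \<Longrightarrow> integrable (Fm x) (\<lambda>y. y)"
    and Fm_meas: "\<And>y. (\<lambda>x. cdf (Fm x) y) \<in> borel_measurable SX"
    \<comment> \<open>the walk modulated by X: given X, the xi_n are independent with laws F_{X_n}\<close>
    and xi_meas: "\<And>n. n \<ge> 1 \<Longrightarrow> \<xi> n \<in> borel_measurable M"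
    and xi_cond: "\<And>n (y :: nat \<Rightarrow> real) A. A \<in> sets (\<Pi>\<^sub>M i\<in>UNIV. SX) \<Longrightarrow>
           measure M ({\<omega> \<in> space M. (\<lambda>i. X (Suc i) \<omega>) \<in> A}
                      \<inter> (\<Inter>i\<in>{1..n}. {\<omega> \<in> space M. \<xi> i \<omega> \<le> y i}))
         = (\<integral>\<omega>. indicator A (\<lambda>i. X (Suc i) \<omega>) * (\<Prod>i\<in>{1..n}. cdf (Fm (X i \<omega>)) (y i)) \<partial>M)"
    \<comment> \<open>reference distribution F with finite mean, c measurable with values in [0,1]\<close>
    and F_dist: "real_distribution F"
    and F_mean: "integrable F (\<lambda>y. y)"
    and c_meas: "c \<in> borel_measurable SX"
    and c_range: "\<And>x. x \<in> space SX \<Longrightarrow> 0 \<le> c x \<and> c x \<le> 1"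
    \<comment> \<open>F^I subexponential\<close>
    and FI_subexp: "subexponential (\<lambda>y. 1 - itail F y)"
    \<comment> \<open>(D1)\<close>
    and D1: "\<And>x y. x \<in> space SX \<Longrightarrow> 1 - cdf (Fm x) y \<le> 1 - cdf F y"
    \<comment> \<open>(D2)\<close>
    and D2: "\<And>x. x \<in> space SX \<Longrightarrow>
               ((\<lambda>y. itail (Fm x) y / itail F y) \<longlongrightarrow> c x) at_top"
    \<comment> \<open>(D3)\<close>
    and D3_int: "integrable (stat_measure M SX X T) (\<lambda>x. \<integral>y. y \<partial>Fm x)"
    and D3_pos: "- (\<integral>x. (\<integral>y. y \<partial>Fm x) \<partial>stat_measure M SX X T) > 0"
    \<comment> \<open>(D4)\<close>
    and D4: "\<exists>b::real. b \<ge> 0 \<and> ereal b > kappa SX Fm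
           \<and> (\<lambda>n::nat. measure M {\<omega> \<in> space M. b * real (T 0 \<omega>) > real n})
               \<in> o[sequentially](\<lambda>n. itail F (real n))
           \<and> (\<lambda>n::nat. measure M {\<omega> \<in> space M. b * real (T 1 \<omega> - T 0 \<omega>) > real n})
               \<in> o[sequentially](\<lambda>n. 1 - cdf F (real n))"
  shows "((\<lambda>y. measure M {\<omega> \<in> space M. (SUP n. ereal (\<Sum>i\<in>{1..n}. \<xi> i \<omega>)) > ereal y}
                / itail F y)
          \<longlongrightarrow> (\<integral>x. c x \<partial>stat_measure M SX X T)
                / (- (\<integral>x. (\<integral>y. y \<partial>Fm x) \<partial>stat_measure M SX X T))) at_top"
proof -
  interpret M: prob_space M by (rule P)
  let ?U = unit_uniform and ?H = "itail_law F" and ?\<pi> = "stat_measure M SX X T"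
  let ?C = "cycle (SOME x. x \<in> space SX) X T" and ?S = "cycle_space SX"
  let ?x = "\<lambda>i c. snd c i" and ?a = "\<lambda>x. \<integral>y. y \<partial>Fm x"
  interpret U: prob_space ?U by (rule prob_space_unit_uniform)
  obtain b where b: "0 \<le> b" "kappa SX Fm < ereal b"
    and b0: "(\<lambda>n::nat. measure M {\<omega> \<in> space M. b * real (T 0 \<omega>) > real n}) \<in> o[sequentially](\<lambda>n. itail F (real n))"
    and b1: "(\<lambda>n::nat. measure M {\<omega> \<in> space M. b * real (T 1 \<omega> - T 0 \<omega>) > real n}) \<in> o[sequentially](\<lambda>n. 1 - cdf F (real n))"
    using D4 by blast
  obtain \<beta> \<eta> where \<beta>: "0 \<le> \<beta>" and \<eta>: "0 < \<eta>" and drift: "\<And>x. x \<in> space SX \<Longrightarrow> trunc_mean (Fm x) \<beta> \<le> b - \<eta>"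
    using kappa_less[of SX Fm b, OF Fm_dist Fm_mean b(2)] by blast
  interpret W: modulated_walk ?H ?U SX "\<lambda>x. quantile (Fm x)" "quantile F" c \<beta> b \<eta>
    by (rule modulated_walk_quantile[OF Fm_dist Fm_mean Fm_meas F_dist F_mean FI_subexp D1 D2 b(1) \<beta> \<eta> drift])
  \<comment> \<open>Taking the whole sequence space for \<open>A\<close> averages the conditional
    law over the environment, the form in which \<open>increments_law\<close> compares it with the
    coupling.\<close>
  have law: "measure M {\<omega> \<in> space M. \<forall>i\<in>{1..n}. \<xi> i \<omega> \<le> y i} = (\<integral>\<omega>. (\<Prod>i\<in>{1..n}. cdf (Fm (X i \<omega>)) (y i)) \<partial>M)" for n and y :: "nat \<Rightarrow> real"
  proof -
    let ?A = "space (\<Pi>\<^sub>M i\<in>(UNIV :: nat set). SX)"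
    have A: "(\<lambda>i. X (Suc i) \<omega>) \<in> ?A" if "\<omega> \<in> space M" for \<omega>
      using measurable_space[OF X_meas that] by (auto simp: space_PiM)
    have "{\<omega> \<in> space M. \<forall>i\<in>{1..n}. \<xi> i \<omega> \<le> y i}
        = {\<omega> \<in> space M. (\<lambda>i. X (Suc i) \<omega>) \<in> ?A} \<inter> (\<Inter>i\<in>{1..n}. {\<omega> \<in> space M. \<xi> i \<omega> \<le> y i})"
      using A by blast
    then have "measure M {\<omega> \<in> space M. \<forall>i\<in>{1..n}. \<xi> i \<omega> \<le> y i}
        = (\<integral>\<omega>. indicator ?A (\<lambda>i. X (Suc i) \<omega>) * (\<Prod>i\<in>{1..n}. cdf (Fm (X i \<omega>)) (y i)) \<partial>M)"
      using xi_cond[OF sets.top, where n=n and y=y] by simp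
    also have "\<dots> = (\<integral>\<omega>. (\<Prod>i\<in>{1..n}. cdf (Fm (X i \<omega>)) (y i)) \<partial>M)"
      by (intro Bochner_Integration.integral_cong refl) (simp add: A)
    finally show ?thesis .
  qed
  have rv: "?C k \<in> measurable M ?S" for k using cyc_indep by (auto simp: M.indep_vars_def)
  define N0 N1 where "N0 = distr M ?S (?C 0)" and "N1 = distr M ?S (?C 1)"
  have N: "prob_space N0" "prob_space N1" unfolding N0_def N1_def by (rule M.prob_space_distr[OF rv])+
  have fst01: "fst (?C 0 \<omega>) = T 0 \<omega>" "fst (?C 1 \<omega>) = T 1 \<omega> - T 0 \<omega>" for \<omega>
    by (simp_all add: cycle_def Let_def)
  have len: "fst \<in> measurable N0 (count_space UNIV)" "fst \<in> measurable N1 (count_space UNIV)"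
    and x: "?x i \<in> measurable N0 SX" "?x i \<in> measurable N1 SX" for i
    unfolding N0_def N1_def by (simp_all add: cycle_space_measurable)
  have mlen: "(\<lambda>c. real (fst c)) \<in> borel_measurable ?S"
    by (rule measurable_compose[OF cycle_space_measurable(2)]) simp
  have T01: "(\<lambda>\<omega>. T 1 \<omega> - T 0 \<omega>) \<in> measurable M (count_space UNIV)"
    using measurable_compose[OF rv[of 1] cycle_space_measurable(2)] by (simp only: fst01)
  have len0_tail: "\<forall>\<^sub>F v in at_top. measure N0 {c \<in> space N0. v < b * real (fst c)} \<le> \<epsilon> * tail ?H v" if "0 < \<epsilon>" for \<epsilon>
  proof -
    have "measure N0 {c \<in> space N0. v < b * real (fst c)} = measure M {\<omega> \<in> space M. v < b * real (T 0 \<omega>)}" for v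
    proof -
      have "{c \<in> space ?S. v < b * real (fst c)} \<in> sets ?S" using mlen by measurable
      then have "measure N0 {c \<in> space N0. v < b * real (fst c)} = measure M (?C 0 -` {c \<in> space ?S. v < b * real (fst c)} \<inter> space M)"
        unfolding N0_def by (simp add: measure_distr[OF rv])
      also have "?C 0 -` {c \<in> space ?S. v < b * real (fst c)} \<inter> space M = {\<omega> \<in> space M. v < b * real (T 0 \<omega>)}"
        using measurable_space[OF rv[of 0]] by (auto simp: fst01)
      finally show ?thesis .
    qed
    then show ?thesis using tail_smallo_itail[OF F_dist F_mean FI_subexp P T_meas b0 that] by simp
  qed
  have len_excess: "\<forall>\<^sub>F v in at_top. (\<integral>c. max 0 (b * real (fst c) - v) \<partial>N1) \<le> \<epsilon> * tail ?H v" if "0 < \<epsilon>" for \<epsilon>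
  proof -
    have "(\<lambda>c. max 0 (b * real (fst c) - v)) \<in> borel_measurable ?S" for v using mlen by measurable
    from integral_distr[OF rv this]
    have "(\<integral>c. max 0 (b * real (fst c) - v) \<partial>N1) = (\<integral>\<omega>. max 0 (b * real (T 1 \<omega> - T 0 \<omega>) - v) \<partial>M)" for v
      by (simp only: N1_def fst01)
    then show ?thesis using excess_smallo_itail[OF F_dist F_mean FI_subexp P T01 tau_int b1 that] by simp
  qed
  have len_int: "integrable N1 (\<lambda>c. real (fst c))"
    unfolding N1_def integrable_distr_eq[OF rv mlen] fst01 by (rule tau_int)
  \<comment> \<open>A measurable version of the mean: the two agree on the state space, and the
    measurability of \<open>q\<close> comes from that of the coupling.\<close>
  define q where "q z = (\<integral>u. quantile (Fm z) u \<partial>?U)" for z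
  have q: "q z = ?a z" if "z \<in> space SX" for z
    unfolding q_def using integral_quantile(1)[OF Fm_dist[OF that], of "\<lambda>x. x"] by simp
  have mq: "q \<in> borel_measurable SX"
    unfolding q_def using W.g_meas by (intro U.borel_measurable_lebesgue_integral) (simp add: case_prod_beta')
  have mq': "(\<lambda>z. \<bar>q z\<bar>) \<in> borel_measurable SX" using mq by simp
  have sp: "space ?\<pi> = space SX" by (simp add: stat_measure_def space_measure_of_conv)
  have iq: "integrable ?\<pi> q" using D3_int by (subst Bochner_Integration.integrable_cong[OF refl, of _ _ ?a]) (auto simp: sp q)
  have eq: "(\<integral>z. q z \<partial>?\<pi>) = (\<integral>z. ?a z \<partial>?\<pi>)" by (rule Bochner_Integration.integral_cong) (auto simp: sp q)
  define \<tau> where "\<tau> = (\<integral>\<omega>. real (T 1 \<omega> - T 0 \<omega>) \<partial>M)"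
  have \<tau>: "0 < \<tau>"
    unfolding \<tau>_def by (rule stat_measure_integral_pos[OF P X_meas T_meas T_mono tau_int c_meas])
  have first: "(\<integral>c. (\<Sum>z\<leftarrow>block ?x fst c. f z) \<partial>N1) = \<tau> * (\<integral>z. f z \<partial>?\<pi>)"
      "integrable N1 (\<lambda>c. \<Sum>z\<leftarrow>block ?x fst c. f z)"
    if f: "f \<in> borel_measurable SX" "integrable ?\<pi> f" for f
  proof -
    have "(\<integral>z. f z \<partial>?\<pi>) = (\<integral>\<omega>. (\<Sum>n\<in>{T 0 \<omega>..<T 1 \<omega>}. f (X (Suc n) \<omega>)) \<partial>M) / \<tau>"
      unfolding \<tau>_def by (rule stat_measure_integral_eq[OF P X_meas T_meas T_mono tau_int f])
    then show "(\<integral>c. (\<Sum>z\<leftarrow>block ?x fst c. f z) \<partial>N1) = \<tau> * (\<integral>z. f z \<partial>?\<pi>)"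
      using \<tau> unfolding N1_def integral_first_cycle(1)[OF rv f(1)] by simp
    show "integrable N1 (\<lambda>c. \<Sum>z\<leftarrow>block ?x fst c. f z)"
      unfolding N1_def integral_first_cycle(2)[OF rv f(1)]
      by (rule stat_measure_integrable[OF P X_meas T_meas T_mono tau_int f])
  qed
  have ic: "integrable ?\<pi> c"
    by (rule stat_measure_integrable_bounded[OF P X_meas T_meas T_mono tau_int c_meas]) (use c_range in auto)
  \<comment> \<open>Minus the mean increment over a cycle. Both this mean and the cycle sum of
    \<open>c\<close> carry the factor \<tau>, which cancels in the limit.\<close>
  let ?\<mu> = "\<tau> * - (\<integral>z. ?a z \<partial>?\<pi>)"
  have \<mu>: "0 < ?\<mu>" using \<tau> D3_pos by (intro mult_pos_pos)
  have mean: "(\<integral>c. (\<Sum>z\<leftarrow>block ?x fst c. \<integral>u. quantile (Fm z) u \<partial>?U) \<partial>N1) = - ?\<mu>"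
    using first(1)[OF mq iq] unfolding q_def[symmetric] by (simp add: eq)
  have a_int: "integrable N1 (\<lambda>c. \<Sum>z\<leftarrow>block ?x fst c. \<bar>\<integral>u. quantile (Fm z) u \<partial>?U\<bar>)"
    unfolding q_def[symmetric] by (rule first(2)[OF mq']) (use iq in simp)
  have lim: "((\<lambda>y. (SUP m. \<integral>c. (\<integral>cs. W.hitg (block ?x fst c @ blocks ?x fst m cs) y \<partial>seqs N1) \<partial>N0) / tail ?H y)
      \<longlongrightarrow> \<tau> * (\<integral>z. c z \<partial>?\<pi>) / ?\<mu>) at_top"
    using W.regenerative_asymptotics[OF N(1) len(1) x(1) N(2) len(2) x(2) len0_tail len_excess len_int c_meas a_int mean \<mu>]
    unfolding first(1)[OF c_meas ic] .
  have "\<tau> * (\<integral>z. c z \<partial>?\<pi>) / ?\<mu> = (\<integral>z. c z \<partial>?\<pi>) / - (\<integral>z. ?a z \<partial>?\<pi>)"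
    using \<tau> by simp
  with lim have lim': "((\<lambda>y. (SUP m. \<integral>c. (\<integral>cs. W.hitg (block ?x fst c @ blocks ?x fst m cs) y \<partial>seqs N1) \<partial>N0) / tail ?H y)
      \<longlongrightarrow> (\<integral>z. c z \<partial>?\<pi>) / - (\<integral>z. ?a z \<partial>?\<pi>)) at_top" by (simp only:)
  show ?thesis
  proof (rule Lim_transform_eventually[OF lim'])
    show "\<forall>\<^sub>F y in at_top. (SUP m. \<integral>c. (\<integral>cs. W.hitg (block ?x fst c @ blocks ?x fst m cs) y \<partial>seqs N1) \<partial>N0) / tail ?H y
        = measure M {\<omega> \<in> space M. (SUP n. ereal (\<Sum>i\<in>{1..n}. \<xi> i \<omega>)) > ereal y} / itail F y"
      using eventually_ge_at_top[of 0]
    proof eventually_elim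
      case (elim y)
      have "(\<integral>c. (\<integral>cs. W.hitg (block ?x fst c @ blocks ?x fst m cs) y \<partial>seqs N1) \<partial>N0)
          = (\<integral>\<omega>. W.hitg (map (\<lambda>n. X (Suc n) \<omega>) [0..<T m \<omega>]) y \<partial>M)" for m
        unfolding N0_def N1_def
        by (rule integral_prefix_eq_blocks[OF P T_mono cyc_indep cyc_ident U.prob_space_axioms W.g_meas W.g_measurable, symmetric])
      moreover have "measure M {\<omega> \<in> space M. (SUP n. ereal (\<Sum>i\<in>{1..n}. \<xi> i \<omega>)) > ereal y}
          = (SUP m. \<integral>\<omega>. W.hitg (map (\<lambda>n. X (Suc n) \<omega>) [0..<T m \<omega>]) y \<partial>M)"
        by (rule sup_increments_eq[OF P X_meas Fm_dist Fm_meas xi_meas law T_meas T_mono elim])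
      ultimately show ?case using elim by (simp add: itail_law(2)[OF F_dist F_mean])
    qed
  qed
qed

end
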